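(* $M=\mathbb{C}_q[S^2]=\mathbb{C}_q[SL_2]_0$ is a framed quantum manifold, framed by the $q$-monopole bundle with total space $P=\mathbb{C}_q[SL_2]$ and fibre $A=\mathbb{C}[t,t^{-1}]$, with cotangent bundle $$\Omega^1(\mathbb{C}_q[S^2])\cong\mathcal{E}_{-2}\oplus\mathcal{E}_{2}$$ as left $\mathbb{C}_q[S^2]$-modules, where $\mathcal{E}_{-2}=\mathbb{C}_q[SL_2]_{2}$ and $\mathcal{E}_2=\mathbb{C}_q[SL_2]_{-2}$ are the monopole bundles of charges $-2$ and $2$. The isomorphism is $f\oplus h\mapsto f\,\theta(b_-)+h\,\theta(b_+)$, given by the soldering form $$\theta(b_-)=d^2\,\mathrm{d}b_-+q^2b^2\,\mathrm{d}b_+-[2;q^2]\,bd\,\mathrm{d}b_0=e^-,$$ $$\theta(b_+)=a^2\,\mathrm{d}b_++q^{-2}c^2\,\mathrm{d}b_--[2;q^{-2}]\,ac\,\mathrm{d}b_0=e^+,$$ and makes $\Omega^1(\mathbb{C}_q[S^2])$ a projective left $\mathbb{C}_q[S^2]$-module.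
   Context: $q\in\mathbb{C}$ is invertible, $[n;q]=(1-q^n)/(1-q)$ (so $[2;q^{\pm2}]=1+q^{\pm2}$). $\mathbb{C}_q[SL_2]$ is the Hopf algebra generated by $a,b,c,d$ with $ba=qab$, $ca=qac$, $db=qbd$, $dc=qcd$, $bc=cb$, $ad=1+q^{-1}bc$, $da=1+qbc$, matrix coproduct and counit, and antipode $Sa=d,\ Sd=a,\ Sb=-qb,\ Sc=-q^{-1}c$. It is $\mathbb{Z}$-graded by $\deg a=\deg c=1$, $\deg b=\deg d=-1$; $\mathbb{C}_q[SL_2]_n$ is the degree $n$ component. $\mathbb{C}_q[S^2]=\mathbb{C}_q[SL_2]_0$ is generated by $b_0=bc$, $b_+=cd$, $b_-=ab$. Calculus: $\Omega^1(\mathbb{C}_q[SL_2])$ is the left-covariant bimodule calculus that is free as a left module on left-invariant forms $e^+,e^-,e^0$, with $e^\pm x=q^{\deg x}x\,e^\pm$ and $e^0x=q^{2\deg x}x\,e^0$ for homogeneous $x$, and $$\mathrm{d}a=ae^0+qbe^+,\quad \mathrm{d}b=ae^--q^{-2}be^0,\quad \mathrm{d}c=ce^0+qde^+,\quad \mathrm{d}d=ce^--q^{-2}de^0.$$ It corresponds to the right ideal $I_P\subset P^+=\ker\epsilon$ generated by $a+q^2d-(1+q^2),\,b^2,\,c^2,\,bc,\,(a-1)b,\,(d-1)c$. The calculus on the sphere is the restriction $\Omega^1(\mathbb{C}_q[S^2])=\mathrm{span}\{m\,\mathrm{d}n: m,n\in\mathbb{C}_q[S^2]\}\subset\Omega^1(\mathbb{C}_q[SL_2])$.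 Bundle: $A=\mathbb{C}[t,t^{-1}]$ with $\Delta t=t\otimes t$; $\pi:P\to A$ is the Hopf algebra map $\pi(a)=t$, $\pi(d)=t^{-1}$, $\pi(b)=\pi(c)=0$; $\Delta_R=(\mathrm{id}\otimes\pi)\Delta$ (so $x\mapsto x\otimes t^{\deg x}$) and $M=P^A=\mathbb{C}_q[S^2]$. The calculus on $A$ is given by the ideal $I_A=\langle(t-1)(t-q^2)\rangle=\pi(I_P)$. Framing: an algebra $M$ is a framed quantum manifold if it is the base $M=P^A$ of a quantum principal bundle with differential calculi and there are a right $A$-comodule $V$ and a right $A$-comodule map $\theta:V\to P\,\Omega^1(M)$ such that $s_\theta:(P\otimes V)^A\to\Omega^1(M)$, $p\otimes v\mapsto p\theta(v)$, is an isomorphism of left $M$-modules. Here quantum principal bundle means: $P$ is a right $A$-comodule algebra; $0\to P(\Omega^1M)P\to\Omega^1P\xrightarrow{\mathrm{ver}}P\otimes A^+\to0$, $\mathrm{ver}(p\otimes p')=p\Delta_Rp'$, is exact, where $\Omega^1B=\ker(B\otimes B\to B)$ is the universal calculus and $A^+=\ker\epsilon$; and, writing $\Omega^1(B)=\Omega^1B/N_B$ for the chosen calculi, $N_M=N_P\cap\Omega^1M$, $\Delta_RN_P\subseteq N_P\otimes A$, $\mathrm{ver}(N_P)=P\otimes I_A$. In the present case $V=(P^+\cap M)/(I_P\cap M)$ is 2-dimensional with basis the classes of $b_\pm$ and coaction $\Delta_Rb_\pm=b_\pm\otimes t^{\pm2}$, so $(P\otimes V)^A=\mathbb{C}_q[SL_2]_2\otimes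 b_-\oplus\mathbb{C}_q[SL_2]_{-2}\otimes b_+=\mathcal{E}_{-2}\oplus\mathcal{E}_2$; and $\theta(v)=S\tilde v_{(1)}\mathrm{d}\tilde v_{(2)}$ for a representative $\tilde v\in P^+\cap M$ of $v$. *)

theory Defs
  imports
    Complex_Main
    "HOL-Library.Poly_Mapping"
    "HOL-Algebra.Module"
    "HOL-Algebra.QuotRing"
    "HOL-Algebra.Elementary_Groups"
    "HOL-Algebra.Chinese_Remainder"
begin

section \<open>Linear algebra over rings given as records\<close>

text \<open>
  Vector spaces, algebras and modules are records of type \<^typ>\<open>('r, 'v) module\<close>. As in the theory
  \<open>HOL-Algebra.Module\<close>, the fields \<open>mult\<close> and \<open>one\<close> of such a record are irrelevant when it is only
  regarded as a module.  The locale \<^locale>\<open>module\<close> asks for commutative scalars, so modules over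
  noncommutative rings get their own predicate.
\<close>

definition cfield :: "(complex, complex) module" where
  "cfield = \<lparr>carrier = UNIV, mult = (*), one = 1, zero = 0, add = (+), smult = (*)\<rparr>"

definition left_module :: "('r, 'm) ring_scheme \<Rightarrow> ('r, 'x, 'k) module_scheme \<Rightarrow> bool" where
  "left_module R X \<longleftrightarrow> ring R \<and> abelian_group X \<and>
     (\<forall>r\<in>carrier R. \<forall>x\<in>carrier X. r \<odot>\<^bsub>X\<^esub> x \<in> carrier X) \<and>
     (\<forall>r\<in>carrier R. \<forall>s\<in>carrier R. \<forall>x\<in>carrier X.
        (r \<oplus>\<^bsub>R\<^esub> s) \<odot>\<^bsub>X\<^esub> x = r \<odot>\<^bsub>X\<^esub> x \<oplus>\<^bsub>X\<^esub> s \<odot>\<^bsub>X\<^esub> x) \<and>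
     (\<forall>r\<in>carrier R. \<forall>x\<in>carrier X. \<forall>y\<in>carrier X.
        r \<odot>\<^bsub>X\<^esub> (x \<oplus>\<^bsub>X\<^esub> y) = r \<odot>\<^bsub>X\<^esub> x \<oplus>\<^bsub>X\<^esub> r \<odot>\<^bsub>X\<^esub> y) \<and>
     (\<forall>r\<in>carrier R. \<forall>s\<in>carrier R. \<forall>x\<in>carrier X.
        (r \<otimes>\<^bsub>R\<^esub> s) \<odot>\<^bsub>X\<^esub> x = r \<odot>\<^bsub>X\<^esub> (s \<odot>\<^bsub>X\<^esub> x)) \<and>
     (\<forall>x\<in>carrier X. \<one>\<^bsub>R\<^esub> \<odot>\<^bsub>X\<^esub> x = x)"

definition mod_hom ::
  "('r, 'm) ring_scheme \<Rightarrow> ('r, 'x, 'k) module_scheme \<Rightarrow> ('r, 'y, 'l) module_scheme \<Rightarrow> ('x \<Rightarrow> 'y) set"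
  where
  "mod_hom R X Y = {f \<in> carrier X \<rightarrow> carrier Y.
     (\<forall>x\<in>carrier X. \<forall>y\<in>carrier X. f (x \<oplus>\<^bsub>X\<^esub> y) = f x \<oplus>\<^bsub>Y\<^esub> f y) \<and>
     (\<forall>r\<in>carrier R. \<forall>x\<in>carrier X. f (r \<odot>\<^bsub>X\<^esub> x) = r \<odot>\<^bsub>Y\<^esub> f x)}"

definition mod_iso ::
  "('r, 'm) ring_scheme \<Rightarrow> ('r, 'x, 'k) module_scheme \<Rightarrow> ('r, 'y, 'l) module_scheme \<Rightarrow> ('x \<Rightarrow> 'y) set"
  where
  "mod_iso R X Y = {f \<in> mod_hom R X Y. bij_betw f (carrier X) (carrier Y)}"

abbreviation lin_hom where "lin_hom \<equiv> mod_hom cfield"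

definition mod_span :: "('r, 'm) ring_scheme \<Rightarrow> ('r, 'x, 'k) module_scheme \<Rightarrow> 'x set \<Rightarrow> 'x set" where
  "mod_span R X S = \<Inter>{H. submodule H R X \<and> S \<subseteq> H}"

abbreviation lin_span where "lin_span \<equiv> mod_span cfield"

text \<open>
  The union in the scalar multiplication is \<open>N + r X\<close>; also for \<open>r = 0\<close>, where \<open>r X\<close> alone would not
  be a coset.
\<close>
definition quot_mod :: "('r, 'x, 'k) module_scheme \<Rightarrow> 'x set \<Rightarrow> ('r, 'x set) module" where
  "quot_mod X N =
     ring.extend (X Quot N) (module.fields (\<lambda>r C. \<Union>x\<in>C. N +>\<^bsub>X\<^esub> (r \<odot>\<^bsub>X\<^esub> x)))"

definition dsum :: "('r, 'x, 'k) module_scheme \<Rightarrow> ('r, 'y, 'l) module_scheme \<Rightarrow> ('r, 'x \<times> 'y) module"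
  where
  "dsum X Y =
     ring.extend (RDirProd X Y) (module.fields (\<lambda>r (x, y). (r \<odot>\<^bsub>X\<^esub> x, r \<odot>\<^bsub>Y\<^esub> y)))"

definition free_module :: "('r, 'm) ring_scheme \<Rightarrow> 'i set \<Rightarrow> ('r, 'i \<Rightarrow> 'r) module" where
  "free_module R I =
     \<lparr>carrier = {f. (\<forall>i. f i \<in> carrier R) \<and> (\<forall>i. i \<notin> I \<longrightarrow> f i = \<zero>\<^bsub>R\<^esub>) \<and> finite {i. f i \<noteq> \<zero>\<^bsub>R\<^esub>}},
      mult = (\<lambda>f g i. f i \<otimes>\<^bsub>R\<^esub> g i), one = (\<lambda>_. \<one>\<^bsub>R\<^esub>), zero = (\<lambda>_. \<zero>\<^bsub>R\<^esub>),
      add = (\<lambda>f g i. f i \<oplus>\<^bsub>R\<^esub> g i), smult = (\<lambda>r f i. r \<otimes>\<^bsub>R\<^esub> f i)\<rparr>"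

text \<open>
  Projective: direct summand of a free module. An index set inside the type of \<open>X\<close> is no restriction,
  since the elements of \<open>X\<close> generate \<open>X\<close>.
\<close>
definition projective :: "('r, 'm) ring_scheme \<Rightarrow> ('r, 'x, 'k) module_scheme \<Rightarrow> bool" where
  "projective R X \<longleftrightarrow> left_module R X \<and>
     (\<exists>I :: 'x set. \<exists>\<iota> \<in> mod_hom R X (free_module R I). \<exists>\<pi> \<in> mod_hom R (free_module R I) X.
        \<forall>x\<in>carrier X. \<pi> (\<iota> x) = x)"

definition right_ideal :: "'x set \<Rightarrow> ('x, 'm) ring_scheme \<Rightarrow> bool" where
  "right_ideal I R \<longleftrightarrow> additive_subgroup I R \<and> (\<forall>x\<in>I. \<forall>r\<in>carrier R. x \<otimes>\<^bsub>R\<^esub> r \<in> I)"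

definition gen_right_ideal :: "('x, 'm) ring_scheme \<Rightarrow> 'x set \<Rightarrow> 'x set" where
  "gen_right_ideal R S = \<Inter>{I. right_ideal I R \<and> S \<subseteq> I}"

definition opposite :: "('x, 'm) ring_scheme \<Rightarrow> ('x, 'm) ring_scheme" where
  "opposite R = R\<lparr>mult := (\<lambda>x y. y \<otimes>\<^bsub>R\<^esub> x)\<rparr>"


section \<open>Complex algebras and tensor products\<close>

text \<open>The locale \<^locale>\<open>algebra\<close> is restricted to commutative algebras.\<close>

definition cplx_algebra :: "(complex, 'x, 'k) module_scheme \<Rightarrow> bool" where
  "cplx_algebra B \<longleftrightarrow> module cfield B \<and> ring B \<and>
     (\<forall>r. \<forall>x\<in>carrier B. \<forall>y\<in>carrier B.
        (r \<odot>\<^bsub>B\<^esub> x) \<otimes>\<^bsub>B\<^esub> y = r \<odot>\<^bsub>B\<^esub> (x \<otimes>\<^bsub>B\<^esub> y) \<and> x \<otimes>\<^bsub>B\<^esub> (r \<odot>\<^bsub>B\<^esub> y) = r \<odot>\<^bsub>B\<^esub> (x \<otimes>\<^bsub>B\<^esub> y))"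

definition alg_hom ::
  "(complex, 'x, 'k) module_scheme \<Rightarrow> (complex, 'y, 'l) module_scheme \<Rightarrow> ('x \<Rightarrow> 'y) set" where
  "alg_hom B C = ring_hom B C \<inter> lin_hom B C"

definition monoid_algebra :: "('g, 'm) monoid_scheme \<Rightarrow> (complex, 'g \<Rightarrow>\<^sub>0 complex) module" where
  "monoid_algebra G =
     \<lparr>carrier = {f. Poly_Mapping.keys f \<subseteq> carrier G},
      mult = (\<lambda>f g. \<Sum>x\<in>Poly_Mapping.keys f. \<Sum>y\<in>Poly_Mapping.keys g.
                Poly_Mapping.single (x \<otimes>\<^bsub>G\<^esub> y) (Poly_Mapping.lookup f x * Poly_Mapping.lookup g y)),
      one = Poly_Mapping.single \<one>\<^bsub>G\<^esub> 1, zero = 0, add = (+),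
      smult = (\<lambda>r. Poly_Mapping.map ((*) r))\<rparr>"

text \<open>
  \<open>U \<otimes> W\<close> is the free vector space on \<open>carrier U \<times> carrier W\<close> modulo bilinearity. As it is built
  from the monoid algebra of the product of the multiplicative structures, it carries the
  multiplication \<open>(u \<otimes> w)(u' \<otimes> w') = uu' \<otimes> ww'\<close> if \<open>U\<close> and \<open>W\<close> are algebras.
\<close>
definition tensor_rel ::
  "(complex, 'u, 'k) module_scheme \<Rightarrow> (complex, 'w, 'l) module_scheme \<Rightarrow> ('u \<times> 'w \<Rightarrow>\<^sub>0 complex) set" where
  "tensor_rel U W = lin_span (monoid_algebra (U \<times>\<times> W))
     ({Poly_Mapping.single (u \<oplus>\<^bsub>U\<^esub> u', w) 1 - Poly_Mapping.single (u, w) 1 - Poly_Mapping.single (u', w) 1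
        | u u' w. u \<in> carrier U \<and> u' \<in> carrier U \<and> w \<in> carrier W} \<union>
      {Poly_Mapping.single (u, w \<oplus>\<^bsub>W\<^esub> w') 1 - Poly_Mapping.single (u, w) 1 - Poly_Mapping.single (u, w') 1
        | u w w'. u \<in> carrier U \<and> w \<in> carrier W \<and> w' \<in> carrier W} \<union>
      {Poly_Mapping.single (r \<odot>\<^bsub>U\<^esub> u, w) 1 - Poly_Mapping.single (u, w) r
        | r u w. u \<in> carrier U \<and> w \<in> carrier W} \<union>
      {Poly_Mapping.single (u, r \<odot>\<^bsub>W\<^esub> w) 1 - Poly_Mapping.single (u, w) r
        | r u w. u \<in> carrier U \<and> w \<in> carrier W})"

definition tensor ::
  "(complex, 'u, 'k) module_scheme \<Rightarrow> (complex, 'w, 'l) module_scheme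
     \<Rightarrow> (complex, ('u \<times> 'w \<Rightarrow>\<^sub>0 complex) set) module" where
  "tensor U W = quot_mod (monoid_algebra (U \<times>\<times> W)) (tensor_rel U W)"

definition pure ::
  "(complex, 'u, 'k) module_scheme \<Rightarrow> (complex, 'w, 'l) module_scheme
     \<Rightarrow> 'u \<Rightarrow> 'w \<Rightarrow> ('u \<times> 'w \<Rightarrow>\<^sub>0 complex) set" where
  "pure U W u w = tensor_rel U W +>\<^bsub>monoid_algebra (U \<times>\<times> W)\<^esub> Poly_Mapping.single (u, w) 1"

text \<open>The linear map \<open>U \<otimes> W \<rightarrow> Z\<close> induced by \<open>\<beta>\<close>, which has to be bilinear.\<close>

definition tlift ::
  "(complex, 'u, 'k) module_scheme \<Rightarrow> (complex, 'w, 'l) module_scheme \<Rightarrow> (complex, 'z, 'm) module_scheme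
     \<Rightarrow> ('u \<Rightarrow> 'w \<Rightarrow> 'z) \<Rightarrow> ('u \<times> 'w \<Rightarrow>\<^sub>0 complex) set \<Rightarrow> 'z" where
  "tlift U W Z \<beta> = (THE \<phi>. \<phi> \<in> extensional (carrier (tensor U W)) \<and> \<phi> \<in> lin_hom (tensor U W) Z \<and>
     (\<forall>u\<in>carrier U. \<forall>w\<in>carrier W. \<phi> (pure U W u w) = \<beta> u w))"

definition tmap ::
  "(complex, 'u, 'k) module_scheme \<Rightarrow> (complex, 'w, 'l) module_scheme
     \<Rightarrow> (complex, 'x, 'm) module_scheme \<Rightarrow> (complex, 'y, 'n) module_scheme
     \<Rightarrow> ('u \<Rightarrow> 'x) \<Rightarrow> ('w \<Rightarrow> 'y) \<Rightarrow> ('u \<times> 'w \<Rightarrow>\<^sub>0 complex) set \<Rightarrow> ('x \<times> 'y \<Rightarrow>\<^sub>0 complex) set" where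
  "tmap U W X Y f g = tlift U W (tensor X Y) (\<lambda>u w. pure X Y (f u) (g w))"

definition tassoc ::
  "(complex, 'u, 'k) module_scheme \<Rightarrow> (complex, 'v, 'l) module_scheme \<Rightarrow> (complex, 'w, 'm) module_scheme
     \<Rightarrow> (('u \<times> 'v \<Rightarrow>\<^sub>0 complex) set \<times> 'w \<Rightarrow>\<^sub>0 complex) set
     \<Rightarrow> ('u \<times> ('v \<times> 'w \<Rightarrow>\<^sub>0 complex) set \<Rightarrow>\<^sub>0 complex) set" where
  "tassoc U V W = tlift (tensor U V) W (tensor U (tensor V W))
     (\<lambda>x w. tlift U V (tensor U (tensor V W)) (\<lambda>u v. pure U (tensor V W) u (pure V W v w)) x)"

text \<open>
  For subspaces \<open>X \<subseteq> U\<close> and \<open>Y \<subseteq> W\<close>, the space \<open>X \<otimes> Y\<close> regarded as a subspace of \<open>U \<otimes> W\<close>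
  (over a field the canonical map is injective).
\<close>
definition tspan ::
  "(complex, 'u, 'k) module_scheme \<Rightarrow> (complex, 'w, 'l) module_scheme \<Rightarrow> 'u set \<Rightarrow> 'w set
     \<Rightarrow> ('u \<times> 'w \<Rightarrow>\<^sub>0 complex) set set" where
  "tspan U W X Y = lin_span (tensor U W) {pure U W x y | x y. x \<in> X \<and> y \<in> Y}"


section \<open>Hopf algebras and comodules\<close>

record 'a hopf = "(complex, 'a) module" +
  comult :: "'a \<Rightarrow> ('a \<times> 'a \<Rightarrow>\<^sub>0 complex) set"
  counit :: "'a \<Rightarrow> complex"
  antipode :: "'a \<Rightarrow> 'a"

definition augmentation :: "('a, 'k) hopf_scheme \<Rightarrow> 'a set" where
  "augmentation A = {x \<in> carrier A. counit A x = 0}"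

definition right_comodule ::
  "('a, 'k) hopf_scheme \<Rightarrow> (complex, 'v, 'l) module_scheme \<Rightarrow> ('v \<Rightarrow> ('v \<times> 'a \<Rightarrow>\<^sub>0 complex) set) \<Rightarrow> bool"
  where
  "right_comodule A V \<rho> \<longleftrightarrow> module cfield V \<and> \<rho> \<in> lin_hom V (tensor V A) \<and>
     (\<forall>v\<in>carrier V.
        tassoc V A A (tmap V A (tensor V A) A \<rho> id (\<rho> v))
          = tmap V A V (tensor A A) id (comult A) (\<rho> v) \<and>
        tlift V A V (\<lambda>v x. counit A x \<odot>\<^bsub>V\<^esub> v) (\<rho> v) = v)"

definition hopf_algebra :: "('a, 'k) hopf_scheme \<Rightarrow> bool" where
  "hopf_algebra A \<longleftrightarrow> cplx_algebra A \<and>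
     comult A \<in> alg_hom A (tensor A A) \<and> counit A \<in> alg_hom A cfield \<and> antipode A \<in> lin_hom A A \<and>
     right_comodule A A (comult A) \<and>
     (\<forall>x\<in>carrier A.
        tlift A A A (\<lambda>x y. counit A x \<odot>\<^bsub>A\<^esub> y) (comult A x) = x \<and>
        tlift A A A (\<lambda>x y. antipode A x \<otimes>\<^bsub>A\<^esub> y) (comult A x) = counit A x \<odot>\<^bsub>A\<^esub> \<one>\<^bsub>A\<^esub> \<and>
        tlift A A A (\<lambda>x y. x \<otimes>\<^bsub>A\<^esub> antipode A y) (comult A x) = counit A x \<odot>\<^bsub>A\<^esub> \<one>\<^bsub>A\<^esub>)"

definition comodule_algebra ::
  "('a, 'k) hopf_scheme \<Rightarrow> (complex, 'p, 'l) module_scheme \<Rightarrow> ('p \<Rightarrow> ('p \<times> 'a \<Rightarrow>\<^sub>0 complex) set) \<Rightarrow> bool"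
  where
  "comodule_algebra A P \<delta> \<longleftrightarrow>
     cplx_algebra P \<and> right_comodule A P \<delta> \<and> \<delta> \<in> alg_hom P (tensor P A)"

definition coinvariants ::
  "('a, 'k) hopf_scheme \<Rightarrow> (complex, 'v, 'l) module_scheme \<Rightarrow> ('v \<Rightarrow> ('v \<times> 'a \<Rightarrow>\<^sub>0 complex) set) \<Rightarrow> 'v set"
  where
  "coinvariants A V \<rho> = {v \<in> carrier V. \<rho> v = pure V A v \<one>\<^bsub>A\<^esub>}"

text \<open>\<open>(u \<otimes> x, u' \<otimes> x') \<mapsto> \<beta> u u' \<otimes> x x'\<close> for \<open>\<beta> : U \<times> U' \<rightarrow> Z\<close> and \<open>x, x' \<in> A\<close>.\<close>

definition tcombine ::
  "('a, 'k) hopf_scheme \<Rightarrow> (complex, 'u, 'l) module_scheme \<Rightarrow> (complex, 'v, 'm) module_scheme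
     \<Rightarrow> (complex, 'z, 'n) module_scheme \<Rightarrow> ('u \<Rightarrow> 'v \<Rightarrow> 'z)
     \<Rightarrow> ('u \<times> 'a \<Rightarrow>\<^sub>0 complex) set \<Rightarrow> ('v \<times> 'a \<Rightarrow>\<^sub>0 complex) set \<Rightarrow> ('z \<times> 'a \<Rightarrow>\<^sub>0 complex) set" where
  "tcombine A U U' Z \<beta> X Y =
     tlift U A (tensor Z A)
       (\<lambda>u x. tlift U' A (tensor Z A) (\<lambda>u' x'. pure Z A (\<beta> u u') (x \<otimes>\<^bsub>A\<^esub> x')) Y) X"

definition diag_coaction ::
  "('a, 'k) hopf_scheme \<Rightarrow> (complex, 'u, 'l) module_scheme \<Rightarrow> (complex, 'v, 'm) module_scheme
     \<Rightarrow> ('u \<Rightarrow> ('u \<times> 'a \<Rightarrow>\<^sub>0 complex) set) \<Rightarrow> ('v \<Rightarrow> ('v \<times> 'a \<Rightarrow>\<^sub>0 complex) set)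
     \<Rightarrow> ('u \<times> 'v \<Rightarrow>\<^sub>0 complex) set \<Rightarrow> (('u \<times> 'v \<Rightarrow>\<^sub>0 complex) set \<times> 'a \<Rightarrow>\<^sub>0 complex) set" where
  "diag_coaction A U V \<rho> \<rho>' = tlift U V (tensor (tensor U V) A)
     (\<lambda>u v. tcombine A U V (tensor U V) (pure U V) (\<rho> u) (\<rho>' v))"


section \<open>Differential calculi\<close>

record ('p, 'w) bimod = "(complex, 'w) module" +
  lact :: "'p \<Rightarrow> 'w \<Rightarrow> 'w" (infixr "\<rhd>\<index>" 70)
  ract :: "'w \<Rightarrow> 'p \<Rightarrow> 'w" (infixl "\<lhd>\<index>" 70)

definition left_mod :: "('p, 'w, 'k) bimod_scheme \<Rightarrow> 'w set \<Rightarrow> ('p, 'w) module" where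
  "left_mod \<Omega> W = \<lparr>carrier = W, mult = mult \<Omega>, one = one \<Omega>, zero = zero \<Omega>, add = add \<Omega>,
                   smult = lact \<Omega>\<rparr>"

definition bimodule :: "(complex, 'p, 'k) module_scheme \<Rightarrow> ('p, 'w, 'l) bimod_scheme \<Rightarrow> bool" where
  "bimodule P \<Omega> \<longleftrightarrow> module cfield \<Omega> \<and> left_module P (left_mod \<Omega> (carrier \<Omega>)) \<and>
     left_module (opposite P) ((left_mod \<Omega> (carrier \<Omega>))\<lparr>smult := (\<lambda>p w. w \<lhd>\<^bsub>\<Omega>\<^esub> p)\<rparr>) \<and>
     (\<forall>p\<in>carrier P. \<forall>p'\<in>carrier P. \<forall>w\<in>carrier \<Omega>.
        (p \<rhd>\<^bsub>\<Omega>\<^esub> w) \<lhd>\<^bsub>\<Omega>\<^esub> p' = p \<rhd>\<^bsub>\<Omega>\<^esub> (w \<lhd>\<^bsub>\<Omega>\<^esub> p')) \<and>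
     (\<forall>r. \<forall>w\<in>carrier \<Omega>.
        (r \<odot>\<^bsub>P\<^esub> \<one>\<^bsub>P\<^esub>) \<rhd>\<^bsub>\<Omega>\<^esub> w = r \<odot>\<^bsub>\<Omega>\<^esub> w \<and> w \<lhd>\<^bsub>\<Omega>\<^esub> (r \<odot>\<^bsub>P\<^esub> \<one>\<^bsub>P\<^esub>) = r \<odot>\<^bsub>\<Omega>\<^esub> w)"

definition derivation ::
  "(complex, 'p, 'k) module_scheme \<Rightarrow> ('p, 'w, 'l) bimod_scheme \<Rightarrow> ('p \<Rightarrow> 'w) \<Rightarrow> bool" where
  "derivation P \<Omega> d \<longleftrightarrow> d \<in> lin_hom P \<Omega> \<and>
     (\<forall>x\<in>carrier P. \<forall>y\<in>carrier P. d (x \<otimes>\<^bsub>P\<^esub> y) = (d x \<lhd>\<^bsub>\<Omega>\<^esub> y) \<oplus>\<^bsub>\<Omega>\<^esub> (x \<rhd>\<^bsub>\<Omega>\<^esub> d y))"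

definition forms :: "('p, 'w, 'l) bimod_scheme \<Rightarrow> ('p \<Rightarrow> 'w) \<Rightarrow> 'p set \<Rightarrow> 'p set \<Rightarrow> 'w set" where
  "forms \<Omega> d B C = lin_span \<Omega> {b \<rhd>\<^bsub>\<Omega>\<^esub> d c | b c. b \<in> B \<and> c \<in> C}"

definition first_order_calculus ::
  "(complex, 'p, 'k) module_scheme \<Rightarrow> ('p, 'w, 'l) bimod_scheme \<Rightarrow> ('p \<Rightarrow> 'w) \<Rightarrow> bool" where
  "first_order_calculus P \<Omega> d \<longleftrightarrow>
     bimodule P \<Omega> \<and> derivation P \<Omega> d \<and> carrier \<Omega> = forms \<Omega> d (carrier P) (carrier P)"

text \<open>
  For a subalgebra \<open>B\<close> of \<open>P\<close>: the universal calculus \<open>ker (B \<otimes> B \<rightarrow> B)\<close>, as a subspace of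
  \<open>P \<otimes> P\<close>; its quotients correspond to sub-bimodules \<open>N\<close>. For a calculus \<open>(\<Omega>, d)\<close> the
  sub-bimodule is the kernel of \<open>b \<otimes> b' \<mapsto> b db'\<close>.
\<close>
definition univ_forms ::
  "(complex, 'p, 'k) module_scheme \<Rightarrow> 'p set \<Rightarrow> ('p \<times> 'p \<Rightarrow>\<^sub>0 complex) set set" where
  "univ_forms P B = {X \<in> tspan P P B B. tlift P P P (mult P) X = \<zero>\<^bsub>P\<^esub>}"

definition sub_bimodule ::
  "(complex, 'p, 'k) module_scheme \<Rightarrow> 'p set \<Rightarrow> ('p \<times> 'p \<Rightarrow>\<^sub>0 complex) set set \<Rightarrow> bool" where
  "sub_bimodule P B N \<longleftrightarrow> submodule N cfield (tensor P P) \<and> N \<subseteq> univ_forms P B \<and>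
     (\<forall>b\<in>B. \<forall>X\<in>N. pure P P b \<one>\<^bsub>P\<^esub> \<otimes>\<^bsub>tensor P P\<^esub> X \<in> N \<and> X \<otimes>\<^bsub>tensor P P\<^esub> pure P P \<one>\<^bsub>P\<^esub> b \<in> N)"

definition calculus_kernel ::
  "(complex, 'p, 'k) module_scheme \<Rightarrow> ('p, 'w, 'l) bimod_scheme \<Rightarrow> ('p \<Rightarrow> 'w) \<Rightarrow> 'p set
     \<Rightarrow> ('p \<times> 'p \<Rightarrow>\<^sub>0 complex) set set" where
  "calculus_kernel P \<Omega> d B =
     {X \<in> univ_forms P B. tlift P P \<Omega> (\<lambda>b b'. b \<rhd>\<^bsub>\<Omega>\<^esub> d b') X = \<zero>\<^bsub>\<Omega>\<^esub>}"


section \<open>Quantum principal bundles and framings\<close>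

definition ver ::
  "('a, 'k) hopf_scheme \<Rightarrow> (complex, 'p, 'l) module_scheme \<Rightarrow> ('p \<Rightarrow> ('p \<times> 'a \<Rightarrow>\<^sub>0 complex) set)
     \<Rightarrow> ('p \<times> 'p \<Rightarrow>\<^sub>0 complex) set \<Rightarrow> ('p \<times> 'a \<Rightarrow>\<^sub>0 complex) set" where
  "ver A P \<delta> = tlift P P (tensor P A) (\<lambda>p p'. pure P A p \<one>\<^bsub>A\<^esub> \<otimes>\<^bsub>tensor P A\<^esub> \<delta> p')"

text \<open>\<open>P (\<Omega>\<^sup>1M) P\<close>\<close>

definition horizontal_forms ::
  "(complex, 'p, 'l) module_scheme \<Rightarrow> 'p set \<Rightarrow> ('p \<times> 'p \<Rightarrow>\<^sub>0 complex) set set" where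
  "horizontal_forms P M = lin_span (tensor P P)
     {pure P P p \<one>\<^bsub>P\<^esub> \<otimes>\<^bsub>tensor P P\<^esub> X \<otimes>\<^bsub>tensor P P\<^esub> pure P P \<one>\<^bsub>P\<^esub> p'
        | p X p'. p \<in> carrier P \<and> X \<in> univ_forms P M \<and> p' \<in> carrier P}"

definition quantum_principal_bundle ::
  "('a, 'k) hopf_scheme \<Rightarrow> (complex, 'p, 'l) module_scheme \<Rightarrow> ('p \<Rightarrow> ('p \<times> 'a \<Rightarrow>\<^sub>0 complex) set)
     \<Rightarrow> ('p \<times> 'p \<Rightarrow>\<^sub>0 complex) set set \<Rightarrow> ('p \<times> 'p \<Rightarrow>\<^sub>0 complex) set set \<Rightarrow> 'a set \<Rightarrow> bool" where
  "quantum_principal_bundle A P \<delta> N\<^sub>P N\<^sub>M I\<^sub>A \<longleftrightarrow>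
     (let M = coinvariants A P \<delta> in
      hopf_algebra A \<and> comodule_algebra A P \<delta> \<and>
      sub_bimodule P (carrier P) N\<^sub>P \<and> sub_bimodule P M N\<^sub>M \<and>
      right_ideal I\<^sub>A A \<and> I\<^sub>A \<subseteq> augmentation A \<and>
      horizontal_forms P M = {X \<in> univ_forms P (carrier P). ver A P \<delta> X = \<zero>\<^bsub>tensor P A\<^esub>} \<and>
      ver A P \<delta> ` univ_forms P (carrier P) = tspan P A (carrier P) (augmentation A) \<and>
      N\<^sub>M = N\<^sub>P \<inter> univ_forms P M \<and>
      diag_coaction A P P \<delta> \<delta> ` N\<^sub>P \<subseteq> tspan (tensor P P) A N\<^sub>P (carrier A) \<and>
      ver A P \<delta> ` N\<^sub>P = tspan P A (carrier P) I\<^sub>A)"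

text \<open>The coaction on \<open>\<Omega>\<^sup>1(P)\<close> induced by the diagonal coaction on the universal calculus.\<close>

definition form_coaction ::
  "('a, 'k) hopf_scheme \<Rightarrow> (complex, 'p, 'l) module_scheme \<Rightarrow> ('p \<Rightarrow> ('p \<times> 'a \<Rightarrow>\<^sub>0 complex) set)
     \<Rightarrow> ('p, 'w, 'm) bimod_scheme \<Rightarrow> ('p \<Rightarrow> 'w) \<Rightarrow> 'w \<Rightarrow> ('w \<times> 'a \<Rightarrow>\<^sub>0 complex) set" where
  "form_coaction A P \<delta> \<Omega> d = (THE \<phi>. \<phi> \<in> extensional (carrier \<Omega>) \<and> \<phi> \<in> lin_hom \<Omega> (tensor \<Omega> A) \<and>
     (\<forall>p\<in>carrier P. \<forall>p'\<in>carrier P.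
        \<phi> (p \<rhd>\<^bsub>\<Omega>\<^esub> d p') = tcombine A P P \<Omega> (\<lambda>x y. x \<rhd>\<^bsub>\<Omega>\<^esub> d y) (\<delta> p) (\<delta> p')))"

text \<open>\<open>(P \<otimes> V)\<^sup>A\<close> as a left module over \<open>M = P\<^sup>A\<close>.\<close>

definition assoc_bundle ::
  "('a, 'k) hopf_scheme \<Rightarrow> (complex, 'p, 'l) module_scheme \<Rightarrow> ('p \<Rightarrow> ('p \<times> 'a \<Rightarrow>\<^sub>0 complex) set)
     \<Rightarrow> (complex, 'v, 'm) module_scheme \<Rightarrow> ('v \<Rightarrow> ('v \<times> 'a \<Rightarrow>\<^sub>0 complex) set)
     \<Rightarrow> ('p, ('p \<times> 'v \<Rightarrow>\<^sub>0 complex) set) module" where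
  "assoc_bundle A P \<delta> V \<rho> =
     \<lparr>carrier = coinvariants A (tensor P V) (diag_coaction A P V \<delta> \<rho>),
      mult = mult (tensor P V), one = one (tensor P V), zero = zero (tensor P V),
      add = add (tensor P V), smult = (\<lambda>m. tmap P V P V (\<lambda>p. m \<otimes>\<^bsub>P\<^esub> p) id)\<rparr>"

text \<open>
  The calculus on \<open>M\<close> is the one of the forms \<open>m dn\<close> in \<open>\<Omega>\<^sup>1(P)\<close>, as forced (up to isomorphism)
  by \<open>N\<^sub>M = N\<^sub>P \<inter> \<Omega>\<^sup>1M\<close>. The space \<open>P \<Omega>\<^sup>1(M)\<close> is \<open>forms \<Omega> d (carrier P) M\<close>.
\<close>
definition framed_quantum_manifold ::
  "'p set \<Rightarrow> ('a, 'k) hopf_scheme \<Rightarrow> (complex, 'p, 'l) module_scheme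
     \<Rightarrow> ('p \<Rightarrow> ('p \<times> 'a \<Rightarrow>\<^sub>0 complex) set) \<Rightarrow> ('p, 'w, 'm) bimod_scheme \<Rightarrow> ('p \<Rightarrow> 'w) \<Rightarrow> 'a set
     \<Rightarrow> (complex, 'v, 'n) module_scheme \<Rightarrow> ('v \<Rightarrow> ('v \<times> 'a \<Rightarrow>\<^sub>0 complex) set) \<Rightarrow> ('v \<Rightarrow> 'w) \<Rightarrow> bool" where
  "framed_quantum_manifold M A P \<delta> \<Omega> d I\<^sub>A V \<rho> \<theta> \<longleftrightarrow>
     M = coinvariants A P \<delta> \<and>
     first_order_calculus P \<Omega> d \<and>
     quantum_principal_bundle A P \<delta> (calculus_kernel P \<Omega> d (carrier P)) (calculus_kernel P \<Omega> d M) I\<^sub>A \<and>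
     right_comodule A V \<rho> \<and>
     \<theta> \<in> lin_hom V (\<Omega>\<lparr>carrier := forms \<Omega> d (carrier P) M\<rparr>) \<and>
     (\<forall>v\<in>carrier V. form_coaction A P \<delta> \<Omega> d (\<theta> v) = tmap V A \<Omega> A \<theta> id (\<rho> v)) \<and>
     left_module (P\<lparr>carrier := M\<rparr>) (assoc_bundle A P \<delta> V \<rho>) \<and>
     left_module (P\<lparr>carrier := M\<rparr>) (left_mod \<Omega> (forms \<Omega> d M M)) \<and>
     tlift P V \<Omega> (\<lambda>p v. p \<rhd>\<^bsub>\<Omega>\<^esub> \<theta> v)
       \<in> mod_iso (P\<lparr>carrier := M\<rparr>) (assoc_bundle A P \<delta> V \<rho>) (left_mod \<Omega> (forms \<Omega> d M M))"


section \<open>The Hopf algebra of functions on quantum SL(2)\<close>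

datatype sl2_gen = Ga | Gb | Gc | Gd

definition free_sl2 :: "(complex, sl2_gen list \<Rightarrow>\<^sub>0 complex) module" where
  "free_sl2 = monoid_algebra \<lparr>carrier = UNIV, monoid.mult = (@), one = []\<rparr>"

definition sl2_rels :: "complex \<Rightarrow> (sl2_gen list \<Rightarrow>\<^sub>0 complex) set" where
  "sl2_rels q =
     {Poly_Mapping.single [Gb, Ga] 1 - Poly_Mapping.single [Ga, Gb] q,
      Poly_Mapping.single [Gc, Ga] 1 - Poly_Mapping.single [Ga, Gc] q,
      Poly_Mapping.single [Gd, Gb] 1 - Poly_Mapping.single [Gb, Gd] q,
      Poly_Mapping.single [Gd, Gc] 1 - Poly_Mapping.single [Gc, Gd] q,
      Poly_Mapping.single [Gb, Gc] 1 - Poly_Mapping.single [Gc, Gb] 1,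
      Poly_Mapping.single [Ga, Gd] 1 - Poly_Mapping.single [] 1 - Poly_Mapping.single [Gb, Gc] (inverse q),
      Poly_Mapping.single [Gd, Ga] 1 - Poly_Mapping.single [] 1 - Poly_Mapping.single [Gb, Gc] q}"

type_synonym sl2 = "(sl2_gen list \<Rightarrow>\<^sub>0 complex) set"

definition CqSL2_alg :: "complex \<Rightarrow> (complex, sl2) module" where
  "CqSL2_alg q = quot_mod free_sl2 (genideal free_sl2 (sl2_rels q))"

definition word :: "complex \<Rightarrow> sl2_gen list \<Rightarrow> sl2" where
  "word q w = genideal free_sl2 (sl2_rels q) +>\<^bsub>free_sl2\<^esub> Poly_Mapping.single w 1"

abbreviation gen :: "complex \<Rightarrow> sl2_gen \<Rightarrow> sl2" where
  "gen q g \<equiv> word q [g]"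

definition sl2_comult :: "complex \<Rightarrow> sl2 \<Rightarrow> (sl2 \<times> sl2 \<Rightarrow>\<^sub>0 complex) set" where
  "sl2_comult q =
     (let P = CqSL2_alg q; T = tensor P P; a = gen q Ga; b = gen q Gb; c = gen q Gc; d = gen q Gd in
      THE \<phi>. \<phi> \<in> extensional (carrier P) \<and> \<phi> \<in> alg_hom P T \<and>
        \<phi> a = pure P P a a \<oplus>\<^bsub>T\<^esub> pure P P b c \<and> \<phi> b = pure P P a b \<oplus>\<^bsub>T\<^esub> pure P P b d \<and>
        \<phi> c = pure P P c a \<oplus>\<^bsub>T\<^esub> pure P P d c \<and> \<phi> d = pure P P c b \<oplus>\<^bsub>T\<^esub> pure P P d d)"

definition sl2_counit :: "complex \<Rightarrow> sl2 \<Rightarrow> complex" where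
  "sl2_counit q =
     (THE \<phi>. \<phi> \<in> extensional (carrier (CqSL2_alg q)) \<and> \<phi> \<in> alg_hom (CqSL2_alg q) cfield \<and>
        \<phi> (gen q Ga) = 1 \<and> \<phi> (gen q Gb) = 0 \<and> \<phi> (gen q Gc) = 0 \<and> \<phi> (gen q Gd) = 1)"

text \<open>The antipode is an algebra antihomomorphism.\<close>

definition sl2_antipode :: "complex \<Rightarrow> sl2 \<Rightarrow> sl2" where
  "sl2_antipode q =
     (let P = CqSL2_alg q in
      THE \<phi>. \<phi> \<in> extensional (carrier P) \<and> \<phi> \<in> alg_hom P (opposite P) \<and>
        \<phi> (gen q Ga) = gen q Gd \<and> \<phi> (gen q Gd) = gen q Ga \<and>
        \<phi> (gen q Gb) = (- q) \<odot>\<^bsub>P\<^esub> gen q Gb \<and> \<phi> (gen q Gc) = (- inverse q) \<odot>\<^bsub>P\<^esub> gen q Gc)"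

definition CqSL2 :: "complex \<Rightarrow> sl2 hopf" where
  "CqSL2 q = module.extend (CqSL2_alg q) (hopf.fields (sl2_comult q) (sl2_counit q) (sl2_antipode q))"

fun gen_deg :: "sl2_gen \<Rightarrow> int" where
  "gen_deg Ga = 1" | "gen_deg Gb = - 1" | "gen_deg Gc = 1" | "gen_deg Gd = - 1"

definition degree_comp :: "complex \<Rightarrow> int \<Rightarrow> sl2 set" where
  "degree_comp q n = lin_span (CqSL2 q) {word q w | w. sum_list (map gen_deg w) = n}"

text \<open>Only the algebra structure is meant: the coproduct does not restrict to the sphere.\<close>

definition CqS2 :: "complex \<Rightarrow> sl2 hopf" where
  "CqS2 q = (CqSL2 q)\<lparr>carrier := degree_comp q 0\<rparr>"

definition b_zero :: "complex \<Rightarrow> sl2" where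
  "b_zero q = gen q Gb \<otimes>\<^bsub>CqSL2 q\<^esub> gen q Gc"

definition b_plus :: "complex \<Rightarrow> sl2" where
  "b_plus q = gen q Gc \<otimes>\<^bsub>CqSL2 q\<^esub> gen q Gd"

definition b_minus :: "complex \<Rightarrow> sl2" where
  "b_minus q = gen q Ga \<otimes>\<^bsub>CqSL2 q\<^esub> gen q Gb"

text \<open>Note the sign: the bundle of charge \<open>n\<close> is the component of degree \<open>- n\<close>.\<close>

definition monopole_bundle :: "complex \<Rightarrow> int \<Rightarrow> (sl2, sl2) module" where
  "monopole_bundle q n = (let P = CqSL2 q in
     \<lparr>carrier = degree_comp q (- n), mult = mult P, one = one P, zero = zero P, add = add P,
      smult = mult P\<rparr>)"


section \<open>The calculus on quantum SL(2)\<close>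

text \<open>The algebra map \<open>x \<mapsto> s\<^bsup>deg x\<^esup> x\<close>.\<close>

definition deg_scale :: "complex \<Rightarrow> complex \<Rightarrow> sl2 \<Rightarrow> sl2" where
  "deg_scale q s = (THE \<phi>. \<phi> \<in> extensional (carrier (CqSL2 q)) \<and> \<phi> \<in> lin_hom (CqSL2 q) (CqSL2 q) \<and>
     (\<forall>n. \<forall>x\<in>degree_comp q n. \<phi> x = (s powi n) \<odot>\<^bsub>CqSL2 q\<^esub> x))"

text \<open>\<open>(x, y, z)\<close> stands for \<open>x e\<^sup>+ + y e\<^sup>- + z e\<^sup>0\<close>.\<close>

definition Omega_SL2 :: "complex \<Rightarrow> (sl2, sl2 \<times> sl2 \<times> sl2) bimod" where
  "Omega_SL2 q = (let P = CqSL2 q in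
     module.extend (dsum P (dsum P P)) (bimod.fields
       (\<lambda>p (x, y, z). (p \<otimes>\<^bsub>P\<^esub> x, p \<otimes>\<^bsub>P\<^esub> y, p \<otimes>\<^bsub>P\<^esub> z))
       (\<lambda>(x, y, z) p. (x \<otimes>\<^bsub>P\<^esub> deg_scale q q p, y \<otimes>\<^bsub>P\<^esub> deg_scale q q p, z \<otimes>\<^bsub>P\<^esub> deg_scale q (q\<^sup>2) p))))"

definition e_plus :: "complex \<Rightarrow> sl2 \<times> sl2 \<times> sl2" where
  "e_plus q = (\<one>\<^bsub>CqSL2 q\<^esub>, \<zero>\<^bsub>CqSL2 q\<^esub>, \<zero>\<^bsub>CqSL2 q\<^esub>)"

definition e_minus :: "complex \<Rightarrow> sl2 \<times> sl2 \<times> sl2" where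
  "e_minus q = (\<zero>\<^bsub>CqSL2 q\<^esub>, \<one>\<^bsub>CqSL2 q\<^esub>, \<zero>\<^bsub>CqSL2 q\<^esub>)"

definition e_zero :: "complex \<Rightarrow> sl2 \<times> sl2 \<times> sl2" where
  "e_zero q = (\<zero>\<^bsub>CqSL2 q\<^esub>, \<zero>\<^bsub>CqSL2 q\<^esub>, \<one>\<^bsub>CqSL2 q\<^esub>)"

definition d_SL2 :: "complex \<Rightarrow> sl2 \<Rightarrow> sl2 \<times> sl2 \<times> sl2" where
  "d_SL2 q = (let P = CqSL2 q; \<Omega> = Omega_SL2 q; a = gen q Ga; b = gen q Gb; c = gen q Gc; d = gen q Gd in
     THE D. D \<in> extensional (carrier P) \<and> derivation P \<Omega> D \<and>
       D a = (a \<rhd>\<^bsub>\<Omega>\<^esub> e_zero q) \<oplus>\<^bsub>\<Omega>\<^esub> ((q \<odot>\<^bsub>P\<^esub> b) \<rhd>\<^bsub>\<Omega>\<^esub> e_plus q) \<and>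
       D b = (a \<rhd>\<^bsub>\<Omega>\<^esub> e_minus q) \<ominus>\<^bsub>\<Omega>\<^esub> ((inverse (q\<^sup>2) \<odot>\<^bsub>P\<^esub> b) \<rhd>\<^bsub>\<Omega>\<^esub> e_zero q) \<and>
       D c = (c \<rhd>\<^bsub>\<Omega>\<^esub> e_zero q) \<oplus>\<^bsub>\<Omega>\<^esub> ((q \<odot>\<^bsub>P\<^esub> d) \<rhd>\<^bsub>\<Omega>\<^esub> e_plus q) \<and>
       D d = (c \<rhd>\<^bsub>\<Omega>\<^esub> e_minus q) \<ominus>\<^bsub>\<Omega>\<^esub> ((inverse (q\<^sup>2) \<odot>\<^bsub>P\<^esub> d) \<rhd>\<^bsub>\<Omega>\<^esub> e_zero q))"

text \<open>\<open>\<Omega>\<^sup>1\<close> of the sphere, as a left module over the functions on the sphere\<close>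

definition Omega_S2 :: "complex \<Rightarrow> (sl2, sl2 \<times> sl2 \<times> sl2) module" where
  "Omega_S2 q = left_mod (Omega_SL2 q)
     (forms (Omega_SL2 q) (d_SL2 q) (carrier (CqS2 q)) (carrier (CqS2 q)))"


section \<open>The q-monopole bundle and the soldering form\<close>

definition laurent_alg :: "(complex, int \<Rightarrow>\<^sub>0 complex) module" where
  "laurent_alg = monoid_algebra integer_group"

definition tpow :: "int \<Rightarrow> int \<Rightarrow>\<^sub>0 complex" where
  "tpow n = Poly_Mapping.single n 1"

definition laurent :: "(int \<Rightarrow>\<^sub>0 complex) hopf" where
  "laurent = (let A = laurent_alg in module.extend A (hopf.fields
     (THE \<phi>. \<phi> \<in> extensional (carrier A) \<and> \<phi> \<in> alg_hom A (tensor A A) \<and>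
        \<phi> (tpow 1) = pure A A (tpow 1) (tpow 1))
     (THE \<phi>. \<phi> \<in> extensional (carrier A) \<and> \<phi> \<in> alg_hom A cfield \<and> \<phi> (tpow 1) = 1)
     (THE \<phi>. \<phi> \<in> extensional (carrier A) \<and> \<phi> \<in> alg_hom A A \<and> \<phi> (tpow 1) = tpow (- 1))))"

definition laurent_ideal :: "complex \<Rightarrow> (int \<Rightarrow>\<^sub>0 complex) set" where
  "laurent_ideal q = genideal laurent
     {(tpow 1 \<ominus>\<^bsub>laurent\<^esub> \<one>\<^bsub>laurent\<^esub>) \<otimes>\<^bsub>laurent\<^esub> (tpow 1 \<ominus>\<^bsub>laurent\<^esub> q\<^sup>2 \<odot>\<^bsub>laurent\<^esub> \<one>\<^bsub>laurent\<^esub>)}"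

definition sl2_proj :: "complex \<Rightarrow> sl2 \<Rightarrow> int \<Rightarrow>\<^sub>0 complex" where
  "sl2_proj q = (THE \<phi>. \<phi> \<in> extensional (carrier (CqSL2 q)) \<and> \<phi> \<in> alg_hom (CqSL2 q) laurent \<and>
     \<phi> (gen q Ga) = tpow 1 \<and> \<phi> (gen q Gd) = tpow (- 1) \<and> \<phi> (gen q Gb) = 0 \<and> \<phi> (gen q Gc) = 0)"

definition sl2_coaction :: "complex \<Rightarrow> sl2 \<Rightarrow> (sl2 \<times> (int \<Rightarrow>\<^sub>0 complex) \<Rightarrow>\<^sub>0 complex) set" where
  "sl2_coaction q x =
     tmap (CqSL2 q) (CqSL2 q) (CqSL2 q) laurent id (sl2_proj q) (comult (CqSL2 q) x)"

definition sl2_ideal :: "complex \<Rightarrow> sl2 set" where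
  "sl2_ideal q =
     (let P = CqSL2 q; a = gen q Ga; b = gen q Gb; c = gen q Gc; d = gen q Gd in
      gen_right_ideal P
        {(a \<oplus>\<^bsub>P\<^esub> q\<^sup>2 \<odot>\<^bsub>P\<^esub> d) \<ominus>\<^bsub>P\<^esub> (1 + q\<^sup>2) \<odot>\<^bsub>P\<^esub> \<one>\<^bsub>P\<^esub>, b \<otimes>\<^bsub>P\<^esub> b, c \<otimes>\<^bsub>P\<^esub> c, b \<otimes>\<^bsub>P\<^esub> c,
         (a \<ominus>\<^bsub>P\<^esub> \<one>\<^bsub>P\<^esub>) \<otimes>\<^bsub>P\<^esub> b, (d \<ominus>\<^bsub>P\<^esub> \<one>\<^bsub>P\<^esub>) \<otimes>\<^bsub>P\<^esub> c})"

definition framing_space :: "complex \<Rightarrow> (complex, sl2 set) module" where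
  "framing_space q = quot_mod
     ((CqSL2 q)\<lparr>carrier := augmentation (CqSL2 q) \<inter> carrier (CqS2 q)\<rparr>)
     (sl2_ideal q \<inter> carrier (CqS2 q))"

definition framing_class :: "complex \<Rightarrow> sl2 \<Rightarrow> sl2 set" where
  "framing_class q x = (sl2_ideal q \<inter> carrier (CqS2 q)) +>\<^bsub>CqSL2 q\<^esub> x"

definition framing_coaction ::
  "complex \<Rightarrow> sl2 set \<Rightarrow> (sl2 set \<times> (int \<Rightarrow>\<^sub>0 complex) \<Rightarrow>\<^sub>0 complex) set" where
  "framing_coaction q = (let V = framing_space q in
     THE \<phi>. \<phi> \<in> extensional (carrier V) \<and> \<phi> \<in> lin_hom V (tensor V laurent) \<and>
       \<phi> (framing_class q (b_plus q)) = pure V laurent (framing_class q (b_plus q)) (tpow 2) \<and>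
       \<phi> (framing_class q (b_minus q)) = pure V laurent (framing_class q (b_minus q)) (tpow (- 2)))"

text \<open>\<open>\<theta>(v) = S v\<^sub>1 d v\<^sub>2\<close>, the common value on all representatives of the class \<open>v\<close>\<close>

definition soldering_form :: "complex \<Rightarrow> sl2 set \<Rightarrow> sl2 \<times> sl2 \<times> sl2" where
  "soldering_form q v = (let P = CqSL2 q; \<Omega> = Omega_SL2 q in
     the_elem ((\<lambda>x. tlift P P \<Omega> (\<lambda>y z. antipode P y \<rhd>\<^bsub>\<Omega>\<^esub> d_SL2 q z) (comult P x)) ` v))"

text \<open>\<open>[n; q] = (1 - q\<^sup>n) / (1 - q)\<close>, with the removable singularity at \<open>q = 1\<close> filled in\<close>

definition q_int :: "nat \<Rightarrow> complex \<Rightarrow> complex" where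
  "q_int n q = (if q = 1 then of_nat n else (1 - q ^ n) / (1 - q))"

end

theory Submission
  imports Defs
begin

text \<open>
  A coaction of \<open>\<complex>[t, t\<^sup>-\<^sup>1]\<close> is the same as a grading by the integers, so all equivariance statements, including
  those for \<open>(P \<otimes> V)\<^sup>A\<close>, become statements about degrees. No basis of \<open>P\<close> is needed: every map on \<open>P\<close> comes from
  the presentation, and identities are checked on words.

  Exactness of the bundle holds because for each \<open>n\<close> there is a sum \<open>\<Sum> x\<^sub>j \<otimes> y\<^sub>j\<close> with \<open>\<Sum> x\<^sub>j y\<^sub>j = 1\<close> and \<open>deg y\<^sub>j = n\<close>;
  then \<open>p \<otimes> t\<^sup>n \<mapsto> \<Sum> p x\<^sub>j \<otimes> y\<^sub>j\<close> splits the vertical map modulo horizontal forms. The \<open>e\<^sup>0\<close> component of \<open>dx\<close> is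
  \<open>[deg x; q\<^sup>2] x\<close>, and the ideal of the calculus on \<open>A\<close> consists of the elements killed by \<open>\<epsilon>\<close> and by \<open>t\<^sup>n \<mapsto> [n; q\<^sup>2]\<close>.
  Hence the lift of an element of \<open>P \<otimes> I\<^sub>A\<close> has a differential form without \<open>e\<^sup>0\<close> component, which can be removed
  by a horizontal form, since \<open>e\<^sup>+\<close> and \<open>e\<^sup>-\<close> lie in \<open>P \<Omega>\<^sup>1(M)\<close>: they are the combinations of \<open>db\<^sub>-, db\<^sub>+, db\<^sub>0\<close> in
  the theorem. The same combinations show that \<open>\<Omega>\<^sup>1(M) = P\<^bsub>-2\<^esub> e\<^sup>+ \<oplus> P\<^bsub>2\<^esub> e\<^sup>-\<close> and give a dual basis.

  The Maurer--Cartan form \<open>\<omega>(x) = S x\<^sub>1 dx\<^sub>2\<close> has constant coefficients and \<open>I\<^sub>P = ker \<epsilon> \<inter> ker \<omega>\<close>, so that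
  \<open>\<omega>\<close> induces \<open>\<theta>\<close> and embeds \<open>V\<close> as the span of \<open>e\<^sup>+\<close> and \<open>e\<^sup>-\<close>.
\<close>

section \<open>Complex vector spaces given as records\<close>

text \<open>Most structure maps of the statement are given by unique description, so each needs a
  construction and a uniqueness argument. The presentation of P yields algebra maps only, and
  \<open>d\<close> is none. But a derivation twisted by x -> s^(deg x) x is the middle entry of an
  algebra map into triangular matrices, so the three coefficients of \<open>d\<close> are built
  separately, with s = q, q, q^2. Independence of vectors has to be certified without a basis of P.
  The counit does this: it separates scalars, and all forms whose independence matters have constant
  coefficients. Roots of unity and q^2 = 1 fit into the same argument, because only [m+n; q^2] =
  q^(2n) [m; q^2] + [n; q^2] is used, and this holds with [n; 1] = n. The constants in the soldering
  form come from the coproduct of ab, which is a^2 (x) ab + ab (x) ad + ba (x) cb + b^2 (x) cd. Here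
  S(a^2) = d^2, S(b^2) = q^2 b^2, S(ab) = -q bd and S(ba) = -q^2 bd, while d(ad) = q^-1 d(bc). The
  two middle terms add up to -(1 + q^2) bd db_0.\<close>

lemma cfield_simps [simp]:
  "carrier cfield = UNIV" "x \<otimes>\<^bsub>cfield\<^esub> y = x * y" "\<one>\<^bsub>cfield\<^esub> = 1" "\<zero>\<^bsub>cfield\<^esub> = 0"
  "x \<oplus>\<^bsub>cfield\<^esub> y = x + y" "x \<odot>\<^bsub>cfield\<^esub> y = x * y"
  by (simp_all add: cfield_def)

lemma cring_cfield: "cring cfield"
proof (rule cringI)
  show "abelian_group cfield"
    by (rule abelian_groupI) (auto simp: algebra_simps intro: exI[of _ "- _"] ab_left_minus)
  show "comm_monoid cfield" by (rule comm_monoidI) (auto simp: algebra_simps)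
qed (auto simp: algebra_simps)

lemma a_inv_cfield [simp]: "\<ominus>\<^bsub>cfield\<^esub> x = - x"
proof -
  interpret cring cfield by (rule cring_cfield)
  have "\<ominus>\<^bsub>cfield\<^esub> x \<oplus>\<^bsub>cfield\<^esub> x = \<zero>\<^bsub>cfield\<^esub>" by (rule l_neg) simp
  then show ?thesis by (simp add: eq_neg_iff_add_eq_0)
qed

abbreviation "vs X \<equiv> module cfield X"

lemma vsI:
  assumes "abelian_group X" "\<And>r x. x \<in> carrier X \<Longrightarrow> r \<odot>\<^bsub>X\<^esub> x \<in> carrier X"
    "\<And>r s x. x \<in> carrier X \<Longrightarrow> (r + s) \<odot>\<^bsub>X\<^esub> x = r \<odot>\<^bsub>X\<^esub> x \<oplus>\<^bsub>X\<^esub> s \<odot>\<^bsub>X\<^esub> x"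
    "\<And>r x y. x \<in> carrier X \<Longrightarrow> y \<in> carrier X \<Longrightarrow> r \<odot>\<^bsub>X\<^esub> (x \<oplus>\<^bsub>X\<^esub> y) = r \<odot>\<^bsub>X\<^esub> x \<oplus>\<^bsub>X\<^esub> r \<odot>\<^bsub>X\<^esub> y"
    "\<And>r s x. x \<in> carrier X \<Longrightarrow> (r * s) \<odot>\<^bsub>X\<^esub> x = r \<odot>\<^bsub>X\<^esub> (s \<odot>\<^bsub>X\<^esub> x)"
    "\<And>x. x \<in> carrier X \<Longrightarrow> 1 \<odot>\<^bsub>X\<^esub> x = x"
  shows "vs X"
  by (rule moduleI) (use assms cring_cfield in auto)

lemma vs_cfield: "vs cfield"
  by (rule vsI) (use cring_cfield in \<open>auto simp: algebra_simps cring_def ring_def\<close>)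

context
  fixes X (structure)
  assumes X: "vs X"
begin

interpretation module cfield X by (rule X)

lemma vs_smult_closed: "x \<in> carrier X \<Longrightarrow> r \<odot> x \<in> carrier X" by simp
lemma vs_add_closed: "x \<in> carrier X \<Longrightarrow> y \<in> carrier X \<Longrightarrow> x \<oplus> y \<in> carrier X" by simp
lemma vs_zero_closed: "\<zero> \<in> carrier X" by simp
lemma vs_minus_closed: "x \<in> carrier X \<Longrightarrow> y \<in> carrier X \<Longrightarrow> x \<ominus> y \<in> carrier X" by simp
lemma vs_add_smult: "x \<in> carrier X \<Longrightarrow> (r + s) \<odot> x = r \<odot> x \<oplus> s \<odot> x"
  using smult_l_distr[of r s x] by simp
lemma vs_smult_add: "x \<in> carrier X \<Longrightarrow> y \<in> carrier X \<Longrightarrow> r \<odot> (x \<oplus> y) = r \<odot> x \<oplus> r \<odot> y"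
  using smult_r_distr[of r x y] by simp
lemma vs_smult_smult: "x \<in> carrier X \<Longrightarrow> r \<odot> (s \<odot> x) = (r * s) \<odot> x"
  using smult_assoc1[of r s x] by simp
lemma vs_one: "x \<in> carrier X \<Longrightarrow> 1 \<odot> x = x" using smult_one by simp
lemma vs_zero_smult: "x \<in> carrier X \<Longrightarrow> 0 \<odot> x = \<zero>" using smult_l_null by simp
lemma vs_smult_zero: "r \<odot> \<zero> = \<zero>" using smult_r_null by simp
lemma vs_neg: "x \<in> carrier X \<Longrightarrow> \<ominus> x = (- 1) \<odot> x"
  using smult_l_minus[of 1 x] vs_one by simp
lemma vs_minus: "x \<in> carrier X \<Longrightarrow> y \<in> carrier X \<Longrightarrow> x \<ominus> y = x \<oplus> (- 1) \<odot> y"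
  by (simp add: a_minus_def vs_neg)
lemma vs_minus_eq_zero: "x \<in> carrier X \<Longrightarrow> y \<in> carrier X \<Longrightarrow> x \<ominus> y = \<zero> \<longleftrightarrow> x = y"
  using M.minus_equality M.r_neg M.minus_minus M.a_inv_closed unfolding a_minus_def by (metis M.a_comm)

lemma vs_submoduleI:
  assumes "H \<subseteq> carrier X" "\<zero> \<in> H" "\<And>x y. x \<in> H \<Longrightarrow> y \<in> H \<Longrightarrow> x \<oplus> y \<in> H" "\<And>r x. x \<in> H \<Longrightarrow> r \<odot> x \<in> H"
  shows "submodule H cfield X"
proof (rule submoduleI)
  fix a assume "a \<in> H"
  then have "(-1) \<odot> a \<in> H" "a \<in> carrier X" using assms by auto
  then show "\<ominus> a \<in> H" by (simp add: vs_neg)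
qed (use assms in auto)

lemma vs_submoduleD:
  assumes "submodule H cfield X"
  shows "H \<subseteq> carrier X" "\<zero> \<in> H" "\<And>x y. x \<in> H \<Longrightarrow> y \<in> H \<Longrightarrow> x \<oplus> y \<in> H" "\<And>r x. x \<in> H \<Longrightarrow> r \<odot> x \<in> H"
    "\<And>x y. x \<in> H \<Longrightarrow> y \<in> H \<Longrightarrow> x \<ominus> y \<in> H"
  using submoduleE[OF assms] subgroup.one_closed[OF submodule.axioms(1)[OF assms]]
  by (auto simp: a_minus_def)

lemma vs_sub: "submodule H cfield X \<Longrightarrow> vs (X\<lparr>carrier := H\<rparr>)"
  by (rule submodule.submodule_is_module) (use X in auto)

lemma submodule_Inter: "(\<And>H. H \<in> \<H> \<Longrightarrow> submodule H cfield X) \<Longrightarrow> \<H> \<noteq> {} \<Longrightarrow> submodule (\<Inter>\<H>) cfield X"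
  by (rule vs_submoduleI) (auto dest: vs_submoduleD)

lemma span_submodule:
  assumes "S \<subseteq> carrier X" shows "submodule (lin_span X S) cfield X"
  unfolding mod_span_def
  by (rule submodule_Inter) (use assms carrier_is_submodule in auto)

lemma span_superset: "S \<subseteq> lin_span X S" by (auto simp: mod_span_def)

lemma span_minimal: "submodule H cfield X \<Longrightarrow> S \<subseteq> H \<Longrightarrow> lin_span X S \<subseteq> H"
  by (auto simp: mod_span_def)

lemma span_induct [consumes 3, case_names zero base add smult]:
  assumes x: "x \<in> lin_span X S" and S: "S \<subseteq> carrier X" and Q: "Q \<zero>" "\<And>x. x \<in> S \<Longrightarrow> Q x"
    "\<And>x y. x \<in> lin_span X S \<Longrightarrow> y \<in> lin_span X S \<Longrightarrow> Q x \<Longrightarrow> Q y \<Longrightarrow> Q (x \<oplus> y)"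
    "\<And>r x. x \<in> lin_span X S \<Longrightarrow> Q x \<Longrightarrow> Q (r \<odot> x)"
  shows "Q x"
proof -
  note D = vs_submoduleD[OF span_submodule[OF S]]
  have "submodule {x \<in> lin_span X S. Q x} cfield X"
    by (rule vs_submoduleI) (use D Q in auto)
  from span_minimal[OF this] x show ?thesis using span_superset Q by blast
qed

end

lemmas vs_closed = vs_smult_closed vs_add_closed vs_zero_closed vs_minus_closed

lemma lin_homI:
  assumes "\<And>x. x \<in> carrier X \<Longrightarrow> f x \<in> carrier Y"
    "\<And>x y. x \<in> carrier X \<Longrightarrow> y \<in> carrier X \<Longrightarrow> f (x \<oplus>\<^bsub>X\<^esub> y) = f x \<oplus>\<^bsub>Y\<^esub> f y"
    "\<And>r x. x \<in> carrier X \<Longrightarrow> f (r \<odot>\<^bsub>X\<^esub> x) = r \<odot>\<^bsub>Y\<^esub> f x"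
  shows "f \<in> lin_hom X Y"
  using assms by (auto simp: mod_hom_def)

lemma lin_hom_closed: "f \<in> lin_hom X Y \<Longrightarrow> x \<in> carrier X \<Longrightarrow> f x \<in> carrier Y"
  and lin_hom_add: "f \<in> lin_hom X Y \<Longrightarrow> x \<in> carrier X \<Longrightarrow> y \<in> carrier X \<Longrightarrow> f (x \<oplus>\<^bsub>X\<^esub> y) = f x \<oplus>\<^bsub>Y\<^esub> f y"
  and lin_hom_smult: "f \<in> lin_hom X Y \<Longrightarrow> x \<in> carrier X \<Longrightarrow> f (r \<odot>\<^bsub>X\<^esub> x) = r \<odot>\<^bsub>Y\<^esub> f x"
  by (auto simp: mod_hom_def)

lemma lin_hom_zero:
  assumes "vs X" "vs Y" "f \<in> lin_hom X Y"
  shows "f \<zero>\<^bsub>X\<^esub> = \<zero>\<^bsub>Y\<^esub>"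
proof -
  have "f (0 \<odot>\<^bsub>X\<^esub> \<zero>\<^bsub>X\<^esub>) = 0 \<odot>\<^bsub>Y\<^esub> f \<zero>\<^bsub>X\<^esub>"
    using assms by (intro lin_hom_smult) (auto intro: vs_zero_closed)
  then show ?thesis using assms by (simp add: vs_zero_smult vs_zero_closed lin_hom_closed[OF assms(3)])
qed

lemma lin_hom_minus:
  assumes "vs X" "vs Y" "f \<in> lin_hom X Y" "x \<in> carrier X" "y \<in> carrier X"
  shows "f (x \<ominus>\<^bsub>X\<^esub> y) = f x \<ominus>\<^bsub>Y\<^esub> f y"
  using assms by (simp add: vs_minus vs_closed lin_hom_add[OF assms(3)] lin_hom_smult[OF assms(3)] lin_hom_closed[OF assms(3)])

lemma lin_hom_cong:
  assumes "f \<in> lin_hom X Y" "\<And>x. x \<in> carrier X \<Longrightarrow> g x = f x" "vs X"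
  shows "g \<in> lin_hom X Y"
  using assms by (intro lin_homI) (auto simp: vs_closed lin_hom_add[OF assms(1)] lin_hom_smult[OF assms(1)] lin_hom_closed[OF assms(1)])

lemma lin_hom_restrict: "f \<in> lin_hom X Y \<Longrightarrow> vs X \<Longrightarrow> restrict f (carrier X) \<in> lin_hom X Y"
  by (erule lin_hom_cong) auto

lemma lin_hom_comp: "f \<in> lin_hom X Y \<Longrightarrow> g \<in> lin_hom Y Z \<Longrightarrow> (\<lambda>x. g (f x)) \<in> lin_hom X Z"
  by (auto simp: mod_hom_def Pi_iff)

lemma lin_hom_id: "id \<in> lin_hom X X" "(\<lambda>x. x) \<in> lin_hom X X"
  by (auto simp: mod_hom_def)

lemma lin_hom_kernel:
  assumes "vs X" "vs Y" "f \<in> lin_hom X Y"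
  shows "submodule {x \<in> carrier X. f x = \<zero>\<^bsub>Y\<^esub>} cfield X"
  using assms by (intro vs_submoduleI)
    (auto simp: vs_closed lin_hom_add[OF assms(3)] lin_hom_smult[OF assms(3)] lin_hom_zero[OF assms(1-3)] vs_smult_zero vs_zero_closed
      abelian_monoid.l_zero[OF abelian_group.axioms(1)[OF module.axioms(2)]])

lemma lin_hom_vimage:
  assumes "vs X" "vs Y" "f \<in> lin_hom X Y" "submodule H cfield Y"
  shows "submodule {x \<in> carrier X. f x \<in> H} cfield X"
  using assms vs_submoduleD[OF assms(2,4)] by (intro vs_submoduleI)
    (auto simp: vs_closed lin_hom_add[OF assms(3)] lin_hom_smult[OF assms(3)] lin_hom_zero[OF assms(1-3)])

lemma lin_hom_span_image:
  assumes "vs X" "vs Y" "f \<in> lin_hom X Y" "submodule H cfield Y" "S \<subseteq> carrier X"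
    "\<And>s. s \<in> S \<Longrightarrow> f s \<in> H" "x \<in> lin_span X S"
  shows "f x \<in> H"
proof -
  have "lin_span X S \<subseteq> {x \<in> carrier X. f x \<in> H}"
    by (rule span_minimal[OF assms(1) lin_hom_vimage[OF assms(1-4)]]) (use assms in auto)
  with assms show ?thesis by auto
qed

text \<open>The Hopf algebras, form modules and bundles are records that extend or modify others.
  This lemma and the next three carry algebraic structure between records that agree in the fields
  that matter.\<close>

lemma abelian_group_cong:
  assumes "abelian_group R" "carrier R' = carrier R" "add R' = add R" "zero R' = zero R"
  shows "abelian_group R'"
proof -
  interpret abelian_group R by fact
  show ?thesis by (rule abelian_groupI) (auto simp: assms a_ac intro: l_neg)
qed

lemma ring_cong:
  assumes "ring R" "carrier R' = carrier R" "add R' = add R" "zero R' = zero R" "mult R' = mult R" "one R' = one R"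
  shows "ring R'"
proof -
  interpret ring R by fact
  have "abelian_group R'" by (rule abelian_group_cong[OF is_abelian_group]) (use assms in auto)
  then show ?thesis
    by (intro ringI monoidI) (auto simp: assms l_distr r_distr m_assoc)
qed

lemma vs_cong:
  assumes "vs R" "carrier R' = carrier R" "add R' = add R" "zero R' = zero R" "smult R' = smult R"
  shows "vs R'"
proof -
  have "abelian_group R'" by (rule abelian_group_cong[OF module.axioms(2)[OF assms(1)]]) (use assms in auto)
  then show ?thesis by (rule vsI) (use assms in \<open>auto simp: vs_closed vs_add_smult vs_smult_add vs_smult_smult vs_one\<close>)
qed

lemma cplx_algebra_cong:
  assumes "cplx_algebra R" "carrier R' = carrier R" "add R' = add R" "zero R' = zero R" "mult R' = mult R" "one R' = one R"
    "smult R' = smult R"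
  shows "cplx_algebra R'"
proof -
  have "vs R'" "ring R'" using vs_cong[of R R'] ring_cong[of R R'] assms by (auto simp: cplx_algebra_def)
  then show ?thesis using assms by (auto simp: cplx_algebra_def)
qed

lemma cplx_algebraD:
  assumes "cplx_algebra B"
  shows "vs B" "ring B"
    "\<And>r x y. x \<in> carrier B \<Longrightarrow> y \<in> carrier B \<Longrightarrow> (r \<odot>\<^bsub>B\<^esub> x) \<otimes>\<^bsub>B\<^esub> y = r \<odot>\<^bsub>B\<^esub> (x \<otimes>\<^bsub>B\<^esub> y)"
    "\<And>r x y. x \<in> carrier B \<Longrightarrow> y \<in> carrier B \<Longrightarrow> x \<otimes>\<^bsub>B\<^esub> (r \<odot>\<^bsub>B\<^esub> y) = r \<odot>\<^bsub>B\<^esub> (x \<otimes>\<^bsub>B\<^esub> y)"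
  using assms by (auto simp: cplx_algebra_def)

section \<open>Quotients\<close>

lemma quot_mod_sel:
  "carrier (quot_mod X N) = a_rcosets\<^bsub>X\<^esub> N" "add (quot_mod X N) = set_add X" "zero (quot_mod X N) = N"
  "mult (quot_mod X N) = rcoset_mult X N" "one (quot_mod X N) = N +>\<^bsub>X\<^esub> \<one>\<^bsub>X\<^esub>"
  "smult (quot_mod X N) = (\<lambda>r C. \<Union>x\<in>C. N +>\<^bsub>X\<^esub> (r \<odot>\<^bsub>X\<^esub> x))"
  by (simp_all add: quot_mod_def ring.defs module.defs FactRing_def)

context
  fixes Y (structure) and N
  assumes Y: "vs Y" and N: "submodule N cfield Y"
begin

interpretation module cfield Y by (rule Y)
interpretation N: abelian_subgroup N Y
  by (rule abelian_subgroupI3) (use submodule.axioms(1)[OF N] in \<open>auto intro: additive_subgroup.intro M.abelian_group_axioms\<close>)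

lemma quot_carrier: "carrier (quot_mod Y N) = (\<lambda>y. N +> y) ` carrier Y"
  unfolding quot_mod_sel A_RCOSETS_defs a_r_coset_def r_coset_def by auto

lemma quot_add: "x \<in> carrier Y \<Longrightarrow> y \<in> carrier Y \<Longrightarrow> (N +> x) \<oplus>\<^bsub>quot_mod Y N\<^esub> (N +> y) = N +> (x \<oplus> y)"
  unfolding quot_mod_sel by (rule N.a_rcos_sum)

lemma quot_eq_iff: "x \<in> carrier Y \<Longrightarrow> y \<in> carrier Y \<Longrightarrow> N +> x = N +> y \<longleftrightarrow> x \<ominus> y \<in> N"
  using N.a_rcos_module[of y x] N.a_repr_independence'[of x y] N.a_rcos_self[of x]
  unfolding a_minus_def by metis

lemma quot_mem: "x \<in> carrier Y \<Longrightarrow> x' \<in> N +> x \<longleftrightarrow> x' \<in> carrier Y \<and> x' \<ominus> x \<in> N"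
  using N.a_rcos_module[of x x'] N.a_elemrcos_carrier[of x x'] by (auto simp: a_minus_def)

lemma quot_zero: "N +> \<zero> = N" "\<zero>\<^bsub>quot_mod Y N\<^esub> = N +> \<zero>"
  using vs_submoduleD(1)[OF Y N] by (auto simp: quot_mod_sel)

lemma quot_smult: "x \<in> carrier Y \<Longrightarrow> r \<odot>\<^bsub>quot_mod Y N\<^esub> (N +> x) = N +> (r \<odot> x)"
proof -
  assume x: "x \<in> carrier Y"
  \<comment> \<open>All members of the union in the scalar multiplication of \<open>quot_mod\<close>
    are the same coset, so the union is that coset.\<close>
  have "N +> (r \<odot> x') = N +> (r \<odot> x)" if "x' \<in> N +> x" for x'
  proof -
    from that x have x': "x' \<in> carrier Y" "x' \<ominus> x \<in> N" by (auto simp: quot_mem)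
    then have "r \<odot> (x' \<ominus> x) \<in> N" by (auto intro: vs_submoduleD[OF Y N])
    moreover have "r \<odot> (x' \<ominus> x) = r \<odot> x' \<ominus> r \<odot> x"
      using x x' Y by (simp add: vs_minus vs_smult_add vs_smult_smult vs_smult_closed mult.commute)
    ultimately show ?thesis using quot_eq_iff[of "r \<odot> x'" "r \<odot> x"] x x' by simp
  qed
  then show ?thesis unfolding quot_mod_sel using N.a_rcos_self[OF x] by (intro SUP_eq_const) blast+
qed

lemma quot_vs: "vs (quot_mod Y N)"
proof (rule vsI)
  show "abelian_group (quot_mod Y N)"
  proof (rule abelian_groupI)
    fix x assume "x \<in> carrier (quot_mod Y N)"
    then obtain y where y: "y \<in> carrier Y" "x = N +> y" by (auto simp: quot_carrier)
    then show "\<exists>z\<in>carrier (quot_mod Y N). z \<oplus>\<^bsub>quot_mod Y N\<^esub> x = \<zero>\<^bsub>quot_mod Y N\<^esub>"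
      by (intro bexI[of _ "N +> (\<ominus> y)"]) (auto simp: quot_add quot_carrier quot_zero l_neg)
  qed (auto simp: quot_carrier quot_add quot_zero(2) a_ac)
qed (use Y in \<open>auto simp: quot_carrier quot_add quot_smult vs_closed vs_add_smult vs_smult_add vs_smult_smult vs_one\<close>)

lemma quot_lin: "(\<lambda>y. N +> y) \<in> lin_hom Y (quot_mod Y N)"
  by (rule lin_homI) (auto simp: quot_carrier quot_add quot_smult)

text \<open>Universal property of the quotient. The map is produced extensional because the
  descriptions in the definitions select among extensional functions, and uniqueness depends on
  it.\<close>

lemma quot_lift:
  assumes Z: "vs Z" and f: "f \<in> lin_hom Y Z" and 0: "\<And>x. x \<in> N \<Longrightarrow> f x = \<zero>\<^bsub>Z\<^esub>"
  obtains g where "g \<in> lin_hom (quot_mod Y N) Z" "g \<in> extensional (carrier (quot_mod Y N))"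
    "\<And>y. y \<in> carrier Y \<Longrightarrow> g (N +> y) = f y"
proof -
  define g where "g = (\<lambda>C \<in> carrier (quot_mod Y N). f (SOME y. y \<in> carrier Y \<and> C = N +> y))"
  have g: "g (N +> y) = f y" if y: "y \<in> carrier Y" for y
  proof -
    define y' where "y' = (SOME y'. y' \<in> carrier Y \<and> N +> y = N +> y')"
    have "y' \<in> carrier Y \<and> N +> y = N +> y'" unfolding y'_def by (rule someI[of _ y]) (use y in auto)
    then have y': "y' \<in> carrier Y" "y \<ominus> y' \<in> N" using y by (auto simp: quot_eq_iff)
    then have "f y \<ominus>\<^bsub>Z\<^esub> f y' = \<zero>\<^bsub>Z\<^esub>" using 0 lin_hom_minus[OF Y Z f, of y y'] y by auto
    then have "f y = f y'" using vs_minus_eq_zero[OF Z] lin_hom_closed[OF f] y y' by auto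
    then show ?thesis using y by (auto simp: g_def quot_carrier y'_def)
  qed
  show ?thesis
    by (rule that[of g]) (auto intro!: lin_homI simp: quot_carrier quot_add quot_smult g lin_hom_closed[OF f]
      lin_hom_add[OF f] lin_hom_smult[OF f] vs_closed[OF Y], auto simp: g_def quot_carrier)
qed

end

text \<open>A scalar r acts as multiplication by r times the unit, so ring ideals are automatically
  subspaces.\<close>

lemma ideal_submodule:
  assumes B: "cplx_algebra B" and I: "ideal I B"
  shows "submodule I cfield B"
proof -
  note D = cplx_algebraD[OF B]
  interpret ring B by fact
  interpret ideal I B by fact
  show ?thesis
  proof (rule vs_submoduleI[OF D(1)])
    fix r x assume x: "x \<in> I"
    then have x': "x \<in> carrier B" by (rule a_Hcarr)
    have "(r \<odot>\<^bsub>B\<^esub> \<one>\<^bsub>B\<^esub>) \<otimes>\<^bsub>B\<^esub> x \<in> I" using x by (intro I_l_closed vs_smult_closed[OF D(1)]) auto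
    then show "r \<odot>\<^bsub>B\<^esub> x \<in> I" using x' by (simp add: D(3))
  qed (auto intro: a_Hcarr)
qed

lemma quot_algebra:
  assumes B: "cplx_algebra B" and I: "ideal I B"
  shows "cplx_algebra (quot_mod B I)"
    "\<And>x y. x \<in> carrier B \<Longrightarrow> y \<in> carrier B \<Longrightarrow>
       (I +>\<^bsub>B\<^esub> x) \<otimes>\<^bsub>quot_mod B I\<^esub> (I +>\<^bsub>B\<^esub> y) = I +>\<^bsub>B\<^esub> (x \<otimes>\<^bsub>B\<^esub> y)"
    "\<one>\<^bsub>quot_mod B I\<^esub> = I +>\<^bsub>B\<^esub> \<one>\<^bsub>B\<^esub>"
proof -
  note D = cplx_algebraD[OF B]
  note N = ideal_submodule[OF B I]
  interpret ring B by fact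
  interpret ideal I B by fact
  show m: "(I +>\<^bsub>B\<^esub> x) \<otimes>\<^bsub>quot_mod B I\<^esub> (I +>\<^bsub>B\<^esub> y) = I +>\<^bsub>B\<^esub> (x \<otimes>\<^bsub>B\<^esub> y)"
    if "x \<in> carrier B" "y \<in> carrier B" for x y
    using that by (simp add: quot_mod_sel rcoset_mult_add)
  show "\<one>\<^bsub>quot_mod B I\<^esub> = I +>\<^bsub>B\<^esub> \<one>\<^bsub>B\<^esub>" by (simp add: quot_mod_sel)
  have "ring (quot_mod B I)"
    by (rule ring_cong[OF quotient_is_ring]) (auto simp: quot_mod_def ring.defs)
  then show "cplx_algebra (quot_mod B I)"
    unfolding cplx_algebra_def
    by (auto simp: quot_vs[OF D(1) N] quot_carrier[OF D(1) N] quot_smult[OF D(1) N] m D vs_closed[OF D(1)])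
qed

section \<open>Free vector spaces and monoid algebras\<close>

abbreviation "pkeys \<equiv> Poly_Mapping.keys"
abbreviation "coef \<equiv> Poly_Mapping.lookup"
abbreviation "sgl \<equiv> Poly_Mapping.single"
abbreviation "pscale r \<equiv> Poly_Mapping.map ((*) (r::complex))"

lemma lookup_pscale [simp]: "coef (pscale r f) k = r * coef f k"
  by transfer (simp add: when_def)

lemma pscale_single [simp]: "pscale r (sgl k c) = sgl k (r * c)"
  by (rule poly_mapping_eqI) (simp add: lookup_single when_def)

lemma pscale_add: "pscale r (f + g) = pscale r f + pscale r g"
  by (rule poly_mapping_eqI) (simp add: lookup_add algebra_simps)

lemma monoid_algebra_sel [simp]:
  "carrier (monoid_algebra G) = {f. pkeys f \<subseteq> carrier G}" "\<zero>\<^bsub>monoid_algebra G\<^esub> = 0"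
  "f \<oplus>\<^bsub>monoid_algebra G\<^esub> g = f + g" "r \<odot>\<^bsub>monoid_algebra G\<^esub> f = pscale r f" "\<one>\<^bsub>monoid_algebra G\<^esub> = sgl \<one>\<^bsub>G\<^esub> 1"
  by (simp_all add: monoid_algebra_def)

lemma keys_pscale: "pkeys (pscale r f) \<subseteq> pkeys f"
  by (auto simp: in_keys_iff)

lemma keys_add_subset: "pkeys f \<subseteq> A \<Longrightarrow> pkeys g \<subseteq> A \<Longrightarrow> pkeys (f + g) \<subseteq> A"
  using keys_add[of f g] by auto

lemma monoid_algebra_vs: "vs (monoid_algebra G)"
proof (rule vsI)
  show "abelian_group (monoid_algebra G)"
  proof (rule abelian_groupI)
    fix f assume "f \<in> carrier (monoid_algebra G)"
    then show "\<exists>g\<in>carrier (monoid_algebra G). g \<oplus>\<^bsub>monoid_algebra G\<^esub> f = \<zero>\<^bsub>monoid_algebra G\<^esub>"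
      by (intro bexI[of _ "- f"]) (auto simp: in_keys_iff)
  qed (auto simp: algebra_simps dest: set_mp[OF keys_add])
qed (auto simp: pscale_add dest: set_mp[OF keys_add] set_mp[OF keys_pscale] intro!: poly_mapping_eqI simp: lookup_add algebra_simps)

lemma poly_mapping_decomp: "f = (\<Sum>k\<in>pkeys f. sgl k (coef f k))"
  by (rule poly_mapping_eqI) (auto simp: lookup_sum lookup_single when_def in_keys_iff sum.delta)

lemma poly_mapping_induct [consumes 1, case_names zero single add]:
  fixes f :: "'g \<Rightarrow>\<^sub>0 'c :: comm_monoid_add"
  assumes "pkeys f \<subseteq> A" "Q 0" "\<And>k c. k \<in> A \<Longrightarrow> Q (sgl k c)"
    "\<And>f g. pkeys f \<subseteq> A \<Longrightarrow> pkeys g \<subseteq> A \<Longrightarrow> Q f \<Longrightarrow> Q g \<Longrightarrow> Q (f + g)"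
  shows "Q f"
proof -
  have "pkeys (\<Sum>k\<in>K. sgl k (coef f k)) \<subseteq> A \<and> Q (\<Sum>k\<in>K. sgl k (coef f k))" if "K \<subseteq> pkeys f" for K
    using finite_subset[OF that finite_keys] that
  proof (induction K rule: finite_induct)
    case (insert k K)
    then have "k \<in> A" using assms(1) by auto
    then have s: "pkeys (sgl k (coef f k)) \<subseteq> A" "Q (sgl k (coef f k))" using assms(3) by auto
    have "Q (sgl k (coef f k) + (\<Sum>k\<in>K. sgl k (coef f k)))" using insert s by (intro assms(4)) auto
    then show ?case using insert s by (simp add: keys_add_subset)
  qed (use assms in auto)
  from this[of "pkeys f"] show ?thesis using poly_mapping_decomp[of f] by simp
qed

text \<open>Linear extension of a map from a basis to the free vector space. Maps out of tensor
  products and presented algebras are obtained from it by passing to a quotient.\<close>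

definition lext :: "(complex, 'x, 'k) module_scheme \<Rightarrow> ('g \<Rightarrow> 'x) \<Rightarrow> ('g \<Rightarrow>\<^sub>0 complex) \<Rightarrow> 'x" where
  "lext X \<beta> f = finsum X (\<lambda>k. coef f k \<odot>\<^bsub>X\<^esub> \<beta> k) (pkeys f)"

context
  fixes X (structure) and \<beta> :: "'g \<Rightarrow> 'x" and A :: "'g set"
  assumes X: "vs X" and \<beta>: "\<And>k. k \<in> A \<Longrightarrow> \<beta> k \<in> carrier X"
begin

interpretation module cfield X by (rule X)

text \<open>Summing over any finite set that contains the support lets the sums for f, g and f + g
  be compared over one index set.\<close>

lemma lext_superset:
  assumes "pkeys f \<subseteq> K" "K \<subseteq> A" "finite K"
  shows "lext X \<beta> f = finsum X (\<lambda>k. coef f k \<odot> \<beta> k) K"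
proof -
  have 0: "coef f k \<odot> \<beta> k = \<zero>" if "k \<in> K - pkeys f" for k
    using that assms \<beta> by (auto simp: in_keys_iff vs_zero_smult[OF X])
  have "finsum X (\<lambda>k. coef f k \<odot> \<beta> k) K = finsum X (\<lambda>k. coef f k \<odot> \<beta> k) (pkeys f)"
    by (rule add.finprod_mono_neutral_cong_left[symmetric]) (use assms \<beta> 0 in auto)
  then show ?thesis by (simp add: lext_def)
qed

lemma lext_closed: "pkeys f \<subseteq> A \<Longrightarrow> lext X \<beta> f \<in> carrier X"
  unfolding lext_def using \<beta> by (intro finsum_closed) auto

lemma lext_add:
  assumes "pkeys f \<subseteq> A" "pkeys g \<subseteq> A"
  shows "lext X \<beta> (f + g) = lext X \<beta> f \<oplus> lext X \<beta> g"
proof -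
  let ?K = "pkeys f \<union> pkeys g"
  have \<beta>': "\<beta> k \<in> carrier X" if "k \<in> ?K" for k using that assms \<beta> by auto
  have "lext X \<beta> (f + g) = finsum X (\<lambda>k. coef (f + g) k \<odot> \<beta> k) ?K"
    by (rule lext_superset) (use assms keys_add[of f g] in auto)
  also have "\<dots> = finsum X (\<lambda>k. coef f k \<odot> \<beta> k \<oplus> coef g k \<odot> \<beta> k) ?K"
    by (rule add.finprod_cong') (use \<beta>' in \<open>auto simp: lookup_add vs_add_smult[OF X]\<close>)
  also have "\<dots> = finsum X (\<lambda>k. coef f k \<odot> \<beta> k) ?K \<oplus> finsum X (\<lambda>k. coef g k \<odot> \<beta> k) ?K"
    by (rule finsum_addf) (use \<beta>' in auto)
  also have "\<dots> = lext X \<beta> f \<oplus> lext X \<beta> g"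
    using lext_superset[of f ?K] lext_superset[of g ?K] assms by auto
  finally show ?thesis .
qed

lemma lext_single: "k \<in> A \<Longrightarrow> lext X \<beta> (sgl k c) = c \<odot> \<beta> k"
proof -
  assume k: "k \<in> A"
  have "lext X \<beta> (sgl k c) = finsum X (\<lambda>k'. coef (sgl k c) k' \<odot> \<beta> k') {k}"
    by (rule lext_superset) (use k in auto)
  then show ?thesis using k \<beta> by auto
qed

lemma lext_pscale: "pkeys f \<subseteq> A \<Longrightarrow> lext X \<beta> (pscale r f) = r \<odot> lext X \<beta> f"
proof (induction f rule: poly_mapping_induct[where A = A])
  case zero
  have "pscale r 0 = (0 :: 'g \<Rightarrow>\<^sub>0 complex)" by (rule poly_mapping_eqI) simp
  then show ?case by (simp add: lext_def vs_smult_zero[OF X])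
next
  case (single k c)
  then show ?case using \<beta> by (simp add: lext_single vs_smult_smult[OF X])
next
  case (add f g)
  have k: "pkeys (pscale r f) \<subseteq> A" "pkeys (pscale r g) \<subseteq> A" using add keys_pscale[of r f] keys_pscale[of r g] by auto
  show ?case using add k by (simp add: pscale_add lext_add lext_closed vs_smult_add[OF X])
qed

end

lemma lext_lin:
  assumes "vs X" "\<And>k. k \<in> carrier G \<Longrightarrow> \<beta> k \<in> carrier X"
  shows "lext X \<beta> \<in> lin_hom (monoid_algebra G) X"
  by (rule lin_homI) (use lext_closed[of X "carrier G" \<beta>] lext_add[of X "carrier G" \<beta>] lext_pscale[of X "carrier G" \<beta>] assms in auto)

lemma lext_sgl:
  assumes "vs X" "k \<in> carrier G \<Longrightarrow> \<beta> k \<in> carrier X" "k \<in> carrier G"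
  shows "lext X \<beta> (sgl k c) = c \<odot>\<^bsub>X\<^esub> \<beta> k"
  by (rule lext_single[of X "{k}"]) (use assms in auto)

text \<open>The product is defined through the exact supports. Over common larger index sets its
  bilinearity becomes visible termwise.\<close>

lemma monoid_algebra_mult_superset:
  assumes "pkeys f \<subseteq> K" "pkeys g \<subseteq> L" "finite K" "finite L"
  shows "f \<otimes>\<^bsub>monoid_algebra G\<^esub> g = (\<Sum>x\<in>K. \<Sum>y\<in>L. sgl (x \<otimes>\<^bsub>G\<^esub> y) (coef f x * coef g y))"
proof -
  have "f \<otimes>\<^bsub>monoid_algebra G\<^esub> g = (\<Sum>x\<in>pkeys f. \<Sum>y\<in>pkeys g. sgl (x \<otimes>\<^bsub>G\<^esub> y) (coef f x * coef g y))"
    by (simp add: monoid_algebra_def)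
  also have "\<dots> = (\<Sum>x\<in>pkeys f. \<Sum>y\<in>L. sgl (x \<otimes>\<^bsub>G\<^esub> y) (coef f x * coef g y))"
    by (intro sum.cong refl sum.mono_neutral_left) (use assms in \<open>auto simp: in_keys_iff\<close>)
  also have "\<dots> = (\<Sum>x\<in>K. \<Sum>y\<in>L. sgl (x \<otimes>\<^bsub>G\<^esub> y) (coef f x * coef g y))"
    by (intro sum.mono_neutral_left) (use assms in \<open>auto simp: in_keys_iff\<close>)
  finally show ?thesis .
qed

lemma monoid_algebra_mult_single [simp]:
  "sgl x r \<otimes>\<^bsub>monoid_algebra G\<^esub> sgl y s = sgl (x \<otimes>\<^bsub>G\<^esub> y) (r * s)"
  by (subst monoid_algebra_mult_superset[of _ "{x}" _ "{y}"]) auto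

lemma monoid_algebra_mult_add:
  "(f + f') \<otimes>\<^bsub>monoid_algebra G\<^esub> g = f \<otimes>\<^bsub>monoid_algebra G\<^esub> g + f' \<otimes>\<^bsub>monoid_algebra G\<^esub> g"
  "f \<otimes>\<^bsub>monoid_algebra G\<^esub> (g + g') = f \<otimes>\<^bsub>monoid_algebra G\<^esub> g + f \<otimes>\<^bsub>monoid_algebra G\<^esub> g'"
  by (simp_all add: monoid_algebra_mult_superset[of _ "pkeys f \<union> pkeys f'" _ "pkeys g \<union> pkeys g'"]
      keys_add lookup_add algebra_simps single_add sum.distrib le_supI1 le_supI2
      subset_trans[OF keys_add])

lemma monoid_algebra_mult_pscale:
  "pscale r f \<otimes>\<^bsub>monoid_algebra G\<^esub> g = pscale r (f \<otimes>\<^bsub>monoid_algebra G\<^esub> g)"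
  "f \<otimes>\<^bsub>monoid_algebra G\<^esub> pscale r g = pscale r (f \<otimes>\<^bsub>monoid_algebra G\<^esub> g)"
proof -
  have s: "pscale r (sum h I) = (\<Sum>i\<in>I. pscale r (h i))" for h :: "'z \<Rightarrow> 'a \<Rightarrow>\<^sub>0 complex" and I
    by (rule poly_mapping_eqI) (simp add: lookup_sum sum_distrib_left)
  show "pscale r f \<otimes>\<^bsub>monoid_algebra G\<^esub> g = pscale r (f \<otimes>\<^bsub>monoid_algebra G\<^esub> g)"
    "f \<otimes>\<^bsub>monoid_algebra G\<^esub> pscale r g = pscale r (f \<otimes>\<^bsub>monoid_algebra G\<^esub> g)"
    by (simp_all add: monoid_algebra_mult_superset[of _ "pkeys f" _ "pkeys g"] keys_pscale s mult_ac)
qed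

lemma monoid_algebra_mult_zero [simp]:
  "0 \<otimes>\<^bsub>monoid_algebra G\<^esub> g = 0" "f \<otimes>\<^bsub>monoid_algebra G\<^esub> 0 = 0"
  by (simp_all add: monoid_algebra_def)

lemma monoid_algebra_algebra:
  assumes "monoid G" shows "cplx_algebra (monoid_algebra G)"
proof -
  interpret monoid G by fact
  let ?R = "monoid_algebra G"
  have ag: "abelian_group ?R" using monoid_algebra_vs by (rule module.axioms)
  have closed: "pkeys (f \<otimes>\<^bsub>?R\<^esub> g) \<subseteq> carrier G" if f: "pkeys f \<subseteq> carrier G" and g: "pkeys g \<subseteq> carrier G" for f g
    using f
  proof (induction f rule: poly_mapping_induct[where A = "carrier G"])
    case (single x r)
    from g show ?case
      by (induction g rule: poly_mapping_induct[where A = "carrier G"])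
        (use single in \<open>simp_all add: monoid_algebra_mult_add keys_add_subset\<close>)
  next
    case (add f f')
    then show ?case by (simp add: monoid_algebra_mult_add keys_add_subset)
  qed simp
  have assoc: "(f \<otimes>\<^bsub>?R\<^esub> g) \<otimes>\<^bsub>?R\<^esub> h = f \<otimes>\<^bsub>?R\<^esub> (g \<otimes>\<^bsub>?R\<^esub> h)"
    if f: "pkeys f \<subseteq> carrier G" and g: "pkeys g \<subseteq> carrier G" and h: "pkeys h \<subseteq> carrier G" for f g h
    using f
  proof (induction f rule: poly_mapping_induct[where A = "carrier G"])
    case (single x r)
    from g show ?case
    proof (induction g rule: poly_mapping_induct[where A = "carrier G"])
      case (single y s)
      from h show ?case
        by (induction h rule: poly_mapping_induct[where A = "carrier G"])
          (use \<open>x \<in> carrier G\<close> \<open>y \<in> carrier G\<close> in \<open>auto simp: monoid_algebra_mult_add m_assoc mult_ac\<close>)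
    qed (auto simp: monoid_algebra_mult_add)
  qed (auto simp: monoid_algebra_mult_add)
  have one: "sgl \<one>\<^bsub>G\<^esub> 1 \<otimes>\<^bsub>?R\<^esub> f = f \<and> f \<otimes>\<^bsub>?R\<^esub> sgl \<one>\<^bsub>G\<^esub> 1 = f" if f: "pkeys f \<subseteq> carrier G" for f
    using f by (induction f rule: poly_mapping_induct[where A = "carrier G"]) (auto simp: monoid_algebra_mult_add)
  have "ring ?R"
    by (rule ringI[OF ag monoidI]) (use closed assoc one in \<open>auto simp: monoid_algebra_mult_add\<close>)
  then show ?thesis
    by (auto simp: cplx_algebra_def monoid_algebra_vs monoid_algebra_mult_pscale)
qed

lemma alg_homI:
  assumes "f \<in> lin_hom B C" "\<And>x y. x \<in> carrier B \<Longrightarrow> y \<in> carrier B \<Longrightarrow> f (x \<otimes>\<^bsub>B\<^esub> y) = f x \<otimes>\<^bsub>C\<^esub> f y" "f \<one>\<^bsub>B\<^esub> = \<one>\<^bsub>C\<^esub>"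
  shows "f \<in> alg_hom B C"
  using assms by (auto simp: alg_hom_def ring_hom_def mod_hom_def)

lemma alg_homD:
  assumes "f \<in> alg_hom B C"
  shows "f \<in> lin_hom B C" "\<And>x y. x \<in> carrier B \<Longrightarrow> y \<in> carrier B \<Longrightarrow> f (x \<otimes>\<^bsub>B\<^esub> y) = f x \<otimes>\<^bsub>C\<^esub> f y" "f \<one>\<^bsub>B\<^esub> = \<one>\<^bsub>C\<^esub>"
  using assms by (auto simp: alg_hom_def ring_hom_def)

lemma alg_hom_comp: "f \<in> alg_hom B C \<Longrightarrow> g \<in> alg_hom C D \<Longrightarrow> (\<lambda>x. g (f x)) \<in> alg_hom B D"
  using lin_hom_closed[OF alg_homD(1), of f B C] by (intro alg_homI) (auto simp: alg_homD intro: lin_hom_comp[of f B C])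

text \<open>Universal property of the monoid algebra: multiplicativity on the basis extends by
  bilinearity, one factor at a time.\<close>

lemma lext_alg_hom:
  assumes G: "monoid G" and B: "cplx_algebra B" and \<beta>: "\<And>x. x \<in> carrier G \<Longrightarrow> \<beta> x \<in> carrier B"
    "\<And>x y. x \<in> carrier G \<Longrightarrow> y \<in> carrier G \<Longrightarrow> \<beta> (x \<otimes>\<^bsub>G\<^esub> y) = \<beta> x \<otimes>\<^bsub>B\<^esub> \<beta> y" "\<beta> \<one>\<^bsub>G\<^esub> = \<one>\<^bsub>B\<^esub>"
  shows "lext B \<beta> \<in> alg_hom (monoid_algebra G) B"
proof -
  interpret G: monoid G by fact
  interpret B: ring B using B by (simp add: cplx_algebra_def)
  note D = cplx_algebraD[OF B]
  let ?R = "monoid_algebra G"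
  have lin: "lext B \<beta> \<in> lin_hom ?R B" by (rule lext_lin) (use D \<beta> in auto)
  have single: "lext B \<beta> (sgl k c) = c \<odot>\<^bsub>B\<^esub> \<beta> k" if "k \<in> carrier G" for k c
    by (rule lext_sgl[where G = G]) (use that D \<beta> in auto)
  have zero: "lext B \<beta> 0 = \<zero>\<^bsub>B\<^esub>" by (simp add: lext_def)
  have add: "lext B \<beta> (f + g) = lext B \<beta> f \<oplus>\<^bsub>B\<^esub> lext B \<beta> g" if "pkeys f \<subseteq> carrier G" "pkeys g \<subseteq> carrier G" for f g
    using lin_hom_add[OF lin, of f g] that by simp
  have clo: "lext B \<beta> f \<in> carrier B" if "pkeys f \<subseteq> carrier G" for f
    using lin_hom_closed[OF lin, of f] that by simp
  have mclo: "pkeys (f \<otimes>\<^bsub>?R\<^esub> g) \<subseteq> carrier G" if "pkeys f \<subseteq> carrier G" "pkeys g \<subseteq> carrier G" for f g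
    using that monoid_algebra_algebra[OF G] ring.ring_simprules(5)[of ?R f g] by (simp add: cplx_algebra_def)
  have mult: "lext B \<beta> (f \<otimes>\<^bsub>?R\<^esub> g) = lext B \<beta> f \<otimes>\<^bsub>B\<^esub> lext B \<beta> g"
    if f: "pkeys f \<subseteq> carrier G" and g: "pkeys g \<subseteq> carrier G" for f g
    using f
  proof (induction f rule: poly_mapping_induct[where A = "carrier G"])
    case (single x r)
    have k: "pkeys (sgl x r) \<subseteq> carrier G" for r using \<open>x \<in> carrier G\<close> by simp
    from g show ?case
      by (induction g rule: poly_mapping_induct[where A = "carrier G"])
        (use \<open>x \<in> carrier G\<close> k clo in \<open>auto simp: monoid_algebra_mult_add zero add mclo \<open>\<And>k c. _ \<Longrightarrow> lext B \<beta> (sgl k c) = _\<close>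
            \<beta> D vs_smult_smult[OF D(1)] vs_closed[OF D(1)] B.r_distr mult_ac\<close>)
  next
    case (add f f')
    then show ?case using g by (auto simp: monoid_algebra_mult_add \<open>\<And>f g. _ \<Longrightarrow> _ \<Longrightarrow> lext B \<beta> (f + g) = _\<close> mclo clo B.l_distr)
  qed (use g zero clo in auto)
  show ?thesis
    by (rule alg_homI) (use mult single lin \<beta> vs_one[OF D(1)] in auto)
qed

section \<open>Tensor products\<close>

definition bilin where
  "bilin U W Z \<beta> \<longleftrightarrow> (\<forall>u\<in>carrier U. (\<lambda>w. \<beta> u w) \<in> lin_hom W Z) \<and> (\<forall>w\<in>carrier W. (\<lambda>u. \<beta> u w) \<in> lin_hom U Z)"

lemma bilinI:
  assumes "\<And>u. u \<in> carrier U \<Longrightarrow> (\<lambda>w. \<beta> u w) \<in> lin_hom W Z" "\<And>w. w \<in> carrier W \<Longrightarrow> (\<lambda>u. \<beta> u w) \<in> lin_hom U Z"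
  shows "bilin U W Z \<beta>"
  using assms by (auto simp: bilin_def)

lemma bilinD:
  assumes "bilin U W Z \<beta>"
  shows "u \<in> carrier U \<Longrightarrow> (\<lambda>w. \<beta> u w) \<in> lin_hom W Z" "w \<in> carrier W \<Longrightarrow> (\<lambda>u. \<beta> u w) \<in> lin_hom U Z"
    "u \<in> carrier U \<Longrightarrow> w \<in> carrier W \<Longrightarrow> \<beta> u w \<in> carrier Z"
  using assms lin_hom_closed[of "\<lambda>w. \<beta> u w" W Z] by (auto simp: bilin_def)

definition tensor_gens where
  "tensor_gens U W =
     {sgl (u \<oplus>\<^bsub>U\<^esub> u', w) 1 - sgl (u, w) 1 - sgl (u', w) (1::complex)
        | u u' w. u \<in> carrier U \<and> u' \<in> carrier U \<and> w \<in> carrier W} \<union>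
      {sgl (u, w \<oplus>\<^bsub>W\<^esub> w') 1 - sgl (u, w) 1 - sgl (u, w') 1
        | u w w'. u \<in> carrier U \<and> w \<in> carrier W \<and> w' \<in> carrier W} \<union>
      {sgl (r \<odot>\<^bsub>U\<^esub> u, w) 1 - sgl (u, w) r
        | r u w. u \<in> carrier U \<and> w \<in> carrier W} \<union>
      {sgl (u, r \<odot>\<^bsub>W\<^esub> w) 1 - sgl (u, w) r
        | r u w. u \<in> carrier U \<and> w \<in> carrier W}"

lemma tensor_rel_eq: "tensor_rel U W = lin_span (monoid_algebra (U \<times>\<times> W)) (tensor_gens U W)"
  by (simp add: tensor_rel_def tensor_gens_def)

lemma keys_diff_subset: "pkeys f \<subseteq> A \<Longrightarrow> pkeys g \<subseteq> A \<Longrightarrow> pkeys (f - g) \<subseteq> (A :: 'z set)" for f g :: "'z \<Rightarrow>\<^sub>0 complex"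
  by (simp add: in_keys_iff lookup_minus subset_iff) (metis diff_self)

lemma monoid_algebra_minus [simp]:
  "pkeys f \<subseteq> carrier G \<Longrightarrow> pkeys g \<subseteq> carrier G \<Longrightarrow> f \<ominus>\<^bsub>monoid_algebra G\<^esub> g = f - g"
  by (subst vs_minus[OF monoid_algebra_vs]) (auto intro!: poly_mapping_eqI simp: lookup_add lookup_minus)

context
  fixes U (structure) and W (structure)
  assumes U: "vs U" and W: "vs W"
begin

private abbreviation (input) "F \<equiv> monoid_algebra (U \<times>\<times> W)"

lemma tensor_gens_carrier: "tensor_gens U W \<subseteq> carrier F"
proof -
  have k: "pkeys (sgl (u, w) c) \<subseteq> carrier U \<times> carrier W" if "u \<in> carrier U" "w \<in> carrier W" for u w and c :: complex
    using that by auto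
  note cl = k keys_diff_subset vs_closed[OF U] vs_closed[OF W]
  show ?thesis
    unfolding tensor_gens_def monoid_algebra_sel carrier_DirProd
    by (intro Un_least subsetI; elim CollectE exE conjE; simp only: mem_Collect_eq; intro cl; assumption)
qed

lemma tensor_rel_submodule: "submodule (tensor_rel U W) cfield F"
  unfolding tensor_rel_eq by (rule span_submodule[OF monoid_algebra_vs tensor_gens_carrier])

lemma tensor_vs: "vs (tensor U W)"
  unfolding tensor_def by (rule quot_vs[OF monoid_algebra_vs tensor_rel_submodule])

lemma pure_closed: "u \<in> carrier U \<Longrightarrow> w \<in> carrier W \<Longrightarrow> pure U W u w \<in> carrier (tensor U W)"
  unfolding tensor_def pure_def quot_carrier[OF monoid_algebra_vs tensor_rel_submodule]
  by (intro imageI) (simp add: carrier_DirProd)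

private lemma tensor_class:
  assumes "f - g \<in> tensor_rel U W" "pkeys f \<subseteq> carrier U \<times> carrier W" "pkeys g \<subseteq> carrier U \<times> carrier W"
  shows "tensor_rel U W +>\<^bsub>F\<^esub> f = tensor_rel U W +>\<^bsub>F\<^esub> g"
  by (subst quot_eq_iff[OF monoid_algebra_vs tensor_rel_submodule]) (use assms in \<open>simp_all add: carrier_DirProd\<close>)

private lemma tensor_class_add:
  assumes "pkeys f \<subseteq> carrier U \<times> carrier W" "pkeys g \<subseteq> carrier U \<times> carrier W"
  shows "tensor_rel U W +>\<^bsub>F\<^esub> (f + g) = (tensor_rel U W +>\<^bsub>F\<^esub> f) \<oplus>\<^bsub>tensor U W\<^esub> (tensor_rel U W +>\<^bsub>F\<^esub> g)"
  unfolding tensor_def using assms by (subst quot_add[OF monoid_algebra_vs tensor_rel_submodule]) (simp_all add: carrier_DirProd)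

private lemma tensor_class_smult:
  assumes "pkeys f \<subseteq> carrier U \<times> carrier W"
  shows "tensor_rel U W +>\<^bsub>F\<^esub> (pscale r f) = r \<odot>\<^bsub>tensor U W\<^esub> (tensor_rel U W +>\<^bsub>F\<^esub> f)"
  unfolding tensor_def using assms by (subst quot_smult[OF monoid_algebra_vs tensor_rel_submodule]) (simp_all add: carrier_DirProd)

private lemma tensor_class_sgl:
  assumes "u \<in> carrier U" "w \<in> carrier W"
  shows "tensor_rel U W +>\<^bsub>F\<^esub> (sgl (u, w) c) = c \<odot>\<^bsub>tensor U W\<^esub> pure U W u w"
  using tensor_class_smult[of "sgl (u, w) 1" c] assms by (simp add: pure_def)

private lemma gens_rel: "x \<in> tensor_gens U W \<Longrightarrow> x \<in> tensor_rel U W"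
  using span_superset[OF monoid_algebra_vs, of "tensor_gens U W"] unfolding tensor_rel_eq by auto

lemma pure_add_left:
  assumes "u \<in> carrier U" "u' \<in> carrier U" "w \<in> carrier W"
  shows "pure U W (u \<oplus> u') w = pure U W u w \<oplus>\<^bsub>tensor U W\<^esub> pure U W u' w"
proof -
  have "tensor_rel U W +>\<^bsub>F\<^esub> sgl (u \<oplus> u', w) 1 = tensor_rel U W +>\<^bsub>F\<^esub> (sgl (u, w) 1 + sgl (u', w) 1)"
  proof (rule tensor_class)
    show "sgl (u \<oplus> u', w) 1 - (sgl (u, w) 1 + sgl (u', w) 1) \<in> tensor_rel U W"
      by (rule gens_rel) (use assms in \<open>auto simp: tensor_gens_def diff_diff_eq\<close>)
  qed (use assms vs_closed[OF U] in \<open>simp_all add: keys_add_subset\<close>)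
  then show ?thesis using assms by (simp add: pure_def tensor_class_add)
qed

lemma pure_add_right:
  assumes "u \<in> carrier U" "w' \<in> carrier W" "w \<in> carrier W"
  shows "pure U W u (w \<oplus>\<^bsub>W\<^esub> w') = pure U W u w \<oplus>\<^bsub>tensor U W\<^esub> pure U W u w'"
proof -
  have "tensor_rel U W +>\<^bsub>F\<^esub> sgl (u, w \<oplus>\<^bsub>W\<^esub> w') 1 = tensor_rel U W +>\<^bsub>F\<^esub> (sgl (u, w) 1 + sgl (u, w') 1)"
  proof (rule tensor_class)
    show "sgl (u, w \<oplus>\<^bsub>W\<^esub> w') 1 - (sgl (u, w) 1 + sgl (u, w') 1) \<in> tensor_rel U W"
      by (rule gens_rel) (use assms in \<open>auto simp: tensor_gens_def diff_diff_eq\<close>)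
  qed (use assms vs_closed[OF W] in \<open>simp_all add: keys_add_subset\<close>)
  then show ?thesis using assms by (simp add: pure_def tensor_class_add)
qed

lemma pure_smult_left:
  assumes "u \<in> carrier U" "w \<in> carrier W"
  shows "pure U W (r \<odot> u) w = r \<odot>\<^bsub>tensor U W\<^esub> pure U W u w"
proof -
  have "tensor_rel U W +>\<^bsub>F\<^esub> sgl (r \<odot> u, w) 1 = tensor_rel U W +>\<^bsub>F\<^esub> sgl (u, w) r"
  proof (rule tensor_class)
    show "sgl (r \<odot> u, w) 1 - sgl (u, w) r \<in> tensor_rel U W"
      by (rule gens_rel) (use assms in \<open>auto simp: tensor_gens_def\<close>)
  qed (use assms vs_closed[OF U] in auto)
  then show ?thesis using assms by (simp add: pure_def[of _ _ "r \<odot> u"] tensor_class_sgl)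
qed

lemma pure_smult_right:
  assumes "u \<in> carrier U" "w \<in> carrier W"
  shows "pure U W u (r \<odot>\<^bsub>W\<^esub> w) = r \<odot>\<^bsub>tensor U W\<^esub> pure U W u w"
proof -
  have "tensor_rel U W +>\<^bsub>F\<^esub> sgl (u, r \<odot>\<^bsub>W\<^esub> w) 1 = tensor_rel U W +>\<^bsub>F\<^esub> sgl (u, w) r"
  proof (rule tensor_class)
    show "sgl (u, r \<odot>\<^bsub>W\<^esub> w) 1 - sgl (u, w) r \<in> tensor_rel U W"
      by (rule gens_rel) (use assms in \<open>auto simp: tensor_gens_def\<close>)
  qed (use assms vs_closed[OF W] in auto)
  then show ?thesis using assms by (simp add: pure_def[of _ _ u "_ \<odot>\<^bsub>_\<^esub> _"] tensor_class_sgl)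
qed

lemma pure_bilin: "bilin U W (tensor U W) (pure U W)"
  by (intro bilinI lin_homI) (auto simp: pure_closed pure_add_left pure_add_right pure_smult_left pure_smult_right)

lemma pure_zero:
  "u \<in> carrier U \<Longrightarrow> pure U W u \<zero>\<^bsub>W\<^esub> = \<zero>\<^bsub>tensor U W\<^esub>" "w \<in> carrier W \<Longrightarrow> pure U W \<zero> w = \<zero>\<^bsub>tensor U W\<^esub>"
  using lin_hom_zero[OF W tensor_vs bilinD(1)[OF pure_bilin]] lin_hom_zero[OF U tensor_vs bilinD(2)[OF pure_bilin]] by auto

text \<open>Zero and scalar multiples need no cases: zero is the pure tensor of two zeros, and a
  scalar is absorbed into the left factor.\<close>

lemma tensor_induct [consumes 3, case_names pure add]:
  assumes X: "X \<in> carrier (tensor U W)" and p: "\<And>u w. u \<in> carrier U \<Longrightarrow> w \<in> carrier W \<Longrightarrow> Q (pure U W u w)"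
    and a: "\<And>X Y. X \<in> carrier (tensor U W) \<Longrightarrow> Y \<in> carrier (tensor U W) \<Longrightarrow> Q X \<Longrightarrow> Q Y \<Longrightarrow> Q (X \<oplus>\<^bsub>tensor U W\<^esub> Y)"
  shows "Q X"
proof -
  have car: "carrier (tensor U W) = (\<lambda>y. tensor_rel U W +>\<^bsub>F\<^esub> y) ` carrier F"
    unfolding tensor_def by (rule quot_carrier[OF monoid_algebra_vs tensor_rel_submodule])
  have "Q (tensor_rel U W +>\<^bsub>F\<^esub> f)" if "pkeys f \<subseteq> carrier U \<times> carrier W" for f
    using that
  proof (induction f rule: poly_mapping_induct)
    case zero
    have "tensor_rel U W +>\<^bsub>F\<^esub> 0 = \<zero>\<^bsub>tensor U W\<^esub>"
      using quot_zero(2)[OF monoid_algebra_vs tensor_rel_submodule] by (simp add: tensor_def)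
    also have "\<dots> = pure U W \<zero> \<zero>\<^bsub>W\<^esub>" using pure_zero(1)[of \<zero>] U by (simp add: vs_zero_closed)
    finally show ?case using p U W by (simp add: vs_zero_closed)
  next
    case (single k c)
    then show ?case using U p[of "c \<odot> fst k" "snd k"]
      by (auto simp: tensor_class_sgl pure_smult_left vs_smult_closed)
  next
    case (add f g)
    then show ?case using a by (auto simp: tensor_class_add car carrier_DirProd)
  qed
  then show ?thesis using X unfolding car by (auto simp: carrier_DirProd)
qed

lemma tensor_hom_eq:
  assumes Z: "vs Z" and \<phi>: "\<phi> \<in> lin_hom (tensor U W) Z" and \<psi>: "\<psi> \<in> lin_hom (tensor U W) Z"
    and eq: "\<And>u w. u \<in> carrier U \<Longrightarrow> w \<in> carrier W \<Longrightarrow> \<phi> (pure U W u w) = \<psi> (pure U W u w)"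
    and X: "X \<in> carrier (tensor U W)"
  shows "\<phi> X = \<psi> X"
  by (rule tensor_induct[OF X]) (simp_all add: eq lin_hom_add[OF \<phi>] lin_hom_add[OF \<psi>])

text \<open>Universal property of the tensor product, which evaluates the description
  \<open>tlift\<close>. Existence: the linear extension kills the four kinds of relators.
  Uniqueness: pure tensors generate.\<close>

lemma tlift:
  assumes Z: "vs Z" and \<beta>: "bilin U W Z \<beta>"
  shows "tlift U W Z \<beta> \<in> lin_hom (tensor U W) Z"
    "\<And>u w. u \<in> carrier U \<Longrightarrow> w \<in> carrier W \<Longrightarrow> tlift U W Z \<beta> (pure U W u w) = \<beta> u w"
proof -
  let ?f = "lext Z (\<lambda>(u, w). \<beta> u w)"
  have clo: "(case k of (u, w) \<Rightarrow> \<beta> u w) \<in> carrier Z" if "k \<in> carrier (U \<times>\<times> W)" for k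
    using that bilinD(3)[OF \<beta>] by (auto simp: carrier_DirProd)
  have f: "?f \<in> lin_hom F Z" by (rule lext_lin[OF Z clo])
  have f1: "?f (sgl (u, w) c) = c \<odot>\<^bsub>Z\<^esub> \<beta> u w" if "u \<in> carrier U" "w \<in> carrier W" for u w c
    using lext_sgl[of Z "(u, w)" "U \<times>\<times> W" "\<lambda>(u, w). \<beta> u w"] Z bilinD(3)[OF \<beta>] that by (simp add: carrier_DirProd)
  have "?f x = \<zero>\<^bsub>Z\<^esub>" if x: "x \<in> tensor_gens U W" for x
  proof -
    have sub: "?f (g - h) = ?f g \<ominus>\<^bsub>Z\<^esub> ?f h" if "pkeys g \<subseteq> carrier U \<times> carrier W" "pkeys h \<subseteq> carrier U \<times> carrier W" for g h
      using lin_hom_minus[OF monoid_algebra_vs Z f, of g h] that by (simp add: carrier_DirProd)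
    have k: "pkeys (sgl (u, w) c) \<subseteq> carrier U \<times> carrier W" if "u \<in> carrier U" "w \<in> carrier W" for u w and c :: complex
      using that by auto
    have m: "x \<oplus>\<^bsub>Z\<^esub> y \<ominus>\<^bsub>Z\<^esub> x \<ominus>\<^bsub>Z\<^esub> y = \<zero>\<^bsub>Z\<^esub>" "x \<ominus>\<^bsub>Z\<^esub> x = \<zero>\<^bsub>Z\<^esub>" if "x \<in> carrier Z" "y \<in> carrier Z" for x y
    proof -
      interpret Z: module cfield Z by (rule Z)
      have "x \<oplus>\<^bsub>Z\<^esub> y \<ominus>\<^bsub>Z\<^esub> x = y" using that by (simp add: a_minus_def Z.M.a_comm[of x y] Z.M.a_assoc Z.M.r_neg)
      then show "x \<oplus>\<^bsub>Z\<^esub> y \<ominus>\<^bsub>Z\<^esub> x \<ominus>\<^bsub>Z\<^esub> y = \<zero>\<^bsub>Z\<^esub>" "x \<ominus>\<^bsub>Z\<^esub> x = \<zero>\<^bsub>Z\<^esub>" using that by (simp_all add: a_minus_def Z.M.r_neg)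
    qed
    have \<beta>a: "\<beta> (u \<oplus> u') w = \<beta> u w \<oplus>\<^bsub>Z\<^esub> \<beta> u' w" "\<beta> (r \<odot> u) w = r \<odot>\<^bsub>Z\<^esub> \<beta> u w"
      if "u \<in> carrier U" "u' \<in> carrier U" "w \<in> carrier W" for u u' w r
      using lin_hom_add[OF bilinD(2)[OF \<beta>], of w u u'] lin_hom_smult[OF bilinD(2)[OF \<beta>], of w u] that by auto
    have \<beta>b: "\<beta> u (w \<oplus>\<^bsub>W\<^esub> w') = \<beta> u w \<oplus>\<^bsub>Z\<^esub> \<beta> u w'" "\<beta> u (r \<odot>\<^bsub>W\<^esub> w) = r \<odot>\<^bsub>Z\<^esub> \<beta> u w"
      if "u \<in> carrier U" "w' \<in> carrier W" "w \<in> carrier W" for u w w' r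
      using lin_hom_add[OF bilinD(1)[OF \<beta>], of u w w'] lin_hom_smult[OF bilinD(1)[OF \<beta>], of u w] that by auto
    show ?thesis
      using x unfolding tensor_gens_def
      by (elim UnE CollectE exE conjE)
        (simp_all only: sub k keys_diff_subset f1 vs_closed[OF U] vs_closed[OF W] vs_closed[OF Z] vs_one[OF Z] bilinD(3)[OF \<beta>] \<beta>a \<beta>b m(1) m(2)[OF _ vs_zero_closed[OF Z]])
  qed
  then have "?f x = \<zero>\<^bsub>Z\<^esub>" if "x \<in> tensor_rel U W" for x
    using span_minimal[OF monoid_algebra_vs lin_hom_kernel[OF monoid_algebra_vs Z f], of "tensor_gens U W"] tensor_gens_carrier that
    unfolding tensor_rel_eq by blast
  then obtain g where g: "g \<in> lin_hom (tensor U W) Z" "g \<in> extensional (carrier (tensor U W))"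
    "\<And>y. y \<in> carrier F \<Longrightarrow> g (tensor_rel U W +>\<^bsub>F\<^esub> y) = ?f y"
    using quot_lift[OF monoid_algebra_vs tensor_rel_submodule Z f] unfolding tensor_def by metis
  have gp: "g (pure U W u w) = \<beta> u w" if "u \<in> carrier U" "w \<in> carrier W" for u w
    using g(3)[of "sgl (u, w) 1"] that f1[of u w 1] bilinD(3)[OF \<beta>] by (simp add: pure_def carrier_DirProd vs_one[OF Z])
  have "tlift U W Z \<beta> = g"
    unfolding tlift_def
  proof (rule the_equality)
    fix \<phi> assume \<phi>: "\<phi> \<in> extensional (carrier (tensor U W)) \<and> \<phi> \<in> lin_hom (tensor U W) Z \<and>
      (\<forall>u\<in>carrier U. \<forall>w\<in>carrier W. \<phi> (pure U W u w) = \<beta> u w)"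
    show "\<phi> = g"
      by (rule extensionalityI[of _ "carrier (tensor U W)"]) (use \<phi> g gp tensor_hom_eq[OF Z, of \<phi> g] in auto)
  qed (use g gp in auto)
  then show "tlift U W Z \<beta> \<in> lin_hom (tensor U W) Z"
    "\<And>u w. u \<in> carrier U \<Longrightarrow> w \<in> carrier W \<Longrightarrow> tlift U W Z \<beta> (pure U W u w) = \<beta> u w"
    using g gp by auto
qed

end

lemma ring_bilin:
  assumes "cplx_algebra B"
  shows "bilin B B B (mult B)"
proof -
  note D = cplx_algebraD[OF assms]
  interpret ring B by (rule D)
  show ?thesis by (intro bilinI lin_homI) (auto simp: D l_distr r_distr)
qed

lemma cplx_algebraI:
  assumes X: "vs X" and b: "bilin X X X (mult X)" and one: "\<one>\<^bsub>X\<^esub> \<in> carrier X"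
    and assoc: "\<And>x y z. x \<in> carrier X \<Longrightarrow> y \<in> carrier X \<Longrightarrow> z \<in> carrier X \<Longrightarrow> (x \<otimes>\<^bsub>X\<^esub> y) \<otimes>\<^bsub>X\<^esub> z = x \<otimes>\<^bsub>X\<^esub> (y \<otimes>\<^bsub>X\<^esub> z)"
    and l: "\<And>x. x \<in> carrier X \<Longrightarrow> \<one>\<^bsub>X\<^esub> \<otimes>\<^bsub>X\<^esub> x = x" and r: "\<And>x. x \<in> carrier X \<Longrightarrow> x \<otimes>\<^bsub>X\<^esub> \<one>\<^bsub>X\<^esub> = x"
  shows "cplx_algebra X"
proof -
  have "ring X"
    by (intro ringI monoidI module.axioms(2)[OF X])
      (use bilinD(3)[OF b] lin_hom_add[OF bilinD(1)[OF b]] lin_hom_add[OF bilinD(2)[OF b]] one assoc l r in auto)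
  then show ?thesis using X lin_hom_smult[OF bilinD(1)[OF b]] lin_hom_smult[OF bilinD(2)[OF b]] by (auto simp: cplx_algebra_def)
qed

context
  fixes U (structure) and W (structure)
  assumes U: "cplx_algebra U" and W: "cplx_algebra W"
begin

private abbreviation (input) "FA \<equiv> monoid_algebra (U \<times>\<times> W)"
private abbreviation (input) "TA \<equiv> tensor U W"

private lemma UW: "vs U" "vs W" using U W by (auto simp: cplx_algebra_def)
interpretation U: ring U using U by (simp add: cplx_algebra_def)
interpretation W: ring W using W by (simp add: cplx_algebra_def)

private lemma monoid_UW: "monoid (U \<times>\<times> W)"
  by (rule DirProd_monoid) (simp_all add: U.is_monoid W.is_monoid)

private lemma F: "cplx_algebra FA" by (rule monoid_algebra_algebra[OF monoid_UW])

text \<open>By distributivity, a relator times a basis element is again a relator of the same kind.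
  This is what makes the tensor relations a two-sided ideal, and hence the tensor product of
  algebras an algebra.\<close>

private lemma mult_gens:
  assumes x: "x \<in> tensor_gens U W" and k: "k \<in> carrier U \<times> carrier W"
  shows "x \<otimes>\<^bsub>FA\<^esub> sgl k 1 \<in> tensor_rel U W" "sgl k 1 \<otimes>\<^bsub>FA\<^esub> x \<in> tensor_rel U W"
proof -
  obtain p s where k: "k = (p, s)" "p \<in> carrier U" "s \<in> carrier W" using k by auto
  have d: "(f - g) \<otimes>\<^bsub>FA\<^esub> h = f \<otimes>\<^bsub>FA\<^esub> h - g \<otimes>\<^bsub>FA\<^esub> h" "h \<otimes>\<^bsub>FA\<^esub> (f - g) = h \<otimes>\<^bsub>FA\<^esub> f - h \<otimes>\<^bsub>FA\<^esub> g" for f g h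
    using monoid_algebra_mult_add(1)[of "U \<times>\<times> W" "f - g" g h] monoid_algebra_mult_add(2)[of "U \<times>\<times> W" h "f - g" g] by simp_all
  have "x \<otimes>\<^bsub>FA\<^esub> sgl k 1 \<in> tensor_gens U W"
    using x k unfolding tensor_gens_def
    apply (elim UnE CollectE exE conjE)
       apply (simp_all add: d mult_DirProd U.l_distr W.l_distr cplx_algebraD(3)[OF U] cplx_algebraD(3)[OF W])
       apply (blast intro: U.m_closed W.m_closed)+
    done
  moreover have "sgl k 1 \<otimes>\<^bsub>FA\<^esub> x \<in> tensor_gens U W"
    using x k unfolding tensor_gens_def
    apply (elim UnE CollectE exE conjE)
       apply (simp_all add: d mult_DirProd U.r_distr W.r_distr cplx_algebraD(4)[OF U] cplx_algebraD(4)[OF W])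
       apply (blast intro: U.m_closed W.m_closed)+
    done
  ultimately show "x \<otimes>\<^bsub>FA\<^esub> sgl k 1 \<in> tensor_rel U W" "sgl k 1 \<otimes>\<^bsub>FA\<^esub> x \<in> tensor_rel U W"
    using span_superset[OF monoid_algebra_vs, of "tensor_gens U W"] unfolding tensor_rel_eq by auto
qed

lemma tensor_rel_ideal: "ideal (tensor_rel U W) FA"
proof -
  interpret F: ring FA using F by (simp add: cplx_algebra_def)
  note sub = tensor_rel_submodule[OF UW] and b = ring_bilin[OF F]
  note S = vs_submoduleD[OF monoid_algebra_vs sub]
  have 1: "x \<otimes>\<^bsub>FA\<^esub> sgl k 1 \<in> tensor_rel U W \<and> sgl k 1 \<otimes>\<^bsub>FA\<^esub> x \<in> tensor_rel U W"
    if k: "k \<in> carrier U \<times> carrier W" and x: "x \<in> tensor_rel U W" for x k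
  proof -
    have kF: "sgl k 1 \<in> carrier FA" using k by (simp add: carrier_DirProd)
    show ?thesis
      using lin_hom_span_image[OF monoid_algebra_vs monoid_algebra_vs bilinD(1)[OF b kF] sub tensor_gens_carrier[OF UW]]
        lin_hom_span_image[OF monoid_algebra_vs monoid_algebra_vs bilinD(2)[OF b kF] sub tensor_gens_carrier[OF UW]] mult_gens k x
      by (simp add: tensor_rel_eq)
  qed
  have 2: "x \<otimes>\<^bsub>FA\<^esub> y \<in> tensor_rel U W \<and> y \<otimes>\<^bsub>FA\<^esub> x \<in> tensor_rel U W"
    if y: "y \<in> carrier FA" and x: "x \<in> tensor_rel U W" for x y
  proof -
    have "pkeys y \<subseteq> carrier U \<times> carrier W" using y by (simp add: carrier_DirProd)
    then show ?thesis
    proof (induction y rule: poly_mapping_induct)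
      case zero
      then show ?case using S(2) by simp
    next
      case (single k c)
      from S(4)[of _ c] 1[OF single x] monoid_algebra_mult_pscale(1)[of "U \<times>\<times> W" c "sgl k 1" x]
        monoid_algebra_mult_pscale(2)[of "U \<times>\<times> W" x c "sgl k 1"] show ?case by simp
    next
      case (add f g)
      then show ?case using S(3) by (simp add: monoid_algebra_mult_add)
    qed
  qed
  show ?thesis
    by (rule idealI) (use 2 F.ring_axioms submodule.axioms(1)[OF sub] in auto)
qed

lemma tensor_algebra: "cplx_algebra TA"
  and tensor_one: "\<one>\<^bsub>TA\<^esub> = pure U W \<one> \<one>\<^bsub>W\<^esub>"
  and pure_mult: "\<And>u w u' w'. u \<in> carrier U \<Longrightarrow> w \<in> carrier W \<Longrightarrow> u' \<in> carrier U \<Longrightarrow> w' \<in> carrier W \<Longrightarrow>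
    pure U W u w \<otimes>\<^bsub>TA\<^esub> pure U W u' w' = pure U W (u \<otimes> u') (w \<otimes>\<^bsub>W\<^esub> w')"
  using quot_algebra[OF F tensor_rel_ideal] unfolding tensor_def pure_def
  by (simp_all add: carrier_DirProd mult_DirProd)

end

lemma lin_hom_plus:
  assumes "vs Y" "f \<in> lin_hom X Y" "g \<in> lin_hom X Y"
  shows "(\<lambda>x. f x \<oplus>\<^bsub>Y\<^esub> g x) \<in> lin_hom X Y"
proof -
  interpret Y: module cfield Y by fact
  show ?thesis
    by (rule lin_homI) (auto simp: lin_hom_add[OF assms(2)] lin_hom_add[OF assms(3)] lin_hom_smult[OF assms(2)]
      lin_hom_smult[OF assms(3)] lin_hom_closed[OF assms(2)] lin_hom_closed[OF assms(3)] vs_smult_add[OF assms(1)] Y.M.a_ac)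
qed

lemma lin_hom_eq_span:
  assumes "vs X" "f \<in> lin_hom X Y" "g \<in> lin_hom X Y" "vs Y" "S \<subseteq> carrier X" "\<And>s. s \<in> S \<Longrightarrow> f s = g s" "x \<in> lin_span X S"
  shows "f x = g x"
  using assms(1,7,5)
proof (induction rule: span_induct)
  case zero
  then show ?case using lin_hom_zero[OF assms(1,4,2)] lin_hom_zero[OF assms(1,4,3)] by simp
next
  case (add x y)
  then have "x \<in> carrier X" "y \<in> carrier X" using vs_submoduleD(1)[OF assms(1) span_submodule[OF assms(1,5)]] by auto
  then show ?case using add lin_hom_add[OF assms(2)] lin_hom_add[OF assms(3)] by simp
next
  case (smult r x)
  then have "x \<in> carrier X" using vs_submoduleD(1)[OF assms(1) span_submodule[OF assms(1,5)]] by auto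
  then show ?case using smult lin_hom_smult[OF assms(2)] lin_hom_smult[OF assms(3)] by simp
qed (use assms in auto)

lemma bilin_comp:
  assumes "bilin U W Y \<beta>" "f \<in> lin_hom Y Z"
  shows "bilin U W Z (\<lambda>u w. f (\<beta> u w))"
  using lin_hom_comp[OF bilinD(1)[OF assms(1)] assms(2)] lin_hom_comp[OF bilinD(2)[OF assms(1)] assms(2)]
  by (intro bilinI)

lemma bilin_pre:
  assumes "bilin U W Y \<beta>" "f \<in> lin_hom U' U" "g \<in> lin_hom W' W"
  shows "bilin U' W' Y (\<lambda>u w. \<beta> (f u) (g w))"
  using lin_hom_comp[OF assms(3) bilinD(1)[OF assms(1)]] lin_hom_comp[OF assms(2) bilinD(2)[OF assms(1)]]
  by (intro bilinI) (auto simp: lin_hom_closed[OF assms(2)] lin_hom_closed[OF assms(3)])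

text \<open>Nested lifts such as \<open>tassoc\<close> and \<open>tcombine\<close> contain an inner
  lift that depends on a parameter. Its linearity in the parameter is needed before the outer lift
  can be evaluated.\<close>

lemma tlift_param:
  assumes V: "vs V" and W: "vs W" and Z: "vs Z" and S: "vs S"
    and b: "\<And>s. s \<in> carrier S \<Longrightarrow> bilin V W Z (\<gamma> s)"
    and l: "\<And>v w. v \<in> carrier V \<Longrightarrow> w \<in> carrier W \<Longrightarrow> (\<lambda>s. \<gamma> s v w) \<in> lin_hom S Z"
    and Y: "Y \<in> carrier (tensor V W)"
  shows "(\<lambda>s. tlift V W Z (\<gamma> s) Y) \<in> lin_hom S Z"
  using V W Y
proof (induction rule: tensor_induct)
  case (pure u w)
  show ?case by (rule lin_hom_cong[OF l[OF pure]]) (use tlift(2)[OF V W Z b] pure S in auto)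
next
  case (add X Y)
  show ?case
    by (rule lin_hom_cong[OF lin_hom_plus[OF Z add(3,4)]]) (use lin_hom_add[OF tlift(1)[OF V W Z b]] add S in auto)
qed

lemma tmap:
  assumes U: "vs U" and W: "vs W" and X: "vs X" and Y: "vs Y" and f: "f \<in> lin_hom U X" and g: "g \<in> lin_hom W Y"
  shows "tmap U W X Y f g \<in> lin_hom (tensor U W) (tensor X Y)"
    "\<And>u w. u \<in> carrier U \<Longrightarrow> w \<in> carrier W \<Longrightarrow> tmap U W X Y f g (pure U W u w) = pure X Y (f u) (g w)"
proof -
  note * = bilin_pre[OF pure_bilin[OF X Y] f g]
  show "tmap U W X Y f g \<in> lin_hom (tensor U W) (tensor X Y)"
    "\<And>u w. u \<in> carrier U \<Longrightarrow> w \<in> carrier W \<Longrightarrow> tmap U W X Y f g (pure U W u w) = pure X Y (f u) (g w)"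
    unfolding tmap_def using tlift[OF U W tensor_vs[OF X Y] *] by auto
qed

lemma tassoc:
  assumes U: "vs U" and V: "vs V" and W: "vs W"
  shows "tassoc U V W \<in> lin_hom (tensor (tensor U V) W) (tensor U (tensor V W))"
    "\<And>u v w. u \<in> carrier U \<Longrightarrow> v \<in> carrier V \<Longrightarrow> w \<in> carrier W \<Longrightarrow>
       tassoc U V W (pure (tensor U V) W (pure U V u v) w) = pure U (tensor V W) u (pure V W v w)"
proof -
  note VW = tensor_vs[OF V W] and UV = tensor_vs[OF U V]
  note T = tensor_vs[OF U VW]
  let ?h = "\<lambda>w. tlift U V (tensor U (tensor V W)) (\<lambda>u v. pure U (tensor V W) u (pure V W v w))"
  have b: "bilin U V (tensor U (tensor V W)) (\<lambda>u v. pure U (tensor V W) u (pure V W v w))" if "w \<in> carrier W" for w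
    using bilin_pre[OF pure_bilin[OF U VW] lin_hom_id(2) bilinD(2)[OF pure_bilin[OF V W] that]] by simp
  have l: "(\<lambda>w. pure U (tensor V W) u (pure V W v w)) \<in> lin_hom W (tensor U (tensor V W))"
    if "u \<in> carrier U" "v \<in> carrier V" for u v
    by (rule lin_hom_comp[OF bilinD(1)[OF pure_bilin[OF V W] that(2)] bilinD(1)[OF pure_bilin[OF U VW] that(1)]])
  have B: "bilin (tensor U V) W (tensor U (tensor V W)) (\<lambda>x w. ?h w x)"
    by (rule bilinI) (use tlift_param[OF U V T W b l] tlift(1)[OF U V T b] in auto)
  show "tassoc U V W \<in> lin_hom (tensor (tensor U V) W) (tensor U (tensor V W))"
    unfolding tassoc_def by (rule tlift(1)[OF UV W T B])
  show "tassoc U V W (pure (tensor U V) W (pure U V u v) w) = pure U (tensor V W) u (pure V W v w)"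
    if "u \<in> carrier U" "v \<in> carrier V" "w \<in> carrier W" for u v w
    unfolding tassoc_def using tlift(2)[OF UV W T B] tlift(2)[OF U V T b] that pure_closed[OF U V] by simp
qed

text \<open>A map linear in four arguments, assembled from two nested lifts. It supplies the formula
  for diagonal coactions on pure tensors.\<close>

lemma tcombine:
  assumes A: "cplx_algebra A" and U: "vs U" and V: "vs V" and Z: "vs Z" and \<beta>: "bilin U V Z \<beta>"
  shows "bilin (tensor U A) (tensor V A) (tensor Z A) (tcombine A U V Z \<beta>)"
    "\<And>u x v y. u \<in> carrier U \<Longrightarrow> x \<in> carrier A \<Longrightarrow> v \<in> carrier V \<Longrightarrow> y \<in> carrier A \<Longrightarrow>
       tcombine A U V Z \<beta> (pure U A u x) (pure V A v y) = pure Z A (\<beta> u v) (x \<otimes>\<^bsub>A\<^esub> y)"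
proof -
  have vA: "vs A" using A by (simp add: cplx_algebra_def)
  note UA = tensor_vs[OF U vA] and VA = tensor_vs[OF V vA] and ZA = tensor_vs[OF Z vA]
  note m = ring_bilin[OF A] and p = pure_bilin[OF Z vA]
  let ?g = "\<lambda>u x. tlift V A (tensor Z A) (\<lambda>v y. pure Z A (\<beta> u v) (x \<otimes>\<^bsub>A\<^esub> y))"
  have b: "bilin V A (tensor Z A) (\<lambda>v y. pure Z A (\<beta> u v) (x \<otimes>\<^bsub>A\<^esub> y))" if "u \<in> carrier U" "x \<in> carrier A" for u x
    by (rule bilin_pre[OF p bilinD(1)[OF \<beta> that(1)] bilinD(1)[OF m that(2)]])
  have lu: "(\<lambda>u. pure Z A (\<beta> u v) (x \<otimes>\<^bsub>A\<^esub> y)) \<in> lin_hom U (tensor Z A)"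
    if "x \<in> carrier A" "v \<in> carrier V" "y \<in> carrier A" for x v y
    using lin_hom_comp[OF bilinD(2)[OF \<beta> that(2)] bilinD(2)[OF p bilinD(3)[OF m that(1,3)]]] .
  have lx: "(\<lambda>x. pure Z A (\<beta> u v) (x \<otimes>\<^bsub>A\<^esub> y)) \<in> lin_hom A (tensor Z A)"
    if "u \<in> carrier U" "v \<in> carrier V" "y \<in> carrier A" for u v y
    using lin_hom_comp[OF bilinD(2)[OF m that(3)] bilinD(1)[OF p bilinD(3)[OF \<beta> that(1,2)]]] .
  have B: "bilin U A (tensor Z A) (\<lambda>u x. ?g u x Y)" if Y: "Y \<in> carrier (tensor V A)" for Y
  proof (rule bilinI)
    fix u assume u: "u \<in> carrier U"
    show "(\<lambda>x. ?g u x Y) \<in> lin_hom A (tensor Z A)"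
      by (rule tlift_param[OF V vA ZA vA b lx Y]) (use u in auto)
  next
    fix x assume x: "x \<in> carrier A"
    show "(\<lambda>u. ?g u x Y) \<in> lin_hom U (tensor Z A)"
      by (rule tlift_param[OF V vA ZA U b lu Y]) (use x in auto)
  qed
  have g: "?g u x (pure V A v y) = pure Z A (\<beta> u v) (x \<otimes>\<^bsub>A\<^esub> y)"
    if "u \<in> carrier U" "x \<in> carrier A" "v \<in> carrier V" "y \<in> carrier A" for u x v y
    using tlift(2)[OF V vA ZA b[OF that(1,2)] that(3,4)] .
  show "bilin (tensor U A) (tensor V A) (tensor Z A) (tcombine A U V Z \<beta>)"
    unfolding tcombine_def
  proof (rule bilinI)
    fix Y assume Y: "Y \<in> carrier (tensor V A)"
    show "(\<lambda>X. tlift U A (tensor Z A) (\<lambda>u x. ?g u x Y) X) \<in> lin_hom (tensor U A) (tensor Z A)"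
      by (rule tlift(1)[OF U vA ZA B[OF Y]])
  next
    fix X assume X: "X \<in> carrier (tensor U A)"
    show "(\<lambda>Y. tlift U A (tensor Z A) (\<lambda>u x. ?g u x Y) X) \<in> lin_hom (tensor V A) (tensor Z A)"
      by (rule tlift_param[OF U vA ZA VA B _ X]) (use tlift(1)[OF V vA ZA b] in auto)
  qed
  show "tcombine A U V Z \<beta> (pure U A u x) (pure V A v y) = pure Z A (\<beta> u v) (x \<otimes>\<^bsub>A\<^esub> y)"
    if "u \<in> carrier U" "x \<in> carrier A" "v \<in> carrier V" "y \<in> carrier A" for u x v y
    unfolding tcombine_def
    using tlift(2)[OF U vA ZA B[OF pure_closed[OF V vA that(3,4)]] that(1,2)] g[OF that] by simp
qed

lemma diag_coaction:
  assumes A: "cplx_algebra A" and U: "vs U" and V: "vs V"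
    and \<rho>: "\<rho> \<in> lin_hom U (tensor U A)" and \<rho>': "\<rho>' \<in> lin_hom V (tensor V A)"
  shows "diag_coaction A U V \<rho> \<rho>' \<in> lin_hom (tensor U V) (tensor (tensor U V) A)"
    "\<And>u v. u \<in> carrier U \<Longrightarrow> v \<in> carrier V \<Longrightarrow>
       diag_coaction A U V \<rho> \<rho>' (pure U V u v) = tcombine A U V (tensor U V) (pure U V) (\<rho> u) (\<rho>' v)"
proof -
  have vA: "vs A" using A by (simp add: cplx_algebra_def)
  note T = tensor_vs[OF tensor_vs[OF U V] vA]
  note b = bilin_pre[OF tcombine(1)[OF A U V tensor_vs[OF U V] pure_bilin[OF U V]] \<rho> \<rho>']
  show "diag_coaction A U V \<rho> \<rho>' \<in> lin_hom (tensor U V) (tensor (tensor U V) A)"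
    "\<And>u v. u \<in> carrier U \<Longrightarrow> v \<in> carrier V \<Longrightarrow>
       diag_coaction A U V \<rho> \<rho>' (pure U V u v) = tcombine A U V (tensor U V) (pure U V) (\<rho> u) (\<rho>' v)"
    unfolding diag_coaction_def using tlift[OF U V T b] by auto
qed

lemma tspan_submodule:
  assumes "vs U" "vs W" "X \<subseteq> carrier U" "Y \<subseteq> carrier W"
  shows "submodule (tspan U W X Y) cfield (tensor U W)"
  unfolding tspan_def by (rule span_submodule[OF tensor_vs]) (use assms in \<open>auto intro: pure_closed\<close>)

lemma tspan_pure: "vs U \<Longrightarrow> vs W \<Longrightarrow> x \<in> X \<Longrightarrow> y \<in> Y \<Longrightarrow> pure U W x y \<in> tspan U W X Y"
  unfolding tspan_def by (rule set_mp[OF span_superset[OF tensor_vs]]) auto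

lemma tspan_carrier:
  assumes "vs U" "vs W"
  shows "tspan U W (carrier U) (carrier W) = carrier (tensor U W)"
proof
  note S = vs_submoduleD[OF tensor_vs[OF assms] tspan_submodule[OF assms subset_refl subset_refl]]
  show "tspan U W (carrier U) (carrier W) \<subseteq> carrier (tensor U W)" by (rule S)
  show "carrier (tensor U W) \<subseteq> tspan U W (carrier U) (carrier W)"
  proof
    fix X assume "X \<in> carrier (tensor U W)"
    with assms show "X \<in> tspan U W (carrier U) (carrier W)"
      by (induction rule: tensor_induct) (auto intro: tspan_pure assms S)
  qed
qed

lemma mod_hom_cong:
  assumes "carrier X' = carrier X" "add X' = add X" "smult X' = smult X"
    "carrier Y' = carrier Y" "add Y' = add Y" "smult Y' = smult Y"
  shows "mod_hom R X' Y' = mod_hom R X Y"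
  using assms by (simp add: mod_hom_def)

text \<open>The coproducts are defined with tensor squares of the bare algebra records, but used
  with those of the extended Hopf records. Both are equal because only the listed fields
  enter.\<close>

lemma tensor_cong:
  assumes "carrier X' = carrier X" "add X' = add X" "smult X' = smult X" "mult X' = mult X" "one X' = one X"
    "carrier Y' = carrier Y" "add Y' = add Y" "smult Y' = smult Y" "mult Y' = mult Y" "one Y' = one Y"
  shows "tensor X' Y' = tensor X Y" "pure X' Y' = pure X Y" "tensor_rel X' Y' = tensor_rel X Y"
proof -
  have d: "X' \<times>\<times> Y' = X \<times>\<times> Y" using assms by (simp add: DirProd_def)
  show r: "tensor_rel X' Y' = tensor_rel X Y" unfolding tensor_rel_def d by (simp add: assms)
  show "tensor X' Y' = tensor X Y" by (simp add: tensor_def d r)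
  show "pure X' Y' = pure X Y" by (intro ext) (simp add: pure_def d r)
qed

lemma pscale_one [simp]: "pscale 1 f = f"
  by (rule poly_mapping_eqI) simp

section \<open>Laurent polynomials\<close>

lemma laurent_sel [simp]:
  "carrier laurent = UNIV" "\<zero>\<^bsub>laurent\<^esub> = 0" "f \<oplus>\<^bsub>laurent\<^esub> g = f + g" "r \<odot>\<^bsub>laurent\<^esub> f = pscale r f" "\<one>\<^bsub>laurent\<^esub> = tpow 0"
  "mult laurent = mult laurent_alg" "smult laurent = smult laurent_alg" "add laurent = add laurent_alg"
  by (simp_all add: laurent_def laurent_alg_def module.defs hopf.defs Let_def tpow_def)

lemma laurent_alg_sel [simp]:
  "carrier laurent_alg = UNIV" "\<zero>\<^bsub>laurent_alg\<^esub> = 0" "f \<oplus>\<^bsub>laurent_alg\<^esub> g = f + g" "r \<odot>\<^bsub>laurent_alg\<^esub> f = pscale r f"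
  "\<one>\<^bsub>laurent_alg\<^esub> = tpow 0"
  by (simp_all add: laurent_alg_def tpow_def)

lemma laurent_alg_algebra: "cplx_algebra laurent_alg"
  unfolding laurent_alg_def by (rule monoid_algebra_algebra) (simp add: group.is_monoid)

lemma laurent_algebra: "cplx_algebra laurent"
  by (rule cplx_algebra_cong[OF laurent_alg_algebra]) auto

lemma laurent_vs: "vs laurent" using laurent_algebra by (simp add: cplx_algebra_def)

lemma tpow_mult [simp]: "tpow m \<otimes>\<^bsub>laurent_alg\<^esub> tpow n = tpow (m + n)"
  by (simp add: laurent_alg_def tpow_def)

lemma laurent_mult_add [simp]:
  "(f + f') \<otimes>\<^bsub>laurent_alg\<^esub> g = f \<otimes>\<^bsub>laurent_alg\<^esub> g + f' \<otimes>\<^bsub>laurent_alg\<^esub> g"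
  "f \<otimes>\<^bsub>laurent_alg\<^esub> (g + g') = f \<otimes>\<^bsub>laurent_alg\<^esub> g + f \<otimes>\<^bsub>laurent_alg\<^esub> g'"
  "pscale r f \<otimes>\<^bsub>laurent_alg\<^esub> g = pscale r (f \<otimes>\<^bsub>laurent_alg\<^esub> g)"
  "f \<otimes>\<^bsub>laurent_alg\<^esub> pscale r g = pscale r (f \<otimes>\<^bsub>laurent_alg\<^esub> g)"
  by (simp_all add: laurent_alg_def monoid_algebra_mult_add monoid_algebra_mult_pscale)

lemma laurent_induct [case_names zero tpow add]:
  assumes "Q 0" "\<And>n c. Q (pscale c (tpow n))" "\<And>f g. Q f \<Longrightarrow> Q g \<Longrightarrow> Q (f + g)"
  shows "Q f"
proof -
  have "pkeys f \<subseteq> UNIV" by simp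
  then show ?thesis
  proof (induction f rule: poly_mapping_induct)
    case (single k c)
    then show ?case using assms(2)[of c k] by (simp add: tpow_def)
  qed (use assms in auto)
qed

lemma laurent_hom_eq:
  assumes X: "vs X" and f: "f \<in> lin_hom laurent X" and g: "g \<in> lin_hom laurent X" and eq: "\<And>n. f (tpow n) = g (tpow n)"
  shows "f p = g p"
proof (induction p rule: laurent_induct)
  case zero
  then show ?case using lin_hom_zero[OF laurent_vs X f] lin_hom_zero[OF laurent_vs X g] by simp
next
  case (tpow n c)
  then show ?case using lin_hom_smult[OF f, of "tpow n" c] lin_hom_smult[OF g, of "tpow n" c] eq by simp
next
  case (add p p')
  then show ?case using lin_hom_add[OF f, of p p'] lin_hom_add[OF g, of p p'] by simp
qed

lemma lin_hom_laurent_alg: "lin_hom laurent_alg X = lin_hom laurent X"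
  by (rule mod_hom_cong) auto

lemma laurent_alg_hom_eq:
  assumes B: "cplx_algebra B" and f: "f \<in> alg_hom laurent_alg B" and g: "g \<in> alg_hom laurent_alg B"
    and eq: "f (tpow 1) = g (tpow 1)"
  shows "f p = g p"
proof -
  interpret B: ring B using B by (simp add: cplx_algebra_def)
  note F = alg_homD[OF f] and G = alg_homD[OF g]
  have fm: "f (tpow (m + n)) = f (tpow m) \<otimes>\<^bsub>B\<^esub> f (tpow n)" and gm: "g (tpow (m + n)) = g (tpow m) \<otimes>\<^bsub>B\<^esub> g (tpow n)" for m n
    using F(2)[of "tpow m" "tpow n"] G(2)[of "tpow m" "tpow n"] by auto
  have fc: "f x \<in> carrier B" and gc: "g x \<in> carrier B" for x using lin_hom_closed[OF F(1)] lin_hom_closed[OF G(1)] by auto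
  \<comment> \<open>The value at t^-1 is forced by uniqueness of inverses, since f(t) =
    g(t).\<close>
  have "f (tpow (-1)) = f (tpow (-1)) \<otimes>\<^bsub>B\<^esub> (g (tpow 1) \<otimes>\<^bsub>B\<^esub> g (tpow (-1)))"
    using gm[of 1 "-1"] G(3) fc by simp
  also have "\<dots> = (f (tpow (-1)) \<otimes>\<^bsub>B\<^esub> f (tpow 1)) \<otimes>\<^bsub>B\<^esub> g (tpow (-1))"
    using eq fc gc B.m_assoc by metis
  also have "\<dots> = g (tpow (-1))" using fm[of "-1" 1] F(3) gc by simp
  finally have inv: "f (tpow (-1)) = g (tpow (-1))" .
  have "f (tpow n) = g (tpow n)" for n
  proof (induction n rule: int_induct[where k = 0])
    case base
    then show ?case using F(3) G(3) by simp
  next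
    case (step1 i)
    then show ?case using eq fm gm by simp
  next
    case (step2 i)
    then show ?case using inv fm[of i "-1"] gm[of i "-1"] by simp
  qed
  then show ?thesis using laurent_hom_eq[of B f g] F(1) G(1) B by (simp add: lin_hom_laurent_alg cplx_algebra_def)
qed

lemma laurent_alg_hom_ex:
  assumes B: "cplx_algebra B" and \<beta>: "\<And>n. \<beta> n \<in> carrier B" "\<And>m n. \<beta> (m + n) = \<beta> m \<otimes>\<^bsub>B\<^esub> \<beta> n" "\<beta> 0 = \<one>\<^bsub>B\<^esub>"
  shows "lext B \<beta> \<in> alg_hom laurent_alg B" "lext B \<beta> (tpow n) = \<beta> n"
proof -
  have vB: "vs B" using B by (simp add: cplx_algebra_def)
  show "lext B \<beta> \<in> alg_hom laurent_alg B"
    unfolding laurent_alg_def by (rule lext_alg_hom) (use assms in \<open>auto simp: group.is_monoid\<close>)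
  show "lext B \<beta> (tpow n) = \<beta> n"
    unfolding tpow_def using lext_sgl[OF vB, of n integer_group \<beta> 1] \<beta> by (simp add: vs_one[OF vB])
qed

text \<open>Evaluates the descriptions in the definition of \<open>laurent\<close>; the family of
  powers determines the map, and the value at t determines the family.\<close>

lemma the_laurent_hom:
  assumes B: "cplx_algebra B" and \<beta>: "\<And>n. \<beta> n \<in> carrier B" "\<And>m n. \<beta> (m + n) = \<beta> m \<otimes>\<^bsub>B\<^esub> \<beta> n" "\<beta> 0 = \<one>\<^bsub>B\<^esub>"
  shows "(THE \<phi>. \<phi> \<in> extensional (carrier laurent_alg) \<and> \<phi> \<in> alg_hom laurent_alg B \<and> \<phi> (tpow 1) = \<beta> 1) = lext B \<beta>"
proof (rule the_equality)
  note E = laurent_alg_hom_ex[OF assms]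
  show "lext B \<beta> \<in> extensional (carrier laurent_alg) \<and> lext B \<beta> \<in> alg_hom laurent_alg B \<and> lext B \<beta> (tpow 1) = \<beta> 1"
    using E by (auto simp: extensional_def)
  show "\<phi> = lext B \<beta>" if "\<phi> \<in> extensional (carrier laurent_alg) \<and> \<phi> \<in> alg_hom laurent_alg B \<and> \<phi> (tpow 1) = \<beta> 1" for \<phi>
    using laurent_alg_hom_eq[OF B, of \<phi> "lext B \<beta>"] E that by auto
qed

lemma cplx_algebra_cfield: "cplx_algebra cfield"
  by (rule cplx_algebraI[OF vs_cfield]) (auto intro!: bilinI lin_homI simp: algebra_simps)

lemma tensor_laurent: "tensor laurent laurent = tensor laurent_alg laurent_alg" "pure laurent laurent = pure laurent_alg laurent_alg"
  by (rule tensor_cong; auto)+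

lemma alg_hom_laurent: "alg_hom laurent B = alg_hom laurent_alg B"
  by (simp add: alg_hom_def ring_hom_def mod_hom_def)

lemma laurent_comult: "comult laurent \<in> alg_hom laurent (tensor laurent laurent)" "comult laurent (tpow n) = pure laurent laurent (tpow n) (tpow n)"
proof -
  note vA = cplx_algebraD(1)[OF laurent_alg_algebra] and T = tensor_algebra[OF laurent_alg_algebra laurent_alg_algebra]
  let ?b = "\<lambda>n. pure laurent_alg laurent_alg (tpow n) (tpow n)"
  have b: "?b n \<in> carrier (tensor laurent_alg laurent_alg)" "?b (m + n) = ?b m \<otimes>\<^bsub>tensor laurent_alg laurent_alg\<^esub> ?b n"
    "?b 0 = \<one>\<^bsub>tensor laurent_alg laurent_alg\<^esub>" for m n
    using pure_closed[OF vA vA] pure_mult[OF laurent_alg_algebra laurent_alg_algebra] tensor_one[OF laurent_alg_algebra laurent_alg_algebra]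
    by auto
  have "comult laurent = lext (tensor laurent_alg laurent_alg) ?b"
    using the_laurent_hom[OF T b] by (simp add: laurent_def Let_def hopf.defs module.defs)
  then show "comult laurent \<in> alg_hom laurent (tensor laurent laurent)" "comult laurent (tpow n) = pure laurent laurent (tpow n) (tpow n)"
    using laurent_alg_hom_ex[OF T b] by (auto simp: tensor_laurent alg_hom_laurent)
qed

lemma laurent_counit: "counit laurent \<in> alg_hom laurent cfield" "counit laurent (tpow n) = 1"
proof -
  have "counit laurent = lext cfield (\<lambda>n. 1)"
    using the_laurent_hom[OF cplx_algebra_cfield, of "\<lambda>n. 1"] by (simp add: laurent_def Let_def hopf.defs module.defs)
  then show "counit laurent \<in> alg_hom laurent cfield" "counit laurent (tpow n) = 1"
    using laurent_alg_hom_ex[OF cplx_algebra_cfield, of "\<lambda>n. 1"] by (auto simp: alg_hom_laurent)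
qed

lemma laurent_antipode: "antipode laurent \<in> lin_hom laurent laurent" "antipode laurent (tpow n) = tpow (- n)"
proof -
  have "antipode laurent = lext laurent_alg (\<lambda>n. tpow (- n))"
    using the_laurent_hom[OF laurent_alg_algebra, of "\<lambda>n. tpow (- n)"] by (simp add: laurent_def Let_def hopf.defs module.defs)
  moreover have "lin_hom laurent laurent = lin_hom laurent_alg laurent_alg" by (rule mod_hom_cong) auto
  ultimately show "antipode laurent \<in> lin_hom laurent laurent" "antipode laurent (tpow n) = tpow (- n)"
    using laurent_alg_hom_ex[OF laurent_alg_algebra, of "\<lambda>n. tpow (- n)"] by (auto simp: alg_hom_def)
qed

section \<open>Coactions of the Laurent polynomials are gradings\<close>

text \<open>The coefficient of t^n in an element of the tensor product with the Laurent polynomials.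
  Composed with a coaction it becomes the projection onto degree n.\<close>

definition tcoef where
  "tcoef X n = tlift X laurent X (\<lambda>x f. coef f n \<odot>\<^bsub>X\<^esub> x)"

lemma coef_lin: "(\<lambda>f. coef f n \<odot>\<^bsub>X\<^esub> x) \<in> lin_hom laurent X" if "vs X" "x \<in> carrier X"
  using that by (intro lin_homI) (auto simp: lookup_add vs_closed vs_add_smult vs_smult_smult)

lemma smult_lin: "(\<lambda>x. r \<odot>\<^bsub>X\<^esub> x) \<in> lin_hom X X" if "vs X"
  using that by (intro lin_homI) (auto simp: vs_closed vs_smult_add vs_smult_smult mult.commute)

lemma tcoef:
  assumes X: "vs X"
  shows "tcoef X n \<in> lin_hom (tensor X laurent) X"
    "x \<in> carrier X \<Longrightarrow> tcoef X n (pure X laurent x f) = coef f n \<odot>\<^bsub>X\<^esub> x"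
    "x \<in> carrier X \<Longrightarrow> tcoef X n (pure X laurent x (tpow m)) = (if m = n then x else \<zero>\<^bsub>X\<^esub>)"
proof -
  have b: "bilin X laurent X (\<lambda>x f. coef f n \<odot>\<^bsub>X\<^esub> x)"
    by (rule bilinI) (use X coef_lin smult_lin in auto)
  show "tcoef X n \<in> lin_hom (tensor X laurent) X"
    "x \<in> carrier X \<Longrightarrow> tcoef X n (pure X laurent x f) = coef f n \<odot>\<^bsub>X\<^esub> x"
    "x \<in> carrier X \<Longrightarrow> tcoef X n (pure X laurent x (tpow m)) = (if m = n then x else \<zero>\<^bsub>X\<^esub>)"
    unfolding tcoef_def using tlift[OF X laurent_vs X b]
    by (auto simp: tpow_def lookup_single when_def vs_one[OF X] vs_zero_smult[OF X])
qed

text \<open>Every element is the finite sum of its coefficients tensored with powers of t, so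
  membership can be tested coefficientwise.\<close>

lemma tensor_laurent_in_tspan:
  assumes X: "vs X" and H: "submodule H cfield X" and Y: "Y \<in> carrier (tensor X laurent)" and c: "\<And>n. tcoef X n Y \<in> H"
  shows "Y \<in> tspan X laurent H (carrier laurent)"
proof -
  let ?T = "tensor X laurent"
  note T = tensor_vs[OF X laurent_vs]
  interpret T: module cfield ?T by (rule T)
  let ?p = "\<lambda>Y n. pure X laurent (tcoef X n Y) (tpow n)"
  have clo: "?p Y n \<in> carrier ?T" if "Y \<in> carrier ?T" for Y n
    using that by (intro pure_closed[OF X laurent_vs] lin_hom_closed[OF tcoef(1)[OF X]]) auto
  have add: "finsum ?T (?p (Y \<oplus>\<^bsub>?T\<^esub> Y')) F = finsum ?T (?p Y) F \<oplus>\<^bsub>?T\<^esub> finsum ?T (?p Y') F"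
    if "Y \<in> carrier ?T" "Y' \<in> carrier ?T" for Y Y' F
  proof -
    have "finsum ?T (?p (Y \<oplus>\<^bsub>?T\<^esub> Y')) F = finsum ?T (\<lambda>n. ?p Y n \<oplus>\<^bsub>?T\<^esub> ?p Y' n) F"
      by (rule T.M.finsum_cong') (use that clo lin_hom_add[OF tcoef(1)[OF X]] lin_hom_closed[OF tcoef(1)[OF X]] pure_add_left[OF X laurent_vs] in auto)
    then show ?thesis using that clo by (subst (asm) T.M.finsum_addf) auto
  qed
  \<comment> \<open>Asking for the expansion over every sufficiently large finite set, instead of
    over one support, makes the property stable under addition.\<close>
  define good where "good Y \<longleftrightarrow> (\<exists>F. finite F \<and> (\<forall>F'. finite F' \<longrightarrow> F \<subseteq> F' \<longrightarrow> finsum ?T (?p Y) F' = Y))" for Y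
  have good_add: "good (Y \<oplus>\<^bsub>?T\<^esub> Y')" if Y: "Y \<in> carrier ?T" "Y' \<in> carrier ?T" and g: "good Y" "good Y'" for Y Y'
  proof -
    from g(1) obtain F where F: "finite F" "\<forall>K. finite K \<longrightarrow> F \<subseteq> K \<longrightarrow> finsum ?T (?p Y) K = Y"
      unfolding good_def by (elim exE conjE)
    from g(2) obtain F' where F': "finite F'" "\<forall>K. finite K \<longrightarrow> F' \<subseteq> K \<longrightarrow> finsum ?T (?p Y') K = Y'"
      unfolding good_def by (elim exE conjE)
    show ?thesis unfolding good_def
    proof (intro exI[of _ "F \<union> F'"] conjI allI impI)
      fix K assume K: "finite K" "F \<union> F' \<subseteq> K"
      have "finsum ?T (?p Y) K = Y" by (rule F(2)[rule_format]) (use K in auto)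
      moreover have "finsum ?T (?p Y') K = Y'" by (rule F'(2)[rule_format]) (use K in auto)
      ultimately show "finsum ?T (?p (Y \<oplus>\<^bsub>?T\<^esub> Y')) K = Y \<oplus>\<^bsub>?T\<^esub> Y'" by (simp only: add[OF Y])
    qed (use F F' in auto)
  qed
  have good_tpow: "good (pure X laurent x (pscale c (tpow n)))" if x: "x \<in> carrier X" for x n c
  proof -
    have eq: "pure X laurent x (pscale c (tpow n)) = pure X laurent (c \<odot>\<^bsub>X\<^esub> x) (tpow n)"
      using pure_smult_left[OF X laurent_vs x, of "tpow n" c] pure_smult_right[OF X laurent_vs x, of "tpow n" c] by simp
    have x': "c \<odot>\<^bsub>X\<^esub> x \<in> carrier X" using x X by (simp add: vs_closed)
    have "finsum ?T (?p (pure X laurent (c \<odot>\<^bsub>X\<^esub> x) (tpow n))) F = pure X laurent (c \<odot>\<^bsub>X\<^esub> x) (tpow n)"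
      if F: "finite F" "{n} \<subseteq> F" for F
    proof -
      have "finsum ?T (?p (pure X laurent (c \<odot>\<^bsub>X\<^esub> x) (tpow n))) F
        = finsum ?T (\<lambda>m. if n = m then pure X laurent (c \<odot>\<^bsub>X\<^esub> x) (tpow m) else \<zero>\<^bsub>?T\<^esub>) F"
        by (rule T.M.finsum_cong') (use x' pure_zero(2)[OF X laurent_vs] pure_closed[OF X laurent_vs] in \<open>auto simp: tcoef(3)[OF X]\<close>)
      also have "\<dots> = pure X laurent (c \<odot>\<^bsub>X\<^esub> x) (tpow n)"
        by (rule T.M.add.finprod_singleton) (use F x' pure_closed[OF X laurent_vs] in auto)
      finally show ?thesis .
    qed
    then show ?thesis unfolding good_def eq by (intro exI[of _ "{n}"]) auto
  qed
  have "good Y"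
    using X laurent_vs Y
  proof (induction rule: tensor_induct)
    case (pure x f)
    show ?case
    proof (induction f rule: laurent_induct)
      case zero
      have "pscale 0 (tpow 0) = 0" by (simp add: tpow_def del: single_one)
      then show ?case using good_tpow[OF pure(1), of 0 0] by simp
    next
      case (add f g)
      then show ?case using good_add[of "pure X laurent x f" "pure X laurent x g"] pure_add_right[OF X laurent_vs pure(1), of g f] pure_closed[OF X laurent_vs pure(1)]
        by simp
    qed (rule good_tpow[OF pure(1)])
  qed (rule good_add)
  then obtain F where F: "finite F" "\<forall>K. finite K \<longrightarrow> F \<subseteq> K \<longrightarrow> finsum ?T (?p Y) K = Y"
    unfolding good_def by (elim exE conjE)
  have FY: "finsum ?T (?p Y) F = Y" by (rule F(2)[rule_format, OF F(1) subset_refl])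
  have HX: "H \<subseteq> carrier X" by (rule vs_submoduleD(1)[OF X H])
  note S = vs_submoduleD[OF T tspan_submodule[OF X laurent_vs HX subset_refl]]
  have p: "?p Y n \<in> tspan X laurent H (carrier laurent)" for n by (rule tspan_pure[OF X laurent_vs c]) simp
  have "finsum ?T (?p Y) F \<in> tspan X laurent H (carrier laurent)"
    using F(1)
  proof (induction F rule: finite_induct)
    case (insert n F)
    then show ?case using S(3)[OF p insert.IH] clo[OF Y] by (subst T.M.finsum_insert) auto
  qed (use S(2) in simp)
  then show ?thesis by (simp only: FY)
qed

text \<open>Directness of the grading is a consequence: if x has degrees m and n, then x (x) t^m = x
  (x) t^n, and \<open>tcoef\<close> gives x = 0 unless m = n.\<close>

definition graded_coaction where
  "graded_coaction X G \<delta> \<longleftrightarrow> vs X \<and> (\<forall>n. submodule (G n) cfield X) \<and> lin_span X (\<Union>n::int. G n) = carrier X \<and>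
     \<delta> \<in> lin_hom X (tensor X laurent) \<and> (\<forall>n. \<forall>x\<in>G n. \<delta> x = pure X laurent x (tpow n))"

lemma lin_hom_into:
  assumes "vs Y" "submodule H cfield Y" "f \<in> lin_hom X Y" "\<And>x. x \<in> carrier X \<Longrightarrow> f x \<in> H"
  shows "f \<in> lin_hom X (Y\<lparr>carrier := H\<rparr>)"
  using assms by (auto simp: mod_hom_def)

context
  fixes X :: "(complex, 'x, 'k) module_scheme" and G :: "int \<Rightarrow> 'x set" and \<delta>
  assumes gc: "graded_coaction X G \<delta>"
begin

lemma gcD:
  shows "vs X" "submodule (G n) cfield X" "lin_span X (\<Union>n. G n) = carrier X"
     "\<delta> \<in> lin_hom X (tensor X laurent)" "x \<in> G n \<Longrightarrow> \<delta> x = pure X laurent x (tpow n)" "G n \<subseteq> carrier X"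
  using gc vs_submoduleD(1)[of X "G n"] by (auto simp: graded_coaction_def)

lemma gc_eq:
  assumes "vs Z" "f \<in> lin_hom X Z" "g \<in> lin_hom X Z" "\<And>n x. x \<in> G n \<Longrightarrow> f x = g x" "x \<in> carrier X"
  shows "f x = g x"
proof (rule lin_hom_eq_span[OF gcD(1) assms(2,3,1)])
  show "x \<in> lin_span X (\<Union>n. G n)" using assms gcD(3) by simp
qed (use assms gcD(6) in auto)

end

lemma gc_induct [consumes 2, case_names hom add]:
  assumes gc: "graded_coaction X G \<delta>" and x: "x \<in> carrier X" and h: "\<And>n x. x \<in> G n \<Longrightarrow> Q x"
    and a: "\<And>x y. x \<in> carrier X \<Longrightarrow> y \<in> carrier X \<Longrightarrow> Q x \<Longrightarrow> Q y \<Longrightarrow> Q (x \<oplus>\<^bsub>X\<^esub> y)"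
  shows "Q x"
proof -
  have sub: "(\<Union>n. G n) \<subseteq> carrier X" using gcD(6)[OF gc] by auto
  note S = vs_submoduleD[OF gcD(1)[OF gc] span_submodule[OF gcD(1)[OF gc] sub]]
  \<comment> \<open>Quantifying over all multiples makes the scalar case of the span induction
    trivial, and homogeneous components are closed under scalars.\<close>
  have "\<forall>r. Q (r \<odot>\<^bsub>X\<^esub> x)"
    using gcD(1)[OF gc] x[folded gcD(3)[OF gc]] sub
  proof (induction rule: span_induct)
    case zero
    then show ?case using h[OF vs_submoduleD(2)[OF gcD(1,2)[OF gc]]] by (simp add: vs_smult_zero[OF gcD(1)[OF gc]])
  next
    case (base x)
    then show ?case using h vs_submoduleD(4)[OF gcD(1,2)[OF gc]] by blast
  next
    case (add x y)
    then show ?case using a S(1) vs_closed[OF gcD(1)[OF gc]] by (auto simp: vs_smult_add[OF gcD(1)[OF gc]] subset_iff)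
  next
    case (smult r x)
    then show ?case using S(1) by (auto simp: vs_smult_smult[OF gcD(1)[OF gc]] subset_iff)
  qed
  then have "Q (1 \<odot>\<^bsub>X\<^esub> x)" by blast
  then show ?thesis using x by (simp add: vs_one[OF gcD(1)[OF gc]])
qed

context
  fixes X :: "(complex, 'x, 'k) module_scheme" and G :: "int \<Rightarrow> 'x set" and \<delta>
  assumes gc: "graded_coaction X G \<delta>"
begin

text \<open>The coefficient maps of the coaction are the projections onto the homogeneous
  components; this replaces a choice of decomposition.\<close>

lemma gc_component:
  assumes "x \<in> carrier X"
  shows "tcoef X n (\<delta> x) \<in> G n"
  using gc assms
proof (induction rule: gc_induct)
  case (hom m x)
  then show ?case using tcoef(3)[OF gcD(1)[OF gc], of x n m] gcD(6)[OF gc, of m] gcD(5)[OF gc, of x m] vs_submoduleD(2)[OF gcD(1,2)[OF gc]] by auto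
next
  case (add x y)
  then show ?case
    using lin_hom_add[OF lin_hom_comp[OF gcD(4)[OF gc] tcoef(1)[OF gcD(1)[OF gc]]], of x y n] vs_submoduleD(3)[OF gcD(1,2)[OF gc]] by simp
qed

text \<open>A coinvariant equals its own coefficient at t^0, which lies in degree 0.\<close>

lemma gc_coinvariants: "coinvariants laurent X \<delta> = G 0"
proof
  show "coinvariants laurent X \<delta> \<subseteq> G 0"
  proof
    fix x assume "x \<in> coinvariants laurent X \<delta>"
    then have "x \<in> carrier X" "\<delta> x = pure X laurent x (tpow 0)" by (auto simp: coinvariants_def)
    then show "x \<in> G 0" using gc_component[of x 0] tcoef(3)[OF gcD(1)[OF gc], of x 0 0] by simp
  qed
  show "G 0 \<subseteq> coinvariants laurent X \<delta>"
    using gcD(5)[OF gc, of _ 0] gcD(6)[OF gc, of 0] by (auto simp: coinvariants_def)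
qed

text \<open>Both comodule axioms are linear, so they only have to be checked on homogeneous
  elements, where they say that t^n is grouplike with counit 1.\<close>

lemma gc_right_comodule: "right_comodule laurent X \<delta>"
proof -
  note X = gcD(1)[OF gc] and A = laurent_vs
  note XA = tensor_vs[OF X A] and AA = tensor_vs[OF A A]
  note m1 = tmap[OF X A XA A gcD(4)[OF gc] lin_hom_id(1)] and m2 = tmap[OF X A X AA lin_hom_id(1) alg_homD(1)[OF laurent_comult(1)]]
  note as = tassoc[OF X A A]
  have clo: "x \<in> carrier X" if "x \<in> G n" for x n using that gcD(6)[OF gc] by auto
  have b: "bilin X laurent X (\<lambda>v x. counit laurent x \<odot>\<^bsub>X\<^esub> v)"
  proof (rule bilinI)
    note c = alg_homD(1)[OF laurent_counit(1)]
    fix u assume "u \<in> carrier X"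
    then show "(\<lambda>x. counit laurent x \<odot>\<^bsub>X\<^esub> u) \<in> lin_hom laurent X"
      using lin_hom_add[OF c] lin_hom_smult[OF c] by (intro lin_homI) (auto simp: vs_closed[OF X] vs_add_smult[OF X] vs_smult_smult[OF X])
  qed (rule smult_lin[OF X])
  note e = tlift[OF X A X b]
  show ?thesis
    unfolding right_comodule_def
  proof (intro conjI ballI)
    fix v assume v: "v \<in> carrier X"
    show "tassoc X laurent laurent (tmap X laurent (tensor X laurent) laurent \<delta> id (\<delta> v))
        = tmap X laurent X (tensor laurent laurent) id (comult laurent) (\<delta> v)"
      by (rule gc_eq[OF gc tensor_vs[OF X AA] lin_hom_comp[OF lin_hom_comp[OF gcD(4)[OF gc] m1(1)] as(1)] lin_hom_comp[OF gcD(4)[OF gc] m2(1)] _ v])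
        (simp add: gcD(5)[OF gc] m1(2) m2(2) clo as(2) laurent_comult(2))
    show "tlift X laurent X (\<lambda>v x. counit laurent x \<odot>\<^bsub>X\<^esub> v) (\<delta> v) = v"
      by (rule gc_eq[OF gc X lin_hom_comp[OF gcD(4)[OF gc] e(1)] lin_hom_id(2) _ v])
        (simp add: gcD(5)[OF gc] e(2) clo laurent_counit(2) vs_one[OF X])
  qed (use X gcD(4)[OF gc] in auto)
qed

end

text \<open>The diagonal coaction is the grading by total degree, since t^k t^(n-k) = t^n. It is
  applied to P (x) P and to P (x) V.\<close>

lemma gc_diag:
  assumes U: "graded_coaction U G \<delta>" and V: "graded_coaction V H \<rho>"
  shows "graded_coaction (tensor U V) (\<lambda>n. lin_span (tensor U V) {pure U V u v | u v k. u \<in> G k \<and> v \<in> H (n - k)})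
    (diag_coaction laurent U V \<delta> \<rho>)"
proof -
  note vU = gcD(1)[OF U] and vV = gcD(1)[OF V] and dU = gcD(4)[OF U] and dV = gcD(4)[OF V]
  note T = tensor_vs[OF vU vV]
  note TA = tensor_vs[OF T laurent_vs]
  let ?S = "\<lambda>n. {pure U V u v | u v k. u \<in> G k \<and> v \<in> H (n - k)}"
  note D = diag_coaction[OF laurent_algebra vU vV dU dV]
  note C = tcombine(2)[OF laurent_algebra vU vV T pure_bilin[OF vU vV]]
  have cU: "u \<in> carrier U" if "u \<in> G k" for u k using gcD(6)[OF U] that by auto
  have cV: "v \<in> carrier V" if "v \<in> H k" for v k using gcD(6)[OF V] that by auto
  have S: "?S n \<subseteq> carrier (tensor U V)" for n using cU cV pure_closed[OF vU vV] by auto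
  note sub = span_submodule[OF T S]
  have un: "(\<Union>n. lin_span (tensor U V) (?S n)) \<subseteq> carrier (tensor U V)" using vs_submoduleD(1)[OF T sub] by auto
  note SP = vs_submoduleD[OF T span_submodule[OF T un]]
  have "X \<in> lin_span (tensor U V) (\<Union>n. lin_span (tensor U V) (?S n))" if "X \<in> carrier (tensor U V)" for X
    using vU vV that
  proof (induction rule: tensor_induct)
    case (pure u v)
    from U pure(1) show ?case
    proof (induction rule: gc_induct)
      case (hom k u)
      from V pure(2) show ?case
      proof (induction rule: gc_induct)
        case (hom l v)
        have "pure U V u v \<in> ?S (k + l)" using hom \<open>u \<in> G k\<close>
          by (intro CollectI exI[of _ u] exI[of _ v] exI[of _ k]) simp
        then have "pure U V u v \<in> lin_span (tensor U V) (?S (k + l))" by (rule set_mp[OF span_superset[OF T]])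
        then show ?case by (rule set_mp[OF span_superset[OF T] UN_I[OF UNIV_I]])
      next
        case (add v v')
        then show ?case using SP(3) cU[OF hom] by (simp add: pure_add_right[OF vU vV])
      qed
    next
      case (add u u')
      then show ?case using SP(3) pure(2) by (simp add: pure_add_left[OF vU vV])
    qed
  qed (rule SP(3))
  moreover have "diag_coaction laurent U V \<delta> \<rho> X = pure (tensor U V) laurent X (tpow n)"
    if "X \<in> lin_span (tensor U V) (?S n)" for X n
  proof (rule lin_hom_eq_span[OF T D(1) bilinD(2)[OF pure_bilin[OF T laurent_vs]] TA S _ that])
    fix s assume "s \<in> ?S n"
    then obtain u v k where s: "s = pure U V u v" "u \<in> G k" "v \<in> H (n - k)" by auto
    then show "diag_coaction laurent U V \<delta> \<rho> s = pure (tensor U V) laurent s (tpow n)"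
      by (simp add: D(2) cU cV gcD(5)[OF U] gcD(5)[OF V] C)
  qed simp
  ultimately show ?thesis
    unfolding graded_coaction_def using T sub D(1) SP(1) by (intro conjI allI ballI equalityI subsetI) auto
qed

text \<open>The coproduct of the Laurent polynomials is itself a grading, with one line in each
  degree; coassociativity then comes from the general comodule lemma.\<close>

lemma gc_laurent: "graded_coaction laurent (\<lambda>n. range (\<lambda>c. pscale c (tpow n))) (comult laurent)"
proof -
  let ?G = "\<lambda>n. range (\<lambda>c. pscale c (tpow n))"
  have sub: "submodule (?G n) cfield laurent" for n
  proof (rule vs_submoduleI[OF laurent_vs])
    show "\<zero>\<^bsub>laurent\<^esub> \<in> ?G n" by (rule range_eqI[of _ _ 0]) (simp add: tpow_def)
    show "x \<oplus>\<^bsub>laurent\<^esub> y \<in> ?G n" if "x \<in> ?G n" "y \<in> ?G n" for x y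
      using that by (auto simp: tpow_def single_add[symmetric])
    show "r \<odot>\<^bsub>laurent\<^esub> x \<in> ?G n" if "x \<in> ?G n" for x r
      using that by (auto simp: tpow_def)
  qed simp
  have un: "(\<Union>n. ?G n) \<subseteq> carrier laurent" by simp
  note SP = vs_submoduleD[OF laurent_vs span_submodule[OF laurent_vs un]]
  have "f \<in> lin_span laurent (\<Union>n. ?G n)" for f
  proof (induction f rule: laurent_induct)
    case (tpow n c)
    then show ?case using span_superset[OF laurent_vs, of "\<Union>n. ?G n"] by blast
  qed (use SP(2,3) in auto)
  moreover have "comult laurent x = pure laurent laurent x (tpow n)" if "x \<in> ?G n" for x n
    using that lin_hom_smult[OF alg_homD(1)[OF laurent_comult(1)], of "tpow n"] pure_smult_left[OF laurent_vs laurent_vs, of "tpow n" "tpow n"]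
    by (auto simp: laurent_comult(2))
  ultimately show ?thesis
    unfolding graded_coaction_def using laurent_vs sub alg_homD(1)[OF laurent_comult(1)] by auto
qed

lemma laurent_hopf: "hopf_algebra laurent"
proof -
  note A = laurent_vs and ab = ring_bilin[OF laurent_algebra] and cm = alg_homD(1)[OF laurent_comult(1)]
  note cu = alg_homD(1)[OF laurent_counit(1)] and an = laurent_antipode(1)
  have b1: "bilin laurent laurent laurent (\<lambda>x y. counit laurent x \<odot>\<^bsub>laurent\<^esub> y)"
    using lin_hom_add[OF cu] lin_hom_smult[OF cu] smult_lin[OF A]
    by (intro bilinI lin_homI) (auto simp: pscale_add intro!: poly_mapping_eqI simp: lookup_add algebra_simps)
  have b2: "bilin laurent laurent laurent (\<lambda>x y. antipode laurent x \<otimes>\<^bsub>laurent\<^esub> y)"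
    using bilin_pre[OF ab an lin_hom_id(2)] by simp
  have b3: "bilin laurent laurent laurent (\<lambda>x y. x \<otimes>\<^bsub>laurent\<^esub> antipode laurent y)"
    using bilin_pre[OF ab lin_hom_id(2) an] by simp
  have l: "(\<lambda>x. counit laurent x \<odot>\<^bsub>laurent\<^esub> \<one>\<^bsub>laurent\<^esub>) \<in> lin_hom laurent laurent"
    by (rule bilinD(2)[OF b1]) simp
  note t = tlift[OF A A A]
  show ?thesis
    unfolding hopf_algebra_def
  proof (intro conjI ballI)
    fix x
    show "tlift laurent laurent laurent (\<lambda>x y. counit laurent x \<odot>\<^bsub>laurent\<^esub> y) (comult laurent x) = x"
      by (rule laurent_hom_eq[OF A lin_hom_comp[OF cm t(1)[OF b1]] lin_hom_id(2)])
        (simp only: laurent_comult(2) t(2)[OF b1] laurent_sel(1) UNIV_I, simp add: laurent_counit(2))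
    show "tlift laurent laurent laurent (\<lambda>x y. antipode laurent x \<otimes>\<^bsub>laurent\<^esub> y) (comult laurent x) = counit laurent x \<odot>\<^bsub>laurent\<^esub> \<one>\<^bsub>laurent\<^esub>"
      by (rule laurent_hom_eq[OF A lin_hom_comp[OF cm t(1)[OF b2]] l])
        (simp only: laurent_comult(2) t(2)[OF b2] laurent_sel(1) UNIV_I, simp add: laurent_counit(2) laurent_antipode(2))
    show "tlift laurent laurent laurent (\<lambda>x y. x \<otimes>\<^bsub>laurent\<^esub> antipode laurent y) (comult laurent x) = counit laurent x \<odot>\<^bsub>laurent\<^esub> \<one>\<^bsub>laurent\<^esub>"
      by (rule laurent_hom_eq[OF A lin_hom_comp[OF cm t(1)[OF b3]] l])
        (simp only: laurent_comult(2) t(2)[OF b3] laurent_sel(1) UNIV_I, simp add: laurent_counit(2) laurent_antipode(2))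
  qed (use laurent_algebra laurent_comult laurent_counit laurent_antipode gc_right_comodule[OF gc_laurent] in auto)
qed

section \<open>The algebra of functions on quantum SL(2)\<close>

lemma alg_hom_cong:
  assumes "carrier X' = carrier X" "add X' = add X" "smult X' = smult X" "mult X' = mult X" "one X' = one X"
  shows "alg_hom X' B = alg_hom X B" "alg_hom B X' = alg_hom B X"
  using assms by (auto simp: alg_hom_def ring_hom_def mod_hom_def)

abbreviation (input) LM :: "sl2_gen list monoid" where
  "LM \<equiv> \<lparr>carrier = UNIV, monoid.mult = (@), one = []\<rparr>"

lemma monoid_LM: "monoid LM"
  by (rule monoidI) auto

lemma free_sl2_algebra: "cplx_algebra free_sl2"
  unfolding free_sl2_def by (rule monoid_algebra_algebra[OF monoid_LM])

lemma free_sl2_sel [simp]: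
  "carrier free_sl2 = UNIV" "\<zero>\<^bsub>free_sl2\<^esub> = 0" "f \<oplus>\<^bsub>free_sl2\<^esub> g = f + g" "r \<odot>\<^bsub>free_sl2\<^esub> f = pscale r f" "\<one>\<^bsub>free_sl2\<^esub> = sgl [] 1"
  "sgl u r \<otimes>\<^bsub>free_sl2\<^esub> sgl v s = sgl (u @ v) (r * s)" "f \<ominus>\<^bsub>free_sl2\<^esub> g = f - g"
  by (simp_all add: free_sl2_def)

lemma free_sl2_mult [simp]:
  "(f + f') \<otimes>\<^bsub>free_sl2\<^esub> g = f \<otimes>\<^bsub>free_sl2\<^esub> g + f' \<otimes>\<^bsub>free_sl2\<^esub> g"
  "f \<otimes>\<^bsub>free_sl2\<^esub> (g + g') = f \<otimes>\<^bsub>free_sl2\<^esub> g + f \<otimes>\<^bsub>free_sl2\<^esub> g'"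
  "0 \<otimes>\<^bsub>free_sl2\<^esub> g = 0" "f \<otimes>\<^bsub>free_sl2\<^esub> 0 = 0"
  by (simp_all add: free_sl2_def monoid_algebra_mult_add)

text \<open>The condition under which an assignment of the four generators extends to an algebra map
  from P to B. It is checked for B the scalars, the Laurent polynomials, P and its opposite, P (x)
  P, and the triangular algebra over P.\<close>

definition sl2_relations :: "complex \<Rightarrow> (complex, 'b, 'k) module_scheme \<Rightarrow> (sl2_gen \<Rightarrow> 'b) \<Rightarrow> bool" where
  "sl2_relations q B g \<longleftrightarrow> (\<forall>x. g x \<in> carrier B) \<and>
     g Gb \<otimes>\<^bsub>B\<^esub> g Ga = q \<odot>\<^bsub>B\<^esub> (g Ga \<otimes>\<^bsub>B\<^esub> g Gb) \<and>
     g Gc \<otimes>\<^bsub>B\<^esub> g Ga = q \<odot>\<^bsub>B\<^esub> (g Ga \<otimes>\<^bsub>B\<^esub> g Gc) \<and>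
     g Gd \<otimes>\<^bsub>B\<^esub> g Gb = q \<odot>\<^bsub>B\<^esub> (g Gb \<otimes>\<^bsub>B\<^esub> g Gd) \<and>
     g Gd \<otimes>\<^bsub>B\<^esub> g Gc = q \<odot>\<^bsub>B\<^esub> (g Gc \<otimes>\<^bsub>B\<^esub> g Gd) \<and>
     g Gb \<otimes>\<^bsub>B\<^esub> g Gc = g Gc \<otimes>\<^bsub>B\<^esub> g Gb \<and>
     g Ga \<otimes>\<^bsub>B\<^esub> g Gd = \<one>\<^bsub>B\<^esub> \<oplus>\<^bsub>B\<^esub> inverse q \<odot>\<^bsub>B\<^esub> (g Gb \<otimes>\<^bsub>B\<^esub> g Gc) \<and>
     g Gd \<otimes>\<^bsub>B\<^esub> g Ga = \<one>\<^bsub>B\<^esub> \<oplus>\<^bsub>B\<^esub> q \<odot>\<^bsub>B\<^esub> (g Gb \<otimes>\<^bsub>B\<^esub> g Gc)"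

lemma CqSL2_sel:
  "carrier (CqSL2 q) = carrier (CqSL2_alg q)" "mult (CqSL2 q) = mult (CqSL2_alg q)" "one (CqSL2 q) = one (CqSL2_alg q)"
  "zero (CqSL2 q) = zero (CqSL2_alg q)" "add (CqSL2 q) = add (CqSL2_alg q)" "smult (CqSL2 q) = smult (CqSL2_alg q)"
  "comult (CqSL2 q) = sl2_comult q" "counit (CqSL2 q) = sl2_counit q" "antipode (CqSL2 q) = sl2_antipode q"
  by (simp_all add: CqSL2_def module.defs hopf.defs)

text \<open>Identities in P are verified on representatives in the free algebra: after rewriting
  words by the relations, both sides are classes of polynomials with equal coefficients.\<close>

definition sl2_class :: "complex \<Rightarrow> (sl2_gen list \<Rightarrow>\<^sub>0 complex) \<Rightarrow> sl2" where
  "sl2_class q f = genideal free_sl2 (sl2_rels q) +>\<^bsub>free_sl2\<^esub> f"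

fun gen_prod :: "('b, 'k) monoid_scheme \<Rightarrow> (sl2_gen \<Rightarrow> 'b) \<Rightarrow> sl2_gen list \<Rightarrow> 'b" where
  "gen_prod B g [] = \<one>\<^bsub>B\<^esub>"
| "gen_prod B g (x # w) = g x \<otimes>\<^bsub>B\<^esub> gen_prod B g w"

locale quantum_sl2 =
  fixes q :: complex
  assumes q: "q \<noteq> 0"
begin

abbreviation "P \<equiv> CqSL2 q"
abbreviation "cls \<equiv> sl2_class q"

lemma J_ideal: "ideal (genideal free_sl2 (sl2_rels q)) free_sl2"
  by (rule ring.genideal_ideal) (use free_sl2_algebra in \<open>auto simp: cplx_algebra_def\<close>)

lemmas J_submodule = ideal_submodule[OF free_sl2_algebra J_ideal]
lemmas F_vs = cplx_algebraD(1)[OF free_sl2_algebra]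

lemma P0_algebra: "cplx_algebra (CqSL2_alg q)"
  unfolding CqSL2_alg_def by (rule quot_algebra(1)[OF free_sl2_algebra J_ideal])

lemma P_algebra: "cplx_algebra P"
  by (rule cplx_algebra_cong[OF P0_algebra]) (simp_all add: CqSL2_sel)

lemmas P_vs = cplx_algebraD(1)[OF P_algebra]
lemmas P_ring = cplx_algebraD(2)[OF P_algebra]

sublocale P: ring P by (rule P_ring)

lemma P_carrier: "carrier P = range cls"
  unfolding CqSL2_sel CqSL2_alg_def sl2_class_def using quot_carrier[OF F_vs J_submodule] by simp

lemma cls_closed [simp]: "cls f \<in> carrier P" by (simp add: P_carrier)

lemma cls_add: "cls (f + g) = cls f \<oplus>\<^bsub>P\<^esub> cls g"
  unfolding CqSL2_sel CqSL2_alg_def sl2_class_def using quot_add[OF F_vs J_submodule, of f g] by simp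

lemma cls_smult: "r \<odot>\<^bsub>P\<^esub> cls f = cls (pscale r f)"
  unfolding CqSL2_sel CqSL2_alg_def sl2_class_def using quot_smult[OF F_vs J_submodule, of f r] by simp

lemma cls_mult: "cls f \<otimes>\<^bsub>P\<^esub> cls g = cls (f \<otimes>\<^bsub>free_sl2\<^esub> g)"
  unfolding CqSL2_sel CqSL2_alg_def sl2_class_def using quot_algebra(2)[OF free_sl2_algebra J_ideal, of f g] by simp

lemma cls_one: "\<one>\<^bsub>P\<^esub> = cls (sgl [] 1)"
  unfolding CqSL2_sel CqSL2_alg_def sl2_class_def using quot_algebra(3)[OF free_sl2_algebra J_ideal] by simp

lemma cls_zero: "\<zero>\<^bsub>P\<^esub> = cls 0"
  unfolding CqSL2_sel CqSL2_alg_def sl2_class_def using quot_zero(2)[OF F_vs J_submodule] by simp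

lemma word_cls: "word q w = cls (sgl w 1)" by (simp add: word_def sl2_class_def)

lemma word_closed [simp]: "word q w \<in> carrier P" by (simp add: word_cls)

lemma word_append: "word q (u @ v) = word q u \<otimes>\<^bsub>P\<^esub> word q v"
  by (simp add: word_cls cls_mult)

lemma word_Cons: "word q (x # v) = gen q x \<otimes>\<^bsub>P\<^esub> word q v"
  using word_append[of "[x]" v] by simp

lemma word_Nil: "word q [] = \<one>\<^bsub>P\<^esub>" by (simp add: word_cls cls_one)

lemma cls_sgl: "cls (sgl w r) = r \<odot>\<^bsub>P\<^esub> word q w" by (simp add: word_cls cls_smult)

lemma cls_eqI: "f - g \<in> genideal free_sl2 (sl2_rels q) \<Longrightarrow> cls f = cls g"
  unfolding sl2_class_def using quot_eq_iff[OF F_vs J_submodule, of f g] by simp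

lemma P_span: "lin_span P (range (word q)) = carrier P"
proof
  have s: "range (word q) \<subseteq> carrier P" by auto
  note S = vs_submoduleD[OF P_vs span_submodule[OF P_vs s]]
  show "lin_span P (range (word q)) \<subseteq> carrier P" by (rule S)
  have w: "word q w \<in> lin_span P (range (word q))" for w
    by (rule set_mp[OF span_superset[OF P_vs]]) simp
  have "cls f \<in> lin_span P (range (word q))" for f
  proof (rule poly_mapping_induct[where A = UNIV and f = f])
    show "cls 0 \<in> lin_span P (range (word q))" using S(2) by (simp add: cls_zero)
  qed (auto simp: cls_sgl cls_add intro: S w)
  then show "carrier P \<subseteq> lin_span P (range (word q))" by (auto simp: P_carrier)
qed

lemma P_hom_eq:
  assumes "vs Z" "f \<in> lin_hom P Z" "g \<in> lin_hom P Z" "\<And>w. f (word q w) = g (word q w)" "x \<in> carrier P"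
  shows "f x = g x"
  by (rule lin_hom_eq_span[OF P_vs assms(2,3,1), of "range (word q)"]) (use assms P_span in auto)

lemma P_submodule_all:
  assumes "submodule H cfield P" "\<And>w. word q w \<in> H"
  shows "carrier P \<subseteq> H"
  unfolding P_span[symmetric] by (rule span_minimal[OF P_vs assms(1)]) (use assms(2) in auto)

lemma alg_hom_words_eq:
  assumes "f \<in> alg_hom P B" "g \<in> alg_hom P B" "vs B" "\<And>x. f (gen q x) = g (gen q x)" "x \<in> carrier P"
  shows "f x = g x"
proof (rule P_hom_eq[OF assms(3) alg_homD(1)[OF assms(1)] alg_homD(1)[OF assms(2)] _ assms(5)])
  show "f (word q w) = g (word q w)" for w
  proof (induction w)
    case Nil
    show ?case by (simp add: word_Nil alg_homD(3)[OF assms(1)] alg_homD(3)[OF assms(2)])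
  next
    case (Cons x w)
    then show ?case by (simp add: word_Cons[of x w] alg_homD(2)[OF assms(1)] alg_homD(2)[OF assms(2)] assms(4))
  qed
qed

text \<open>The relations oriented as rewrite rules, with an arbitrary coefficient so that they
  apply to each term of a sum.\<close>

lemma rel_cls:
  "cls (sgl [Gb, Ga] r) = cls (sgl [Ga, Gb] (q * r))"
  "cls (sgl [Gc, Ga] r) = cls (sgl [Ga, Gc] (q * r))"
  "cls (sgl [Gd, Gb] r) = cls (sgl [Gb, Gd] (q * r))"
  "cls (sgl [Gd, Gc] r) = cls (sgl [Gc, Gd] (q * r))"
  "cls (sgl [Gc, Gb] r) = cls (sgl [Gb, Gc] r)"
  "cls (sgl [Ga, Gd] r) = cls (sgl [] r + sgl [Gb, Gc] (inverse q * r))"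
  "cls (sgl [Gd, Ga] r) = cls (sgl [] r + sgl [Gb, Gc] (q * r))"
proof -
  have r: "cls f = cls g" if "f - g \<in> sl2_rels q" for f g
    using ring.genideal_self[OF cplx_algebraD(2)[OF free_sl2_algebra], of "sl2_rels q"] that by (intro cls_eqI) auto
  have s: "cls (sgl u r) = cls (pscale r g)" if "sgl u 1 - g \<in> sl2_rels q" for u g
    using r[OF that] cls_smult[of r "sgl u 1"] cls_smult[of r g] by simp
  show "cls (sgl [Gb, Ga] r) = cls (sgl [Ga, Gb] (q * r))"
    using s[of "[Gb, Ga]" "sgl [Ga, Gb] q"] by (simp add: sl2_rels_def mult.commute)
  show "cls (sgl [Gc, Ga] r) = cls (sgl [Ga, Gc] (q * r))"
    using s[of "[Gc, Ga]" "sgl [Ga, Gc] q"] by (simp add: sl2_rels_def mult.commute)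
  show "cls (sgl [Gd, Gb] r) = cls (sgl [Gb, Gd] (q * r))"
    using s[of "[Gd, Gb]" "sgl [Gb, Gd] q"] by (simp add: sl2_rels_def mult.commute)
  show "cls (sgl [Gd, Gc] r) = cls (sgl [Gc, Gd] (q * r))"
    using s[of "[Gd, Gc]" "sgl [Gc, Gd] q"] by (simp add: sl2_rels_def mult.commute)
  show "cls (sgl [Gc, Gb] r) = cls (sgl [Gb, Gc] r)"
    using s[of "[Gb, Gc]" "sgl [Gc, Gb] 1"] by (simp add: sl2_rels_def)
  show "cls (sgl [Ga, Gd] r) = cls (sgl [] r + sgl [Gb, Gc] (inverse q * r))"
    using s[of "[Ga, Gd]" "sgl [] 1 + sgl [Gb, Gc] (inverse q)"] by (simp add: sl2_rels_def diff_diff_eq pscale_add mult.commute)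
  show "cls (sgl [Gd, Ga] r) = cls (sgl [] r + sgl [Gb, Gc] (q * r))"
    using s[of "[Gd, Ga]" "sgl [] 1 + sgl [Gb, Gc] q"] by (simp add: sl2_rels_def diff_diff_eq pscale_add mult.commute)
qed

text \<open>The linear extension of the product of letters kills the relators, its kernel is an
  ideal, and so it factors through the presented algebra.\<close>

lemma sl2_hom_ex:
  assumes B: "cplx_algebra B" and g: "sl2_relations q B g"
  obtains \<phi> where "\<phi> \<in> extensional (carrier P)" "\<phi> \<in> alg_hom P B" "\<And>x. \<phi> (gen q x) = g x"
proof -
  note D = cplx_algebraD[OF B]
  interpret B: ring B by (rule D)
  have gc: "g x \<in> carrier B" for x using g by (simp add: sl2_relations_def)
  have pc: "gen_prod B g w \<in> carrier B" for w by (induction w) (auto simp: gc)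
  have pa: "gen_prod B g (u @ v) = gen_prod B g u \<otimes>\<^bsub>B\<^esub> gen_prod B g v" for u v
    by (induction u) (auto simp: gc pc B.m_assoc)
  let ?f = "lext B (gen_prod B g)"
  have f: "?f \<in> alg_hom free_sl2 B"
    unfolding free_sl2_def by (rule lext_alg_hom[OF monoid_LM B]) (use pc pa in auto)
  note fD = alg_homD[OF f]
  have fs: "?f (sgl w r) = r \<odot>\<^bsub>B\<^esub> gen_prod B g w" for w r
    using lext_sgl[OF D(1), of w LM "gen_prod B g" r] pc by simp
  have fm: "?f (x - y) = ?f x \<ominus>\<^bsub>B\<^esub> ?f y" for x y
    using lin_hom_minus[OF F_vs D(1) fD(1), of x y] by simp
  have fa: "?f (x + y) = ?f x \<oplus>\<^bsub>B\<^esub> ?f y" for x y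
    using lin_hom_add[OF fD(1), of x y] by simp
  have fc: "?f x \<in> carrier B" for x using lin_hom_closed[OF fD(1)] by simp
  have "?f x = \<zero>\<^bsub>B\<^esub>" if x: "x \<in> sl2_rels q" for x
  proof -
    have mm: "u \<ominus>\<^bsub>B\<^esub> u = \<zero>\<^bsub>B\<^esub>" "u \<oplus>\<^bsub>B\<^esub> v \<ominus>\<^bsub>B\<^esub> u \<ominus>\<^bsub>B\<^esub> v = \<zero>\<^bsub>B\<^esub>" if "u \<in> carrier B" "v \<in> carrier B" for u v
    proof -
      have "u \<oplus>\<^bsub>B\<^esub> v \<ominus>\<^bsub>B\<^esub> u = v" using that by (simp add: a_minus_def B.a_comm[of u v] B.a_assoc B.r_neg)
      then show "u \<ominus>\<^bsub>B\<^esub> u = \<zero>\<^bsub>B\<^esub>" "u \<oplus>\<^bsub>B\<^esub> v \<ominus>\<^bsub>B\<^esub> u \<ominus>\<^bsub>B\<^esub> v = \<zero>\<^bsub>B\<^esub>" using that by (simp_all add: a_minus_def B.r_neg)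
    qed
    show ?thesis
      using x g unfolding sl2_rels_def sl2_relations_def
      by (elim insertE emptyE conjE)
        (simp_all add: fm fs gc vs_one[OF D(1)] mm(1)[OF _ B.zero_closed] mm(2) vs_closed[OF D(1)])
  qed
  moreover have "ideal (a_kernel free_sl2 B ?f) free_sl2"
    by (rule ring_hom_ring.kernel_is_ideal, rule ring_hom_ringI2)
      (use free_sl2_algebra B f in \<open>auto simp: cplx_algebra_def alg_hom_def\<close>)
  ultimately have "genideal free_sl2 (sl2_rels q) \<subseteq> a_kernel free_sl2 B ?f"
    by (intro ring.genideal_minimal cplx_algebraD(2)[OF free_sl2_algebra]) (auto simp: a_kernel_def')
  then have ker: "x \<in> genideal free_sl2 (sl2_rels q) \<Longrightarrow> ?f x = \<zero>\<^bsub>B\<^esub>" for x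
    by (auto simp: a_kernel_def')
  obtain \<phi> where \<phi>: "\<phi> \<in> lin_hom (CqSL2_alg q) B" "\<phi> \<in> extensional (carrier (CqSL2_alg q))"
    "\<And>y. \<phi> (cls y) = ?f y"
    using quot_lift[OF F_vs J_submodule D(1) fD(1) ker] unfolding CqSL2_alg_def sl2_class_def by (metis UNIV_I free_sl2_sel(1))
  show ?thesis
  proof (rule that[of \<phi>])
    show "\<phi> \<in> extensional (carrier P)" using \<phi> by (simp add: CqSL2_sel)
    have "lin_hom P B = lin_hom (CqSL2_alg q) B" by (rule mod_hom_cong) (simp_all add: CqSL2_sel)
    then show "\<phi> \<in> alg_hom P B"
      using \<phi> fD by (intro alg_homI) (auto simp: P_carrier cls_mult cls_one)
    show "\<phi> (gen q x) = g x" for x by (simp add: word_cls \<phi> fs gc vs_one[OF D(1)])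
  qed
qed

lemma sl2_hom_unique:
  assumes "\<phi> \<in> extensional (carrier P)" "\<phi> \<in> alg_hom P B" "\<psi> \<in> extensional (carrier P)" "\<psi> \<in> alg_hom P B" "vs B"
    "\<And>x. \<phi> (gen q x) = \<psi> (gen q x)"
  shows "\<phi> = \<psi>"
  using alg_hom_words_eq[OF assms(2,4,5,6)] assms(1,3) by (intro extensionalityI) auto

text \<open>The predicate \<open>Q\<close> is left abstract, so that one lemma evaluates
  descriptions that list the values on generators in different orders.\<close>

lemma the_sl2_hom:
  assumes B: "cplx_algebra B" and g: "sl2_relations q B g"
    and Q: "\<And>\<phi>. Q \<phi> \<longleftrightarrow> \<phi> \<in> extensional (carrier P) \<and> \<phi> \<in> alg_hom P B \<and> (\<forall>x. \<phi> (gen q x) = g x)"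
  shows "(THE \<phi>. Q \<phi>) \<in> alg_hom P B" "(THE \<phi>. Q \<phi>) (gen q x) = g x"
proof -
  obtain \<phi> where \<phi>: "\<phi> \<in> extensional (carrier P)" "\<phi> \<in> alg_hom P B" "\<And>x. \<phi> (gen q x) = g x"
    using sl2_hom_ex[OF B g] by blast
  have "(THE \<phi>. Q \<phi>) = \<phi>"
  proof (rule the_equality)
    show "Q \<phi>" unfolding Q using \<phi> by blast
    fix \<psi> assume "Q \<psi>"
    then have \<psi>: "\<psi> \<in> extensional (carrier P)" "\<psi> \<in> alg_hom P B" "\<forall>x. \<psi> (gen q x) = g x" unfolding Q by blast+
    show "\<psi> = \<phi>"
      by (rule sl2_hom_unique[OF \<psi>(1,2) \<phi>(1,2) cplx_algebraD(1)[OF B]]) (simp only: \<psi>(3) \<phi>(3))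
  qed
  then show "(THE \<phi>. Q \<phi>) \<in> alg_hom P B" "(THE \<phi>. Q \<phi>) (gen q x) = g x" using \<phi> by auto
qed

lemma all_gen: "(\<forall>x. R x) \<longleftrightarrow> R Ga \<and> R Gb \<and> R Gc \<and> R Gd"
  by (metis sl2_gen.exhaust)

lemma alg_hom_P0: "alg_hom (CqSL2_alg q) B = alg_hom P B"
  by (rule alg_hom_cong(1)) (simp_all add: CqSL2_sel)

section \<open>Counit, projection to the fibre, and antipode\<close>

fun counit_gen :: "sl2_gen \<Rightarrow> complex" where
  "counit_gen Ga = 1" | "counit_gen Gb = 0" | "counit_gen Gc = 0" | "counit_gen Gd = 1"

lemma counit: "counit P \<in> alg_hom P cfield" "counit P (gen q x) = counit_gen x"
proof -
  have r: "sl2_relations q cfield counit_gen" by (simp add: sl2_relations_def)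
  have "counit P = (THE \<phi>. \<phi> \<in> extensional (carrier P) \<and> \<phi> \<in> alg_hom P cfield \<and>
        \<phi> (gen q Ga) = 1 \<and> \<phi> (gen q Gb) = 0 \<and> \<phi> (gen q Gc) = 0 \<and> \<phi> (gen q Gd) = 1)"
    by (simp add: CqSL2_sel sl2_counit_def alg_hom_P0)
  then show "counit P \<in> alg_hom P cfield" "counit P (gen q x) = counit_gen x"
    using the_sl2_hom[OF cplx_algebra_cfield r] by (simp_all add: all_gen)
qed

fun proj_gen :: "sl2_gen \<Rightarrow> int \<Rightarrow>\<^sub>0 complex" where
  "proj_gen Ga = tpow 1" | "proj_gen Gb = 0" | "proj_gen Gc = 0" | "proj_gen Gd = tpow (- 1)"

lemma laurent_mult_zero [simp]: "0 \<otimes>\<^bsub>laurent_alg\<^esub> f = 0" "f \<otimes>\<^bsub>laurent_alg\<^esub> 0 = 0"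
  by (simp_all add: laurent_alg_def)

lemma pscale_zero [simp]: "pscale r 0 = 0" by (rule poly_mapping_eqI) simp

lemma proj: "sl2_proj q \<in> alg_hom P laurent" "sl2_proj q (gen q x) = proj_gen x"
proof -
  have r: "sl2_relations q laurent proj_gen" by (simp add: sl2_relations_def)
  show "sl2_proj q \<in> alg_hom P laurent" "sl2_proj q (gen q x) = proj_gen x"
    unfolding sl2_proj_def using the_sl2_hom[OF laurent_algebra r] by (simp_all add: all_gen conj_ac)
qed

lemma opposite_sel [simp]:
  "carrier (opposite R) = carrier R" "zero (opposite R) = zero R" "add (opposite R) = add R" "one (opposite R) = one R"
  "x \<otimes>\<^bsub>opposite R\<^esub> y = y \<otimes>\<^bsub>R\<^esub> x"
  by (simp_all add: opposite_def)

lemma opposite_smult [simp]: "smult (opposite (R :: (complex, 'x, 'k) module_scheme)) = smult R"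
  by (simp add: opposite_def)

lemma opposite_ring: "ring R \<Longrightarrow> ring (opposite R)"
proof -
  assume "ring R"
  then interpret ring R .
  have "abelian_group (opposite R)" by (rule abelian_group_cong[OF is_abelian_group]) auto
  then show ?thesis by (intro ringI monoidI) (auto simp: m_assoc l_distr r_distr)
qed

lemma opposite_algebra: "cplx_algebra B \<Longrightarrow> cplx_algebra (opposite B)"
  using vs_cong[of B "opposite B"] opposite_ring[of B] by (simp add: cplx_algebra_def)

fun antipode_gen :: "sl2_gen \<Rightarrow> sl2" where
  "antipode_gen Ga = gen q Gd" | "antipode_gen Gb = (- q) \<odot>\<^bsub>P\<^esub> gen q Gb"
| "antipode_gen Gc = (- inverse q) \<odot>\<^bsub>P\<^esub> gen q Gc" | "antipode_gen Gd = gen q Ga"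

lemma antipode: "antipode P \<in> alg_hom P (opposite P)" "antipode P (gen q x) = antipode_gen x"
proof -
  have r: "sl2_relations q (opposite P) antipode_gen"
    unfolding sl2_relations_def all_gen using q
    by (simp add: word_cls cls_mult cls_smult cls_one cls_add[symmetric])
      (simp add: cls_add rel_cls, (simp add: cls_add[symmetric] field_simps)?)
  have e: "alg_hom P (opposite (CqSL2_alg q)) = alg_hom P (opposite P)"
    by (rule alg_hom_cong(2)) (simp_all add: CqSL2_sel opposite_def)
  have "antipode P = (THE \<phi>. \<phi> \<in> extensional (carrier P) \<and> \<phi> \<in> alg_hom P (opposite P) \<and>
        \<phi> (gen q Ga) = gen q Gd \<and> \<phi> (gen q Gd) = gen q Ga \<and>
        \<phi> (gen q Gb) = (- q) \<odot>\<^bsub>P\<^esub> gen q Gb \<and> \<phi> (gen q Gc) = (- inverse q) \<odot>\<^bsub>P\<^esub> gen q Gc)"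
    by (simp add: CqSL2_sel sl2_antipode_def alg_hom_P0 e Let_def)
  then show "antipode P \<in> alg_hom P (opposite P)" "antipode P (gen q x) = antipode_gen x"
    using the_sl2_hom[OF opposite_algebra[OF P_algebra] r] by (simp_all add: all_gen conj_ac)
qed

end

section \<open>Tensor products of algebra maps and the triangular algebra\<close>

lemma lin_span_bilin:
  assumes U: "vs U" and W: "vs W" and Z: "vs Z" and b: "bilin U W Z \<beta>" and H: "submodule H cfield Z"
    and S: "S \<subseteq> carrier U" and T: "T \<subseteq> carrier W" and st: "\<And>s t. s \<in> S \<Longrightarrow> t \<in> T \<Longrightarrow> \<beta> s t \<in> H"
    and x: "x \<in> lin_span U S" and y: "y \<in> lin_span W T"
  shows "\<beta> x y \<in> H"
proof (rule lin_hom_span_image[OF W Z bilinD(1)[OF b] H T _ y])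
  show "x \<in> carrier U" using x vs_submoduleD(1)[OF U span_submodule[OF U S]] by auto
  fix t assume t: "t \<in> T"
  show "\<beta> x t \<in> H"
    by (rule lin_hom_span_image[OF U Z bilinD(2)[OF b] H S _ x]) (use t T st in auto)
qed

text \<open>Multiplicativity is linear in each factor, so it is reduced to pure tensors in the
  second factor and then in the first.\<close>

lemma tmap_alg_hom:
  assumes U: "cplx_algebra U" and W: "cplx_algebra W" and X: "cplx_algebra X" and Y: "cplx_algebra Y"
    and f: "f \<in> alg_hom U X" and g: "g \<in> alg_hom W Y"
  shows "tmap U W X Y f g \<in> alg_hom (tensor U W) (tensor X Y)"
proof (rule alg_homI)
  note vU = cplx_algebraD(1)[OF U] and vW = cplx_algebraD(1)[OF W] and vX = cplx_algebraD(1)[OF X] and vY = cplx_algebraD(1)[OF Y]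
  note fD = alg_homD[OF f] and gD = alg_homD[OF g]
  note t = tmap[OF vU vW vX vY fD(1) gD(1)]
  note bT = ring_bilin[OF tensor_algebra[OF U W]] and bS = ring_bilin[OF tensor_algebra[OF X Y]]
  interpret U: ring U using U by (simp add: cplx_algebra_def)
  interpret W: ring W using W by (simp add: cplx_algebra_def)
  show "tmap U W X Y f g \<in> lin_hom (tensor U W) (tensor X Y)" by (rule t)
  show "tmap U W X Y f g \<one>\<^bsub>tensor U W\<^esub> = \<one>\<^bsub>tensor X Y\<^esub>"
    by (simp add: tensor_one[OF U W] tensor_one[OF X Y] t(2) fD(3) gD(3))
  fix x y assume x: "x \<in> carrier (tensor U W)" and y: "y \<in> carrier (tensor U W)"
  have 1: "tmap U W X Y f g (pure U W u w \<otimes>\<^bsub>tensor U W\<^esub> y) = pure X Y (f u) (g w) \<otimes>\<^bsub>tensor X Y\<^esub> tmap U W X Y f g y"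
    if u: "u \<in> carrier U" and w: "w \<in> carrier W" for u w
    by (rule tensor_hom_eq[OF vU vW tensor_vs[OF vX vY] lin_hom_comp[OF bilinD(1)[OF bT pure_closed[OF vU vW u w]] t(1)]
       lin_hom_comp[OF t(1) bilinD(1)[OF bS]] _ y])
      (use u w in \<open>auto simp: pure_mult[OF U W] pure_mult[OF X Y] t(2) fD(2) gD(2) lin_hom_closed[OF fD(1)] lin_hom_closed[OF gD(1)]
          intro!: pure_closed[OF vX vY]\<close>)
  show "tmap U W X Y f g (x \<otimes>\<^bsub>tensor U W\<^esub> y) = tmap U W X Y f g x \<otimes>\<^bsub>tensor X Y\<^esub> tmap U W X Y f g y"
    by (rule tensor_hom_eq[OF vU vW tensor_vs[OF vX vY] lin_hom_comp[OF bilinD(2)[OF bT y] t(1)]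
       lin_hom_comp[OF t(1) bilinD(2)[OF bS]] _ x])
      (use y in \<open>auto simp: 1 t(2) lin_hom_closed[OF t(1)]\<close>)
qed

lemma dsum_sel [simp]:
  "carrier (dsum X Y) = carrier X \<times> carrier Y" "\<zero>\<^bsub>dsum X Y\<^esub> = (\<zero>\<^bsub>X\<^esub>, \<zero>\<^bsub>Y\<^esub>)"
  "(x, y) \<oplus>\<^bsub>dsum X Y\<^esub> (x', y') = (x \<oplus>\<^bsub>X\<^esub> x', y \<oplus>\<^bsub>Y\<^esub> y')" "r \<odot>\<^bsub>dsum X Y\<^esub> (x, y) = (r \<odot>\<^bsub>X\<^esub> x, r \<odot>\<^bsub>Y\<^esub> y)"
  by (simp_all add: dsum_def RDirProd_def DirProd_def ring.defs monoid.defs module.defs)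

lemma dsum_group:
  assumes "abelian_group X" "abelian_group Y"
  shows "abelian_group (dsum X Y)"
proof -
  interpret X: abelian_group X by fact
  interpret Y: abelian_group Y by fact
  show ?thesis
  proof (rule abelian_groupI)
    fix z assume "z \<in> carrier (dsum X Y)"
    then show "\<exists>w\<in>carrier (dsum X Y). w \<oplus>\<^bsub>dsum X Y\<^esub> z = \<zero>\<^bsub>dsum X Y\<^esub>"
      by (intro bexI[of _ "(\<ominus>\<^bsub>X\<^esub> fst z, \<ominus>\<^bsub>Y\<^esub> snd z)"]) (auto simp: X.l_neg Y.l_neg)
  qed (auto simp: X.a_ac Y.a_ac)
qed

lemma dsum_vs:
  assumes "vs X" "vs Y" shows "vs (dsum X Y)"
  by (rule vsI[OF dsum_group[OF assms[THEN module.axioms(2)]]])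
    (use assms in \<open>auto simp: vs_closed vs_add_smult vs_smult_add vs_smult_smult vs_one\<close>)

text \<open>The algebra maps of the form \<open>x \<mapsto> (x, \<partial>x, \<sigma>x)\<close> are given by the twisted derivations, \<open>\<partial>(xy) = x \<partial>y + \<partial>x \<sigma>y\<close>.\<close>

definition triangular :: "(complex, 'b, 'k) module_scheme \<Rightarrow> (complex, 'b \<times> 'b \<times> 'b) module" where
  "triangular B = (dsum B (dsum B B))
     \<lparr>mult := (\<lambda>(x, y, z) (x', y', z'). (x \<otimes>\<^bsub>B\<^esub> x', x \<otimes>\<^bsub>B\<^esub> y' \<oplus>\<^bsub>B\<^esub> y \<otimes>\<^bsub>B\<^esub> z', z \<otimes>\<^bsub>B\<^esub> z')),
      one := (\<one>\<^bsub>B\<^esub>, \<zero>\<^bsub>B\<^esub>, \<one>\<^bsub>B\<^esub>)\<rparr>"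

lemma triangular_sel [simp]:
  "carrier (triangular B) = carrier B \<times> carrier B \<times> carrier B"
  "(x, y, z) \<otimes>\<^bsub>triangular B\<^esub> (x', y', z') = (x \<otimes>\<^bsub>B\<^esub> x', x \<otimes>\<^bsub>B\<^esub> y' \<oplus>\<^bsub>B\<^esub> y \<otimes>\<^bsub>B\<^esub> z', z \<otimes>\<^bsub>B\<^esub> z')"
  "\<one>\<^bsub>triangular B\<^esub> = (\<one>\<^bsub>B\<^esub>, \<zero>\<^bsub>B\<^esub>, \<one>\<^bsub>B\<^esub>)" "\<zero>\<^bsub>triangular B\<^esub> = (\<zero>\<^bsub>B\<^esub>, \<zero>\<^bsub>B\<^esub>, \<zero>\<^bsub>B\<^esub>)"
  "(x, y, z) \<oplus>\<^bsub>triangular B\<^esub> (x', y', z') = (x \<oplus>\<^bsub>B\<^esub> x', y \<oplus>\<^bsub>B\<^esub> y', z \<oplus>\<^bsub>B\<^esub> z')"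
  "r \<odot>\<^bsub>triangular B\<^esub> (x, y, z) = (r \<odot>\<^bsub>B\<^esub> x, r \<odot>\<^bsub>B\<^esub> y, r \<odot>\<^bsub>B\<^esub> z)"
  by (simp_all add: triangular_def)

lemma triangular_algebra:
  assumes B: "cplx_algebra B" shows "cplx_algebra (triangular B)"
proof -
  note D = cplx_algebraD[OF B]
  interpret ring B by (rule D)
  have v: "vs (triangular B)"
    by (rule vs_cong[OF dsum_vs[OF D(1) dsum_vs[OF D(1) D(1)]]]) (simp_all add: triangular_def)
  show ?thesis
    by (rule cplx_algebraI[OF v])
      (auto intro!: bilinI lin_homI simp: D vs_closed[OF D(1)] vs_smult_add[OF D(1)] l_distr r_distr m_assoc a_ac)
qed

context quantum_sl2
begin

subsection \<open>The coproduct\<close>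

text \<open>The counterpart of \<open>sl2_class\<close> for P (x) P: polynomials in pairs of words,
  so that relations between coproducts also become comparisons of coefficients.\<close>

definition pair_class :: "(sl2_gen list \<times> sl2_gen list \<Rightarrow>\<^sub>0 complex) \<Rightarrow> (sl2 \<times> sl2 \<Rightarrow>\<^sub>0 complex) set" where
  "pair_class = lext (tensor P P) (\<lambda>(u, v). pure P P (word q u) (word q v))"

abbreviation "PP \<equiv> tensor P P"

lemmas PP_algebra = tensor_algebra[OF P_algebra P_algebra]
lemmas PP_vs = tensor_vs[OF P_vs P_vs]

lemma pair_class_hom: "pair_class \<in> alg_hom (monoid_algebra (LM \<times>\<times> LM)) PP"
  unfolding pair_class_def
  by (rule lext_alg_hom[OF DirProd_monoid[OF monoid_LM monoid_LM] PP_algebra])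
    (auto simp: pure_closed[OF P_vs P_vs] pure_mult[OF P_algebra P_algebra] tensor_one[OF P_algebra P_algebra] word_append word_Nil)

lemma pair_class_closed [simp]: "pair_class f \<in> carrier PP"
  using lin_hom_closed[OF alg_homD(1)[OF pair_class_hom], of f] by simp

lemma pair_class_add: "pair_class (f + g) = pair_class f \<oplus>\<^bsub>PP\<^esub> pair_class g"
  using lin_hom_add[OF alg_homD(1)[OF pair_class_hom], of f g] by simp

lemma pair_class_smult: "r \<odot>\<^bsub>PP\<^esub> pair_class f = pair_class (pscale r f)"
  using lin_hom_smult[OF alg_homD(1)[OF pair_class_hom], of f r] by simp

lemma pair_class_mult: "pair_class f \<otimes>\<^bsub>PP\<^esub> pair_class g = pair_class (f \<otimes>\<^bsub>monoid_algebra (LM \<times>\<times> LM)\<^esub> g)"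
  using alg_homD(2)[OF pair_class_hom, of f g] by simp

lemma pair_class_one: "\<one>\<^bsub>PP\<^esub> = pair_class (sgl ([], []) 1)"
  using alg_homD(3)[OF pair_class_hom] by simp

lemma pair_class_sgl: "pair_class (sgl (u, v) r) = r \<odot>\<^bsub>PP\<^esub> pure P P (word q u) (word q v)"
  unfolding pair_class_def
  by (subst lext_sgl[OF PP_vs, of _ "LM \<times>\<times> LM"]) (auto simp: pure_closed[OF P_vs P_vs])

lemma pair_class_pure:
  "pair_class (sgl (u, v) r) = pure P P (cls (sgl u r)) (word q v)" "pair_class (sgl (u, v) r) = pure P P (word q u) (cls (sgl v r))"
  by (simp_all add: pair_class_sgl cls_sgl pure_smult_left[OF P_vs P_vs] pure_smult_right[OF P_vs P_vs])

lemma pair_rel: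
  "pair_class (sgl ([Gb, Ga], v) r) = pair_class (sgl ([Ga, Gb], v) (q * r))"
  "pair_class (sgl ([Gc, Ga], v) r) = pair_class (sgl ([Ga, Gc], v) (q * r))"
  "pair_class (sgl ([Gd, Gb], v) r) = pair_class (sgl ([Gb, Gd], v) (q * r))"
  "pair_class (sgl ([Gd, Gc], v) r) = pair_class (sgl ([Gc, Gd], v) (q * r))"
  "pair_class (sgl ([Gc, Gb], v) r) = pair_class (sgl ([Gb, Gc], v) r)"
  "pair_class (sgl ([Ga, Gd], v) r) = pair_class (sgl ([], v) r) \<oplus>\<^bsub>PP\<^esub> pair_class (sgl ([Gb, Gc], v) (inverse q * r))"
  "pair_class (sgl ([Gd, Ga], v) r) = pair_class (sgl ([], v) r) \<oplus>\<^bsub>PP\<^esub> pair_class (sgl ([Gb, Gc], v) (q * r))"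
  "pair_class (sgl (v, [Gb, Ga]) r) = pair_class (sgl (v, [Ga, Gb]) (q * r))"
  "pair_class (sgl (v, [Gc, Ga]) r) = pair_class (sgl (v, [Ga, Gc]) (q * r))"
  "pair_class (sgl (v, [Gd, Gb]) r) = pair_class (sgl (v, [Gb, Gd]) (q * r))"
  "pair_class (sgl (v, [Gd, Gc]) r) = pair_class (sgl (v, [Gc, Gd]) (q * r))"
  "pair_class (sgl (v, [Gc, Gb]) r) = pair_class (sgl (v, [Gb, Gc]) r)"
  "pair_class (sgl (v, [Ga, Gd]) r) = pair_class (sgl (v, []) r) \<oplus>\<^bsub>PP\<^esub> pair_class (sgl (v, [Gb, Gc]) (inverse q * r))"
  "pair_class (sgl (v, [Gd, Ga]) r) = pair_class (sgl (v, []) r) \<oplus>\<^bsub>PP\<^esub> pair_class (sgl (v, [Gb, Gc]) (q * r))"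
proof -
  have l: "pure P P (cls (sgl u r)) (word q v) = pure P P (cls (sgl u' s)) (word q v)" if "cls (sgl u r) = cls (sgl u' s)" for u u' r s v
    using that by simp
  note P = pair_class_pure
  show
    "pair_class (sgl ([Gb, Ga], v) r) = pair_class (sgl ([Ga, Gb], v) (q * r))"
    "pair_class (sgl ([Gc, Ga], v) r) = pair_class (sgl ([Ga, Gc], v) (q * r))"
    "pair_class (sgl ([Gd, Gb], v) r) = pair_class (sgl ([Gb, Gd], v) (q * r))"
    "pair_class (sgl ([Gd, Gc], v) r) = pair_class (sgl ([Gc, Gd], v) (q * r))"
    "pair_class (sgl ([Gc, Gb], v) r) = pair_class (sgl ([Gb, Gc], v) r)"
    "pair_class (sgl ([Ga, Gd], v) r) = pair_class (sgl ([], v) r) \<oplus>\<^bsub>PP\<^esub> pair_class (sgl ([Gb, Gc], v) (inverse q * r))"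
    "pair_class (sgl ([Gd, Ga], v) r) = pair_class (sgl ([], v) r) \<oplus>\<^bsub>PP\<^esub> pair_class (sgl ([Gb, Gc], v) (q * r))"
    by (simp_all only: P(1) rel_cls cls_add pure_add_left[OF P_vs P_vs] cls_closed word_closed)
  show
    "pair_class (sgl (v, [Gb, Ga]) r) = pair_class (sgl (v, [Ga, Gb]) (q * r))"
    "pair_class (sgl (v, [Gc, Ga]) r) = pair_class (sgl (v, [Ga, Gc]) (q * r))"
    "pair_class (sgl (v, [Gd, Gb]) r) = pair_class (sgl (v, [Gb, Gd]) (q * r))"
    "pair_class (sgl (v, [Gd, Gc]) r) = pair_class (sgl (v, [Gc, Gd]) (q * r))"
    "pair_class (sgl (v, [Gc, Gb]) r) = pair_class (sgl (v, [Gb, Gc]) r)"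
    "pair_class (sgl (v, [Ga, Gd]) r) = pair_class (sgl (v, []) r) \<oplus>\<^bsub>PP\<^esub> pair_class (sgl (v, [Gb, Gc]) (inverse q * r))"
    "pair_class (sgl (v, [Gd, Ga]) r) = pair_class (sgl (v, []) r) \<oplus>\<^bsub>PP\<^esub> pair_class (sgl (v, [Gb, Gc]) (q * r))"
    by (simp_all only: P(2) rel_cls cls_add pure_add_right[OF P_vs P_vs] cls_closed word_closed)
qed

fun comult_gen :: "sl2_gen \<Rightarrow> (sl2 \<times> sl2 \<Rightarrow>\<^sub>0 complex) set" where
  "comult_gen Ga = pair_class (sgl ([Ga], [Ga]) 1 + sgl ([Gb], [Gc]) 1)"
| "comult_gen Gb = pair_class (sgl ([Ga], [Gb]) 1 + sgl ([Gb], [Gd]) 1)"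
| "comult_gen Gc = pair_class (sgl ([Gc], [Ga]) 1 + sgl ([Gd], [Gc]) 1)"
| "comult_gen Gd = pair_class (sgl ([Gc], [Gb]) 1 + sgl ([Gd], [Gd]) 1)"

lemma pair_class_eqI: "f = g \<Longrightarrow> pair_class f = pair_class g" by simp

text \<open>Each relation between coproducts expands into pairs of words of length at most two.
  Reordering each factor separately leaves an identity between coefficients.\<close>

lemma comult_relations: "sl2_relations q PP comult_gen"
  unfolding sl2_relations_def all_gen comult_gen.simps pair_class_mult pair_class_smult pair_class_one monoid_algebra_mult_add
    monoid_algebra_mult_single mult_DirProd monoid.simps append.simps pscale_add pscale_single pair_class_add[symmetric]
  by (intro conjI; (unfold pair_class_add pair_rel)?; (unfold pair_class_add[symmetric])?;
      (rule pair_class_eqI, rule poly_mapping_eqI)?; use q in \<open>auto simp: lookup_add lookup_single when_def field_simps\<close>)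

lemma comult: "comult P \<in> alg_hom P PP" "comult P (gen q x) = comult_gen x"
proof -
  have c: "tensor (CqSL2_alg q) (CqSL2_alg q) = PP" "pure (CqSL2_alg q) (CqSL2_alg q) = pure P P"
    by (rule tensor_cong; simp add: CqSL2_sel)+
  have g: "comult_gen Ga = pure P P (gen q Ga) (gen q Ga) \<oplus>\<^bsub>PP\<^esub> pure P P (gen q Gb) (gen q Gc)"
    "comult_gen Gb = pure P P (gen q Ga) (gen q Gb) \<oplus>\<^bsub>PP\<^esub> pure P P (gen q Gb) (gen q Gd)"
    "comult_gen Gc = pure P P (gen q Gc) (gen q Ga) \<oplus>\<^bsub>PP\<^esub> pure P P (gen q Gd) (gen q Gc)"
    "comult_gen Gd = pure P P (gen q Gc) (gen q Gb) \<oplus>\<^bsub>PP\<^esub> pure P P (gen q Gd) (gen q Gd)"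
    by (simp_all add: pair_class_add pair_class_sgl vs_one[OF PP_vs] pure_closed[OF P_vs P_vs])
  have "comult P = (THE \<phi>. \<phi> \<in> extensional (carrier P) \<and> \<phi> \<in> alg_hom P PP \<and>
        \<phi> (gen q Ga) = comult_gen Ga \<and> \<phi> (gen q Gb) = comult_gen Gb \<and>
        \<phi> (gen q Gc) = comult_gen Gc \<and> \<phi> (gen q Gd) = comult_gen Gd)"
    unfolding g CqSL2_sel(7) sl2_comult_def Let_def c alg_hom_P0 CqSL2_sel(1) by (rule refl)
  then show "comult P \<in> alg_hom P PP" "comult P (gen q x) = comult_gen x"
    using the_sl2_hom[OF PP_algebra comult_relations] by (simp_all add: all_gen)
qed

lemma comult_gens:
  "comult P (gen q Ga) = pure P P (gen q Ga) (gen q Ga) \<oplus>\<^bsub>PP\<^esub> pure P P (gen q Gb) (gen q Gc)"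
  "comult P (gen q Gb) = pure P P (gen q Ga) (gen q Gb) \<oplus>\<^bsub>PP\<^esub> pure P P (gen q Gb) (gen q Gd)"
  "comult P (gen q Gc) = pure P P (gen q Gc) (gen q Ga) \<oplus>\<^bsub>PP\<^esub> pure P P (gen q Gd) (gen q Gc)"
  "comult P (gen q Gd) = pure P P (gen q Gc) (gen q Gb) \<oplus>\<^bsub>PP\<^esub> pure P P (gen q Gd) (gen q Gd)"
  by (simp_all add: comult(2) pair_class_add pair_class_sgl vs_one[OF PP_vs] pure_closed[OF P_vs P_vs])

subsection \<open>The grading\<close>

abbreviation "wdeg w \<equiv> sum_list (map gen_deg w)"
abbreviation "PA \<equiv> tensor P laurent"
abbreviation "\<delta> \<equiv> sl2_coaction q"
abbreviation "G \<equiv> degree_comp q"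

lemmas PA_algebra = tensor_algebra[OF P_algebra laurent_algebra]
lemmas PA_vs = tensor_vs[OF P_vs laurent_vs]

lemma coaction_hom: "\<delta> \<in> alg_hom P PA"
proof -
  have id: "id \<in> alg_hom P P" by (rule alg_homI[OF lin_hom_id(1)]) auto
  have "\<delta> = (\<lambda>x. tmap P P P laurent id (sl2_proj q) (comult P x))" by (intro ext) (simp add: sl2_coaction_def)
  then show ?thesis
    using alg_hom_comp[OF comult(1) tmap_alg_hom[OF P_algebra P_algebra P_algebra laurent_algebra id proj(1)]] by simp
qed

lemmas coaction_lin = alg_homD(1)[OF coaction_hom]

lemma coaction_gen: "\<delta> (gen q x) = pure P laurent (gen q x) (tpow (gen_deg x))"
proof -
  note t = tmap[OF P_vs P_vs P_vs laurent_vs lin_hom_id(1) alg_homD(1)[OF proj(1)]]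
  note z = pure_zero(1)[OF P_vs laurent_vs, simplified]
  note pc = pure_closed[OF P_vs P_vs] pure_closed[OF P_vs laurent_vs]
  interpret PA: ring PA using PA_algebra by (simp add: cplx_algebra_def)
  show ?thesis
    unfolding sl2_coaction_def
    by (cases x) (simp_all add: comult_gens lin_hom_add[OF t(1)] pc t(2) proj(2) z)
qed

lemma coaction_word: "\<delta> (word q w) = pure P laurent (word q w) (tpow (wdeg w))"
proof (induction w)
  case Nil
  then show ?case using alg_homD(3)[OF coaction_hom] by (simp add: word_Nil tensor_one[OF P_algebra laurent_algebra])
next
  case (Cons x w)
  then show ?case
    by (simp add: word_Cons[of x w] alg_homD(2)[OF coaction_hom] coaction_gen pure_mult[OF P_algebra laurent_algebra])
qed

abbreviation "Gw n \<equiv> {word q w | w. wdeg w = n}"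

lemma Gw_carrier: "Gw n \<subseteq> carrier P" by auto

lemma G_submodule: "submodule (G n) cfield P"
  unfolding degree_comp_def by (rule span_submodule[OF P_vs Gw_carrier])

lemmas G_sub = vs_submoduleD[OF P_vs G_submodule]

lemma G_carrier [simp]: "x \<in> G n \<Longrightarrow> x \<in> carrier P" using G_sub(1) by auto

lemma word_G: "wdeg w = n \<Longrightarrow> word q w \<in> G n"
  unfolding degree_comp_def by (rule set_mp[OF span_superset[OF P_vs]]) auto

lemma gen_G: "gen_deg x = n \<Longrightarrow> gen q x \<in> G n" by (rule word_G) simp

text \<open>Homogeneity of the relations enters through the existence of the coaction as an algebra
  map, which multiplies a word of degree n by t^n.\<close>

lemma P_graded: "graded_coaction P G \<delta>"
proof -
  have "lin_span P (\<Union>n. G n) = carrier P"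
  proof
    have u: "(\<Union>n. G n) \<subseteq> carrier P" using G_sub(1) by auto
    note s = span_submodule[OF P_vs u]
    show "lin_span P (\<Union>n. G n) \<subseteq> carrier P" by (rule vs_submoduleD(1)[OF P_vs s])
    show "carrier P \<subseteq> lin_span P (\<Union>n. G n)"
      by (rule P_submodule_all[OF s], rule set_mp[OF span_superset[OF P_vs]], rule UN_I[OF UNIV_I], rule word_G[OF refl])
  qed
  moreover have "\<delta> x = pure P laurent x (tpow n)" if "x \<in> G n" for x n
    by (rule lin_hom_eq_span[OF P_vs coaction_lin bilinD(2)[OF pure_bilin[OF P_vs laurent_vs]] PA_vs Gw_carrier _ that[unfolded degree_comp_def]])
      (auto simp: coaction_word)
  ultimately show ?thesis
    unfolding graded_coaction_def using P_vs G_submodule coaction_lin by blast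
qed

lemma G_mult: "x \<in> G m \<Longrightarrow> y \<in> G n \<Longrightarrow> x \<otimes>\<^bsub>P\<^esub> y \<in> G (m + n)"
  unfolding degree_comp_def[of _ m] degree_comp_def[of _ n]
  by (rule lin_span_bilin[OF P_vs P_vs P_vs ring_bilin[OF P_algebra] G_submodule Gw_carrier Gw_carrier])
    (auto simp: word_append[symmetric] intro!: word_G)

lemma G_one: "\<one>\<^bsub>P\<^esub> \<in> G 0" using word_G[of "[]" 0] by (simp add: word_Nil)

subsection \<open>Scaling by the degree\<close>

text \<open>The description asks for a linear map only. It is constructed as an algebra map, because
  rescaling generators by powers of s respects the homogeneous relations, and is unique because the
  components span P.\<close>

lemma deg_scale:
  assumes s: "s \<noteq> 0"
  shows "deg_scale q s \<in> alg_hom P P" "deg_scale q s (gen q x) = (s powi gen_deg x) \<odot>\<^bsub>P\<^esub> gen q x"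
    "deg_scale q s (word q w) = (s powi wdeg w) \<odot>\<^bsub>P\<^esub> word q w"
    "y \<in> G n \<Longrightarrow> deg_scale q s y = (s powi n) \<odot>\<^bsub>P\<^esub> y"
proof -
  let ?g = "\<lambda>x. (s powi gen_deg x) \<odot>\<^bsub>P\<^esub> gen q x"
  have r: "sl2_relations q P ?g"
    unfolding sl2_relations_def all_gen using q s
    by (simp add: word_cls cls_mult cls_smult cls_one)
      (simp add: cls_add rel_cls field_simps)
  obtain \<phi> where \<phi>: "\<phi> \<in> extensional (carrier P)" "\<phi> \<in> alg_hom P P" "\<And>x. \<phi> (gen q x) = ?g x"
    using sl2_hom_ex[OF P_algebra r] by blast
  have w: "\<phi> (word q w) = (s powi wdeg w) \<odot>\<^bsub>P\<^esub> word q w" for w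
  proof (induction w)
    case Nil
    then show ?case by (simp add: word_Nil alg_homD(3)[OF \<phi>(2)] vs_one[OF P_vs])
  next
    case (Cons x w)
    then show ?case
      by (simp add: word_Cons[of x w] alg_homD(2)[OF \<phi>(2)] \<phi>(3) cplx_algebraD[OF P_algebra] vs_closed[OF P_vs] vs_smult_smult[OF P_vs]
        power_int_add s mult.commute)
  qed
  have h: "\<phi> x = (s powi n) \<odot>\<^bsub>P\<^esub> x" if "x \<in> G n" for x n
    by (rule lin_hom_eq_span[OF P_vs alg_homD(1)[OF \<phi>(2)] smult_lin[OF P_vs] P_vs Gw_carrier _ that[unfolded degree_comp_def]])
      (auto simp: w)
  have "deg_scale q s = \<phi>"
    unfolding deg_scale_def
  proof (rule the_equality)
    show "\<phi> \<in> extensional (carrier P) \<and> \<phi> \<in> lin_hom P P \<and> (\<forall>n. \<forall>x\<in>G n. \<phi> x = (s powi n) \<odot>\<^bsub>P\<^esub> x)"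
      by (intro conjI allI ballI \<phi>(1) h alg_homD(1)[OF \<phi>(2)])
    fix \<psi> assume \<psi>: "\<psi> \<in> extensional (carrier P) \<and> \<psi> \<in> lin_hom P P \<and> (\<forall>n. \<forall>x\<in>G n. \<psi> x = (s powi n) \<odot>\<^bsub>P\<^esub> x)"
    have "\<psi> x = \<phi> x" if x: "x \<in> carrier P" for x
      by (rule gc_eq[OF P_graded P_vs conjunct1[OF conjunct2[OF \<psi>]] alg_homD(1)[OF \<phi>(2)] _ x]) (simp only: h conjunct2[OF conjunct2[OF \<psi>], rule_format])
    then show "\<psi> = \<phi>" by (rule extensionalityI[OF conjunct1[OF \<psi>] \<phi>(1)])
  qed
  then show "deg_scale q s \<in> alg_hom P P" "deg_scale q s (gen q x) = ?g x" "deg_scale q s (word q w) = (s powi wdeg w) \<odot>\<^bsub>P\<^esub> word q w"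
    "y \<in> G n \<Longrightarrow> deg_scale q s y = (s powi n) \<odot>\<^bsub>P\<^esub> y"
    using \<phi> w h by auto
qed

text \<open>The derivation is the middle entry of an algebra map into the triangular algebra. The
  outer entries are algebra maps known on generators, hence the identity and the degree scaling, and
  multiplicativity of the middle entry is the twisted Leibniz rule.\<close>

lemma skew_derivation_ex:
  assumes s: "s \<noteq> 0" and v: "sl2_relations q (triangular P) (\<lambda>x. (gen q x, v x, (s powi gen_deg x) \<odot>\<^bsub>P\<^esub> gen q x))"
  obtains D where "D \<in> lin_hom P P" "\<And>x. D (gen q x) = v x"
    "\<And>x y. x \<in> carrier P \<Longrightarrow> y \<in> carrier P \<Longrightarrow> D (x \<otimes>\<^bsub>P\<^esub> y) = (D x \<otimes>\<^bsub>P\<^esub> deg_scale q s y) \<oplus>\<^bsub>P\<^esub> (x \<otimes>\<^bsub>P\<^esub> D y)"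
proof -
  note S = deg_scale[OF s]
  note T = triangular_algebra[OF P_algebra]
  obtain \<phi> where \<phi>: "\<phi> \<in> alg_hom P (triangular P)"
    "\<And>x. \<phi> (gen q x) = (gen q x, v x, (s powi gen_deg x) \<odot>\<^bsub>P\<^esub> gen q x)"
    using sl2_hom_ex[OF T v] by blast
  have clo: "\<phi> x \<in> carrier P \<times> carrier P \<times> carrier P" if "x \<in> carrier P" for x
    using lin_hom_closed[OF alg_homD(1)[OF \<phi>(1)] that] by simp
  have h1: "(\<lambda>x. fst (\<phi> x)) \<in> alg_hom P P" and h3: "(\<lambda>x. snd (snd (\<phi> x))) \<in> alg_hom P P"
    using clo alg_homD(2)[OF \<phi>(1)] alg_homD(3)[OF \<phi>(1)] lin_hom_add[OF alg_homD(1)[OF \<phi>(1)]] lin_hom_smult[OF alg_homD(1)[OF \<phi>(1)]]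
    by (auto intro!: alg_homI lin_homI simp: mem_Times_iff) (auto simp: split_beta triangular_def dsum_def RDirProd_def DirProd_def ring.defs monoid.defs module.defs)
  have 1: "fst (\<phi> x) = x" if "x \<in> carrier P" for x
    by (rule alg_hom_words_eq[OF h1 _ P_vs _ that, of "\<lambda>x. x"]) (auto simp: \<phi>(2) intro: alg_homI lin_hom_id(2))
  have 3: "snd (snd (\<phi> x)) = deg_scale q s x" if "x \<in> carrier P" for x
    by (rule alg_hom_words_eq[OF h3 S(1) P_vs _ that]) (simp add: \<phi>(2) S(2))
  show ?thesis
  proof (rule that[of "\<lambda>x. fst (snd (\<phi> x))"])
    show "(\<lambda>x. fst (snd (\<phi> x))) \<in> lin_hom P P"
      using clo lin_hom_add[OF alg_homD(1)[OF \<phi>(1)]] lin_hom_smult[OF alg_homD(1)[OF \<phi>(1)]]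
      by (auto intro!: lin_homI simp: mem_Times_iff) (auto simp: split_beta triangular_def dsum_def RDirProd_def DirProd_def ring.defs monoid.defs module.defs)
    fix x y assume xy: "x \<in> carrier P" "y \<in> carrier P"
    have e: "\<phi> x = (x, fst (snd (\<phi> x)), deg_scale q s x)" if "x \<in> carrier P" for x using 1[OF that] 3[OF that] by (metis prod.collapse)
    have "\<phi> (x \<otimes>\<^bsub>P\<^esub> y) = (x, fst (snd (\<phi> x)), deg_scale q s x) \<otimes>\<^bsub>triangular P\<^esub> (y, fst (snd (\<phi> y)), deg_scale q s y)"
      using alg_homD(2)[OF \<phi>(1) xy] e xy by metis
    then show "fst (snd (\<phi> (x \<otimes>\<^bsub>P\<^esub> y))) = fst (snd (\<phi> x)) \<otimes>\<^bsub>P\<^esub> deg_scale q s y \<oplus>\<^bsub>P\<^esub> x \<otimes>\<^bsub>P\<^esub> fst (snd (\<phi> y))"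
      using clo[OF xy(1)] clo[OF xy(2)] xy lin_hom_closed[OF alg_homD(1)[OF S(1)] xy(2)] by (simp add: mem_Times_iff P.a_comm)
  qed (simp add: \<phi>(2))
qed

subsection \<open>The calculus\<close>

abbreviation "\<Omega> \<equiv> Omega_SL2 q"
abbreviation "D \<equiv> d_SL2 q"

lemma Omega_sel [simp]:
  "carrier \<Omega> = carrier P \<times> carrier P \<times> carrier P" "\<zero>\<^bsub>\<Omega>\<^esub> = (\<zero>\<^bsub>P\<^esub>, \<zero>\<^bsub>P\<^esub>, \<zero>\<^bsub>P\<^esub>)"
  "(x, y, z) \<oplus>\<^bsub>\<Omega>\<^esub> (x', y', z') = (x \<oplus>\<^bsub>P\<^esub> x', y \<oplus>\<^bsub>P\<^esub> y', z \<oplus>\<^bsub>P\<^esub> z')"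
  "r \<odot>\<^bsub>\<Omega>\<^esub> (x, y, z) = (r \<odot>\<^bsub>P\<^esub> x, r \<odot>\<^bsub>P\<^esub> y, r \<odot>\<^bsub>P\<^esub> z)"
  "p \<rhd>\<^bsub>\<Omega>\<^esub> (x, y, z) = (p \<otimes>\<^bsub>P\<^esub> x, p \<otimes>\<^bsub>P\<^esub> y, p \<otimes>\<^bsub>P\<^esub> z)"
  "(x, y, z) \<lhd>\<^bsub>\<Omega>\<^esub> p = (x \<otimes>\<^bsub>P\<^esub> deg_scale q q p, y \<otimes>\<^bsub>P\<^esub> deg_scale q q p, z \<otimes>\<^bsub>P\<^esub> deg_scale q (q\<^sup>2) p)"
  by (simp_all add: Omega_SL2_def Let_def module.defs bimod.defs del: dsum_sel)
    (simp_all add: dsum_def RDirProd_def DirProd_def ring.defs monoid.defs module.defs)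

lemma Omega_vs: "vs \<Omega>"
  by (rule vs_cong[OF dsum_vs[OF P_vs dsum_vs[OF P_vs P_vs]]])
    (simp_all add: Omega_SL2_def Let_def module.defs bimod.defs)

lemma Omega_minus [simp]:
  "x \<in> carrier P \<Longrightarrow> y \<in> carrier P \<Longrightarrow> z \<in> carrier P \<Longrightarrow> x' \<in> carrier P \<Longrightarrow> y' \<in> carrier P \<Longrightarrow> z' \<in> carrier P \<Longrightarrow>
   (x, y, z) \<ominus>\<^bsub>\<Omega>\<^esub> (x', y', z') = (x \<ominus>\<^bsub>P\<^esub> x', y \<ominus>\<^bsub>P\<^esub> y', z \<ominus>\<^bsub>P\<^esub> z')"
  by (simp add: vs_minus[OF Omega_vs] vs_minus[OF P_vs])

fun d_gen_plus :: "sl2_gen \<Rightarrow> sl2" where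
  "d_gen_plus Ga = q \<odot>\<^bsub>P\<^esub> gen q Gb" | "d_gen_plus Gb = \<zero>\<^bsub>P\<^esub>" | "d_gen_plus Gc = q \<odot>\<^bsub>P\<^esub> gen q Gd" | "d_gen_plus Gd = \<zero>\<^bsub>P\<^esub>"

fun d_gen_minus :: "sl2_gen \<Rightarrow> sl2" where
  "d_gen_minus Ga = \<zero>\<^bsub>P\<^esub>" | "d_gen_minus Gb = gen q Ga" | "d_gen_minus Gc = \<zero>\<^bsub>P\<^esub>" | "d_gen_minus Gd = gen q Gc"

fun d_gen_zero :: "sl2_gen \<Rightarrow> sl2" where
  "d_gen_zero Ga = gen q Ga" | "d_gen_zero Gb = (- inverse (q\<^sup>2)) \<odot>\<^bsub>P\<^esub> gen q Gb"
| "d_gen_zero Gc = gen q Gc" | "d_gen_zero Gd = (- inverse (q\<^sup>2)) \<odot>\<^bsub>P\<^esub> gen q Gd"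

definition d_gen :: "sl2_gen \<Rightarrow> sl2 \<times> sl2 \<times> sl2" where
  "d_gen x = (d_gen_plus x, d_gen_minus x, d_gen_zero x)"

lemma cls_eqI': "f = g \<Longrightarrow> cls f = cls g" by simp

text \<open>This is the compatibility of the prescribed differentials with the relations of P, for
  the coefficients of e^+, e^- and e^0 separately; the twists are the commutation factors of these
  forms.\<close>

lemma triangular_relations:
  "sl2_relations q (triangular P) (\<lambda>x. (gen q x, d_gen_plus x, (q powi gen_deg x) \<odot>\<^bsub>P\<^esub> gen q x))"
  "sl2_relations q (triangular P) (\<lambda>x. (gen q x, d_gen_minus x, (q powi gen_deg x) \<odot>\<^bsub>P\<^esub> gen q x))"
  "sl2_relations q (triangular P) (\<lambda>x. (gen q x, d_gen_zero x, ((q\<^sup>2) powi gen_deg x) \<odot>\<^bsub>P\<^esub> gen q x))"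
  unfolding sl2_relations_def all_gen gen_deg.simps d_gen_plus.simps d_gen_minus.simps d_gen_zero.simps triangular_sel
    word_cls cls_mult cls_smult cls_one cls_zero cls_add[symmetric] free_sl2_mult free_sl2_sel append.simps pscale_single pscale_add
    pscale_zero prod.inject
  by (intro conjI; (unfold cls_add rel_cls)?; (unfold cls_add rel_cls)?; (unfold cls_add[symmetric])?;
      (rule cls_eqI', rule poly_mapping_eqI)?; use q in \<open>auto simp: lookup_add lookup_single when_def field_simps power2_eq_square\<close>)+

lemma left_modI:
  assumes "ring R" "abelian_group X"
    "\<And>r x. r \<in> carrier R \<Longrightarrow> x \<in> carrier X \<Longrightarrow> r \<odot>\<^bsub>X\<^esub> x \<in> carrier X"
    "\<And>r s x. r \<in> carrier R \<Longrightarrow> s \<in> carrier R \<Longrightarrow> x \<in> carrier X \<Longrightarrow> (r \<oplus>\<^bsub>R\<^esub> s) \<odot>\<^bsub>X\<^esub> x = r \<odot>\<^bsub>X\<^esub> x \<oplus>\<^bsub>X\<^esub> s \<odot>\<^bsub>X\<^esub> x"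
    "\<And>r x y. r \<in> carrier R \<Longrightarrow> x \<in> carrier X \<Longrightarrow> y \<in> carrier X \<Longrightarrow> r \<odot>\<^bsub>X\<^esub> (x \<oplus>\<^bsub>X\<^esub> y) = r \<odot>\<^bsub>X\<^esub> x \<oplus>\<^bsub>X\<^esub> r \<odot>\<^bsub>X\<^esub> y"
    "\<And>r s x. r \<in> carrier R \<Longrightarrow> s \<in> carrier R \<Longrightarrow> x \<in> carrier X \<Longrightarrow> (r \<otimes>\<^bsub>R\<^esub> s) \<odot>\<^bsub>X\<^esub> x = r \<odot>\<^bsub>X\<^esub> (s \<odot>\<^bsub>X\<^esub> x)"
    "\<And>x. x \<in> carrier X \<Longrightarrow> \<one>\<^bsub>R\<^esub> \<odot>\<^bsub>X\<^esub> x = x"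
  shows "left_module R X"
  using assms unfolding left_module_def by blast

lemma left_mod_sel [simp]:
  "carrier (left_mod \<Omega>' W) = W" "add (left_mod \<Omega>' W) = add \<Omega>'" "zero (left_mod \<Omega>' W) = zero \<Omega>'" "smult (left_mod \<Omega>' W) = lact \<Omega>'"
  by (simp_all add: left_mod_def)

lemma scale_hom: "deg_scale q q \<in> alg_hom P P" "deg_scale q (q\<^sup>2) \<in> alg_hom P P"
  using deg_scale(1)[of q] deg_scale(1)[of "q\<^sup>2"] q by auto

lemma scale_closed [simp]: "x \<in> carrier P \<Longrightarrow> deg_scale q q x \<in> carrier P" "x \<in> carrier P \<Longrightarrow> deg_scale q (q\<^sup>2) x \<in> carrier P"
  using lin_hom_closed[OF alg_homD(1)[OF scale_hom(1)]] lin_hom_closed[OF alg_homD(1)[OF scale_hom(2)]] by auto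

lemma Omega_bimodule: "bimodule P \<Omega>"
proof -
  note s1 = alg_homD[OF scale_hom(1)] and s2 = alg_homD[OF scale_hom(2)]
  note sa = lin_hom_add[OF s1(1)] lin_hom_add[OF s2(1)] lin_hom_smult[OF s1(1)] lin_hom_smult[OF s2(1)] s1(2,3) s2(2,3)
  have ag: "abelian_group \<Omega>" using Omega_vs by (rule module.axioms)
  have l: "left_module P (left_mod \<Omega> (carrier \<Omega>))"
    by (rule left_modI[OF P_ring abelian_group_cong[OF ag]]) (auto simp: P.l_distr P.r_distr P.m_assoc)
  have r: "left_module (opposite P) ((left_mod \<Omega> (carrier \<Omega>))\<lparr>smult := (\<lambda>p w. w \<lhd>\<^bsub>\<Omega>\<^esub> p)\<rparr>)"
    by (rule left_modI[OF opposite_ring[OF P_ring] abelian_group_cong[OF ag]]) (auto simp: P.l_distr P.r_distr P.m_assoc sa)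
  show ?thesis
    unfolding bimodule_def using Omega_vs l r
    by (auto simp: P.m_assoc sa cplx_algebraD[OF P_algebra])
qed

subsection \<open>The differential\<close>

lemma d_gen_closed [simp]: "d_gen_plus x \<in> carrier P" "d_gen_minus x \<in> carrier P" "d_gen_zero x \<in> carrier P" "d_gen x \<in> carrier \<Omega>"
proof -
  show 1: "d_gen_plus x \<in> carrier P" "d_gen_minus x \<in> carrier P" "d_gen_zero x \<in> carrier P"
    by (cases x; simp add: vs_closed[OF P_vs])+
  then show "d_gen x \<in> carrier \<Omega>" by (simp add: d_gen_def)
qed

lemma e_sel: "e_plus q = (\<one>\<^bsub>P\<^esub>, \<zero>\<^bsub>P\<^esub>, \<zero>\<^bsub>P\<^esub>)" "e_minus q = (\<zero>\<^bsub>P\<^esub>, \<one>\<^bsub>P\<^esub>, \<zero>\<^bsub>P\<^esub>)" "e_zero q = (\<zero>\<^bsub>P\<^esub>, \<zero>\<^bsub>P\<^esub>, \<one>\<^bsub>P\<^esub>)"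
  by (simp_all add: e_plus_def e_minus_def e_zero_def)

lemma derivation_eq:
  assumes D: "derivation P \<Omega> D1" "derivation P \<Omega> D2" and g: "\<And>x. D1 (gen q x) = D2 (gen q x)" and x: "x \<in> carrier P"
  shows "D1 x = D2 x"
proof -
  note L = D[unfolded derivation_def]
  \<comment> \<open>A derivation kills the unit, since d1 = d1 + d1. This starts the induction over
    words.\<close>
  have one: "D' \<one>\<^bsub>P\<^esub> = \<zero>\<^bsub>\<Omega>\<^esub>" if "derivation P \<Omega> D'" for D'
  proof -
    note L = that[unfolded derivation_def]
    obtain u v w where e: "D' \<one>\<^bsub>P\<^esub> = (u, v, w)" by (cases "D' \<one>\<^bsub>P\<^esub>") auto
    have c: "(u, v, w) \<in> carrier \<Omega>" using lin_hom_closed[OF conjunct1[OF L], of "\<one>\<^bsub>P\<^esub>"] by (simp add: e)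
    have "(u, v, w) = (u, v, w) \<oplus>\<^bsub>\<Omega>\<^esub> (u, v, w)"
      using conjunct2[OF L, rule_format, of "\<one>\<^bsub>P\<^esub>" "\<one>\<^bsub>P\<^esub>"] c
      by (simp add: e alg_homD(3)[OF scale_hom(1)] alg_homD(3)[OF scale_hom(2)])
    then show ?thesis using c by (simp add: e P.add.l_cancel_one' eq_commute)
  qed
  show ?thesis
  proof (rule P_hom_eq[OF Omega_vs conjunct1[OF L(1)] conjunct1[OF L(2)] _ x])
    show "D1 (word q w) = D2 (word q w)" for w
    proof (induction w)
      case Nil
      show ?case using one[OF D(1)] one[OF D(2)] by (simp add: word_Nil)
    next
      case (Cons x w)
      then show ?case unfolding word_Cons[of x w] using conjunct2[OF L(1)] conjunct2[OF L(2)] g by simp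
    qed
  qed
qed

text \<open>The calculus is free on the left, so \<open>d\<close> splits into three scalar-valued
  twisted derivations that can be extended from the generators independently.\<close>

lemma d_SL2: "derivation P \<Omega> D" "D (gen q x) = d_gen x"
proof -
  have q2: "q\<^sup>2 \<noteq> 0" using q by simp
  obtain Dp where Dp: "Dp \<in> lin_hom P P" "\<And>x. Dp (gen q x) = d_gen_plus x"
    "\<And>x y. x \<in> carrier P \<Longrightarrow> y \<in> carrier P \<Longrightarrow> Dp (x \<otimes>\<^bsub>P\<^esub> y) = (Dp x \<otimes>\<^bsub>P\<^esub> deg_scale q q y) \<oplus>\<^bsub>P\<^esub> (x \<otimes>\<^bsub>P\<^esub> Dp y)"
    using skew_derivation_ex[OF q triangular_relations(1)] by metis
  obtain Dm where Dm: "Dm \<in> lin_hom P P" "\<And>x. Dm (gen q x) = d_gen_minus x"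
    "\<And>x y. x \<in> carrier P \<Longrightarrow> y \<in> carrier P \<Longrightarrow> Dm (x \<otimes>\<^bsub>P\<^esub> y) = (Dm x \<otimes>\<^bsub>P\<^esub> deg_scale q q y) \<oplus>\<^bsub>P\<^esub> (x \<otimes>\<^bsub>P\<^esub> Dm y)"
    using skew_derivation_ex[OF q triangular_relations(2)] by metis
  obtain Dz where Dz: "Dz \<in> lin_hom P P" "\<And>x. Dz (gen q x) = d_gen_zero x"
    "\<And>x y. x \<in> carrier P \<Longrightarrow> y \<in> carrier P \<Longrightarrow> Dz (x \<otimes>\<^bsub>P\<^esub> y) = (Dz x \<otimes>\<^bsub>P\<^esub> deg_scale q (q\<^sup>2) y) \<oplus>\<^bsub>P\<^esub> (x \<otimes>\<^bsub>P\<^esub> Dz y)"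
    using skew_derivation_ex[OF q2 triangular_relations(3)] by metis
  define D0 where "D0 = (\<lambda>x\<in>carrier P. (Dp x, Dm x, Dz x))"
  have "D0 \<in> lin_hom P \<Omega>"
    by (rule lin_homI) (auto simp: D0_def vs_closed[OF P_vs] lin_hom_closed[OF Dp(1)] lin_hom_closed[OF Dm(1)] lin_hom_closed[OF Dz(1)]
      lin_hom_add[OF Dp(1)] lin_hom_add[OF Dm(1)] lin_hom_add[OF Dz(1)] lin_hom_smult[OF Dp(1)] lin_hom_smult[OF Dm(1)] lin_hom_smult[OF Dz(1)])
  then have d0: "derivation P \<Omega> D0"
    unfolding derivation_def by (auto simp: D0_def Dp(3) Dm(3) Dz(3))
  have g0: "D0 (gen q x) = d_gen x" for x by (simp add: D0_def Dp Dm Dz d_gen_def)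
  have gens: "(\<forall>x. D' (gen q x) = d_gen x) \<longleftrightarrow>
       D' (gen q Ga) = (gen q Ga \<rhd>\<^bsub>\<Omega>\<^esub> e_zero q) \<oplus>\<^bsub>\<Omega>\<^esub> ((q \<odot>\<^bsub>P\<^esub> gen q Gb) \<rhd>\<^bsub>\<Omega>\<^esub> e_plus q) \<and>
       D' (gen q Gb) = (gen q Ga \<rhd>\<^bsub>\<Omega>\<^esub> e_minus q) \<ominus>\<^bsub>\<Omega>\<^esub> ((inverse (q\<^sup>2) \<odot>\<^bsub>P\<^esub> gen q Gb) \<rhd>\<^bsub>\<Omega>\<^esub> e_zero q) \<and>
       D' (gen q Gc) = (gen q Gc \<rhd>\<^bsub>\<Omega>\<^esub> e_zero q) \<oplus>\<^bsub>\<Omega>\<^esub> ((q \<odot>\<^bsub>P\<^esub> gen q Gd) \<rhd>\<^bsub>\<Omega>\<^esub> e_plus q) \<and>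
       D' (gen q Gd) = (gen q Gc \<rhd>\<^bsub>\<Omega>\<^esub> e_minus q) \<ominus>\<^bsub>\<Omega>\<^esub> ((inverse (q\<^sup>2) \<odot>\<^bsub>P\<^esub> gen q Gd) \<rhd>\<^bsub>\<Omega>\<^esub> e_zero q)" for D'
    unfolding all_gen d_gen_def
    by (simp add: e_sel vs_closed[OF P_vs] vs_minus[OF P_vs] vs_smult_smult[OF P_vs] vs_smult_zero[OF P_vs])
  have "D = D0"
    unfolding d_SL2_def Let_def gens[symmetric]
  proof (rule the_equality)
    show "D0 \<in> extensional (carrier P) \<and> derivation P \<Omega> D0 \<and> (\<forall>x. D0 (gen q x) = d_gen x)"
      using d0 g0 by (simp add: D0_def)
    fix D' assume D': "D' \<in> extensional (carrier P) \<and> derivation P \<Omega> D' \<and> (\<forall>x. D' (gen q x) = d_gen x)"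
    show "D' = D0"
    proof (rule extensionalityI)
      show "D' \<in> extensional (carrier P)" using D' by simp
      show "D0 \<in> extensional (carrier P)" by (simp add: D0_def)
      fix x assume x: "x \<in> carrier P"
      show "D' x = D0 x" by (rule derivation_eq[OF _ d0 _ x]) (use D' g0 in auto)
    qed
  qed
  then show "derivation P \<Omega> D" "D (gen q x) = d_gen x" using d0 g0 by auto
qed

lemma D_lin: "D \<in> lin_hom P \<Omega>" using d_SL2(1) by (simp add: derivation_def)

lemma D_mult: "x \<in> carrier P \<Longrightarrow> y \<in> carrier P \<Longrightarrow> D (x \<otimes>\<^bsub>P\<^esub> y) = (D x \<lhd>\<^bsub>\<Omega>\<^esub> y) \<oplus>\<^bsub>\<Omega>\<^esub> (x \<rhd>\<^bsub>\<Omega>\<^esub> D y)"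
  using d_SL2(1) by (simp add: derivation_def)

lemma D_closed: "x \<in> carrier P \<Longrightarrow> D x \<in> carrier \<Omega>" by (rule lin_hom_closed[OF D_lin])

lemma D_one: "D \<one>\<^bsub>P\<^esub> = \<zero>\<^bsub>\<Omega>\<^esub>"
proof -
  obtain u v w where e: "D \<one>\<^bsub>P\<^esub> = (u, v, w)" by (cases "D \<one>\<^bsub>P\<^esub>") auto
  have c: "(u, v, w) \<in> carrier \<Omega>" using D_closed[of "\<one>\<^bsub>P\<^esub>"] by (simp add: e)
  have "(u, v, w) = (u, v, w) \<oplus>\<^bsub>\<Omega>\<^esub> (u, v, w)"
    using D_mult[of "\<one>\<^bsub>P\<^esub>" "\<one>\<^bsub>P\<^esub>"] c by (simp add: e alg_homD(3)[OF scale_hom(1)] alg_homD(3)[OF scale_hom(2)])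
  then show ?thesis using c by (simp add: e P.add.l_cancel_one' eq_commute)
qed

lemma lact_lin: "p \<in> carrier P \<Longrightarrow> (\<lambda>w. p \<rhd>\<^bsub>\<Omega>\<^esub> w) \<in> lin_hom \<Omega> \<Omega>"
  by (rule lin_homI) (auto simp: P.r_distr cplx_algebraD[OF P_algebra])

lemma ract_lin: "p \<in> carrier P \<Longrightarrow> (\<lambda>w. w \<lhd>\<^bsub>\<Omega>\<^esub> p) \<in> lin_hom \<Omega> \<Omega>"
  by (rule lin_homI) (auto simp: P.l_distr cplx_algebraD[OF P_algebra])

lemma lact_bilin: "bilin P \<Omega> \<Omega> (\<lambda>p w. p \<rhd>\<^bsub>\<Omega>\<^esub> w)"
  by (intro bilinI lact_lin lin_homI) (auto simp: P.l_distr cplx_algebraD[OF P_algebra])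

lemma dform_bilin: "bilin P P \<Omega> (\<lambda>p p'. p \<rhd>\<^bsub>\<Omega>\<^esub> D p')"
  using bilin_pre[OF lact_bilin lin_hom_id(2) D_lin] by simp

lemma lact_assoc: "p \<in> carrier P \<Longrightarrow> p' \<in> carrier P \<Longrightarrow> w \<in> carrier \<Omega> \<Longrightarrow> (p \<otimes>\<^bsub>P\<^esub> p') \<rhd>\<^bsub>\<Omega>\<^esub> w = p \<rhd>\<^bsub>\<Omega>\<^esub> (p' \<rhd>\<^bsub>\<Omega>\<^esub> w)"
  by (auto simp: P.m_assoc)

lemma lact_ract: "p \<in> carrier P \<Longrightarrow> p' \<in> carrier P \<Longrightarrow> w \<in> carrier \<Omega> \<Longrightarrow> (p \<rhd>\<^bsub>\<Omega>\<^esub> w) \<lhd>\<^bsub>\<Omega>\<^esub> p' = p \<rhd>\<^bsub>\<Omega>\<^esub> (w \<lhd>\<^bsub>\<Omega>\<^esub> p')"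
  by (auto simp: P.m_assoc)

lemma lact_closed: "p \<in> carrier P \<Longrightarrow> w \<in> carrier \<Omega> \<Longrightarrow> p \<rhd>\<^bsub>\<Omega>\<^esub> w \<in> carrier \<Omega>"
  by (rule lin_hom_closed[OF lact_lin])

lemma ract_closed: "p \<in> carrier P \<Longrightarrow> w \<in> carrier \<Omega> \<Longrightarrow> w \<lhd>\<^bsub>\<Omega>\<^esub> p \<in> carrier \<Omega>"
  by (rule lin_hom_closed[OF ract_lin])

subsection \<open>Normal forms\<close>

text \<open>Here b and c move to the left of a and d, so that a and d become neighbours and can be
  eliminated against each other; the normal forms are b^i c^j a^k and b^i c^j d^k. The orientation
  in \<open>rel_cls\<close> keeps a in front and can leave b or c between a and d.\<close>

lemma rel_cls_context:
  "cls (sgl (u @ [Ga, Gb] @ v) r) = cls (sgl (u @ [Gb, Ga] @ v) (inverse q * r))"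
  "cls (sgl (u @ [Ga, Gc] @ v) r) = cls (sgl (u @ [Gc, Ga] @ v) (inverse q * r))"
  "cls (sgl (u @ [Gd, Gb] @ v) r) = cls (sgl (u @ [Gb, Gd] @ v) (q * r))"
  "cls (sgl (u @ [Gd, Gc] @ v) r) = cls (sgl (u @ [Gc, Gd] @ v) (q * r))"
  "cls (sgl (u @ [Gc, Gb] @ v) r) = cls (sgl (u @ [Gb, Gc] @ v) r)"
  "cls (sgl (u @ [Ga, Gd] @ v) r) = cls (sgl (u @ v) r) \<oplus>\<^bsub>P\<^esub> cls (sgl (u @ [Gb, Gc] @ v) (inverse q * r))"
  "cls (sgl (u @ [Gd, Ga] @ v) r) = cls (sgl (u @ v) r) \<oplus>\<^bsub>P\<^esub> cls (sgl (u @ [Gb, Gc] @ v) (q * r))"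
proof -
  have c: "cls (sgl (u @ w @ v) s) = word q u \<otimes>\<^bsub>P\<^esub> (cls (sgl w s) \<otimes>\<^bsub>P\<^esub> word q v)" for w s
    by (simp add: word_cls cls_mult)
  have c0: "cls (sgl (u @ v) s) = word q u \<otimes>\<^bsub>P\<^esub> (cls (sgl [] s) \<otimes>\<^bsub>P\<^esub> word q v)" for s
    using c[of "[]"] by simp
  have i: "cls (sgl [Ga, Gb] r) = cls (sgl [Gb, Ga] (inverse q * r))" "cls (sgl [Ga, Gc] r) = cls (sgl [Gc, Ga] (inverse q * r))"
    unfolding rel_cls using q by (simp_all add: mult.assoc[symmetric])
  show
    "cls (sgl (u @ [Ga, Gb] @ v) r) = cls (sgl (u @ [Gb, Ga] @ v) (inverse q * r))"
    "cls (sgl (u @ [Ga, Gc] @ v) r) = cls (sgl (u @ [Gc, Ga] @ v) (inverse q * r))"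
    "cls (sgl (u @ [Gd, Gb] @ v) r) = cls (sgl (u @ [Gb, Gd] @ v) (q * r))"
    "cls (sgl (u @ [Gd, Gc] @ v) r) = cls (sgl (u @ [Gc, Gd] @ v) (q * r))"
    "cls (sgl (u @ [Gc, Gb] @ v) r) = cls (sgl (u @ [Gb, Gc] @ v) r)"
    "cls (sgl (u @ [Ga, Gd] @ v) r) = cls (sgl (u @ v) r) \<oplus>\<^bsub>P\<^esub> cls (sgl (u @ [Gb, Gc] @ v) (inverse q * r))"
    "cls (sgl (u @ [Gd, Ga] @ v) r) = cls (sgl (u @ v) r) \<oplus>\<^bsub>P\<^esub> cls (sgl (u @ [Gb, Gc] @ v) (q * r))"
    unfolding c c0
    by (simp_all only: i rel_cls(3-) cls_add P.l_distr P.r_distr cls_closed word_closed P.m_closed)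
qed

text \<open>Prefixes of length at most two, with any suffix, reach each adjacent pair in a word of
  four letters, the longest that occur below.\<close>

lemmas rel_nf = rel_cls_context[of "[]", simplified] rel_cls_context[of "[x]" for x, simplified] rel_cls_context[of "[x, y]" for x y, simplified]

lemma cls_minus: "cls f \<ominus>\<^bsub>P\<^esub> cls g = cls (f + pscale (-1) g)"
  by (simp add: vs_minus[OF P_vs] cls_smult cls_add)

lemmas gen_eval = word_cls cls_mult cls_smult cls_one cls_zero cls_add[symmetric] cls_minus free_sl2_mult free_sl2_sel append.simps
  pscale_single pscale_add pscale_zero add_0_left add_0_right

lemma d_gen_eval: "D (gen q Ga) = (cls (sgl [Gb] q), cls 0, cls (sgl [Ga] 1))"
   "D (gen q Gb) = (cls 0, cls (sgl [Ga] 1), cls (sgl [Gb] (- inverse (q\<^sup>2))))"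
   "D (gen q Gc) = (cls (sgl [Gd] q), cls 0, cls (sgl [Gc] 1))"
   "D (gen q Gd) = (cls 0, cls (sgl [Gc] 1), cls (sgl [Gd] (- inverse (q\<^sup>2))))"
  unfolding d_SL2(2) d_gen_def d_gen_plus.simps d_gen_minus.simps d_gen_zero.simps by (simp_all add: word_cls cls_smult cls_zero)

lemma scale_gen_eval:
  "deg_scale q q (cls (sgl [x] 1)) = cls (sgl [x] (q powi gen_deg x))" "deg_scale q (q\<^sup>2) (cls (sgl [x] 1)) = cls (sgl [x] ((q\<^sup>2) powi gen_deg x))"
  using deg_scale(2)[of q x] deg_scale(2)[of "q\<^sup>2" x] q by (simp_all add: word_cls cls_smult)

text \<open>The e^0 terms cancel: the derivative of the degree -1 factor contributes -q^-2, and
  moving e^0 past that factor contributes q^-2. Only two of the three basic forms survive on the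
  sphere.\<close>

lemma d_b:
  "D (b_minus q) = (cls (sgl [Gb, Gb] 1), cls (sgl [Ga, Ga] 1), cls 0)"
  "D (b_plus q) = (cls (sgl [Gd, Gd] 1), cls (sgl [Gc, Gc] 1), cls 0)"
  "D (b_zero q) = (cls (sgl [Gb, Gd] q), cls (sgl [Gc, Ga] 1), cls 0)"
  unfolding b_minus_def b_plus_def b_zero_def D_mult[OF word_closed word_closed] d_gen_eval
  unfolding word_cls Omega_sel scale_gen_eval gen_deg.simps gen_eval prod.inject
  by (intro conjI; (unfold cls_add rel_nf)?; (unfold cls_add[symmetric])?;
      (rule cls_eqI', rule poly_mapping_eqI)?; use q in \<open>auto simp: lookup_add lookup_single when_def field_simps power2_eq_square\<close>)+

lemma q_int_2: "q_int 2 s = 1 + s"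
proof (cases "s = 1")
  case False
  have "1 - s ^ 2 = (1 + s) * (1 - s)" by (simp add: power2_eq_square algebra_simps)
  then show ?thesis using False by (simp add: q_int_def)
qed (simp add: q_int_def)

text \<open>In the e^- coefficient of the first formula put x = bc. Then d^2 a^2 = (1 + q x)(1 + q^3
  x), and the other two terms contribute q^2 x^2 and -(q + q^3) x - (q^2 + q^4) x^2, which leaves 1.
  In the e^+ coefficient all terms are multiples of b^2 d^2, with factors q^4, q^2 and -(q^2 + q^4).
  The second formula works the same way.\<close>

lemma soldering_formulas:
  "(((gen q Gd \<otimes>\<^bsub>P\<^esub> gen q Gd) \<rhd>\<^bsub>\<Omega>\<^esub> D (b_minus q)) \<oplus>\<^bsub>\<Omega>\<^esub> ((q\<^sup>2 \<odot>\<^bsub>P\<^esub> (gen q Gb \<otimes>\<^bsub>P\<^esub> gen q Gb)) \<rhd>\<^bsub>\<Omega>\<^esub> D (b_plus q)))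
             \<ominus>\<^bsub>\<Omega>\<^esub> ((q_int 2 (q\<^sup>2) \<odot>\<^bsub>P\<^esub> (gen q Gb \<otimes>\<^bsub>P\<^esub> gen q Gd)) \<rhd>\<^bsub>\<Omega>\<^esub> D (b_zero q)) = e_minus q"
  "(((gen q Ga \<otimes>\<^bsub>P\<^esub> gen q Ga) \<rhd>\<^bsub>\<Omega>\<^esub> D (b_plus q)) \<oplus>\<^bsub>\<Omega>\<^esub> ((inverse (q\<^sup>2) \<odot>\<^bsub>P\<^esub> (gen q Gc \<otimes>\<^bsub>P\<^esub> gen q Gc)) \<rhd>\<^bsub>\<Omega>\<^esub> D (b_minus q)))
             \<ominus>\<^bsub>\<Omega>\<^esub> ((q_int 2 (inverse (q\<^sup>2)) \<odot>\<^bsub>P\<^esub> (gen q Ga \<otimes>\<^bsub>P\<^esub> gen q Gc)) \<rhd>\<^bsub>\<Omega>\<^esub> D (b_zero q)) = e_plus q"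
  unfolding d_b e_sel q_int_2
  unfolding word_cls cls_mult cls_smult Omega_sel free_sl2_sel append.simps pscale_single
  unfolding Omega_minus[OF cls_closed cls_closed cls_closed cls_closed cls_closed cls_closed] gen_eval prod.inject
  by (intro conjI; (unfold cls_add rel_nf)?; (unfold cls_add[symmetric])?;
      (rule cls_eqI', rule poly_mapping_eqI)?; use q in \<open>auto simp: lookup_add lookup_single when_def field_simps power2_eq_square\<close>)+

text \<open>The quantum integer [n; q^2] for all integers n, with its limit n at q^2 = 1.\<close>

definition qnum :: "int \<Rightarrow> complex" where
  "qnum n = (if q\<^sup>2 = 1 then of_int n else ((q\<^sup>2) powi n - 1) / (q\<^sup>2 - 1))"

text \<open>This cocycle identity is the twisted Leibniz rule with twist q^2 on powers of t; every
  later property of the quantum integers is drawn from it.\<close>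

lemma qnum_add: "qnum (m + n) = qnum m * (q\<^sup>2) powi n + qnum n"
proof (cases "q\<^sup>2 = 1")
  case False
  have "(A * B - 1) / s = (A - 1) / s * B + (B - 1) / s" for A B s :: complex
    by (simp add: add_divide_distrib[symmetric] left_diff_distrib)
  then show ?thesis using False q by (simp add: qnum_def power_int_add)
qed (simp add: qnum_def)

lemma qnum_0 [simp]: "qnum 0 = 0" by (simp add: qnum_def)
lemma qnum_1 [simp]: "qnum 1 = 1" by (simp add: qnum_def)

lemma qnum_minus_1: "qnum (- 1) = - inverse (q\<^sup>2)"
proof -
  have "qnum (1 + - 1) = inverse (q\<^sup>2) + qnum (- 1)" unfolding qnum_add[of 1 "-1"] by simp
  then show ?thesis by (simp add: eq_neg_iff_add_eq_0 add.commute)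
qed

text \<open>The coefficients 1 and -q^-2 of e^0 in the given differentials are [1; q^2] and
  [-1; q^2].\<close>

lemma d_gen_zero_qnum: "d_gen_zero x = qnum (gen_deg x) \<odot>\<^bsub>P\<^esub> gen q x"
  by (cases x) (simp_all add: qnum_minus_1 vs_one[OF P_vs])

lemma G_smult: "x \<in> G n \<Longrightarrow> r \<odot>\<^bsub>P\<^esub> x \<in> G n" and G_add: "x \<in> G n \<Longrightarrow> y \<in> G n \<Longrightarrow> x \<oplus>\<^bsub>P\<^esub> y \<in> G n"
  and G_zero [simp]: "\<zero>\<^bsub>P\<^esub> \<in> G n"
  by (rule G_sub(4), assumption, rule G_sub(3), assumption+, rule G_sub(2))

lemma d_gen_deg: "d_gen_plus x \<in> G (gen_deg x - 2)" "d_gen_minus x \<in> G (gen_deg x + 2)"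
  by (cases x; simp add: G_smult gen_G)+

lemma G_mult': "x \<in> G m \<Longrightarrow> y \<in> G n \<Longrightarrow> m + n = k \<Longrightarrow> x \<otimes>\<^bsub>P\<^esub> y \<in> G k"
  using G_mult by blast

text \<open>All three components are followed through one induction with the Leibniz rule. The first
  two show that d preserves degree when e^+ and e^- have degrees 2 and -2; the third is
  multiplication by the quantum integer of the degree.\<close>

lemma D_word:
  "fst (D (word q w)) \<in> G (wdeg w - 2) \<and> fst (snd (D (word q w))) \<in> G (wdeg w + 2) \<and> snd (snd (D (word q w))) = qnum (wdeg w) \<odot>\<^bsub>P\<^esub> word q w"
proof (induction w)
  case Nil
  then show ?case by (simp add: word_Nil D_one vs_zero_smult[OF P_vs])
next
  case (Cons x w)
  obtain u v z where e: "D (word q w) = (u, v, z)" by (metis prod.collapse)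
  have q2: "q\<^sup>2 \<noteq> 0" using q by simp
  have IH: "u \<in> G (wdeg w - 2)" "v \<in> G (wdeg w + 2)" "z = qnum (wdeg w) \<odot>\<^bsub>P\<^esub> word q w" using Cons e by auto
  have D: "D (word q (x # w)) = (d_gen x \<lhd>\<^bsub>\<Omega>\<^esub> word q w) \<oplus>\<^bsub>\<Omega>\<^esub> (gen q x \<rhd>\<^bsub>\<Omega>\<^esub> (u, v, z))"
    unfolding word_Cons[of x w] using D_mult[of "gen q x" "word q w"] by (simp add: d_SL2(2) e)
  have s: "deg_scale q q (word q w) \<in> G (wdeg w)"
    unfolding deg_scale(3)[OF q] by (intro G_smult word_G refl)
  have "qnum (gen_deg x) \<odot>\<^bsub>P\<^esub> gen q x \<otimes>\<^bsub>P\<^esub> ((q\<^sup>2 powi wdeg w) \<odot>\<^bsub>P\<^esub> word q w) \<oplus>\<^bsub>P\<^esub> gen q x \<otimes>\<^bsub>P\<^esub> (qnum (wdeg w) \<odot>\<^bsub>P\<^esub> word q w)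
     = qnum (wdeg (x # w)) \<odot>\<^bsub>P\<^esub> word q (x # w)"
    by (simp add: word_Cons[of x w] cplx_algebraD[OF P_algebra] vs_closed[OF P_vs] vs_smult_smult[OF P_vs] qnum_add vs_add_smult[OF P_vs] mult.commute)
  then show ?case
    using IH G_mult'[OF d_gen_deg(1)[of x] s, of "wdeg (x # w) - 2"] G_mult'[OF d_gen_deg(2)[of x] s, of "wdeg (x # w) + 2"]
      G_mult'[OF gen_G[OF refl] IH(1), of x "wdeg (x # w) - 2"] G_mult'[OF gen_G[OF refl] IH(2), of x "wdeg (x # w) + 2"]
    unfolding D d_gen_def
    by (simp add: d_gen_zero_qnum deg_scale(3)[OF q2] G_add)
qed

section \<open>The grading of the forms and the coaction on them\<close>

lemma Omega_submoduleI:
  assumes "submodule A cfield P" "submodule B cfield P" "submodule C cfield P"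
  shows "submodule (A \<times> B \<times> C) cfield \<Omega>"
  using vs_submoduleD[OF P_vs assms(1)] vs_submoduleD[OF P_vs assms(2)] vs_submoduleD[OF P_vs assms(3)]
  by (intro vs_submoduleI[OF Omega_vs]) auto

abbreviation "OG n \<equiv> G (n - 2) \<times> G (n + 2) \<times> G n"

lemma zero_submodule: "submodule {\<zero>\<^bsub>P\<^esub>} cfield P"
  by (rule vs_submoduleI[OF P_vs]) (auto simp: vs_smult_zero[OF P_vs])

lemma fst_lin: "(\<lambda>w. fst w) \<in> lin_hom \<Omega> P" and snd_lin: "(\<lambda>w. fst (snd w)) \<in> lin_hom \<Omega> P" and thd_lin: "(\<lambda>w. snd (snd w)) \<in> lin_hom \<Omega> P"
  by (rule lin_homI; auto)+

lemma D_zero: "x \<in> G n \<Longrightarrow> snd (snd (D x)) = qnum n \<odot>\<^bsub>P\<^esub> x"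
  by (rule lin_hom_eq_span[OF P_vs lin_hom_comp[OF D_lin thd_lin] smult_lin[OF P_vs] P_vs Gw_carrier])
    (auto simp: D_word degree_comp_def)

lemma D_graded: "x \<in> G n \<Longrightarrow> D x \<in> OG n"
proof (rule lin_hom_span_image[OF P_vs Omega_vs D_lin Omega_submoduleI[OF G_submodule G_submodule G_submodule] Gw_carrier])
  fix s assume "s \<in> Gw n"
  then obtain w where w: "s = word q w" "wdeg w = n" by blast
  then show "D s \<in> OG n" using D_word[of w] G_smult[OF word_G[of w n], of "qnum n"] by (simp add: mem_Times_iff)
qed (simp add: degree_comp_def)

lemma D_zero_degree: "x \<in> G 0 \<Longrightarrow> D x \<in> G (- 2) \<times> G 2 \<times> {\<zero>\<^bsub>P\<^esub>}"
  using D_graded[of x 0] D_zero[of x 0] by (auto simp: mem_Times_iff vs_zero_smult[OF P_vs])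

lemma inj_lin: "(\<lambda>p. (p, \<zero>\<^bsub>P\<^esub>, \<zero>\<^bsub>P\<^esub>)) \<in> lin_hom P \<Omega>" "(\<lambda>p. (\<zero>\<^bsub>P\<^esub>, p, \<zero>\<^bsub>P\<^esub>)) \<in> lin_hom P \<Omega>" "(\<lambda>p. (\<zero>\<^bsub>P\<^esub>, \<zero>\<^bsub>P\<^esub>, p)) \<in> lin_hom P \<Omega>"
  by (auto intro!: lin_homI simp: vs_smult_zero[OF P_vs])

text \<open>The forms \<open>e\<^sup>+, e\<^sup>-, e\<^sup>0\<close> have degree \<open>2, -2, 0\<close>.\<close>

definition shift :: "int \<Rightarrow> (sl2 \<Rightarrow> sl2 \<times> sl2 \<times> sl2) \<Rightarrow> _" where
  "shift k i = tlift P laurent (tensor \<Omega> laurent) (\<lambda>p f. pure \<Omega> laurent (i p) (f \<otimes>\<^bsub>laurent\<^esub> tpow k))"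

lemmas OA_vs = tensor_vs[OF Omega_vs laurent_vs]

lemma shift:
  assumes i: "i \<in> lin_hom P \<Omega>"
  shows "shift k i \<in> lin_hom PA (tensor \<Omega> laurent)"
    "p \<in> carrier P \<Longrightarrow> shift k i (pure P laurent p (tpow n)) = pure \<Omega> laurent (i p) (tpow (n + k))"
proof -
  have "bilin P laurent (tensor \<Omega> laurent) (\<lambda>p f. pure \<Omega> laurent (i p) (f \<otimes>\<^bsub>laurent\<^esub> tpow k))"
    by (rule bilin_pre[OF pure_bilin[OF Omega_vs laurent_vs] i bilinD(2)[OF ring_bilin[OF laurent_algebra]]]) simp
  from tlift[OF P_vs laurent_vs OA_vs this]
  show "shift k i \<in> lin_hom PA (tensor \<Omega> laurent)"
    "p \<in> carrier P \<Longrightarrow> shift k i (pure P laurent p (tpow n)) = pure \<Omega> laurent (i p) (tpow (n + k))"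
    unfolding shift_def by auto
qed

text \<open>An explicit candidate for the coaction on forms. It is linear by construction because
  the calculus is free, whereas \<open>form_coaction\<close> is only prescribed on the elements p
  dp'.\<close>

definition ocoact :: "sl2 \<times> sl2 \<times> sl2 \<Rightarrow> _" where
  "ocoact w = shift 2 (\<lambda>p. (p, \<zero>\<^bsub>P\<^esub>, \<zero>\<^bsub>P\<^esub>)) (\<delta> (fst w)) \<oplus>\<^bsub>tensor \<Omega> laurent\<^esub>
     (shift (- 2) (\<lambda>p. (\<zero>\<^bsub>P\<^esub>, p, \<zero>\<^bsub>P\<^esub>)) (\<delta> (fst (snd w))) \<oplus>\<^bsub>tensor \<Omega> laurent\<^esub> shift 0 (\<lambda>p. (\<zero>\<^bsub>P\<^esub>, \<zero>\<^bsub>P\<^esub>, p)) (\<delta> (snd (snd w))))"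

lemma ocoact_lin: "ocoact \<in> lin_hom \<Omega> (tensor \<Omega> laurent)"
proof -
  have "(\<lambda>w. ocoact w) \<in> lin_hom \<Omega> (tensor \<Omega> laurent)"
    unfolding ocoact_def
    by (rule lin_hom_plus[OF OA_vs lin_hom_comp[OF lin_hom_comp[OF fst_lin coaction_lin] shift(1)[OF inj_lin(1)]]
      lin_hom_plus[OF OA_vs lin_hom_comp[OF lin_hom_comp[OF snd_lin coaction_lin] shift(1)[OF inj_lin(2)]]
       lin_hom_comp[OF lin_hom_comp[OF thd_lin coaction_lin] shift(1)[OF inj_lin(3)]]]])
  then show ?thesis by simp
qed

lemma ocoact_graded: "graded_coaction \<Omega> OG ocoact"
proof -
  note pb = pure_bilin[OF Omega_vs laurent_vs] and pa = pure_add_left[OF Omega_vs laurent_vs, symmetric]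
  have 1: "ocoact w = pure \<Omega> laurent w (tpow n)" if w: "w \<in> OG n" for w n
  proof -
    obtain x y z where e: "w = (x, y, z)" "x \<in> G (n - 2)" "y \<in> G (n + 2)" "z \<in> G n" using w by auto
    then have "ocoact w = pure \<Omega> laurent (x, \<zero>\<^bsub>P\<^esub>, \<zero>\<^bsub>P\<^esub>) (tpow n) \<oplus>\<^bsub>tensor \<Omega> laurent\<^esub>
       (pure \<Omega> laurent (\<zero>\<^bsub>P\<^esub>, y, \<zero>\<^bsub>P\<^esub>) (tpow n) \<oplus>\<^bsub>tensor \<Omega> laurent\<^esub> pure \<Omega> laurent (\<zero>\<^bsub>P\<^esub>, \<zero>\<^bsub>P\<^esub>, z) (tpow n))"
      by (simp add: ocoact_def gcD(5)[OF P_graded e(2)] gcD(5)[OF P_graded e(3)] gcD(5)[OF P_graded e(4)] shift(2)[OF inj_lin(1)] shift(2)[OF inj_lin(2)] shift(2)[OF inj_lin(3)])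
    then show ?thesis using e by (simp add: pa)
  qed
  have sub: "submodule (OG n) cfield \<Omega>" for n by (intro Omega_submoduleI G_submodule)
  have u: "(\<Union>n. OG n) \<subseteq> carrier \<Omega>" by auto
  note S = vs_submoduleD[OF Omega_vs span_submodule[OF Omega_vs u]]
  have in1: "w \<in> lin_span \<Omega> (\<Union>n. OG n)" if "w \<in> OG n" for w n
    by (rule set_mp[OF span_superset[OF Omega_vs]], rule UN_I[of n], rule UNIV_I, rule that)
  have a: "(x, \<zero>\<^bsub>P\<^esub>, \<zero>\<^bsub>P\<^esub>) \<in> lin_span \<Omega> (\<Union>n. OG n)" "(\<zero>\<^bsub>P\<^esub>, x, \<zero>\<^bsub>P\<^esub>) \<in> lin_span \<Omega> (\<Union>n. OG n)" "(\<zero>\<^bsub>P\<^esub>, \<zero>\<^bsub>P\<^esub>, x) \<in> lin_span \<Omega> (\<Union>n. OG n)"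
    if x: "x \<in> carrier P" for x
  proof -
    have "(x, \<zero>\<^bsub>P\<^esub>, \<zero>\<^bsub>P\<^esub>) \<in> lin_span \<Omega> (\<Union>n. OG n) \<and> (\<zero>\<^bsub>P\<^esub>, x, \<zero>\<^bsub>P\<^esub>) \<in> lin_span \<Omega> (\<Union>n. OG n) \<and> (\<zero>\<^bsub>P\<^esub>, \<zero>\<^bsub>P\<^esub>, x) \<in> lin_span \<Omega> (\<Union>n. OG n)"
      using P_graded x
    proof (induction rule: gc_induct)
      case (hom n x)
      then show ?case using in1[of "(x, \<zero>\<^bsub>P\<^esub>, \<zero>\<^bsub>P\<^esub>)" "n + 2"] in1[of "(\<zero>\<^bsub>P\<^esub>, x, \<zero>\<^bsub>P\<^esub>)" "n - 2"] in1[of "(\<zero>\<^bsub>P\<^esub>, \<zero>\<^bsub>P\<^esub>, x)" n] by simp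
    next
      case (add x y)
      then show ?case
        using S(3)[of "(x, \<zero>\<^bsub>P\<^esub>, \<zero>\<^bsub>P\<^esub>)" "(y, \<zero>\<^bsub>P\<^esub>, \<zero>\<^bsub>P\<^esub>)"] S(3)[of "(\<zero>\<^bsub>P\<^esub>, x, \<zero>\<^bsub>P\<^esub>)" "(\<zero>\<^bsub>P\<^esub>, y, \<zero>\<^bsub>P\<^esub>)"] S(3)[of "(\<zero>\<^bsub>P\<^esub>, \<zero>\<^bsub>P\<^esub>, x)" "(\<zero>\<^bsub>P\<^esub>, \<zero>\<^bsub>P\<^esub>, y)"] by simp
    qed
    then show "(x, \<zero>\<^bsub>P\<^esub>, \<zero>\<^bsub>P\<^esub>) \<in> lin_span \<Omega> (\<Union>n. OG n)" "(\<zero>\<^bsub>P\<^esub>, x, \<zero>\<^bsub>P\<^esub>) \<in> lin_span \<Omega> (\<Union>n. OG n)" "(\<zero>\<^bsub>P\<^esub>, \<zero>\<^bsub>P\<^esub>, x) \<in> lin_span \<Omega> (\<Union>n. OG n)"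
      by auto
  qed
  have "carrier \<Omega> \<subseteq> lin_span \<Omega> (\<Union>n. OG n)"
  proof
    fix w assume "w \<in> carrier \<Omega>"
    then obtain x y z where e: "w = (x, y, z)" "x \<in> carrier P" "y \<in> carrier P" "z \<in> carrier P" by auto
    from S(3)[OF a(1)[OF e(2)] S(3)[OF a(2)[OF e(3)] a(3)[OF e(4)]]] e show "w \<in> lin_span \<Omega> (\<Union>n. OG n)" by simp
  qed
  then show ?thesis
    unfolding graded_coaction_def using Omega_vs sub S(1) ocoact_lin 1 by auto
qed

subsection \<open>Spaces of forms\<close>

lemma forms_submodule: "B \<subseteq> carrier P \<Longrightarrow> C \<subseteq> carrier P \<Longrightarrow> submodule (forms \<Omega> D B C) cfield \<Omega>"
  unfolding forms_def by (rule span_submodule[OF Omega_vs]) (use lact_closed D_closed in blast)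

lemma forms_base: "b \<in> B \<Longrightarrow> c \<in> C \<Longrightarrow> b \<rhd>\<^bsub>\<Omega>\<^esub> D c \<in> forms \<Omega> D B C"
  unfolding forms_def by (rule set_mp[OF span_superset[OF Omega_vs]]) blast

lemma forms_gens_carrier: "B \<subseteq> carrier P \<Longrightarrow> C \<subseteq> carrier P \<Longrightarrow> {b \<rhd>\<^bsub>\<Omega>\<^esub> D c | b c. b \<in> B \<and> c \<in> C} \<subseteq> carrier \<Omega>"
  using lact_closed D_closed by blast

lemma forms_lact:
  assumes "B \<subseteq> carrier P" "B' \<subseteq> carrier P" "C \<subseteq> carrier P" "p \<in> carrier P" "\<And>b. b \<in> B \<Longrightarrow> p \<otimes>\<^bsub>P\<^esub> b \<in> B'" "w \<in> forms \<Omega> D B C"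
  shows "p \<rhd>\<^bsub>\<Omega>\<^esub> w \<in> forms \<Omega> D B' C"
proof (rule lin_hom_span_image[OF Omega_vs Omega_vs lact_lin[OF assms(4)] forms_submodule[OF assms(2,3)] forms_gens_carrier[OF assms(1,3)]])
  fix s assume "s \<in> {b \<rhd>\<^bsub>\<Omega>\<^esub> D c | b c. b \<in> B \<and> c \<in> C}"
  then obtain b c where s: "s = b \<rhd>\<^bsub>\<Omega>\<^esub> D c" "b \<in> B" "c \<in> C" by blast
  then show "p \<rhd>\<^bsub>\<Omega>\<^esub> s \<in> forms \<Omega> D B' C"
    using forms_base[of "p \<otimes>\<^bsub>P\<^esub> b" B' c C] assms(4,5) lact_assoc[OF assms(4) _ D_closed, of b c] set_mp[OF assms(1)] set_mp[OF assms(3)] by simp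
qed (use assms(6) in \<open>simp add: forms_def\<close>)

lemma b_G: "b_minus q \<in> G 0" "b_plus q \<in> G 0" "b_zero q \<in> G 0"
  unfolding b_minus_def b_plus_def b_zero_def by (rule G_mult'[OF gen_G[OF refl] gen_G[OF refl]]; simp)+

lemma G0_carrier: "G n \<subseteq> carrier P" by auto

text \<open>The soldering formula multiplied by x has coefficients of degree n - 2. The set
  \<open>B\<close> is a parameter because the expansion is used twice: for forms on the sphere, with
  n = 2 and B the degree 0 part, and for P times these forms, with n = 0 and B = P.\<close>

lemma forms_e:
  assumes x: "x \<in> G n" and B: "G (n - 2) \<subseteq> B" "B \<subseteq> carrier P"
  shows "x \<rhd>\<^bsub>\<Omega>\<^esub> e_minus q \<in> forms \<Omega> D B (G 0)"
proof -
  note S = vs_submoduleD[OF Omega_vs forms_submodule[OF B(2) G0_carrier]]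
  note g = gen_G[OF refl]
  have b: "x \<rhd>\<^bsub>\<Omega>\<^esub> (p \<rhd>\<^bsub>\<Omega>\<^esub> D m) \<in> forms \<Omega> D B (G 0)" if "p \<in> G (- 2)" "m \<in> G 0" for p m
    using forms_base[of "x \<otimes>\<^bsub>P\<^esub> p" B m "G 0"] that x B G_mult'[of x n p "-2" "n - 2"] lact_assoc[of x p "D m"] D_closed[of m] by auto
  have l: "x \<rhd>\<^bsub>\<Omega>\<^esub> ((u \<oplus>\<^bsub>\<Omega>\<^esub> v) \<ominus>\<^bsub>\<Omega>\<^esub> w) = (x \<rhd>\<^bsub>\<Omega>\<^esub> u \<oplus>\<^bsub>\<Omega>\<^esub> x \<rhd>\<^bsub>\<Omega>\<^esub> v) \<ominus>\<^bsub>\<Omega>\<^esub> x \<rhd>\<^bsub>\<Omega>\<^esub> w"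
    if "u \<in> carrier \<Omega>" "v \<in> carrier \<Omega>" "w \<in> carrier \<Omega>" for u v w
    using that x lin_hom_minus[OF Omega_vs Omega_vs lact_lin[OF G_carrier[OF x]], of "u \<oplus>\<^bsub>\<Omega>\<^esub> v" w] lin_hom_add[OF lact_lin[OF G_carrier[OF x]], of u v]
      vs_closed(2)[OF Omega_vs] by metis
  have d: "gen q Gd \<otimes>\<^bsub>P\<^esub> gen q Gd \<in> G (- 2)" "q\<^sup>2 \<odot>\<^bsub>P\<^esub> (gen q Gb \<otimes>\<^bsub>P\<^esub> gen q Gb) \<in> G (- 2)" "q_int 2 (q\<^sup>2) \<odot>\<^bsub>P\<^esub> (gen q Gb \<otimes>\<^bsub>P\<^esub> gen q Gd) \<in> G (- 2)"
    by (auto intro!: G_smult G_mult'[OF g g])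
  have c: "p \<rhd>\<^bsub>\<Omega>\<^esub> D m \<in> carrier \<Omega>" if "p \<in> G (- 2)" "m \<in> G 0" for p m
    by (rule lact_closed[OF G_carrier[OF that(1)] D_closed[OF G_carrier[OF that(2)]]])
  show ?thesis
    unfolding soldering_formulas(1)[symmetric]
    by (subst l; intro c S b d b_G)
qed

lemma forms_e':
  assumes x: "x \<in> G n" and B: "G (n + 2) \<subseteq> B" "B \<subseteq> carrier P"
  shows "x \<rhd>\<^bsub>\<Omega>\<^esub> e_plus q \<in> forms \<Omega> D B (G 0)"
proof -
  note S = vs_submoduleD[OF Omega_vs forms_submodule[OF B(2) G0_carrier]]
  note g = gen_G[OF refl]
  have b: "x \<rhd>\<^bsub>\<Omega>\<^esub> (p \<rhd>\<^bsub>\<Omega>\<^esub> D m) \<in> forms \<Omega> D B (G 0)" if "p \<in> G 2" "m \<in> G 0" for p m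
    using forms_base[of "x \<otimes>\<^bsub>P\<^esub> p" B m "G 0"] that x B G_mult'[of x n p 2 "n + 2"] lact_assoc[of x p "D m"] D_closed[of m] by auto
  have l: "x \<rhd>\<^bsub>\<Omega>\<^esub> ((u \<oplus>\<^bsub>\<Omega>\<^esub> v) \<ominus>\<^bsub>\<Omega>\<^esub> w) = (x \<rhd>\<^bsub>\<Omega>\<^esub> u \<oplus>\<^bsub>\<Omega>\<^esub> x \<rhd>\<^bsub>\<Omega>\<^esub> v) \<ominus>\<^bsub>\<Omega>\<^esub> x \<rhd>\<^bsub>\<Omega>\<^esub> w"
    if "u \<in> carrier \<Omega>" "v \<in> carrier \<Omega>" "w \<in> carrier \<Omega>" for u v w
    using that x lin_hom_minus[OF Omega_vs Omega_vs lact_lin[OF G_carrier[OF x]], of "u \<oplus>\<^bsub>\<Omega>\<^esub> v" w] lin_hom_add[OF lact_lin[OF G_carrier[OF x]], of u v]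
      vs_closed(2)[OF Omega_vs] by metis
  have d: "gen q Ga \<otimes>\<^bsub>P\<^esub> gen q Ga \<in> G 2" "inverse (q\<^sup>2) \<odot>\<^bsub>P\<^esub> (gen q Gc \<otimes>\<^bsub>P\<^esub> gen q Gc) \<in> G 2" "q_int 2 (inverse (q\<^sup>2)) \<odot>\<^bsub>P\<^esub> (gen q Ga \<otimes>\<^bsub>P\<^esub> gen q Gc) \<in> G 2"
    by (auto intro!: G_smult G_mult'[OF g g])
  have c: "p \<rhd>\<^bsub>\<Omega>\<^esub> D m \<in> carrier \<Omega>" if "p \<in> G 2" "m \<in> G 0" for p m
    by (rule lact_closed[OF G_carrier[OF that(1)] D_closed[OF G_carrier[OF that(2)]]])
  show ?thesis
    unfolding soldering_formulas(2)[symmetric]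
    by (subst l; intro c S b d b_G)
qed

lemma e_combination: "x \<in> carrier P \<Longrightarrow> y \<in> carrier P \<Longrightarrow> x \<rhd>\<^bsub>\<Omega>\<^esub> e_plus q \<oplus>\<^bsub>\<Omega>\<^esub> y \<rhd>\<^bsub>\<Omega>\<^esub> e_minus q = (x, y, \<zero>\<^bsub>P\<^esub>)"
  by (simp add: e_sel)

text \<open>One inclusion is by degree, as \<open>d\<close> has no e^0 term on degree 0. The other
  expands e^+ and e^- in the differentials of the three generators of the sphere.\<close>

lemma forms_sphere: "forms \<Omega> D (G 0) (G 0) = G (- 2) \<times> G 2 \<times> {\<zero>\<^bsub>P\<^esub>}"
proof
  have "b \<rhd>\<^bsub>\<Omega>\<^esub> D c \<in> G (- 2) \<times> G 2 \<times> {\<zero>\<^bsub>P\<^esub>}" if b: "b \<in> G 0" and c: "c \<in> G 0" for b c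
  proof -
    obtain x y where "D c = (x, y, \<zero>\<^bsub>P\<^esub>)" "x \<in> G (- 2)" "y \<in> G 2" using D_zero_degree[OF c] by auto
    then show ?thesis using b G_mult'[of b 0 x "-2" "-2"] G_mult'[of b 0 y 2 2] by simp
  qed
  then show "forms \<Omega> D (G 0) (G 0) \<subseteq> G (- 2) \<times> G 2 \<times> {\<zero>\<^bsub>P\<^esub>}"
    unfolding forms_def by (intro span_minimal[OF Omega_vs Omega_submoduleI[OF G_submodule G_submodule zero_submodule]]) blast
  show "G (- 2) \<times> G 2 \<times> {\<zero>\<^bsub>P\<^esub>} \<subseteq> forms \<Omega> D (G 0) (G 0)"
  proof
    fix w assume "w \<in> G (- 2) \<times> G 2 \<times> {\<zero>\<^bsub>P\<^esub>}"
    then obtain x y where w: "w = (x, y, \<zero>\<^bsub>P\<^esub>)" "x \<in> G (- 2)" "y \<in> G 2" by auto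
    have "x \<rhd>\<^bsub>\<Omega>\<^esub> e_plus q \<oplus>\<^bsub>\<Omega>\<^esub> y \<rhd>\<^bsub>\<Omega>\<^esub> e_minus q \<in> forms \<Omega> D (G 0) (G 0)"
      by (intro vs_submoduleD(3)[OF Omega_vs forms_submodule] forms_e[OF w(3)] forms_e'[OF w(2)]) (simp_all add: G0_carrier)
    then show "w \<in> forms \<Omega> D (G 0) (G 0)" using w by (simp add: e_combination)
  qed
qed

lemma forms_P_M: "x \<in> carrier P \<Longrightarrow> y \<in> carrier P \<Longrightarrow> (x, y, \<zero>\<^bsub>P\<^esub>) \<in> forms \<Omega> D (carrier P) (G 0)"
proof -
  assume xy: "x \<in> carrier P" "y \<in> carrier P"
  have e: "p \<rhd>\<^bsub>\<Omega>\<^esub> (\<one>\<^bsub>P\<^esub> \<rhd>\<^bsub>\<Omega>\<^esub> w) \<in> forms \<Omega> D (carrier P) (G 0)" if "p \<in> carrier P" "\<one>\<^bsub>P\<^esub> \<rhd>\<^bsub>\<Omega>\<^esub> w \<in> forms \<Omega> D (carrier P) (G 0)" for p w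
    by (rule forms_lact[of "carrier P"]) (use that G0_carrier in auto)
  have "x \<rhd>\<^bsub>\<Omega>\<^esub> (\<one>\<^bsub>P\<^esub> \<rhd>\<^bsub>\<Omega>\<^esub> e_plus q) \<oplus>\<^bsub>\<Omega>\<^esub> y \<rhd>\<^bsub>\<Omega>\<^esub> (\<one>\<^bsub>P\<^esub> \<rhd>\<^bsub>\<Omega>\<^esub> e_minus q) \<in> forms \<Omega> D (carrier P) (G 0)"
    by (intro vs_submoduleD(3)[OF Omega_vs forms_submodule] e forms_e[OF G_one] forms_e'[OF G_one]) (simp_all add: G0_carrier xy)
  then show ?thesis using xy by (simp add: e_sel)
qed

lemma e_zero_form: "e_zero q \<in> forms \<Omega> D (carrier P) (carrier P)"
proof -
  note S = vs_submoduleD[OF Omega_vs forms_submodule[OF subset_refl subset_refl]]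
  \<comment> \<open>This is S(a_1) da_2 for the coproduct a (x) a + b (x) c of a, with S(a) = d and
    S(b) = -q b.\<close>
  have "gen q Gd \<rhd>\<^bsub>\<Omega>\<^esub> D (gen q Ga) \<oplus>\<^bsub>\<Omega>\<^esub> ((- q) \<odot>\<^bsub>P\<^esub> gen q Gb) \<rhd>\<^bsub>\<Omega>\<^esub> D (gen q Gc) \<in> forms \<Omega> D (carrier P) (carrier P)"
    by (intro S forms_base vs_smult_closed[OF P_vs] word_closed)
  also have "gen q Gd \<rhd>\<^bsub>\<Omega>\<^esub> D (gen q Ga) \<oplus>\<^bsub>\<Omega>\<^esub> ((- q) \<odot>\<^bsub>P\<^esub> gen q Gb) \<rhd>\<^bsub>\<Omega>\<^esub> D (gen q Gc) = e_zero q"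
    unfolding d_gen_eval e_sel
    unfolding word_cls cls_smult Omega_sel gen_eval prod.inject
    by (intro conjI; (unfold cls_add rel_nf)?; (unfold cls_add[symmetric])?;
      (rule cls_eqI', rule poly_mapping_eqI)?; use q in \<open>auto simp: lookup_add lookup_single when_def field_simps power2_eq_square\<close>)+
  finally show ?thesis .
qed

lemma forms_all: "forms \<Omega> D (carrier P) (carrier P) = carrier \<Omega>"
proof
  note S = vs_submoduleD[OF Omega_vs forms_submodule[OF subset_refl subset_refl]]
  show "forms \<Omega> D (carrier P) (carrier P) \<subseteq> carrier \<Omega>" by (rule S)
  have sub: "forms \<Omega> D (carrier P) (G 0) \<subseteq> forms \<Omega> D (carrier P) (carrier P)"
    unfolding forms_def
    by (rule span_minimal[OF Omega_vs span_submodule[OF Omega_vs forms_gens_carrier[OF subset_refl subset_refl]]], rule subset_trans[OF _ span_superset[OF Omega_vs]])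
      (use G0_carrier in blast)
  show "carrier \<Omega> \<subseteq> forms \<Omega> D (carrier P) (carrier P)"
  proof
    fix w assume "w \<in> carrier \<Omega>"
    then obtain x y z where w: "w = (x, y, z)" "x \<in> carrier P" "y \<in> carrier P" "z \<in> carrier P" by auto
    have "z \<rhd>\<^bsub>\<Omega>\<^esub> e_zero q \<in> forms \<Omega> D (carrier P) (carrier P)"
      by (rule forms_lact[OF _ _ _ _ _ e_zero_form]) (use w in auto)
    with S(3)[OF set_mp[OF sub forms_P_M[OF w(2,3)]] this]
    show "w \<in> forms \<Omega> D (carrier P) (carrier P)" using w by (simp add: e_sel)
  qed
qed

lemma calculus: "first_order_calculus P \<Omega> D"
  unfolding first_order_calculus_def using Omega_bimodule d_SL2(1) forms_all by simp

abbreviation "fcoact \<equiv> form_coaction laurent P \<delta> \<Omega> D"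

text \<open>Both sides are bilinear in p and p', so homogeneous arguments suffice, and for these p
  dp' has the sum of the degrees.\<close>

lemma ocoact_dform:
  assumes p: "p \<in> carrier P" and p': "p' \<in> carrier P"
  shows "ocoact (p \<rhd>\<^bsub>\<Omega>\<^esub> D p') = tcombine laurent P P \<Omega> (\<lambda>x y. x \<rhd>\<^bsub>\<Omega>\<^esub> D y) (\<delta> p) (\<delta> p')"
proof -
  note T = tcombine[OF laurent_algebra P_vs P_vs Omega_vs dform_bilin]
  note b1 = bilin_comp[OF dform_bilin ocoact_lin] and b2 = bilin_pre[OF T(1) coaction_lin coaction_lin]
  have hom: "ocoact (p \<rhd>\<^bsub>\<Omega>\<^esub> D p') = tcombine laurent P P \<Omega> (\<lambda>x y. x \<rhd>\<^bsub>\<Omega>\<^esub> D y) (\<delta> p) (\<delta> p')"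
    if p: "p \<in> G m" and p': "p' \<in> G n" for p p' m n
  proof -
    obtain x y z where "D p' = (x, y, z)" "x \<in> G (n - 2)" "y \<in> G (n + 2)" "z \<in> G n" using D_graded[OF p'] by auto
    then have "p \<rhd>\<^bsub>\<Omega>\<^esub> D p' \<in> OG (m + n)"
      using p G_mult'[of p m x "n - 2" "m + n - 2"] G_mult'[of p m y "n + 2" "m + n + 2"] G_mult'[of p m z n "m + n"] by simp
    then show ?thesis
      using p p' by (simp add: gcD(5)[OF ocoact_graded] gcD(5)[OF P_graded p] gcD(5)[OF P_graded p'] T(2) del: Omega_sel)
  qed
  have "ocoact (p \<rhd>\<^bsub>\<Omega>\<^esub> D p') = tcombine laurent P P \<Omega> (\<lambda>x y. x \<rhd>\<^bsub>\<Omega>\<^esub> D y) (\<delta> p) (\<delta> p')" if "p \<in> G m" for p m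
    by (rule gc_eq[OF P_graded OA_vs bilinD(1)[OF b1] bilinD(1)[OF b2] _ p']) (use that hom in auto)
  then show ?thesis
    by (intro gc_eq[OF P_graded OA_vs bilinD(2)[OF b1 p'] bilinD(2)[OF b2 p'] _ p])
qed

text \<open>The elements p dp' span the calculus, so at most one linear map has the prescribed
  values, and \<open>ocoact\<close> is one.\<close>

lemma form_coaction_eq: "w \<in> carrier \<Omega> \<Longrightarrow> fcoact w = ocoact w"
proof -
  assume w: "w \<in> carrier \<Omega>"
  have "fcoact = restrict ocoact (carrier \<Omega>)"
    unfolding form_coaction_def
  proof (rule the_equality)
    show "restrict ocoact (carrier \<Omega>) \<in> extensional (carrier \<Omega>) \<and> restrict ocoact (carrier \<Omega>) \<in> lin_hom \<Omega> (tensor \<Omega> laurent) \<and>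
     (\<forall>p\<in>carrier P. \<forall>p'\<in>carrier P. restrict ocoact (carrier \<Omega>) (p \<rhd>\<^bsub>\<Omega>\<^esub> D p') = tcombine laurent P P \<Omega> (\<lambda>x y. x \<rhd>\<^bsub>\<Omega>\<^esub> D y) (\<delta> p) (\<delta> p'))"
      using lin_hom_restrict[OF ocoact_lin Omega_vs] ocoact_dform bilinD(3)[OF dform_bilin] by simp
    fix \<phi> assume \<phi>: "\<phi> \<in> extensional (carrier \<Omega>) \<and> \<phi> \<in> lin_hom \<Omega> (tensor \<Omega> laurent) \<and>
     (\<forall>p\<in>carrier P. \<forall>p'\<in>carrier P. \<phi> (p \<rhd>\<^bsub>\<Omega>\<^esub> D p') = tcombine laurent P P \<Omega> (\<lambda>x y. x \<rhd>\<^bsub>\<Omega>\<^esub> D y) (\<delta> p) (\<delta> p'))"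
    have "\<phi> w = ocoact w" if "w \<in> carrier \<Omega>" for w
      by (rule lin_hom_eq_span[OF Omega_vs conjunct1[OF conjunct2[OF \<phi>]] ocoact_lin OA_vs forms_gens_carrier[OF subset_refl subset_refl]])
        (use that \<phi> ocoact_dform in \<open>auto simp: forms_all[unfolded forms_def] simp del: Omega_sel\<close>)
    then show "\<phi> = restrict ocoact (carrier \<Omega>)"
      by (intro extensionalityI[OF conjunct1[OF \<phi>] restrict_extensional]) simp
  qed
  then show ?thesis using w by simp
qed

end

lemma lin_hom_image:
  assumes X: "vs X" and Y: "vs Y" and f: "f \<in> lin_hom X Y" and H: "submodule H cfield X"
  shows "submodule (f ` H) cfield Y"
proof (rule vs_submoduleI[OF Y])
  note S = vs_submoduleD[OF X H]
  show "f ` H \<subseteq> carrier Y" by (rule image_subsetI, rule lin_hom_closed[OF f], rule set_mp[OF S(1)])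
  show "\<zero>\<^bsub>Y\<^esub> \<in> f ` H" by (rule image_eqI, rule lin_hom_zero[OF X Y f, symmetric], rule S(2))
  fix x r assume "x \<in> f ` H"
  then obtain u where u: "u \<in> H" "x = f u" by blast
  show "r \<odot>\<^bsub>Y\<^esub> x \<in> f ` H"
    unfolding u(2) by (rule image_eqI, rule lin_hom_smult[OF f set_mp[OF S(1) u(1)], symmetric], rule S(4)[OF u(1)])
next
  note S = vs_submoduleD[OF X H]
  fix x y assume "x \<in> f ` H" "y \<in> f ` H"
  then obtain u v where u: "u \<in> H" "x = f u" and v: "v \<in> H" "y = f v" by blast
  show "x \<oplus>\<^bsub>Y\<^esub> y \<in> f ` H"
    unfolding u(2) v(2) by (rule image_eqI, rule lin_hom_add[OF f set_mp[OF S(1) u(1)] set_mp[OF S(1) v(1)], symmetric], rule S(3)[OF u(1) v(1)])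
qed

context quantum_sl2
begin

subsection \<open>The universal calculus\<close>

abbreviation "mu \<equiv> tlift P P P (mult P)"
abbreviation "Phi \<equiv> tlift P P \<Omega> (\<lambda>b b'. b \<rhd>\<^bsub>\<Omega>\<^esub> D b')"
abbreviation "vr \<equiv> ver laurent P \<delta>"
abbreviation "lm p X \<equiv> pure P P p \<one>\<^bsub>P\<^esub> \<otimes>\<^bsub>PP\<^esub> X"
abbreviation "rm X p \<equiv> X \<otimes>\<^bsub>PP\<^esub> pure P P \<one>\<^bsub>P\<^esub> p"

lemmas P_mult_bilin = ring_bilin[OF P_algebra]
lemmas PP_mult_bilin = ring_bilin[OF PP_algebra]
lemmas PA_mult_bilin = ring_bilin[OF PA_algebra]
lemmas pure_PP = pure_closed[OF P_vs P_vs]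
lemmas pure_PA = pure_closed[OF P_vs laurent_vs]
lemmas PP_eq = tensor_hom_eq[OF P_vs P_vs]
lemmas PA_eq = tensor_hom_eq[OF P_vs laurent_vs]

lemma mu: "mu \<in> lin_hom PP P" "p \<in> carrier P \<Longrightarrow> p' \<in> carrier P \<Longrightarrow> mu (pure P P p p') = p \<otimes>\<^bsub>P\<^esub> p'"
  using tlift[OF P_vs P_vs P_vs P_mult_bilin] by auto

lemma Phi: "Phi \<in> lin_hom PP \<Omega>" "p \<in> carrier P \<Longrightarrow> p' \<in> carrier P \<Longrightarrow> Phi (pure P P p p') = p \<rhd>\<^bsub>\<Omega>\<^esub> D p'"
  using tlift[OF P_vs P_vs Omega_vs dform_bilin] by auto

lemma ver: "vr \<in> lin_hom PP PA" "p \<in> carrier P \<Longrightarrow> p' \<in> carrier P \<Longrightarrow> vr (pure P P p p') = pure P laurent p (tpow 0) \<otimes>\<^bsub>PA\<^esub> \<delta> p'"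
proof -
  have "bilin P P PA (\<lambda>p p'. pure P laurent p (tpow 0) \<otimes>\<^bsub>PA\<^esub> \<delta> p')"
    by (rule bilin_pre[OF PA_mult_bilin bilinD(2)[OF pure_bilin[OF P_vs laurent_vs]] coaction_lin]) simp
  from tlift[OF P_vs P_vs PA_vs this]
  show "vr \<in> lin_hom PP PA" "p \<in> carrier P \<Longrightarrow> p' \<in> carrier P \<Longrightarrow> vr (pure P P p p') = pure P laurent p (tpow 0) \<otimes>\<^bsub>PA\<^esub> \<delta> p'"
    unfolding ver_def by simp_all
qed

lemma ver_hom: "p \<in> carrier P \<Longrightarrow> p' \<in> G n \<Longrightarrow> vr (pure P P p p') = pure P laurent (p \<otimes>\<^bsub>P\<^esub> p') (tpow n)"
  by (simp add: ver(2) gcD(5)[OF P_graded] pure_mult[OF P_algebra laurent_algebra])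

lemma lm: "p \<in> carrier P \<Longrightarrow> (\<lambda>X. lm p X) \<in> lin_hom PP PP"
  "p \<in> carrier P \<Longrightarrow> x \<in> carrier P \<Longrightarrow> y \<in> carrier P \<Longrightarrow> lm p (pure P P x y) = pure P P (p \<otimes>\<^bsub>P\<^esub> x) y"
  "p \<in> carrier P \<Longrightarrow> X \<in> carrier PP \<Longrightarrow> lm p X \<in> carrier PP"
proof -
  show 1: "(\<lambda>X. lm p X) \<in> lin_hom PP PP" if "p \<in> carrier P" for p
    by (rule bilinD(1)[OF PP_mult_bilin]) (simp add: pure_PP that)
  show "p \<in> carrier P \<Longrightarrow> x \<in> carrier P \<Longrightarrow> y \<in> carrier P \<Longrightarrow> lm p (pure P P x y) = pure P P (p \<otimes>\<^bsub>P\<^esub> x) y"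
    by (simp add: pure_mult[OF P_algebra P_algebra])
  show "p \<in> carrier P \<Longrightarrow> X \<in> carrier PP \<Longrightarrow> lm p X \<in> carrier PP"
    by (rule lin_hom_closed[OF 1])
qed

lemma rm: "p \<in> carrier P \<Longrightarrow> (\<lambda>X. rm X p) \<in> lin_hom PP PP"
  "p \<in> carrier P \<Longrightarrow> x \<in> carrier P \<Longrightarrow> y \<in> carrier P \<Longrightarrow> rm (pure P P x y) p = pure P P x (y \<otimes>\<^bsub>P\<^esub> p)"
  "p \<in> carrier P \<Longrightarrow> X \<in> carrier PP \<Longrightarrow> rm X p \<in> carrier PP"
proof -
  show 1: "(\<lambda>X. rm X p) \<in> lin_hom PP PP" if "p \<in> carrier P" for p
    by (rule bilinD(2)[OF PP_mult_bilin]) (simp add: pure_PP that)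
  show "p \<in> carrier P \<Longrightarrow> x \<in> carrier P \<Longrightarrow> y \<in> carrier P \<Longrightarrow> rm (pure P P x y) p = pure P P x (y \<otimes>\<^bsub>P\<^esub> p)"
    by (simp add: pure_mult[OF P_algebra P_algebra])
  show "p \<in> carrier P \<Longrightarrow> X \<in> carrier PP \<Longrightarrow> rm X p \<in> carrier PP"
    by (rule lin_hom_closed[OF 1])
qed

lemma Phi_closed: "X \<in> carrier PP \<Longrightarrow> Phi X \<in> carrier \<Omega>" by (rule lin_hom_closed[OF Phi(1)])
lemma ver_closed: "X \<in> carrier PP \<Longrightarrow> vr X \<in> carrier PA" by (rule lin_hom_closed[OF ver(1)])

lemma mu_lm: "p \<in> carrier P \<Longrightarrow> X \<in> carrier PP \<Longrightarrow> mu (lm p X) = p \<otimes>\<^bsub>P\<^esub> mu X"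
  by (rule PP_eq[OF P_vs lin_hom_comp[OF lm(1) mu(1)] lin_hom_comp[OF mu(1) bilinD(1)[OF P_mult_bilin]]])
    (simp_all add: lm(2) mu(2) P.m_assoc)

lemma mu_rm: "p \<in> carrier P \<Longrightarrow> X \<in> carrier PP \<Longrightarrow> mu (rm X p) = mu X \<otimes>\<^bsub>P\<^esub> p"
  by (rule PP_eq[OF P_vs lin_hom_comp[OF rm(1) mu(1)] lin_hom_comp[OF mu(1) bilinD(2)[OF P_mult_bilin]]])
    (simp_all add: rm(2) mu(2) P.m_assoc)

lemma Phi_lm: "p \<in> carrier P \<Longrightarrow> X \<in> carrier PP \<Longrightarrow> Phi (lm p X) = p \<rhd>\<^bsub>\<Omega>\<^esub> Phi X"
  by (rule PP_eq[OF Omega_vs lin_hom_comp[OF lm(1) Phi(1)] lin_hom_comp[OF Phi(1) lact_lin]])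
    (simp_all add: lm(2) Phi(2) lact_assoc D_closed del: Omega_sel)

text \<open>The second term comes from the Leibniz rule. It vanishes on the universal calculus,
  where the product is zero, and therefore the kernel there is also stable under right
  multiplication.\<close>

lemma Phi_rm: "p \<in> carrier P \<Longrightarrow> X \<in> carrier PP \<Longrightarrow> Phi (rm X p) = (Phi X \<lhd>\<^bsub>\<Omega>\<^esub> p) \<oplus>\<^bsub>\<Omega>\<^esub> (mu X \<rhd>\<^bsub>\<Omega>\<^esub> D p)"
  by (rule PP_eq[OF Omega_vs lin_hom_comp[OF rm(1) Phi(1)] lin_hom_plus[OF Omega_vs lin_hom_comp[OF Phi(1) ract_lin] lin_hom_comp[OF mu(1) bilinD(2)[OF lact_bilin D_closed]]]])
    (simp_all add: rm(2) Phi(2) mu(2) lact_assoc lact_ract D_closed D_mult lin_hom_add[OF lact_lin] ract_closed lact_closed del: Omega_sel)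

lemma ver_lm: "p \<in> carrier P \<Longrightarrow> X \<in> carrier PP \<Longrightarrow> vr (lm p X) = pure P laurent p (tpow 0) \<otimes>\<^bsub>PA\<^esub> vr X"
proof (rule PP_eq[OF PA_vs lin_hom_comp[OF lm(1) ver(1)] lin_hom_comp[OF ver(1) bilinD(1)[OF PA_mult_bilin]]])
  interpret PA: ring PA using PA_algebra by (simp add: cplx_algebra_def)
  fix u w assume p: "p \<in> carrier P" and uw: "u \<in> carrier P" "w \<in> carrier P"
  have "pure P laurent (p \<otimes>\<^bsub>P\<^esub> u) (tpow 0) = pure P laurent p (tpow 0) \<otimes>\<^bsub>PA\<^esub> pure P laurent u (tpow 0)"
    using p uw by (simp add: pure_mult[OF P_algebra laurent_algebra])
  then show "vr (lm p (pure P P u w)) = pure P laurent p (tpow 0) \<otimes>\<^bsub>PA\<^esub> vr (pure P P u w)"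
    using p uw by (simp add: lm(2) ver(2) PA.m_assoc pure_PA lin_hom_closed[OF coaction_lin])
qed (simp_all add: pure_PA)

lemma tspan_PP: "B \<subseteq> carrier P \<Longrightarrow> C \<subseteq> carrier P \<Longrightarrow> submodule (tspan P P B C) cfield PP"
  by (rule tspan_submodule[OF P_vs P_vs])

lemma tspan_gens_carrier: "B \<subseteq> carrier P \<Longrightarrow> C \<subseteq> carrier P \<Longrightarrow> {pure P P x y | x y. x \<in> B \<and> y \<in> C} \<subseteq> carrier PP"
  using pure_PP by blast

lemma tspan_image:
  assumes "vs Z" "f \<in> lin_hom PP Z" "submodule H cfield Z" "B \<subseteq> carrier P" "C \<subseteq> carrier P" "X \<in> tspan P P B C"
    "\<And>x y. x \<in> B \<Longrightarrow> y \<in> C \<Longrightarrow> f (pure P P x y) \<in> H"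
  shows "f X \<in> H"
  by (rule lin_hom_span_image[OF PP_vs assms(1-3) tspan_gens_carrier[OF assms(4,5)] _ assms(6)[unfolded tspan_def]]) (use assms(7) in blast)

lemma tspan_eq:
  assumes "vs Z" "f \<in> lin_hom PP Z" "g \<in> lin_hom PP Z" "B \<subseteq> carrier P" "C \<subseteq> carrier P" "X \<in> tspan P P B C"
    "\<And>x y. x \<in> B \<Longrightarrow> y \<in> C \<Longrightarrow> f (pure P P x y) = g (pure P P x y)"
  shows "f X = g X"
  by (rule lin_hom_eq_span[OF PP_vs assms(2,3,1) tspan_gens_carrier[OF assms(4,5)] _ assms(6)[unfolded tspan_def]]) (use assms(7) in blast)

lemma tspan_carrier_sub: "B \<subseteq> carrier P \<Longrightarrow> C \<subseteq> carrier P \<Longrightarrow> tspan P P B C \<subseteq> carrier PP"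
  using vs_submoduleD(1)[OF PP_vs tspan_PP] .

lemma univ_forms_carrier: "B \<subseteq> carrier P \<Longrightarrow> X \<in> univ_forms P B \<Longrightarrow> X \<in> carrier PP"
  using tspan_carrier_sub[of B B] by (auto simp: univ_forms_def)

lemma univ_forms_all: "univ_forms P (carrier P) = {X \<in> carrier PP. mu X = \<zero>\<^bsub>P\<^esub>}"
  by (simp add: univ_forms_def tspan_carrier[OF P_vs P_vs])

lemma univ_forms_submodule: "B \<subseteq> carrier P \<Longrightarrow> submodule (univ_forms P B) cfield PP"
  using vs_submoduleD[OF PP_vs tspan_PP[of B B]]
  by (intro vs_submoduleI[OF PP_vs])
    (auto simp: univ_forms_def lin_hom_zero[OF PP_vs P_vs mu(1)] lin_hom_add[OF mu(1)] lin_hom_smult[OF mu(1)] vs_smult_zero[OF P_vs] subset_iff)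

lemma calculus_kernel_submodule: "B \<subseteq> carrier P \<Longrightarrow> submodule (calculus_kernel P \<Omega> D B) cfield PP"
  using vs_submoduleD[OF PP_vs univ_forms_submodule[of B]]
  by (intro vs_submoduleI[OF PP_vs])
    (auto simp: calculus_kernel_def lin_hom_zero[OF PP_vs Omega_vs Phi(1)] lin_hom_add[OF Phi(1)] lin_hom_smult[OF Phi(1)] vs_smult_zero[OF P_vs] subset_iff)

lemma calculus_sub_bimodule:
  assumes B: "B \<subseteq> carrier P" and m: "\<And>x y. x \<in> B \<Longrightarrow> y \<in> B \<Longrightarrow> x \<otimes>\<^bsub>P\<^esub> y \<in> B"
  shows "sub_bimodule P B (calculus_kernel P \<Omega> D B)"
  unfolding sub_bimodule_def
proof (intro conjI ballI calculus_kernel_submodule[OF B])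
  show "calculus_kernel P \<Omega> D B \<subseteq> univ_forms P B" by (auto simp: calculus_kernel_def)
  fix b X assume b: "b \<in> B" and X: "X \<in> calculus_kernel P \<Omega> D B"
  have b': "b \<in> carrier P" using b B by auto
  have X': "X \<in> tspan P P B B" "mu X = \<zero>\<^bsub>P\<^esub>" "Phi X = \<zero>\<^bsub>\<Omega>\<^esub>" using X by (auto simp: calculus_kernel_def univ_forms_def)
  then have XP: "X \<in> carrier PP" using tspan_carrier_sub[OF B B] by auto
  have "lm b X \<in> tspan P P B B"
    by (rule tspan_image[OF PP_vs lm(1)[OF b'] tspan_PP[OF B B] B B X'(1)]) (use b b' B m in \<open>auto simp: lm(2) subset_iff intro!: tspan_pure[OF P_vs P_vs]\<close>)
  then show "lm b X \<in> calculus_kernel P \<Omega> D B"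
    by (simp add: calculus_kernel_def univ_forms_def mu_lm[OF b' XP] Phi_lm[OF b' XP] X' b')
  have "rm X b \<in> tspan P P B B"
    by (rule tspan_image[OF PP_vs rm(1)[OF b'] tspan_PP[OF B B] B B X'(1)]) (use b b' B m in \<open>auto simp: rm(2) subset_iff intro!: tspan_pure[OF P_vs P_vs]\<close>)
  moreover have "\<zero>\<^bsub>P\<^esub> \<rhd>\<^bsub>\<Omega>\<^esub> D b = \<zero>\<^bsub>\<Omega>\<^esub>" using D_closed[OF b'] by auto
  ultimately show "rm X b \<in> calculus_kernel P \<Omega> D B"
    by (simp add: calculus_kernel_def univ_forms_def mu_rm[OF b' XP] Phi_rm[OF b' XP] X' b')
qed

subsection \<open>Exactness of the bundle\<close>

abbreviation "Hor \<equiv> horizontal_forms P (G 0)"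

lemma hor_gens_carrier: "{pure P P p \<one>\<^bsub>P\<^esub> \<otimes>\<^bsub>PP\<^esub> X \<otimes>\<^bsub>PP\<^esub> pure P P \<one>\<^bsub>P\<^esub> p' | p X p'. p \<in> carrier P \<and> X \<in> univ_forms P (G 0) \<and> p' \<in> carrier P} \<subseteq> carrier PP"
proof
  fix Y assume "Y \<in> {pure P P p \<one>\<^bsub>P\<^esub> \<otimes>\<^bsub>PP\<^esub> X \<otimes>\<^bsub>PP\<^esub> pure P P \<one>\<^bsub>P\<^esub> p' | p X p'. p \<in> carrier P \<and> X \<in> univ_forms P (G 0) \<and> p' \<in> carrier P}"
  then obtain p X p' where Y: "Y = rm (lm p X) p'" "p \<in> carrier P" "X \<in> univ_forms P (G 0)" "p' \<in> carrier P" by blast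
  then show "Y \<in> carrier PP" using rm(3)[OF Y(4) lm(3)[OF Y(2) univ_forms_carrier[OF G0_carrier Y(3)]]] by simp
qed

lemma hor_submodule: "submodule Hor cfield PP"
  unfolding horizontal_forms_def by (rule span_submodule[OF PP_vs hor_gens_carrier])

lemmas hor_sub = vs_submoduleD[OF PP_vs hor_submodule]

lemma hor_base: "p \<in> carrier P \<Longrightarrow> X \<in> univ_forms P (G 0) \<Longrightarrow> p' \<in> carrier P \<Longrightarrow> rm (lm p X) p' \<in> Hor"
  unfolding horizontal_forms_def by (rule set_mp[OF span_superset[OF PP_vs]]) blast

text \<open>The identity of P tensored with the counit of the fibre. After \<open>ver\<close> it
  gives the multiplication map, so it detects the universal calculus.\<close>

definition eps_r where "eps_r = tlift P laurent P (\<lambda>p f. counit laurent f \<odot>\<^bsub>P\<^esub> p)"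

text \<open>The functional t^n -> [n; q^2] on the fibre. Tensored with the identity of P and
  composed with \<open>ver\<close>, it gives the e^0 coefficient of a form.\<close>

definition gfun :: "(int \<Rightarrow>\<^sub>0 complex) \<Rightarrow> complex" where "gfun = lext cfield qnum"

definition g_r where "g_r = tlift P laurent P (\<lambda>p f. gfun f \<odot>\<^bsub>P\<^esub> p)"

lemma gfun: "gfun \<in> lin_hom laurent cfield" "gfun (tpow n) = qnum n"
proof -
  have "gfun \<in> lin_hom laurent_alg cfield"
    unfolding gfun_def laurent_alg_def by (rule lext_lin[OF vs_cfield]) simp
  then show "gfun \<in> lin_hom laurent cfield" by (simp add: lin_hom_laurent_alg)
  show "gfun (tpow n) = qnum n"
    unfolding gfun_def tpow_def using lext_sgl[OF vs_cfield, of n integer_group qnum 1] by simp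
qed

lemma functional_bilin:
  assumes "h \<in> lin_hom laurent cfield"
  shows "bilin P laurent P (\<lambda>p f. h f \<odot>\<^bsub>P\<^esub> p)"
  by (intro bilinI smult_lin[OF P_vs] lin_homI)
    (use lin_hom_add[OF assms] lin_hom_smult[OF assms] in \<open>auto simp: vs_closed[OF P_vs] vs_add_smult[OF P_vs] vs_smult_smult[OF P_vs]\<close>)

lemma eps_r: "eps_r \<in> lin_hom PA P" "p \<in> carrier P \<Longrightarrow> eps_r (pure P laurent p f) = counit laurent f \<odot>\<^bsub>P\<^esub> p"
  using tlift[OF P_vs laurent_vs P_vs functional_bilin[OF alg_homD(1)[OF laurent_counit(1)]]] by (auto simp: eps_r_def)

lemma g_r: "g_r \<in> lin_hom PA P" "p \<in> carrier P \<Longrightarrow> g_r (pure P laurent p f) = gfun f \<odot>\<^bsub>P\<^esub> p"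
  using tlift[OF P_vs laurent_vs P_vs functional_bilin[OF gfun(1)]] by (auto simp: g_r_def)

lemma PP_hom_eq:
  assumes Z: "vs Z" and f: "f \<in> lin_hom PP Z" and g: "g \<in> lin_hom PP Z"
    and e: "\<And>p p' n. p \<in> carrier P \<Longrightarrow> p' \<in> G n \<Longrightarrow> f (pure P P p p') = g (pure P P p p')" and X: "X \<in> carrier PP"
  shows "f X = g X"
proof (rule PP_eq[OF Z f g _ X])
  fix u w assume u: "u \<in> carrier P" and w: "w \<in> carrier P"
  note b = bilinD(1)[OF pure_bilin[OF P_vs P_vs] u]
  show "f (pure P P u w) = g (pure P P u w)"
    by (rule gc_eq[OF P_graded Z lin_hom_comp[OF b f] lin_hom_comp[OF b g] _ w]) (rule e[OF u])
qed

lemma mu_eps: "X \<in> carrier PP \<Longrightarrow> mu X = eps_r (vr X)"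
  by (rule PP_hom_eq[OF P_vs mu(1) lin_hom_comp[OF ver(1) eps_r(1)]])
    (simp_all add: mu(2) ver_hom eps_r(2) laurent_counit(2) vs_one[OF P_vs])

text \<open>For p' of degree n both sides equal [n; q^2] p p'. So the e^0 coefficient of a form
  depends only on its vertical part.\<close>

lemma Phi_zero_comp: "X \<in> carrier PP \<Longrightarrow> snd (snd (Phi X)) = g_r (vr X)"
proof (rule PP_hom_eq[OF P_vs lin_hom_comp[OF Phi(1) thd_lin] lin_hom_comp[OF ver(1) g_r(1)]])
  fix p p' n assume p: "p \<in> carrier P" "p' \<in> G n"
  obtain x y z where e: "D p' = (x, y, z)" by (metis prod.collapse)
  then have "z = qnum n \<odot>\<^bsub>P\<^esub> p'" using D_zero[OF p(2)] by simp
  then show "snd (snd (Phi (pure P P p p'))) = g_r (vr (pure P P p p'))"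
    using p by (simp add: Phi(2) ver_hom g_r(2) gfun(2) e cplx_algebraD[OF P_algebra])
qed

text \<open>The coaction is multiplicative and trivial on degree 0, so \<open>ver\<close> sees an
  element of M (x) M only through its product.\<close>

lemma ver_hor_gen:
  assumes p: "p \<in> carrier P" and p': "p' \<in> carrier P" and X: "X \<in> tspan P P (G 0) (G 0)"
  shows "vr (rm (lm p X) p') = pure P laurent (p \<otimes>\<^bsub>P\<^esub> mu X) (tpow 0) \<otimes>\<^bsub>PA\<^esub> \<delta> p'"
proof (rule tspan_eq[OF PA_vs lin_hom_comp[OF lin_hom_comp[OF lm(1)[OF p] rm(1)[OF p']] ver(1)]
    lin_hom_comp[OF lin_hom_comp[OF lin_hom_comp[OF mu(1) bilinD(1)[OF P_mult_bilin p]] bilinD(2)[OF pure_bilin[OF P_vs laurent_vs]]]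
      bilinD(2)[OF PA_mult_bilin lin_hom_closed[OF coaction_lin p']]] G0_carrier G0_carrier X])
  interpret PA: ring PA using PA_algebra by (simp add: cplx_algebra_def)
  fix x y assume xy: "x \<in> G 0" "y \<in> G 0"
  then show "vr (rm (lm p (pure P P x y)) p') = pure P laurent (p \<otimes>\<^bsub>P\<^esub> mu (pure P P x y)) (tpow 0) \<otimes>\<^bsub>PA\<^esub> \<delta> p'"
    using p p' by (simp add: lm(2) rm(2) ver(2) mu(2) alg_homD(2)[OF coaction_hom] gcD(5)[OF P_graded xy(2)]
      PA.m_assoc[symmetric] pure_PA lin_hom_closed[OF coaction_lin] pure_mult[OF P_algebra laurent_algebra] P.m_assoc)
qed simp

lemma hor_vertical: "X \<in> Hor \<Longrightarrow> vr X = \<zero>\<^bsub>PA\<^esub> \<and> X \<in> carrier PP"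
proof -
  assume X: "X \<in> Hor"
  interpret PA: ring PA using PA_algebra by (simp add: cplx_algebra_def)
  have 0: "submodule {\<zero>\<^bsub>PA\<^esub>} cfield PA"
    by (rule vs_submoduleI[OF PA_vs]) (auto simp: vs_smult_zero[OF PA_vs])
  have "vr X \<in> {\<zero>\<^bsub>PA\<^esub>}"
  proof (rule lin_hom_span_image[OF PP_vs PA_vs ver(1) 0 hor_gens_carrier _ X[unfolded horizontal_forms_def]])
    fix s assume "s \<in> {pure P P p \<one>\<^bsub>P\<^esub> \<otimes>\<^bsub>PP\<^esub> X \<otimes>\<^bsub>PP\<^esub> pure P P \<one>\<^bsub>P\<^esub> p' | p X p'. p \<in> carrier P \<and> X \<in> univ_forms P (G 0) \<and> p' \<in> carrier P}"
    then obtain p Y p' where s: "s = rm (lm p Y) p'" "p \<in> carrier P" "Y \<in> univ_forms P (G 0)" "p' \<in> carrier P" by blast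
    then have "Y \<in> tspan P P (G 0) (G 0)" "mu Y = \<zero>\<^bsub>P\<^esub>" by (auto simp: univ_forms_def)
    then have "vr s = pure P laurent \<zero>\<^bsub>P\<^esub> (tpow 0) \<otimes>\<^bsub>PA\<^esub> \<delta> p'"
      using ver_hor_gen[OF s(2,4)] s(1,2) by simp
    then show "vr s \<in> {\<zero>\<^bsub>PA\<^esub>}" using s(4) by (simp add: pure_zero(2)[OF P_vs laurent_vs] lin_hom_closed[OF coaction_lin])
  qed
  then show ?thesis using hor_sub(1) X by auto
qed

lemma hor_univ: "X \<in> Hor \<Longrightarrow> X \<in> univ_forms P (carrier P)"
  using hor_vertical[of X] mu_eps[of X] lin_hom_zero[OF PA_vs P_vs eps_r(1)] by (simp add: univ_forms_all)

lemma universal_d_form: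
  assumes m: "m \<in> G 0" shows "pure P P \<one>\<^bsub>P\<^esub> m \<ominus>\<^bsub>PP\<^esub> pure P P m \<one>\<^bsub>P\<^esub> \<in> univ_forms P (G 0)"
proof -
  have "pure P P \<one>\<^bsub>P\<^esub> m \<in> tspan P P (G 0) (G 0)" "pure P P m \<one>\<^bsub>P\<^esub> \<in> tspan P P (G 0) (G 0)"
    using m G_one by (auto intro: tspan_pure[OF P_vs P_vs])
  moreover have "mu (pure P P \<one>\<^bsub>P\<^esub> m \<ominus>\<^bsub>PP\<^esub> pure P P m \<one>\<^bsub>P\<^esub>) = \<zero>\<^bsub>P\<^esub>"
    using m by (simp add: lin_hom_minus[OF PP_vs P_vs mu(1)] pure_PP mu(2) vs_minus_eq_zero[OF P_vs])
  ultimately show ?thesis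
    using vs_submoduleD(5)[OF PP_vs tspan_PP[OF G0_carrier G0_carrier]] by (simp add: univ_forms_def)
qed

text \<open>Modulo horizontal forms, functions on the sphere pass through the tensor sign, because
  the difference is p (1 (x) m - m (x) 1) p'.\<close>

lemma hor_move: "p \<in> carrier P \<Longrightarrow> m \<in> G 0 \<Longrightarrow> p' \<in> carrier P \<Longrightarrow> pure P P p (m \<otimes>\<^bsub>P\<^esub> p') \<ominus>\<^bsub>PP\<^esub> pure P P (p \<otimes>\<^bsub>P\<^esub> m) p' \<in> Hor"
  using hor_base[OF _ universal_d_form, of p m p']
  by (simp add: lin_hom_minus[OF PP_vs PP_vs lm(1)] lin_hom_minus[OF PP_vs PP_vs rm(1)] pure_PP lm rm)

lemma hor_dform:
  assumes w: "w \<in> forms \<Omega> D (carrier P) (G 0)" obtains X where "X \<in> Hor" "Phi X = w"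
proof -
  have "submodule (Phi ` Hor) cfield \<Omega>"
    by (rule lin_hom_image[OF PP_vs Omega_vs Phi(1) hor_submodule])
  moreover have "b \<rhd>\<^bsub>\<Omega>\<^esub> D c \<in> Phi ` Hor" if b: "b \<in> carrier P" and c: "c \<in> G 0" for b c
  proof -
    have cP: "c \<in> carrier P" using c by simp
    \<comment> \<open>Subtracting bc (x) 1 moves b (x) c into the universal calculus; the
      differential form is unchanged because d1 = 0.\<close>
    have h: "pure P P b c \<ominus>\<^bsub>PP\<^esub> pure P P (b \<otimes>\<^bsub>P\<^esub> c) \<one>\<^bsub>P\<^esub> \<in> Hor" using hor_move[OF b c P.one_closed] cP by simp
    have "Phi (pure P P b c \<ominus>\<^bsub>PP\<^esub> pure P P (b \<otimes>\<^bsub>P\<^esub> c) \<one>\<^bsub>P\<^esub>) = b \<rhd>\<^bsub>\<Omega>\<^esub> D c \<ominus>\<^bsub>\<Omega>\<^esub> ((b \<otimes>\<^bsub>P\<^esub> c) \<rhd>\<^bsub>\<Omega>\<^esub> \<zero>\<^bsub>\<Omega>\<^esub>)"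
      using b cP by (simp add: lin_hom_minus[OF PP_vs Omega_vs Phi(1)] pure_PP Phi(2) D_one del: Omega_sel)
    also have "\<dots> = b \<rhd>\<^bsub>\<Omega>\<^esub> D c"
      using b cP lact_closed[OF b D_closed[OF cP]] by (auto simp: P.minus_eq)
    finally show ?thesis by (rule image_eqI[OF sym _]) (rule h)
  qed
  ultimately have "forms \<Omega> D (carrier P) (G 0) \<subseteq> Phi ` Hor"
    unfolding forms_def by (intro span_minimal[OF Omega_vs]) blast+
  then have "w \<in> Phi ` Hor" using w by (rule set_mp)
  then show ?thesis by (rule imageE) (rule that; simp)
qed

section \<open>The translation map and the splitting of the vertical map\<close>

abbreviation "TT n \<equiv> tspan P P (G (- n)) (G n)"

lemma TT_submodule: "submodule (TT n) cfield PP" by (rule tspan_PP[OF G0_carrier G0_carrier])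

lemma TT_carrier: "T \<in> TT n \<Longrightarrow> T \<in> carrier PP" using tspan_carrier_sub[OF G0_carrier G0_carrier] by blast

text \<open>Inserting x (x) y between the two factors shifts their degrees in opposite directions,
  which gives the recursion for the translation map in n.\<close>

definition insert_mid :: "sl2 \<Rightarrow> sl2 \<Rightarrow> _" where
  "insert_mid x y = tmap P P P P (\<lambda>u. u \<otimes>\<^bsub>P\<^esub> x) (\<lambda>w. y \<otimes>\<^bsub>P\<^esub> w)"

lemma insert_mid:
  assumes "x \<in> carrier P" "y \<in> carrier P"
  shows "insert_mid x y \<in> lin_hom PP PP"
    "u \<in> carrier P \<Longrightarrow> w \<in> carrier P \<Longrightarrow> insert_mid x y (pure P P u w) = pure P P (u \<otimes>\<^bsub>P\<^esub> x) (y \<otimes>\<^bsub>P\<^esub> w)"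
  using tmap[OF P_vs P_vs P_vs P_vs bilinD(2)[OF P_mult_bilin assms(1)] bilinD(1)[OF P_mult_bilin assms(2)]]
  unfolding insert_mid_def by auto

lemma insert_mid_TT:
  assumes x: "x \<in> G (- k)" and y: "y \<in> G k" and T: "T \<in> TT n"
  shows "insert_mid x y T \<in> TT (n + k)"
proof (rule tspan_image[OF PP_vs insert_mid(1) TT_submodule G0_carrier G0_carrier T])
  fix u w assume "u \<in> G (- n)" "w \<in> G n"
  then show "insert_mid x y (pure P P u w) \<in> TT (n + k)"
    using x y G_mult'[of u "-n" x "-k" "-(n+k)"] G_mult'[of y k w n "n + k"]
    by (simp add: insert_mid(2) tspan_pure[OF P_vs P_vs])
qed (use x y in auto)

text \<open>If the inserted pairs have products summing to 1, the total product u x y w + u x' y' w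
  collapses to u w, so it stays 1 while the degree changes by k.\<close>

lemma TT_step:
  assumes x: "x \<in> G (- k)" "x' \<in> G (- k)" and y: "y \<in> G k" "y' \<in> G k"
    and one: "x \<otimes>\<^bsub>P\<^esub> y \<oplus>\<^bsub>P\<^esub> x' \<otimes>\<^bsub>P\<^esub> y' = \<one>\<^bsub>P\<^esub>" and T: "T \<in> TT n" "mu T = \<one>\<^bsub>P\<^esub>"
  shows "\<exists>T'. T' \<in> TT (n + k) \<and> mu T' = \<one>\<^bsub>P\<^esub>"
proof -
  note xP = G_carrier[OF x(1)] G_carrier[OF x(2)] and yP = G_carrier[OF y(1)] G_carrier[OF y(2)]
  note I = insert_mid[OF xP(1) yP(1)] and I' = insert_mid[OF xP(2) yP(2)]
  let ?T = "insert_mid x y T \<oplus>\<^bsub>PP\<^esub> insert_mid x' y' T"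
  have eq: "(u \<otimes>\<^bsub>P\<^esub> x) \<otimes>\<^bsub>P\<^esub> (y \<otimes>\<^bsub>P\<^esub> w) \<oplus>\<^bsub>P\<^esub> (u \<otimes>\<^bsub>P\<^esub> x') \<otimes>\<^bsub>P\<^esub> (y' \<otimes>\<^bsub>P\<^esub> w) = u \<otimes>\<^bsub>P\<^esub> w"
    if "u \<in> carrier P" "w \<in> carrier P" for u w
  proof -
    have "(u \<otimes>\<^bsub>P\<^esub> x) \<otimes>\<^bsub>P\<^esub> (y \<otimes>\<^bsub>P\<^esub> w) \<oplus>\<^bsub>P\<^esub> (u \<otimes>\<^bsub>P\<^esub> x') \<otimes>\<^bsub>P\<^esub> (y' \<otimes>\<^bsub>P\<^esub> w) = u \<otimes>\<^bsub>P\<^esub> ((x \<otimes>\<^bsub>P\<^esub> y \<oplus>\<^bsub>P\<^esub> x' \<otimes>\<^bsub>P\<^esub> y') \<otimes>\<^bsub>P\<^esub> w)"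
      using that xP yP by (simp add: P.m_assoc P.l_distr P.r_distr)
    then show ?thesis using that by (simp add: one)
  qed
  have "?T \<in> TT (n + k)"
    by (intro vs_submoduleD(3)[OF PP_vs TT_submodule] insert_mid_TT x y T)
  moreover have "mu ?T = mu T"
    by (rule PP_eq[OF P_vs lin_hom_comp[OF lin_hom_plus[OF PP_vs I(1) I'(1)] mu(1)] mu(1) _ TT_carrier[OF T(1)]])
      (use xP yP in \<open>simp add: I(2) I'(2) mu(2) lin_hom_add[OF mu(1)] pure_PP eq\<close>)
  ultimately show ?thesis using T by auto
qed

text \<open>These are S(a_1) a_2 = 1 and S(d_1) d_2 = 1 written out. Their right factors a, c have
  degree 1 and d, b degree -1, so they provide the steps of the translation map upwards and
  downwards.\<close>

lemma gens_one:
  "gen q Gd \<otimes>\<^bsub>P\<^esub> gen q Ga \<oplus>\<^bsub>P\<^esub> ((- q) \<odot>\<^bsub>P\<^esub> gen q Gb) \<otimes>\<^bsub>P\<^esub> gen q Gc = \<one>\<^bsub>P\<^esub>"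
  "gen q Ga \<otimes>\<^bsub>P\<^esub> gen q Gd \<oplus>\<^bsub>P\<^esub> ((- inverse q) \<odot>\<^bsub>P\<^esub> gen q Gc) \<otimes>\<^bsub>P\<^esub> gen q Gb = \<one>\<^bsub>P\<^esub>"
  unfolding gen_eval
  by ((unfold cls_add rel_nf)?; (unfold cls_add[symmetric])?;
      (rule cls_eqI', rule poly_mapping_eqI)?; use q in \<open>auto simp: lookup_add lookup_single when_def field_simps power2_eq_square\<close>)+

lemma translation_ex: "\<exists>T. T \<in> TT n \<and> mu T = \<one>\<^bsub>P\<^esub>"
proof (induction n rule: int_induct[where k = 0])
  case base
  have "pure P P \<one>\<^bsub>P\<^esub> \<one>\<^bsub>P\<^esub> \<in> TT 0" using G_one by (intro tspan_pure[OF P_vs P_vs]) simp_all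
  then show ?case by (intro exI[of _ "pure P P \<one>\<^bsub>P\<^esub> \<one>\<^bsub>P\<^esub>"]) (simp add: mu(2))
next
  case (step1 i)
  then show ?case using TT_step[OF _ _ _ _ gens_one(1), of 1 _ i] by (auto simp: gen_G G_smult)
next
  case (step2 i)
  then show ?case using TT_step[OF _ _ _ _ gens_one(2), of "-1" _ i] by (auto simp: gen_G G_smult)
qed

text \<open>The value of the translation map at \<open>t\<^sup>n\<close>.\<close>

definition transl :: "int \<Rightarrow> (sl2 \<times> sl2 \<Rightarrow>\<^sub>0 complex) set" where
  "transl n = (SOME T. T \<in> TT n \<and> mu T = \<one>\<^bsub>P\<^esub>)"

lemma transl: "transl n \<in> TT n" "mu (transl n) = \<one>\<^bsub>P\<^esub>" "transl n \<in> carrier PP"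
proof -
  show 1: "transl n \<in> TT n" and "mu (transl n) = \<one>\<^bsub>P\<^esub>"
    using someI_ex[OF translation_ex[of n]] unfolding transl_def by auto
  show "transl n \<in> carrier PP" by (rule TT_carrier[OF 1])
qed

lemma ver_transl: "vr (transl n) = pure P laurent \<one>\<^bsub>P\<^esub> (tpow n)"
proof -
  have "vr (transl n) = pure P laurent (mu (transl n)) (tpow n)"
    by (rule tspan_eq[OF PA_vs ver(1) lin_hom_comp[OF mu(1) bilinD(2)[OF pure_bilin[OF P_vs laurent_vs]]] G0_carrier G0_carrier transl(1)])
      (simp_all add: ver_hom mu(2))
  then show ?thesis by (simp add: transl)
qed

text \<open>If the products x y of the pairs in \<open>transl n\<close> sum to 1, then p (x) p' is
  the sum of the p (x) p' x y. Each p' x has degree 0 and may be moved to the left factor, which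
  yields p p' times the translation element.\<close>

lemma hor_transl:
  assumes p: "p \<in> carrier P" and p': "p' \<in> G n"
  shows "pure P P p p' \<ominus>\<^bsub>PP\<^esub> lm (p \<otimes>\<^bsub>P\<^esub> p') (transl n) \<in> Hor"
proof -
  have p'P: "p' \<in> carrier P" using p' by simp
  note pp = P.m_closed[OF p p'P]
  note f1 = lin_hom_comp[OF lin_hom_comp[OF mu(1) bilinD(1)[OF P_mult_bilin p'P]] bilinD(1)[OF pure_bilin[OF P_vs P_vs] p]]
  have l: "(\<lambda>T. pure P P p (p' \<otimes>\<^bsub>P\<^esub> mu T) \<oplus>\<^bsub>PP\<^esub> (- 1) \<odot>\<^bsub>PP\<^esub> lm (p \<otimes>\<^bsub>P\<^esub> p') T) \<in> lin_hom PP PP"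
    by (rule lin_hom_plus[OF PP_vs f1 lin_hom_comp[OF lm(1)[OF pp] smult_lin[OF PP_vs]]])
  have "pure P P p (p' \<otimes>\<^bsub>P\<^esub> mu (transl n)) \<oplus>\<^bsub>PP\<^esub> (- 1) \<odot>\<^bsub>PP\<^esub> lm (p \<otimes>\<^bsub>P\<^esub> p') (transl n) \<in> Hor"
  proof (rule tspan_image[OF PP_vs l hor_submodule G0_carrier G0_carrier transl(1)])
    fix x y assume x: "x \<in> G (- n)" and y: "y \<in> G n"
    have m: "p' \<otimes>\<^bsub>P\<^esub> x \<in> G 0" using G_mult'[OF p' x] by simp
    have "pure P P p ((p' \<otimes>\<^bsub>P\<^esub> x) \<otimes>\<^bsub>P\<^esub> y) \<ominus>\<^bsub>PP\<^esub> pure P P (p \<otimes>\<^bsub>P\<^esub> (p' \<otimes>\<^bsub>P\<^esub> x)) y \<in> Hor"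
      by (rule hor_move[OF p m G_carrier[OF y]])
    then show "pure P P p (p' \<otimes>\<^bsub>P\<^esub> mu (pure P P x y)) \<oplus>\<^bsub>PP\<^esub> (- 1) \<odot>\<^bsub>PP\<^esub> lm (p \<otimes>\<^bsub>P\<^esub> p') (pure P P x y) \<in> Hor"
      using x y p p'P by (simp add: mu(2) lm(2) P.m_assoc vs_minus[OF PP_vs] pure_PP)
  qed
  then show ?thesis using p p'P transl(3) by (simp add: transl(2) vs_minus[OF PP_vs] pure_PP lm(3))
qed

lemma lm_bilin: "bilin P PP PP (\<lambda>p X. lm p X)"
  by (rule bilin_pre[OF PP_mult_bilin bilinD(2)[OF pure_bilin[OF P_vs P_vs]] lin_hom_id(2)]) simp

definition section_map where
  "section_map = tlift P laurent PP (\<lambda>p f. lm p (lext PP transl f))"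

lemma section_map: "section_map \<in> lin_hom PA PP" "p \<in> carrier P \<Longrightarrow> section_map (pure P laurent p (tpow n)) = lm p (transl n)"
proof -
  have l: "lext PP transl \<in> lin_hom laurent PP"
    using lext_lin[OF PP_vs, of integer_group transl] transl(3) by (simp add: lin_hom_laurent_alg[symmetric] laurent_alg_def)
  have s: "lext PP transl (tpow n) = transl n" for n
    unfolding tpow_def using lext_sgl[OF PP_vs, of n integer_group transl 1] transl(3) by (simp add: vs_one[OF PP_vs])
  have b: "bilin P laurent PP (\<lambda>p f. lm p (lext PP transl f))"
    using bilin_pre[OF lm_bilin lin_hom_id(2) l] by simp
  from tlift[OF P_vs laurent_vs PP_vs b] show "section_map \<in> lin_hom PA PP"
    "p \<in> carrier P \<Longrightarrow> section_map (pure P laurent p (tpow n)) = lm p (transl n)"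
    unfolding section_map_def using s by auto
qed

lemma section_closed: "Y \<in> carrier PA \<Longrightarrow> section_map Y \<in> carrier PP" by (rule lin_hom_closed[OF section_map(1)])

lemma PA_hom_eq:
  assumes Z: "vs Z" and f: "f \<in> lin_hom PA Z" and g: "g \<in> lin_hom PA Z"
    and e: "\<And>p n. p \<in> carrier P \<Longrightarrow> f (pure P laurent p (tpow n)) = g (pure P laurent p (tpow n))" and X: "X \<in> carrier PA"
  shows "f X = g X"
proof (rule PA_eq[OF Z f g _ X])
  fix p h assume p: "p \<in> carrier P"
  note b = bilinD(1)[OF pure_bilin[OF P_vs laurent_vs] p]
  show "f (pure P laurent p h) = g (pure P laurent p h)"
    by (rule laurent_hom_eq[OF Z lin_hom_comp[OF b f] lin_hom_comp[OF b g]]) (rule e[OF p])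
qed

lemma ver_section: "Y \<in> carrier PA \<Longrightarrow> vr (section_map Y) = Y"
  by (rule PA_hom_eq[OF PA_vs lin_hom_comp[OF section_map(1) ver(1)] lin_hom_id(2)])
    (simp_all add: section_map(2) ver_lm transl(3) ver_transl pure_mult[OF P_algebra laurent_algebra])

lemma section_ver: "X \<in> carrier PP \<Longrightarrow> X \<ominus>\<^bsub>PP\<^esub> section_map (vr X) \<in> Hor"
proof -
  assume X: "X \<in> carrier PP"
  have l: "(\<lambda>X. X \<oplus>\<^bsub>PP\<^esub> (- 1) \<odot>\<^bsub>PP\<^esub> section_map (vr X)) \<in> lin_hom PP PP"
    by (rule lin_hom_plus[OF PP_vs lin_hom_id(2) lin_hom_comp[OF lin_hom_comp[OF ver(1) section_map(1)] smult_lin[OF PP_vs]]])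
  have h: "p \<in> carrier P \<Longrightarrow> p' \<in> G n \<Longrightarrow> pure P P p p' \<oplus>\<^bsub>PP\<^esub> (- 1) \<odot>\<^bsub>PP\<^esub> section_map (vr (pure P P p p')) \<in> Hor" for p p' n
    using hor_transl[of p p' n] by (simp add: ver_hom section_map(2) vs_minus[OF PP_vs] pure_PP lm(3) transl(3))
  have S: "submodule {X \<in> carrier PP. X \<oplus>\<^bsub>PP\<^esub> (- 1) \<odot>\<^bsub>PP\<^esub> section_map (vr X) \<in> Hor} cfield PP"
    by (rule lin_hom_vimage[OF PP_vs PP_vs l hor_submodule])
  have "X \<oplus>\<^bsub>PP\<^esub> (- 1) \<odot>\<^bsub>PP\<^esub> section_map (vr X) \<in> Hor"
  proof (rule tensor_induct[OF P_vs P_vs X])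
    fix u w assume u: "u \<in> carrier P" and w: "w \<in> carrier P"
    from P_graded w have "pure P P u w \<in> {X \<in> carrier PP. X \<oplus>\<^bsub>PP\<^esub> (- 1) \<odot>\<^bsub>PP\<^esub> section_map (vr X) \<in> Hor}"
    proof (induction rule: gc_induct)
      case (hom n x)
      then show ?case using h[OF u hom] u by (simp add: pure_PP)
    next
      case (add x y)
      then show ?case using vs_submoduleD(3)[OF PP_vs S add(3,4)] u by (simp add: pure_add_right[OF P_vs P_vs])
    qed
    then show "pure P P u w \<oplus>\<^bsub>PP\<^esub> (- 1) \<odot>\<^bsub>PP\<^esub> section_map (vr (pure P P u w)) \<in> Hor" by simp
  next
    fix X Y assume "X \<in> carrier PP" "Y \<in> carrier PP" "X \<oplus>\<^bsub>PP\<^esub> (- 1) \<odot>\<^bsub>PP\<^esub> section_map (vr X) \<in> Hor" "Y \<oplus>\<^bsub>PP\<^esub> (- 1) \<odot>\<^bsub>PP\<^esub> section_map (vr Y) \<in> Hor"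
    then show "X \<oplus>\<^bsub>PP\<^esub> Y \<oplus>\<^bsub>PP\<^esub> (- 1) \<odot>\<^bsub>PP\<^esub> section_map (vr (X \<oplus>\<^bsub>PP\<^esub> Y)) \<in> Hor"
      using vs_submoduleD(3)[OF PP_vs S, of X Y] by simp
  qed
  then show ?thesis using X by (simp add: vs_minus[OF PP_vs] section_closed ver_closed)
qed

lemma exactness: "Hor = {X \<in> univ_forms P (carrier P). vr X = \<zero>\<^bsub>PA\<^esub>}"
proof (intro equalityI subsetI CollectI conjI)
  fix X assume "X \<in> {X \<in> univ_forms P (carrier P). vr X = \<zero>\<^bsub>PA\<^esub>}"
  then have X: "X \<in> carrier PP" "vr X = \<zero>\<^bsub>PA\<^esub>" by (auto simp: univ_forms_all)
  interpret T: module cfield PP by (rule PP_vs)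
  show "X \<in> Hor" using section_ver[OF X(1)] X lin_hom_zero[OF PA_vs PP_vs section_map(1)]
    by (simp add: vs_minus[OF PP_vs] vs_smult_zero[OF PP_vs])
qed (use hor_univ hor_vertical in auto)

lemma PA_tspan: "I \<subseteq> carrier laurent \<Longrightarrow> submodule (tspan P laurent (carrier P) I) cfield PA"
  by (rule tspan_submodule[OF P_vs laurent_vs subset_refl])

lemma PA_tspan_zero:
  assumes Y: "Y \<in> tspan P laurent (carrier P) I" and Z: "vs Z" "f \<in> lin_hom PA Z"
    and f: "\<And>p h. p \<in> carrier P \<Longrightarrow> h \<in> I \<Longrightarrow> f (pure P laurent p h) = \<zero>\<^bsub>Z\<^esub>"
  shows "f Y = \<zero>\<^bsub>Z\<^esub>"
proof -
  have s: "{pure P laurent x y | x y. x \<in> carrier P \<and> y \<in> I} \<subseteq> carrier PA" using pure_PA by auto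
  have "lin_span PA {pure P laurent x y | x y. x \<in> carrier P \<and> y \<in> I} \<subseteq> {X \<in> carrier PA. f X = \<zero>\<^bsub>Z\<^esub>}"
    by (rule span_minimal[OF PA_vs lin_hom_kernel[OF PA_vs Z]]) (use s f in auto)
  then show ?thesis using Y unfolding tspan_def by auto
qed

lemma counit_lin: "counit laurent \<in> lin_hom laurent cfield" by (rule alg_homD(1)[OF laurent_counit(1)])

lemma counit_simps [simp]:
  "counit laurent (f + g) = counit laurent f + counit laurent g" "counit laurent (pscale r f) = r * counit laurent f"
  "gfun (f + g) = gfun f + gfun g" "gfun (pscale r f) = r * gfun f" "counit laurent 0 = 0" "gfun 0 = 0"
  using lin_hom_add[OF counit_lin] lin_hom_smult[OF counit_lin] lin_hom_add[OF gfun(1)] lin_hom_smult[OF gfun(1)]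
    lin_hom_zero[OF laurent_vs vs_cfield counit_lin] lin_hom_zero[OF laurent_vs vs_cfield gfun(1)] by auto

lemma eps_zero_in_tspan:
  assumes Y: "Y \<in> carrier PA" "eps_r Y = \<zero>\<^bsub>P\<^esub>"
  shows "Y \<in> tspan P laurent (carrier P) (augmentation laurent)"
proof -
  let ?H = "tspan P laurent (carrier P) (augmentation laurent)"
  have aug: "augmentation laurent \<subseteq> carrier laurent" by auto
  note S = vs_submoduleD[OF PA_vs PA_tspan[OF aug]]
  \<comment> \<open>The map subtracts \<open>eps_r Y\<close> tensored with 1. It sends every tensor
    p (x) f to p (x) (f - counit of f), so its image lies in the target, and it fixes the given
    Y.\<close>
  have l: "(\<lambda>Y. Y \<oplus>\<^bsub>PA\<^esub> pure P laurent (eps_r Y) (pscale (-1) (tpow 0))) \<in> lin_hom PA PA"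
    by (rule lin_hom_plus[OF PA_vs lin_hom_id(2) lin_hom_comp[OF eps_r(1) bilinD(2)[OF pure_bilin[OF P_vs laurent_vs]]]]) simp
  have "Y \<oplus>\<^bsub>PA\<^esub> pure P laurent (eps_r Y) (pscale (-1) (tpow 0)) \<in> ?H"
  proof (rule tensor_induct[OF P_vs laurent_vs Y(1)])
    fix p f assume p: "p \<in> carrier P"
    have "pure P laurent p (f + pscale (- counit laurent f) (tpow 0)) \<in> ?H"
      by (rule tspan_pure[OF P_vs laurent_vs p]) (simp add: augmentation_def laurent_counit(2))
    moreover have "pure P laurent p (f + pscale (- counit laurent f) (tpow 0)) = pure P laurent p f \<oplus>\<^bsub>PA\<^esub> pure P laurent (counit laurent f \<odot>\<^bsub>P\<^esub> p) (pscale (-1) (tpow 0))"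
      using pure_add_right[OF P_vs laurent_vs p, of "pscale (- counit laurent f) (tpow 0)" f]
        pure_smult_right[OF P_vs laurent_vs p, of "tpow 0"] pure_smult_left[OF P_vs laurent_vs p, of "pscale (-1) (tpow 0)" "counit laurent f"]
      by (simp add: vs_smult_smult[OF PA_vs] pure_PA p)
    ultimately show "pure P laurent p f \<oplus>\<^bsub>PA\<^esub> pure P laurent (eps_r (pure P laurent p f)) (pscale (-1) (tpow 0)) \<in> ?H"
      using p by (simp add: eps_r(2))
  next
    fix X Y assume X: "X \<in> carrier PA" "Y \<in> carrier PA" "X \<oplus>\<^bsub>PA\<^esub> pure P laurent (eps_r X) (pscale (-1) (tpow 0)) \<in> ?H" "Y \<oplus>\<^bsub>PA\<^esub> pure P laurent (eps_r Y) (pscale (-1) (tpow 0)) \<in> ?H"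
    show "X \<oplus>\<^bsub>PA\<^esub> Y \<oplus>\<^bsub>PA\<^esub> pure P laurent (eps_r (X \<oplus>\<^bsub>PA\<^esub> Y)) (pscale (-1) (tpow 0)) \<in> ?H"
      using S(3)[OF X(3,4)] lin_hom_add[OF l X(1,2)] by simp
  qed
  moreover have "Y \<oplus>\<^bsub>PA\<^esub> pure P laurent (eps_r Y) (pscale (-1) (tpow 0)) = Y"
  proof -
    interpret T: module cfield PA by (rule PA_vs)
    show ?thesis using Y by (simp add: pure_zero(2)[OF P_vs laurent_vs])
  qed
  ultimately show ?thesis by simp
qed

lemma ver_univ: "vr ` univ_forms P (carrier P) = tspan P laurent (carrier P) (augmentation laurent)"
proof (intro equalityI subsetI)
  fix Y assume "Y \<in> vr ` univ_forms P (carrier P)"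
  then obtain X where "X \<in> carrier PP" "mu X = \<zero>\<^bsub>P\<^esub>" "Y = vr X" by (auto simp: univ_forms_all)
  then show "Y \<in> tspan P laurent (carrier P) (augmentation laurent)" using mu_eps by (intro eps_zero_in_tspan) (auto simp: ver_closed)
next
  fix Y assume Y: "Y \<in> tspan P laurent (carrier P) (augmentation laurent)"
  have YP: "Y \<in> carrier PA" using vs_submoduleD(1)[OF PA_vs PA_tspan[of "augmentation laurent"]] Y by auto
  have "eps_r Y = \<zero>\<^bsub>P\<^esub>"
    by (rule PA_tspan_zero[OF Y P_vs eps_r(1)]) (simp add: eps_r(2) augmentation_def vs_zero_smult[OF P_vs])
  then have "section_map Y \<in> univ_forms P (carrier P)" using mu_eps[OF section_closed[OF YP]] by (simp add: univ_forms_all section_closed[OF YP] ver_section[OF YP])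
  then show "Y \<in> vr ` univ_forms P (carrier P)" using ver_section[OF YP] by (metis image_eqI)
qed

subsection \<open>The calculus on the fibre\<close>

lemma pscale_commute: "pscale r (pscale s f) = pscale s (pscale r f)"
  by (rule poly_mapping_eqI) simp

lemma laurent_comm: "f \<otimes>\<^bsub>laurent_alg\<^esub> h = h \<otimes>\<^bsub>laurent_alg\<^esub> f"
proof (induction f rule: laurent_induct)
  case (tpow n c)
  show ?case by (induction h rule: laurent_induct) (simp_all add: add.commute pscale_add pscale_commute)
qed simp_all

lemma counit_mult: "counit laurent (f \<otimes>\<^bsub>laurent_alg\<^esub> h) = counit laurent f * counit laurent h"
  using alg_homD(2)[OF laurent_counit(1), of f h] by simp

text \<open>The functional is a twisted derivation over the counit, so the common kernel of the two
  is an ideal although its own kernel alone need not be one.\<close>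

lemma gfun_mult_tpow: "gfun (f \<otimes>\<^bsub>laurent_alg\<^esub> tpow n) = gfun f * (q\<^sup>2) powi n + counit laurent f * qnum n"
  by (induction f rule: laurent_induct) (simp_all add: gfun(2) laurent_counit(2) qnum_add algebra_simps)

definition "fibre_kernel = {f. counit laurent f = 0 \<and> gfun f = 0}"

lemma fibre_kernel_mult: "f \<in> fibre_kernel \<Longrightarrow> f \<otimes>\<^bsub>laurent_alg\<^esub> h \<in> fibre_kernel"
  by (induction h rule: laurent_induct) (simp_all add: fibre_kernel_def counit_mult gfun_mult_tpow)

lemma fibre_kernel_submodule: "submodule fibre_kernel cfield laurent"
  by (rule vs_submoduleI[OF laurent_vs]) (auto simp: fibre_kernel_def)

lemma laurent_ring: "ring laurent" using laurent_algebra by (simp add: cplx_algebra_def)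

lemma fibre_kernel_ideal: "ideal fibre_kernel laurent"
proof (rule idealI[OF laurent_ring])
  show "subgroup fibre_kernel (add_monoid laurent)" by (rule submodule.axioms(1)[OF fibre_kernel_submodule])
qed (use fibre_kernel_mult laurent_comm in auto)

abbreviation "IA \<equiv> laurent_ideal q"
abbreviation "ia_gen \<equiv> tpow 2 + (pscale (- (1 + q\<^sup>2)) (tpow 1) + pscale (q\<^sup>2) (tpow 0))"

lemma IA_eq_gen: "IA = genideal laurent {ia_gen}"
proof -
  have "(tpow 1 \<ominus>\<^bsub>laurent\<^esub> \<one>\<^bsub>laurent\<^esub>) \<otimes>\<^bsub>laurent\<^esub> (tpow 1 \<ominus>\<^bsub>laurent\<^esub> q\<^sup>2 \<odot>\<^bsub>laurent\<^esub> \<one>\<^bsub>laurent\<^esub>) = ia_gen"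
    by (simp add: vs_minus[OF laurent_vs]) (rule poly_mapping_eqI, simp add: lookup_add algebra_simps)
  then show ?thesis by (simp only: laurent_ideal_def)
qed

lemma IA_ideal: "ideal IA laurent"
  unfolding IA_eq_gen by (rule ring.genideal_ideal[OF laurent_ring]) simp

lemma IA_gen: "ia_gen \<in> IA"
  unfolding IA_eq_gen using ring.genideal_self[OF laurent_ring, of "{ia_gen}"] by simp

lemmas IA_submodule = ideal_submodule[OF laurent_algebra IA_ideal]
lemmas IA_sub = vs_submoduleD[OF laurent_vs IA_submodule, simplified]

lemma IA_mult: "f \<in> IA \<Longrightarrow> tpow n \<otimes>\<^bsub>laurent_alg\<^esub> f \<in> IA"
  using ideal.I_l_closed[OF IA_ideal, of f "tpow n"] by simp

text \<open>The difference between f and the combination of 1 and t - 1 with the same values under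
  \<open>counit\<close> and \<open>gfun\<close>; these functionals take the values 1, 0 on the unit
  and 0, 1 on t - 1. That the difference lies in the ideal says that 1 and t - 1 span the
  quotient.\<close>

definition fibre_rest :: "(int \<Rightarrow>\<^sub>0 complex) \<Rightarrow> (int \<Rightarrow>\<^sub>0 complex)" where
  "fibre_rest f = f + (pscale (- counit laurent f) (tpow 0) + pscale (- gfun f) (tpow 1 + pscale (- 1) (tpow 0)))"

lemma fibre_rest_tpow: "fibre_rest (tpow n) \<in> IA"
proof (induction n rule: int_induct[where k = 0])
  case base
  have "fibre_rest (tpow 0) = 0" by (rule poly_mapping_eqI) (simp add: fibre_rest_def laurent_counit(2) gfun(2) lookup_add)
  then show ?case using IA_sub(2) by simp
next
  case (step1 n)
  have "qnum (n + 1) = qnum n * q\<^sup>2 + 1" "qnum (1 + n) = qnum n * q\<^sup>2 + 1"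
    using qnum_add[of n 1] by (simp_all add: add.commute)
  \<comment> \<open>Modulo the generator (t - 1)(t - q^2), multiplication by t acts on t - 1 as q^2;
    the correction is [n; q^2] times the generator.\<close>
  then have "fibre_rest (tpow (n + 1)) = tpow 1 \<otimes>\<^bsub>laurent_alg\<^esub> fibre_rest (tpow n) + pscale (qnum n) ia_gen"
    by (intro poly_mapping_eqI) (simp add: fibre_rest_def laurent_counit(2) gfun(2) lookup_add algebra_simps)
  then show ?case using IA_sub(3)[OF IA_mult[OF step1(2), of 1] IA_sub(4)[OF IA_gen, of "qnum n"]] by simp
next
  case (step2 n)
  have "qnum n = qnum (n - 1) * q\<^sup>2 + 1" using qnum_add[of "n - 1" 1] by simp
  then have "fibre_rest (tpow (n - 1)) = tpow (-1) \<otimes>\<^bsub>laurent_alg\<^esub> fibre_rest (tpow n) + pscale (- qnum (n - 1)) (tpow (-1) \<otimes>\<^bsub>laurent_alg\<^esub> ia_gen)"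
    by (intro poly_mapping_eqI) (simp add: fibre_rest_def laurent_counit(2) gfun(2) lookup_add algebra_simps)
  then show ?case using IA_sub(3)[OF IA_mult[OF step2(2), of "-1"] IA_sub(4)[OF IA_mult[OF IA_gen, of "-1"], of "- qnum (n - 1)"]] by simp
qed

lemma fibre_rest_IA: "fibre_rest f \<in> IA"
proof (induction f rule: laurent_induct)
  case zero
  have "fibre_rest 0 = 0" by (rule poly_mapping_eqI) (simp add: fibre_rest_def lookup_add)
  then show ?case using IA_sub(2) by simp
next
  case (tpow n c)
  have "fibre_rest (pscale c (tpow n)) = pscale c (fibre_rest (tpow n))"
    by (rule poly_mapping_eqI) (simp add: fibre_rest_def lookup_add algebra_simps)
  then show ?case using IA_sub(4)[OF fibre_rest_tpow] by simp
next
  case (add f h)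
  have "fibre_rest (f + h) = fibre_rest f + fibre_rest h"
    by (rule poly_mapping_eqI) (simp add: fibre_rest_def lookup_add algebra_simps)
  then show ?case using IA_sub(3)[OF add] by simp
qed

lemma IA_eq: "IA = fibre_kernel"
proof
  have "qnum 2 = q\<^sup>2 + 1" using qnum_add[of 1 1] by simp
  then have "ia_gen \<in> fibre_kernel" by (simp add: fibre_kernel_def laurent_counit(2) gfun(2))
  then show "IA \<subseteq> fibre_kernel" unfolding IA_eq_gen by (intro ring.genideal_minimal[OF laurent_ring fibre_kernel_ideal]) simp
  have "f \<in> IA" if "f \<in> fibre_kernel" for f
  proof -
    have "fibre_rest f = f" using that by (intro poly_mapping_eqI) (simp add: fibre_rest_def fibre_kernel_def lookup_add)
    then show ?thesis using fibre_rest_IA[of f] by simp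
  qed
  then show "fibre_kernel \<subseteq> IA" by blast
qed

text \<open>As in \<open>eps_zero_in_tspan\<close>: the identity of P tensored with
  \<open>fibre_rest\<close> maps into the target and fixes Y when both of its projections
  vanish.\<close>

lemma eps_g_zero_in_tspan:
  assumes Y: "Y \<in> carrier PA" "eps_r Y = \<zero>\<^bsub>P\<^esub>" "g_r Y = \<zero>\<^bsub>P\<^esub>"
  shows "Y \<in> tspan P laurent (carrier P) IA"
proof -
  let ?H = "tspan P laurent (carrier P) IA"
  let ?u = "pscale (-1) (tpow 0)" and ?v = "pscale (-1) (tpow 1 + pscale (- 1) (tpow 0))"
  let ?r = "\<lambda>Y. Y \<oplus>\<^bsub>PA\<^esub> (pure P laurent (eps_r Y) ?u \<oplus>\<^bsub>PA\<^esub> pure P laurent (g_r Y) ?v)"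
  note S = vs_submoduleD[OF PA_vs PA_tspan[of IA]]
  have l: "?r \<in> lin_hom PA PA"
    by (intro lin_hom_plus[OF PA_vs lin_hom_id(2)] lin_hom_plus[OF PA_vs lin_hom_comp[OF eps_r(1) bilinD(2)[OF pure_bilin[OF P_vs laurent_vs]]]
       lin_hom_comp[OF g_r(1) bilinD(2)[OF pure_bilin[OF P_vs laurent_vs]]]]) simp_all
  have "?r Y \<in> ?H"
  proof (rule tensor_induct[OF P_vs laurent_vs Y(1)])
    fix p f assume p: "p \<in> carrier P"
    have s: "pure P laurent p (pscale (- r) h) = pure P laurent (r \<odot>\<^bsub>P\<^esub> p) (pscale (- 1) h)" for r h
      using pure_smult_right[OF P_vs laurent_vs p, of h] pure_smult_left[OF P_vs laurent_vs p, of "pscale (- 1) h" r]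
      by (simp add: vs_smult_smult[OF PA_vs] pure_PA p)
    have "pure P laurent p (fibre_rest f) \<in> ?H"
      by (rule tspan_pure[OF P_vs laurent_vs p fibre_rest_IA])
    moreover have "pure P laurent p (fibre_rest f) = pure P laurent p f \<oplus>\<^bsub>PA\<^esub> (pure P laurent (counit laurent f \<odot>\<^bsub>P\<^esub> p) ?u \<oplus>\<^bsub>PA\<^esub> pure P laurent (gfun f \<odot>\<^bsub>P\<^esub> p) ?v)"
      using pure_add_right[OF P_vs laurent_vs p] unfolding fibre_rest_def by (simp add: s del: pscale_add)
    ultimately show "?r (pure P laurent p f) \<in> ?H"
      using p by (simp add: eps_r(2) g_r(2))
  next
    fix X Y assume X: "X \<in> carrier PA" "Y \<in> carrier PA" "?r X \<in> ?H" "?r Y \<in> ?H"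
    show "?r (X \<oplus>\<^bsub>PA\<^esub> Y) \<in> ?H" using S(3)[OF _ X(3,4)] lin_hom_add[OF l X(1,2)] by simp
  qed
  moreover have "?r Y = Y"
  proof -
    interpret T: module cfield PA by (rule PA_vs)
    show ?thesis using Y by (simp add: pure_zero(2)[OF P_vs laurent_vs])
  qed
  ultimately show ?thesis by simp
qed

abbreviation "NP \<equiv> calculus_kernel P \<Omega> D (carrier P)"

lemma NP_eq: "NP = {X \<in> carrier PP. mu X = \<zero>\<^bsub>P\<^esub> \<and> Phi X = \<zero>\<^bsub>\<Omega>\<^esub>}"
  by (auto simp: calculus_kernel_def univ_forms_all)

lemma ver_NP: "vr ` NP = tspan P laurent (carrier P) IA"
proof (intro equalityI subsetI)
  fix Y assume "Y \<in> vr ` NP"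
  then obtain X where X: "X \<in> carrier PP" "mu X = \<zero>\<^bsub>P\<^esub>" "Phi X = \<zero>\<^bsub>\<Omega>\<^esub>" "Y = vr X" by (auto simp: NP_eq)
  then show "Y \<in> tspan P laurent (carrier P) IA"
    using mu_eps[OF X(1)] Phi_zero_comp[OF X(1)] by (intro eps_g_zero_in_tspan) (auto simp: ver_closed)
next
  fix Y assume Y: "Y \<in> tspan P laurent (carrier P) IA"
  have YP: "Y \<in> carrier PA" using vs_submoduleD(1)[OF PA_vs PA_tspan[of IA]] Y by auto
  have e: "eps_r Y = \<zero>\<^bsub>P\<^esub>"
    by (rule PA_tspan_zero[OF Y P_vs eps_r(1)]) (simp add: eps_r(2) IA_eq fibre_kernel_def vs_zero_smult[OF P_vs])
  have g: "g_r Y = \<zero>\<^bsub>P\<^esub>"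
    by (rule PA_tspan_zero[OF Y P_vs g_r(1)]) (simp add: g_r(2) IA_eq fibre_kernel_def vs_zero_smult[OF P_vs])
  let ?X = "section_map Y"
  have XP: "?X \<in> carrier PP" by (rule section_closed[OF YP])
  obtain x y z where xyz: "Phi ?X = (x, y, z)" by (metis prod.collapse)
  have c: "x \<in> carrier P" "y \<in> carrier P" using Phi_closed[OF XP] xyz by auto
  have z: "z = \<zero>\<^bsub>P\<^esub>" using Phi_zero_comp[OF XP] xyz ver_section[OF YP] g by simp
  obtain Z where Z: "Z \<in> Hor" "Phi Z = (x, y, \<zero>\<^bsub>P\<^esub>)" using hor_dform[OF forms_P_M[OF c]] by blast
  have ZP: "Z \<in> carrier PP" and vZ: "vr Z = \<zero>\<^bsub>PA\<^esub>" and mZ: "mu Z = \<zero>\<^bsub>P\<^esub>"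
    using hor_vertical[OF Z(1)] hor_univ[OF Z(1)] by (auto simp: univ_forms_all)
  have mX: "mu ?X = \<zero>\<^bsub>P\<^esub>" using mu_eps[OF XP] ver_section[OF YP] e by simp
  have "?X \<ominus>\<^bsub>PP\<^esub> Z \<in> NP"
    using XP ZP mX mZ xyz z Z(2) vs_minus_eq_zero[OF P_vs, of "\<zero>\<^bsub>P\<^esub>" "\<zero>\<^bsub>P\<^esub>"] vs_minus_eq_zero[OF Omega_vs, of "(x, y, \<zero>\<^bsub>P\<^esub>)" "(x, y, \<zero>\<^bsub>P\<^esub>)"] c
    by (simp add: NP_eq lin_hom_minus[OF PP_vs P_vs mu(1)] lin_hom_minus[OF PP_vs Omega_vs Phi(1)] vs_minus_closed[OF PP_vs] del: Omega_minus)
  moreover have "vr (?X \<ominus>\<^bsub>PP\<^esub> Z) = Y"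
    using XP ZP vZ YP
    by (simp add: lin_hom_minus[OF PP_vs PA_vs ver(1)] ver_section) (simp add: vs_minus[OF PA_vs] vs_zero_closed[OF PA_vs] vs_smult_zero[OF PA_vs]
      abelian_monoid.r_zero[OF abelian_group.axioms(1)[OF module.axioms(2)[OF PA_vs]]])
  ultimately show "Y \<in> vr ` NP" by (intro image_eqI[OF sym])
qed

subsection \<open>Equivariance of the calculus\<close>

abbreviation "dcoact \<equiv> diag_coaction laurent P P \<delta> \<delta>"
abbreviation "GG n \<equiv> lin_span PP {pure P P u v | u v k. u \<in> G k \<and> v \<in> G (n - k)}"

lemmas PP_graded = gc_diag[OF P_graded P_graded]
lemma GG_gens_carrier: "{pure P P u v | u v k. u \<in> G k \<and> v \<in> G (n - k)} \<subseteq> carrier PP"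
  using pure_PP by auto

lemma mu_GG: "X \<in> GG n \<Longrightarrow> mu X \<in> G n"
proof (rule lin_hom_span_image[OF PP_vs P_vs mu(1) G_submodule GG_gens_carrier])
  fix s assume "s \<in> {pure P P u v | u v k. u \<in> G k \<and> v \<in> G (n - k)}"
  then obtain u v k where s: "s = pure P P u v" "u \<in> G k" "v \<in> G (n - k)" by blast
  then show "mu s \<in> G n" using G_mult'[OF s(2,3), of n] by (simp add: mu(2))
qed

lemma dform_OG: "p \<in> G m \<Longrightarrow> p' \<in> G n \<Longrightarrow> m + n = k \<Longrightarrow> p \<rhd>\<^bsub>\<Omega>\<^esub> D p' \<in> OG k"
proof -
  assume p: "p \<in> G m" "p' \<in> G n" "m + n = k"
  obtain x y z where "D p' = (x, y, z)" "x \<in> G (n - 2)" "y \<in> G (n + 2)" "z \<in> G n" using D_graded[OF p(2)] by auto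
  then show ?thesis
    using p G_mult'[of p m x "n - 2" "k - 2"] G_mult'[of p m y "n + 2" "k + 2"] G_mult'[of p m z n k] by simp
qed

lemma Phi_GG: "X \<in> GG n \<Longrightarrow> Phi X \<in> OG n"
proof (rule lin_hom_span_image[OF PP_vs Omega_vs Phi(1) gcD(2)[OF ocoact_graded] GG_gens_carrier])
  fix s assume "s \<in> {pure P P u v | u v k. u \<in> G k \<and> v \<in> G (n - k)}"
  then obtain u v k where s: "s = pure P P u v" "u \<in> G k" "v \<in> G (n - k)" by blast
  then show "Phi s \<in> OG n" using dform_OG[OF s(2,3), of n] by (simp add: Phi(2) del: Omega_sel)
qed

lemma graded_component_map:
  assumes X: "graded_coaction X GX \<rho>" and Y: "graded_coaction Y GY \<sigma>" and f: "f \<in> lin_hom X Y"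
    and g: "\<And>n x. x \<in> GX n \<Longrightarrow> f x \<in> GY n" and x: "x \<in> carrier X"
  shows "f (tcoef X n (\<rho> x)) = tcoef Y n (\<sigma> (f x))"
proof -
  note vX = gcD(1)[OF X] and vY = gcD(1)[OF Y]
  show ?thesis
  proof (rule gc_eq[OF X vY lin_hom_comp[OF lin_hom_comp[OF gcD(4)[OF X] tcoef(1)[OF vX]] f] lin_hom_comp[OF lin_hom_comp[OF f gcD(4)[OF Y]] tcoef(1)[OF vY]] _ x])
    fix m x assume x: "x \<in> GX m"
    then show "f (tcoef X n (\<rho> x)) = tcoef Y n (\<sigma> (f x))"
      using set_mp[OF gcD(6)[OF X] x] set_mp[OF gcD(6)[OF Y] g[OF x]] lin_hom_zero[OF vX vY f]
      by (simp add: gcD(5)[OF X x] gcD(5)[OF Y g[OF x]] tcoef(3)[OF vX] tcoef(3)[OF vY])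
  qed
qed

text \<open>The multiplication map and p (x) p' -> p dp' preserve degree, so homogeneous components
  of an element of both kernels stay in both kernels.\<close>

lemma NP_equivariant: "dcoact ` NP \<subseteq> tspan PP laurent NP (carrier laurent)"
proof
  fix Y assume "Y \<in> dcoact ` NP"
  then obtain X where X: "X \<in> carrier PP" "mu X = \<zero>\<^bsub>P\<^esub>" "Phi X = \<zero>\<^bsub>\<Omega>\<^esub>" "Y = dcoact X" by (auto simp: NP_eq)
  have YP: "Y \<in> carrier (tensor PP laurent)" using X lin_hom_closed[OF gcD(4)[OF PP_graded]] by simp
  show "Y \<in> tspan PP laurent NP (carrier laurent)"
  proof (rule tensor_laurent_in_tspan[OF PP_vs calculus_kernel_submodule[OF subset_refl] YP])
    fix n
    have "mu (tcoef PP n (dcoact X)) = \<zero>\<^bsub>P\<^esub>"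
      using graded_component_map[OF PP_graded P_graded mu(1) mu_GG X(1)] lin_hom_zero[OF P_vs P_vs lin_hom_comp[OF coaction_lin tcoef(1)[OF P_vs]]]
      by (simp add: X)
    moreover have "Phi (tcoef PP n (dcoact X)) = \<zero>\<^bsub>\<Omega>\<^esub>"
      using graded_component_map[OF PP_graded ocoact_graded Phi(1) Phi_GG X(1)] lin_hom_zero[OF Omega_vs Omega_vs lin_hom_comp[OF ocoact_lin tcoef(1)[OF Omega_vs]]]
      by (simp add: X del: Omega_sel)
    ultimately show "tcoef PP n Y \<in> NP"
      using lin_hom_closed[OF tcoef(1)[OF PP_vs] YP] by (simp add: NP_eq X(4))
  qed
qed

lemma coinvariants_P: "coinvariants laurent P \<delta> = G 0" by (rule gc_coinvariants[OF P_graded])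

theorem principal_bundle: "quantum_principal_bundle laurent P \<delta> NP (calculus_kernel P \<Omega> D (G 0)) IA"
  unfolding quantum_principal_bundle_def Let_def coinvariants_P
proof (intro conjI)
  show "comodule_algebra laurent P \<delta>"
    unfolding comodule_algebra_def using P_algebra gc_right_comodule[OF P_graded] coaction_hom by blast
  show "sub_bimodule P (carrier P) NP" by (rule calculus_sub_bimodule) auto
  show "sub_bimodule P (G 0) (calculus_kernel P \<Omega> D (G 0))" by (rule calculus_sub_bimodule[OF G0_carrier]) (rule G_mult'[where m = 0 and n = 0]; simp)
  show "right_ideal IA laurent"
    unfolding right_ideal_def using ideal.axioms(1)[OF IA_ideal] ideal.I_r_closed[OF IA_ideal] by blast
  show "IA \<subseteq> augmentation laurent" unfolding IA_eq by (auto simp: fibre_kernel_def augmentation_def)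
  show "Hor = {X \<in> univ_forms P (carrier P). vr X = \<zero>\<^bsub>PA\<^esub>}" by (rule exactness)
  show "vr ` univ_forms P (carrier P) = tspan P laurent (carrier P) (augmentation laurent)" by (rule ver_univ)
  show "dcoact ` NP \<subseteq> tspan PP laurent NP (carrier laurent)" by (rule NP_equivariant)
  show "vr ` NP = tspan P laurent (carrier P) IA" by (rule ver_NP)
  have "tspan P P (G 0) (G 0) \<subseteq> tspan P P (carrier P) (carrier P)"
    using tspan_carrier_sub[OF G0_carrier G0_carrier] by (simp add: tspan_carrier[OF P_vs P_vs])
  then show "calculus_kernel P \<Omega> D (G 0) = NP \<inter> univ_forms P (G 0)"
    by (auto simp: calculus_kernel_def univ_forms_def)
qed (rule laurent_hopf)

subsection \<open>The Maurer--Cartan form\<close>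

abbreviation "S \<equiv> antipode P"
abbreviation "eps \<equiv> counit P"

lemma S_lin: "S \<in> lin_hom P P"
  using alg_homD(1)[OF antipode(1)] by (simp add: mod_hom_def)

lemma S_mult: "x \<in> carrier P \<Longrightarrow> y \<in> carrier P \<Longrightarrow> S (x \<otimes>\<^bsub>P\<^esub> y) = S y \<otimes>\<^bsub>P\<^esub> S x"
  using alg_homD(2)[OF antipode(1)] by simp

lemma S_one: "S \<one>\<^bsub>P\<^esub> = \<one>\<^bsub>P\<^esub>" using alg_homD(3)[OF antipode(1)] by simp

lemma S_closed [simp]: "x \<in> carrier P \<Longrightarrow> S x \<in> carrier P" by (rule lin_hom_closed[OF S_lin])

text \<open>On a coproduct this gives S(x_1) x_2, and \<open>wS\<close> below gives S(x_1) dx_2.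
  Both are defined on all of P (x) P so that they can be computed on products of coproducts.\<close>

definition mS where "mS = tlift P P P (\<lambda>y z. S y \<otimes>\<^bsub>P\<^esub> z)"
definition wS where "wS = tlift P P \<Omega> (\<lambda>y z. S y \<rhd>\<^bsub>\<Omega>\<^esub> D z)"

lemma mS: "mS \<in> lin_hom PP P" "y \<in> carrier P \<Longrightarrow> z \<in> carrier P \<Longrightarrow> mS (pure P P y z) = S y \<otimes>\<^bsub>P\<^esub> z"
  using tlift[OF P_vs P_vs P_vs bilin_pre[OF P_mult_bilin S_lin lin_hom_id(2)]] by (auto simp: mS_def)

lemma wS: "wS \<in> lin_hom PP \<Omega>" "y \<in> carrier P \<Longrightarrow> z \<in> carrier P \<Longrightarrow> wS (pure P P y z) = S y \<rhd>\<^bsub>\<Omega>\<^esub> D z"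
  using tlift[OF P_vs P_vs Omega_vs bilin_pre[OF lact_bilin S_lin D_lin]] by (auto simp: wS_def simp del: Omega_sel)

lemma PP_pure_right_lin: "g \<in> carrier P \<Longrightarrow> h \<in> carrier P \<Longrightarrow> (\<lambda>T. T \<otimes>\<^bsub>PP\<^esub> pure P P g h) \<in> lin_hom PP PP"
  by (rule bilinD(2)[OF PP_mult_bilin]) (simp add: pure_PP)

lemma mS_mult_pure:
  assumes g: "g \<in> carrier P" and h: "h \<in> carrier P" and T: "T \<in> carrier PP"
  shows "mS (T \<otimes>\<^bsub>PP\<^esub> pure P P g h) = S g \<otimes>\<^bsub>P\<^esub> (mS T \<otimes>\<^bsub>P\<^esub> h)"
  by (rule PP_eq[OF P_vs lin_hom_comp[OF PP_pure_right_lin[OF g h] mS(1)]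
     lin_hom_comp[OF lin_hom_comp[OF mS(1) bilinD(2)[OF P_mult_bilin h]] bilinD(1)[OF P_mult_bilin S_closed[OF g]]] _ T])
   (use g h in \<open>simp add: pure_mult[OF P_algebra P_algebra] mS(2) S_mult P.m_assoc\<close>)

text \<open>Since S reverses products, the letter added last acts from outside: the value depends on
  T only through \<open>mS T\<close> and \<open>wS T\<close>. This makes the Maurer-Cartan form
  computable by appending letters on the right.\<close>

lemma wS_mult_pure:
  assumes g: "g \<in> carrier P" and h: "h \<in> carrier P" and T: "T \<in> carrier PP"
  shows "wS (T \<otimes>\<^bsub>PP\<^esub> pure P P g h) = S g \<rhd>\<^bsub>\<Omega>\<^esub> (wS T \<lhd>\<^bsub>\<Omega>\<^esub> h) \<oplus>\<^bsub>\<Omega>\<^esub> (S g \<otimes>\<^bsub>P\<^esub> mS T) \<rhd>\<^bsub>\<Omega>\<^esub> D h"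
  by (rule PP_eq[OF Omega_vs lin_hom_comp[OF PP_pure_right_lin[OF g h] wS(1)]
     lin_hom_plus[OF Omega_vs lin_hom_comp[OF lin_hom_comp[OF wS(1) ract_lin[OF h]] lact_lin[OF S_closed[OF g]]]
       lin_hom_comp[OF lin_hom_comp[OF mS(1) bilinD(1)[OF P_mult_bilin S_closed[OF g]]] bilinD(2)[OF lact_bilin D_closed[OF h]]]] _ T])
   (use g h in \<open>simp add: pure_mult[OF P_algebra P_algebra] mS(2) wS(2) S_mult D_mult lact_assoc lact_ract D_closed lact_closed ract_closed
      lin_hom_add[OF lact_lin] P.m_assoc del: Omega_sel\<close>)

definition omega where "omega x = wS (comult P x)"

lemma omega_lin: "omega \<in> lin_hom P \<Omega>"
  unfolding omega_def[abs_def] by (rule lin_hom_comp[OF alg_homD(1)[OF comult(1)] wS(1)])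

lemma eps_lin: "eps \<in> lin_hom P cfield" by (rule alg_homD(1)[OF counit(1)])

lemma eps_simps [simp]:
  "x \<in> carrier P \<Longrightarrow> y \<in> carrier P \<Longrightarrow> eps (x \<oplus>\<^bsub>P\<^esub> y) = eps x + eps y"
  "x \<in> carrier P \<Longrightarrow> eps (r \<odot>\<^bsub>P\<^esub> x) = r * eps x" "x \<in> carrier P \<Longrightarrow> y \<in> carrier P \<Longrightarrow> eps (x \<otimes>\<^bsub>P\<^esub> y) = eps x * eps y"
  "eps \<one>\<^bsub>P\<^esub> = 1" "eps \<zero>\<^bsub>P\<^esub> = 0"
  using lin_hom_add[OF eps_lin] lin_hom_smult[OF eps_lin] alg_homD(2,3)[OF counit(1)] lin_hom_zero[OF P_vs vs_cfield eps_lin] by auto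

lemma S_gens:
  "S (gen q Ga) = cls (sgl [Gd] 1)" "S (gen q Gb) = cls (sgl [Gb] (- q))" "S (gen q Gc) = cls (sgl [Gc] (- inverse q))" "S (gen q Gd) = cls (sgl [Ga] 1)"
  unfolding antipode(2) by (simp_all add: word_cls cls_smult)

text \<open>Scalars of P, encoded as classes of the empty word so that the rewriting on
  representatives applies. The counit shows that distinct scalars stay distinct.\<close>

definition const :: "complex \<Rightarrow> sl2" where "const r = cls (sgl [] r)"

lemma const_smult: "const r = r \<odot>\<^bsub>P\<^esub> \<one>\<^bsub>P\<^esub>" by (simp add: const_def cls_one cls_smult)

lemma const_closed [simp]: "const r \<in> carrier P" by (simp add: const_def)

lemma eps_const [simp]: "eps (const r) = r" by (simp add: const_smult)

lemma const_inj [simp]: "const r = const s \<longleftrightarrow> r = s" by (metis eps_const)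

lemma const_0 [simp]: "const 0 = \<zero>\<^bsub>P\<^esub>" by (simp add: const_def cls_zero)

lemma comult_closed: "x \<in> carrier P \<Longrightarrow> comult P x \<in> carrier PP"
  by (rule lin_hom_closed[OF alg_homD(1)[OF comult(1)]])

lemma comult_mult_gen:
  assumes x: "x \<in> carrier P"
  shows "comult P (x \<otimes>\<^bsub>P\<^esub> gen q g) = comult P x \<otimes>\<^bsub>PP\<^esub> comult P (gen q g)"
  using x by (simp add: alg_homD(2)[OF comult(1)])

lemma PP_mult_add: "T \<in> carrier PP \<Longrightarrow> g \<in> carrier P \<Longrightarrow> h \<in> carrier P \<Longrightarrow> g' \<in> carrier P \<Longrightarrow> h' \<in> carrier P \<Longrightarrow>
   T \<otimes>\<^bsub>PP\<^esub> (pure P P g h \<oplus>\<^bsub>PP\<^esub> pure P P g' h') = T \<otimes>\<^bsub>PP\<^esub> pure P P g h \<oplus>\<^bsub>PP\<^esub> T \<otimes>\<^bsub>PP\<^esub> pure P P g' h'"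
  using lin_hom_add[OF bilinD(1)[OF PP_mult_bilin]] by (simp add: pure_PP)

lemma PP_mult_pure_closed: "T \<in> carrier PP \<Longrightarrow> g \<in> carrier P \<Longrightarrow> h \<in> carrier P \<Longrightarrow> T \<otimes>\<^bsub>PP\<^esub> pure P P g h \<in> carrier PP"
  by (rule lin_hom_closed[OF PP_pure_right_lin])

lemma mS_gens:
  assumes T: "T \<in> carrier PP" and m: "mS T = const r"
  shows "mS (T \<otimes>\<^bsub>PP\<^esub> comult P (gen q Ga)) = const r" "mS (T \<otimes>\<^bsub>PP\<^esub> comult P (gen q Gb)) = const 0"
    "mS (T \<otimes>\<^bsub>PP\<^esub> comult P (gen q Gc)) = const 0" "mS (T \<otimes>\<^bsub>PP\<^esub> comult P (gen q Gd)) = const r"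
  unfolding comult_gens PP_mult_add[OF T word_closed word_closed word_closed word_closed] lin_hom_add[OF mS(1) PP_mult_pure_closed[OF T word_closed word_closed] PP_mult_pure_closed[OF T word_closed word_closed]]
    mS_mult_pure[OF word_closed word_closed T] m const_def S_gens
  unfolding word_cls gen_eval
  by ((unfold cls_add rel_nf)?; (unfold cls_add[symmetric])?;
      (rule cls_eqI', rule poly_mapping_eqI)?; use q in \<open>auto simp: lookup_add lookup_single when_def field_simps power2_eq_square\<close>)+

lemma mS_gen:
  assumes T: "T \<in> carrier PP" and m: "mS T = const r"
  shows "mS (T \<otimes>\<^bsub>PP\<^esub> comult P (gen q g)) = const (r * counit_gen g)"
  using mS_gens[OF assms] by (cases g) simp_all

text \<open>The left antipode axiom. For x g it reads S(g_1) S(x_1) x_2 g_2, whose inner part is a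
  scalar by induction, so the axiom for single generators remains.\<close>

lemma mS_comult: "x \<in> carrier P \<Longrightarrow> mS (comult P x) = const (eps x)"
proof -
  assume x: "x \<in> carrier P"
  have l: "(\<lambda>x. const (eps x)) \<in> lin_hom P P"
    by (rule lin_homI) (auto simp: const_smult vs_closed[OF P_vs] vs_add_smult[OF P_vs] vs_smult_smult[OF P_vs])
  show ?thesis
  proof (rule P_hom_eq[OF P_vs lin_hom_comp[OF alg_homD(1)[OF comult(1)] mS(1)] l _ x])
    show "mS (comult P (word q w)) = const (eps (word q w))" for w
    proof (induction w rule: rev_induct)
      case Nil
      show ?case by (simp add: word_Nil alg_homD(3)[OF comult(1)] tensor_one[OF P_algebra P_algebra] mS(2) S_one const_smult vs_one[OF P_vs])
    next
      case (snoc g w)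
      then show ?case
        by (simp add: word_append comult_mult_gen mS_gen[OF comult_closed] counit(2))
    qed
  qed
qed

text \<open>\<open>omega_data x e r s t\<close> records that \<open>\<epsilon>(x) = e\<close> and that the Maurer--Cartan form takes \<open>x\<close> to \<open>r e\<^sup>+ + s e\<^sup>- + t e\<^sup>0\<close>.\<close>
definition omega_data where
  "omega_data x e r s t \<longleftrightarrow> x \<in> carrier P \<and> eps x = e \<and> omega x = (const r, const s, const t)"

lemma omega_data_add: "omega_data x e r s t \<Longrightarrow> omega_data x' e' r' s' t' \<Longrightarrow> omega_data (x \<oplus>\<^bsub>P\<^esub> x') (e + e') (r + r') (s + s') (t + t')"
  by (auto simp: omega_data_def lin_hom_add[OF omega_lin] const_smult vs_add_smult[OF P_vs])

lemma omega_data_smult: "omega_data x e r s t \<Longrightarrow> omega_data (k \<odot>\<^bsub>P\<^esub> x) (k * e) (k * r) (k * s) (k * t)"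
  by (auto simp: omega_data_def lin_hom_smult[OF omega_lin] const_smult vs_smult_smult[OF P_vs] vs_closed[OF P_vs])

lemma omega_data_zero: "omega_data \<zero>\<^bsub>P\<^esub> 0 0 0 0"
  by (simp add: omega_data_def lin_hom_zero[OF P_vs Omega_vs omega_lin])

lemma omega_data_one: "omega_data \<one>\<^bsub>P\<^esub> 1 0 0 0"
proof -
  have "omega \<one>\<^bsub>P\<^esub> = \<one>\<^bsub>P\<^esub> \<rhd>\<^bsub>\<Omega>\<^esub> \<zero>\<^bsub>\<Omega>\<^esub>"
    by (simp add: omega_def alg_homD(3)[OF comult(1)] tensor_one[OF P_algebra P_algebra] wS(2) S_one D_one del: Omega_sel)
  then show ?thesis by (simp add: omega_data_def)
qed

text \<open>For T the coproduct of x this is omega(x g) = S(g_1) omega(x) g_2 + eps(x) omega(g). By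
  the commutation rules the first term multiplies the coefficients of e^+, e^-, e^0 by q, q, q^2 if
  g = a, by the inverses if g = d, and by 0 if g is b or c; so coefficients remain constant.\<close>

lemma omega_gen:
  assumes T: "T \<in> carrier PP" and m: "mS T = const e" and w: "wS T = (const r, const s, const t)"
  shows "wS (T \<otimes>\<^bsub>PP\<^esub> comult P (gen q Ga)) = (const (q * r), const (q * s), const (q\<^sup>2 * t + e))"
    "wS (T \<otimes>\<^bsub>PP\<^esub> comult P (gen q Gb)) = (const 0, const e, const 0)"
    "wS (T \<otimes>\<^bsub>PP\<^esub> comult P (gen q Gc)) = (const (q * e), const 0, const 0)"
    "wS (T \<otimes>\<^bsub>PP\<^esub> comult P (gen q Gd)) = (const (inverse q * r), const (inverse q * s), const (inverse (q\<^sup>2) * (t - e)))"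
  unfolding comult_gens PP_mult_add[OF T word_closed word_closed word_closed word_closed] lin_hom_add[OF wS(1) PP_mult_pure_closed[OF T word_closed word_closed] PP_mult_pure_closed[OF T word_closed word_closed]]
    wS_mult_pure[OF word_closed word_closed T] m w const_def S_gens d_gen_eval
  unfolding word_cls Omega_sel scale_gen_eval gen_deg.simps gen_eval prod.inject
  by (intro conjI; (unfold cls_add rel_nf)?; (unfold cls_add[symmetric])?;
      (rule cls_eqI', rule poly_mapping_eqI)?; use q in \<open>auto simp: lookup_add lookup_single when_def field_simps power2_eq_square\<close>)+

lemma omega_data_gen:
  assumes "omega_data x e r s t"
  shows "omega_data (x \<otimes>\<^bsub>P\<^esub> gen q Ga) e (q * r) (q * s) (q\<^sup>2 * t + e)"
    "omega_data (x \<otimes>\<^bsub>P\<^esub> gen q Gb) 0 0 e 0"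
    "omega_data (x \<otimes>\<^bsub>P\<^esub> gen q Gc) 0 (q * e) 0 0"
    "omega_data (x \<otimes>\<^bsub>P\<^esub> gen q Gd) e (inverse q * r) (inverse q * s) (inverse (q\<^sup>2) * (t - e))"
proof -
  have x: "x \<in> carrier P" "eps x = e" "wS (comult P x) = (const r, const s, const t)" using assms by (auto simp: omega_data_def omega_def)
  have m: "mS (comult P x) = const e" using mS_comult[OF x(1)] x by simp
  note g = omega_gen[OF comult_closed[OF x(1)] m x(3)]
  show "omega_data (x \<otimes>\<^bsub>P\<^esub> gen q Ga) e (q * r) (q * s) (q\<^sup>2 * t + e)"
    "omega_data (x \<otimes>\<^bsub>P\<^esub> gen q Gb) 0 0 e 0"
    "omega_data (x \<otimes>\<^bsub>P\<^esub> gen q Gc) 0 (q * e) 0 0"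
    "omega_data (x \<otimes>\<^bsub>P\<^esub> gen q Gd) e (inverse q * r) (inverse q * s) (inverse (q\<^sup>2) * (t - e))"
    unfolding omega_data_def omega_def comult_mult_gen[OF x(1)] g using x by (simp_all add: counit(2))
qed

lemma omega_data_gens:
  "omega_data (gen q Ga) 1 0 0 1" "omega_data (gen q Gb) 0 0 1 0" "omega_data (gen q Gc) 0 q 0 0" "omega_data (gen q Gd) 1 0 0 (- inverse (q\<^sup>2))"
  using omega_data_gen[OF omega_data_one] by simp_all

lemma omega_data_words:
  "omega_data (b_plus q) 0 1 0 0" "omega_data (b_minus q) 0 0 1 0"
  unfolding b_plus_def b_minus_def using omega_data_gen(4)[OF omega_data_gens(3)] omega_data_gen(2)[OF omega_data_gens(1)] q by simp_all

subsection \<open>The right ideal of the calculus\<close>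

abbreviation "IP \<equiv> sl2_ideal q"
abbreviation "IP_gens \<equiv> {(gen q Ga \<oplus>\<^bsub>P\<^esub> q\<^sup>2 \<odot>\<^bsub>P\<^esub> gen q Gd) \<ominus>\<^bsub>P\<^esub> (1 + q\<^sup>2) \<odot>\<^bsub>P\<^esub> \<one>\<^bsub>P\<^esub>, gen q Gb \<otimes>\<^bsub>P\<^esub> gen q Gb, gen q Gc \<otimes>\<^bsub>P\<^esub> gen q Gc, gen q Gb \<otimes>\<^bsub>P\<^esub> gen q Gc,
         (gen q Ga \<ominus>\<^bsub>P\<^esub> \<one>\<^bsub>P\<^esub>) \<otimes>\<^bsub>P\<^esub> gen q Gb, (gen q Gd \<ominus>\<^bsub>P\<^esub> \<one>\<^bsub>P\<^esub>) \<otimes>\<^bsub>P\<^esub> gen q Gc}"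

lemma IP_eq: "IP = \<Inter>{I. right_ideal I P \<and> IP_gens \<subseteq> I}"
  by (simp add: sl2_ideal_def gen_right_ideal_def Let_def)

definition "omega_kernel = {x. omega_data x 0 0 0 0}"

text \<open>The recursion for appending a letter is linear in the data, so zero data remain zero.
  Hence the common kernel is a right ideal.\<close>

lemma omega_data_mult_zero: "omega_data x 0 0 0 0 \<Longrightarrow> y \<in> carrier P \<Longrightarrow> omega_data (x \<otimes>\<^bsub>P\<^esub> y) 0 0 0 0"
proof -
  assume x: "omega_data x 0 0 0 0" and y: "y \<in> carrier P"
  have xP: "x \<in> carrier P" using x by (simp add: omega_data_def)
  have w: "omega_data (x \<otimes>\<^bsub>P\<^esub> word q w) 0 0 0 0" for w
  proof (induction w rule: rev_induct)
    case Nil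
    then show ?case using x xP by (simp add: word_Nil)
  next
    case (snoc g w)
    have "x \<otimes>\<^bsub>P\<^esub> word q (w @ [g]) = (x \<otimes>\<^bsub>P\<^esub> word q w) \<otimes>\<^bsub>P\<^esub> gen q g" using xP by (simp add: word_append P.m_assoc)
    then show ?case using omega_data_gen[OF snoc] by (cases g) simp_all
  qed
  have "submodule {y \<in> carrier P. omega_data (x \<otimes>\<^bsub>P\<^esub> y) 0 0 0 0} cfield P"
    using omega_data_add[of _ 0 0 0 0 _ 0 0 0 0] omega_data_smult[of _ 0 0 0 0] omega_data_zero xP
    by (intro vs_submoduleI[OF P_vs]) (auto simp: vs_closed[OF P_vs] P.r_distr cplx_algebraD[OF P_algebra])
  from P_submodule_all[OF this] w y show ?thesis by auto
qed

lemma kernel_right_ideal: "right_ideal omega_kernel P"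
proof -
  have "submodule omega_kernel cfield P"
    using omega_data_add[of _ 0 0 0 0 _ 0 0 0 0] omega_data_smult[of _ 0 0 0 0] omega_data_zero
    by (intro vs_submoduleI[OF P_vs]) (auto simp: omega_kernel_def, auto simp: omega_data_def)
  from submodule.axioms(1)[OF this] show ?thesis
    unfolding right_ideal_def using omega_data_mult_zero by (auto intro!: additive_subgroup.intro simp: omega_kernel_def)
qed

lemma IP_gens_kernel: "IP_gens \<subseteq> omega_kernel"
proof (intro insert_subsetI empty_subsetI)
  note m = vs_minus[OF P_vs] P.l_distr cplx_algebraD[OF P_algebra] vs_closed[OF P_vs] vs_smult_smult[OF P_vs]
  note g = omega_data_gens and o = omega_data_one
  have "omega_data ((gen q Ga \<oplus>\<^bsub>P\<^esub> q\<^sup>2 \<odot>\<^bsub>P\<^esub> gen q Gd) \<oplus>\<^bsub>P\<^esub> (- (1 + q\<^sup>2)) \<odot>\<^bsub>P\<^esub> \<one>\<^bsub>P\<^esub>) 0 0 0 0"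
    using omega_data_add[OF omega_data_add[OF g(1) omega_data_smult[OF g(4), of "q\<^sup>2"]] omega_data_smult[OF o, of "- (1 + q\<^sup>2)"]] q by simp
  then show "(gen q Ga \<oplus>\<^bsub>P\<^esub> q\<^sup>2 \<odot>\<^bsub>P\<^esub> gen q Gd) \<ominus>\<^bsub>P\<^esub> (1 + q\<^sup>2) \<odot>\<^bsub>P\<^esub> \<one>\<^bsub>P\<^esub> \<in> omega_kernel"
    by (simp add: omega_kernel_def m)
  show "gen q Gb \<otimes>\<^bsub>P\<^esub> gen q Gb \<in> omega_kernel" "gen q Gc \<otimes>\<^bsub>P\<^esub> gen q Gc \<in> omega_kernel" "gen q Gb \<otimes>\<^bsub>P\<^esub> gen q Gc \<in> omega_kernel"
    using omega_data_gen[OF g(2)] omega_data_gen[OF g(3)] by (simp_all add: omega_kernel_def)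
  show "(gen q Ga \<ominus>\<^bsub>P\<^esub> \<one>\<^bsub>P\<^esub>) \<otimes>\<^bsub>P\<^esub> gen q Gb \<in> omega_kernel"
    using omega_data_add[OF omega_data_gen(2)[OF g(1)] omega_data_smult[OF g(2), of "-1"]] by (simp add: omega_kernel_def m)
  show "(gen q Gd \<ominus>\<^bsub>P\<^esub> \<one>\<^bsub>P\<^esub>) \<otimes>\<^bsub>P\<^esub> gen q Gc \<in> omega_kernel"
    using omega_data_add[OF omega_data_gen(3)[OF g(4)] omega_data_smult[OF g(3), of "-1"]] by (simp add: omega_kernel_def m)
qed

lemma right_ideal_IP: "right_ideal IP P"
proof -
  have sub: "subgroup I (add_monoid P)" if "right_ideal I P" for I using that by (auto simp: right_ideal_def additive_subgroup_def)
  have ker: "omega_kernel \<in> {I. right_ideal I P \<and> IP_gens \<subseteq> I}" using kernel_right_ideal IP_gens_kernel by blast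
  have "subgroup (\<Inter>{I. right_ideal I P \<and> IP_gens \<subseteq> I}) (add_monoid P)"
    using ker by (intro group.subgroups_Inter abelian_group.a_group[OF ring.is_abelian_group[OF P_ring]] sub) auto
  then show ?thesis
    unfolding IP_eq right_ideal_def by (auto intro!: additive_subgroup.intro)
qed

lemma IP_gens_in: "IP_gens \<subseteq> IP" unfolding IP_eq by blast

lemma IP_subset_kernel: "IP \<subseteq> omega_kernel"
  unfolding IP_eq using kernel_right_ideal IP_gens_kernel by blast

lemma IP_submodule: "submodule IP cfield P"
proof -
  have a: "additive_subgroup IP P" and m: "\<And>x r. x \<in> IP \<Longrightarrow> r \<in> carrier P \<Longrightarrow> x \<otimes>\<^bsub>P\<^esub> r \<in> IP" using right_ideal_IP by (auto simp: right_ideal_def)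
  interpret additive_subgroup IP P by (rule a)
  show ?thesis
  proof (rule vs_submoduleI[OF P_vs])
    fix r x assume x: "x \<in> IP"
    then have "x \<otimes>\<^bsub>P\<^esub> const r \<in> IP" by (rule m) simp
    then show "r \<odot>\<^bsub>P\<^esub> x \<in> IP" using a_Hcarr[OF x] by (simp add: const_smult cplx_algebraD[OF P_algebra])
  qed (use a_subset a_Hcarr in auto)
qed

lemmas IP_sub = vs_submoduleD[OF P_vs IP_submodule]

lemma IP_mult: "x \<in> IP \<Longrightarrow> y \<in> carrier P \<Longrightarrow> x \<otimes>\<^bsub>P\<^esub> y \<in> IP" using right_ideal_IP by (auto simp: right_ideal_def)

lemma IP_relations:
  "cls (sgl [Ga] 1 + sgl [Gd] (q\<^sup>2) + sgl [] (- (1 + q\<^sup>2))) \<in> IP" "cls (sgl [Gb, Gb] 1) \<in> IP" "cls (sgl [Gc, Gc] 1) \<in> IP" "cls (sgl [Gb, Gc] 1) \<in> IP"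
  "cls (sgl [Ga, Gb] 1 + sgl [Gb] (- 1)) \<in> IP" "cls (sgl [Gd, Gc] 1 + sgl [Gc] (- 1)) \<in> IP"
  using IP_gens_in by (simp_all add: gen_eval)

text \<open>Right multiples of a + q^2 d - (1 + q^2) by a, c and b, corrected by other generators.
  Together with the given relations they reduce products of 1, a, b, c with generators to the span
  of 1, a, b, c.\<close>

lemma IP_derived:
  "cls (sgl [Ga, Ga] 1 + sgl [Ga] (- (1 + q\<^sup>2)) + sgl [] (q\<^sup>2)) \<in> IP" "cls (sgl [Ga, Gc] 1 + sgl [Gc] (- 1)) \<in> IP"
  "cls (sgl [Gd, Gb] 1 + sgl [Gb] (- 1)) \<in> IP"
proof -
  note R = IP_relations
  have "cls (sgl [Ga, Ga] 1 + sgl [Ga] (- (1 + q\<^sup>2)) + sgl [] (q\<^sup>2)) =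
    cls (sgl [Ga] 1 + sgl [Gd] (q\<^sup>2) + sgl [] (- (1 + q\<^sup>2))) \<otimes>\<^bsub>P\<^esub> gen q Ga \<oplus>\<^bsub>P\<^esub> (- (q ^ 3)) \<odot>\<^bsub>P\<^esub> cls (sgl [Gb, Gc] 1)"
    "cls (sgl [Ga, Gc] 1 + sgl [Gc] (- 1)) =
    cls (sgl [Ga] 1 + sgl [Gd] (q\<^sup>2) + sgl [] (- (1 + q\<^sup>2))) \<otimes>\<^bsub>P\<^esub> gen q Gc \<oplus>\<^bsub>P\<^esub> (- (q\<^sup>2)) \<odot>\<^bsub>P\<^esub> cls (sgl [Gd, Gc] 1 + sgl [Gc] (- 1))"
    "cls (sgl [Gd, Gb] 1 + sgl [Gb] (- 1)) =
    inverse (q\<^sup>2) \<odot>\<^bsub>P\<^esub> (cls (sgl [Ga] 1 + sgl [Gd] (q\<^sup>2) + sgl [] (- (1 + q\<^sup>2))) \<otimes>\<^bsub>P\<^esub> gen q Gb \<oplus>\<^bsub>P\<^esub> (- 1) \<odot>\<^bsub>P\<^esub> cls (sgl [Ga, Gb] 1 + sgl [Gb] (- 1)))"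
    unfolding gen_eval
    by ((unfold cls_add rel_nf)?; (unfold cls_add[symmetric])?;
      (rule cls_eqI', rule poly_mapping_eqI)?; use q in \<open>auto simp: lookup_add lookup_single when_def field_simps power2_eq_square power3_eq_cube\<close>)+
  then show "cls (sgl [Ga, Ga] 1 + sgl [Ga] (- (1 + q\<^sup>2)) + sgl [] (q\<^sup>2)) \<in> IP" "cls (sgl [Ga, Gc] 1 + sgl [Gc] (- 1)) \<in> IP"
    "cls (sgl [Gd, Gb] 1 + sgl [Gb] (- 1)) \<in> IP"
    using IP_sub(3)[OF IP_mult[OF R(1) word_closed] IP_sub(4)[OF R(4)]] IP_sub(3)[OF IP_mult[OF R(1) word_closed] IP_sub(4)[OF R(6)]]
      IP_sub(4)[OF IP_sub(3)[OF IP_mult[OF R(1) word_closed] IP_sub(4)[OF R(5)]]]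
    by simp_all
qed

text \<open>\<open>remainder e r s t\<close> is minus the combination of \<open>1, a, b, c\<close> on which \<open>\<epsilon>\<close> and \<open>\<omega>\<close> have the values \<open>e\<close> and \<open>r e\<^sup>+ + s e\<^sup>- + t e\<^sup>0\<close>.\<close>

abbreviation "remainder e r s t \<equiv> cls (sgl [] (t - e) + sgl [Gb] (- s) + sgl [Gc] (- (inverse q * r)) + sgl [Ga] (- t))"

text \<open>The four identities follow the rules of \<open>omega_data_gen\<close>: modulo the right
  ideal, multiplying a remainder by a generator changes its parameters just as multiplying x changes
  its data.\<close>

lemma remainder_step:
  "remainder e (q * r) (q * s) (q\<^sup>2 * t + e) = remainder e r s t \<otimes>\<^bsub>P\<^esub> gen q Ga \<oplus>\<^bsub>P\<^esub>
     (t \<odot>\<^bsub>P\<^esub> cls (sgl [Ga, Ga] 1 + sgl [Ga] (- (1 + q\<^sup>2)) + sgl [] (q\<^sup>2)) \<oplus>\<^bsub>P\<^esub>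
     ((q * s) \<odot>\<^bsub>P\<^esub> cls (sgl [Ga, Gb] 1 + sgl [Gb] (- 1)) \<oplus>\<^bsub>P\<^esub> r \<odot>\<^bsub>P\<^esub> cls (sgl [Ga, Gc] 1 + sgl [Gc] (- 1))))"
  "remainder 0 0 e 0 = remainder e r s t \<otimes>\<^bsub>P\<^esub> gen q Gb \<oplus>\<^bsub>P\<^esub>
     (t \<odot>\<^bsub>P\<^esub> cls (sgl [Ga, Gb] 1 + sgl [Gb] (- 1)) \<oplus>\<^bsub>P\<^esub> (s \<odot>\<^bsub>P\<^esub> cls (sgl [Gb, Gb] 1) \<oplus>\<^bsub>P\<^esub> (inverse q * r) \<odot>\<^bsub>P\<^esub> cls (sgl [Gb, Gc] 1)))"
  "remainder 0 (q * e) 0 0 = remainder e r s t \<otimes>\<^bsub>P\<^esub> gen q Gc \<oplus>\<^bsub>P\<^esub>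
     (t \<odot>\<^bsub>P\<^esub> cls (sgl [Ga, Gc] 1 + sgl [Gc] (- 1)) \<oplus>\<^bsub>P\<^esub> (s \<odot>\<^bsub>P\<^esub> cls (sgl [Gb, Gc] 1) \<oplus>\<^bsub>P\<^esub> (inverse q * r) \<odot>\<^bsub>P\<^esub> cls (sgl [Gc, Gc] 1)))"
  "remainder e (inverse q * r) (inverse q * s) (inverse (q\<^sup>2) * (t - e)) = remainder e r s t \<otimes>\<^bsub>P\<^esub> gen q Gd \<oplus>\<^bsub>P\<^esub>
     ((- (inverse (q\<^sup>2) * (t - e))) \<odot>\<^bsub>P\<^esub> cls (sgl [Ga] 1 + sgl [Gd] (q\<^sup>2) + sgl [] (- (1 + q\<^sup>2))) \<oplus>\<^bsub>P\<^esub>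
     ((inverse q * s) \<odot>\<^bsub>P\<^esub> cls (sgl [Gd, Gb] 1 + sgl [Gb] (- 1)) \<oplus>\<^bsub>P\<^esub>
     ((inverse (q\<^sup>2) * r) \<odot>\<^bsub>P\<^esub> cls (sgl [Gd, Gc] 1 + sgl [Gc] (- 1)) \<oplus>\<^bsub>P\<^esub> (inverse q * t) \<odot>\<^bsub>P\<^esub> cls (sgl [Gb, Gc] 1))))"
  unfolding gen_eval
  by ((unfold cls_add rel_nf)?; (unfold cls_add[symmetric])?;
      (rule cls_eqI', rule poly_mapping_eqI)?; use q in \<open>auto simp: lookup_add lookup_single when_def field_simps power2_eq_square\<close>)+

text \<open>Data and reduction modulo the ideal are propagated together. The e^0 coefficient is kept
  in the form [deg w; q^2] e because \<open>omega_data_G0\<close> needs that it vanishes in degree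
  0.\<close>

lemma remainder_word:
  "\<exists>e r s. omega_data (word q w) e r s (qnum (wdeg w) * e) \<and> word q w \<oplus>\<^bsub>P\<^esub> remainder e r s (qnum (wdeg w) * e) \<in> IP"
proof (induction w rule: rev_induct)
  case Nil
  have "word q [] \<oplus>\<^bsub>P\<^esub> remainder 1 0 0 0 = \<zero>\<^bsub>P\<^esub>"
    unfolding word_cls cls_zero cls_add[symmetric] by (rule cls_eqI') (rule poly_mapping_eqI, simp add: lookup_add lookup_single when_def)
  then show ?case using omega_data_one IP_sub(2) by (intro exI[of _ 1] exI[of _ 0]) (simp add: word_Nil)
next
  case (snoc g w)
  then obtain e r s t where t: "t = qnum (wdeg w) * e" and o: "omega_data (word q w) e r s t" and i: "word q w \<oplus>\<^bsub>P\<^esub> remainder e r s t \<in> IP"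
    by blast
  note R = IP_relations and D = IP_derived
  \<comment> \<open>Appending d lowers the degree: [n - 1; q^2] = q^-2 ([n; q^2] - 1).\<close>
  have qm: "inverse (q\<^sup>2) * (t - e) = qnum (wdeg w - 1) * e"
    using qnum_add[of "wdeg w - 1" 1] q by (simp add: t field_simps)
  have step: "(word q w \<otimes>\<^bsub>P\<^esub> gen q g) \<oplus>\<^bsub>P\<^esub> cls f \<in> IP" if "cls f = remainder e r s t \<otimes>\<^bsub>P\<^esub> gen q g \<oplus>\<^bsub>P\<^esub> y" "y \<in> IP" for f y
  proof -
    have y: "y \<in> carrier P" using that IP_sub(1) by auto
    have "(word q w \<otimes>\<^bsub>P\<^esub> gen q g) \<oplus>\<^bsub>P\<^esub> cls f = (word q w \<oplus>\<^bsub>P\<^esub> remainder e r s t) \<otimes>\<^bsub>P\<^esub> gen q g \<oplus>\<^bsub>P\<^esub> y"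
      unfolding that(1) using y by (simp add: P.l_distr P.a_assoc)
    then show ?thesis using IP_sub(3)[OF IP_mult[OF i word_closed] that(2)] by simp
  qed
  show ?case
  proof (cases g)
    case Ga
    have "q\<^sup>2 * t + e = qnum (wdeg (w @ [g])) * e" by (simp add: Ga add.commute[of 1] qnum_add[of "wdeg w" 1] t) (simp add: algebra_simps)
    then show ?thesis
      using omega_data_gen(1)[OF o] step[unfolded Ga, OF remainder_step(1)] R D Ga
      by (intro exI[of _ e] exI[of _ "q * r"] exI[of _ "q * s"]) (simp add: word_append IP_sub(3,4))
  next
    case Gb
    show ?thesis
      using omega_data_gen(2)[OF o] step[unfolded Gb, OF remainder_step(2)] R D Gb
      by (intro exI[of _ 0] exI[of _ 0] exI[of _ e]) (simp add: word_append IP_sub(3,4))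
  next
    case Gc
    show ?thesis
      using omega_data_gen(3)[OF o] step[unfolded Gc, OF remainder_step(3)] R D Gc
      by (intro exI[of _ 0] exI[of _ "q * e"] exI[of _ 0]) (simp add: word_append IP_sub(3,4))
  next
    case Gd
    have "inverse (q\<^sup>2) * (t - e) = qnum (wdeg (w @ [g])) * e" by (simp add: Gd qm)
    then show ?thesis
      using omega_data_gen(4)[OF o] step[unfolded Gd, OF remainder_step(4)] R D Gd
      by (intro exI[of _ e] exI[of _ "inverse q * r"] exI[of _ "inverse q * s"]) (simp add: word_append IP_sub(3,4))
  qed
qed

lemma remainder_add: "remainder (e + e') (r + r') (s + s') (t + t') = remainder e r s t \<oplus>\<^bsub>P\<^esub> remainder e' r' s' t'"
  unfolding cls_add[symmetric] by (rule cls_eqI', rule poly_mapping_eqI) (auto simp: lookup_add lookup_single when_def algebra_simps)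

lemma remainder_smult: "remainder (k * e) (k * r) (k * s) (k * t) = k \<odot>\<^bsub>P\<^esub> remainder e r s t"
  unfolding cls_smult by (rule cls_eqI', rule poly_mapping_eqI) (auto simp: lookup_add lookup_single when_def algebra_simps)

lemma remainder_closed: "remainder e r s t \<in> carrier P" by simp

text \<open>This says at once that omega has constant coefficients and that P modulo the ideal is
  spanned by 1, a, b, c, with coordinates given by the counit and omega.\<close>

lemma remainder_ex:
  assumes x: "x \<in> carrier P"
  shows "\<exists>e r s t. omega_data x e r s t \<and> x \<oplus>\<^bsub>P\<^esub> remainder e r s t \<in> IP"
proof -
  let ?H = "{x \<in> carrier P. \<exists>e r s t. omega_data x e r s t \<and> x \<oplus>\<^bsub>P\<^esub> remainder e r s t \<in> IP}"
  have sub: "submodule ?H cfield P"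
  proof (rule vs_submoduleI[OF P_vs])
    show "\<zero>\<^bsub>P\<^esub> \<in> ?H" using omega_data_zero IP_sub(2) by (auto intro!: exI[of _ 0] simp: cls_zero[symmetric])
    fix x y k assume "x \<in> ?H"
    then obtain e r s t where x: "x \<in> carrier P" "omega_data x e r s t" "x \<oplus>\<^bsub>P\<^esub> remainder e r s t \<in> IP" by blast
    have "k \<odot>\<^bsub>P\<^esub> x \<oplus>\<^bsub>P\<^esub> remainder (k * e) (k * r) (k * s) (k * t) = k \<odot>\<^bsub>P\<^esub> (x \<oplus>\<^bsub>P\<^esub> remainder e r s t)"
      unfolding remainder_smult using x(1) remainder_closed by (simp only: vs_smult_add[OF P_vs])
    then show "k \<odot>\<^bsub>P\<^esub> x \<in> ?H" using omega_data_smult[OF x(2), of k] IP_sub(4)[OF x(3), of k] by (auto simp: omega_data_def)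
    assume "y \<in> ?H"
    then obtain e' r' s' t' where y: "y \<in> carrier P" "omega_data y e' r' s' t'" "y \<oplus>\<^bsub>P\<^esub> remainder e' r' s' t' \<in> IP" by blast
    have "(x \<oplus>\<^bsub>P\<^esub> y) \<oplus>\<^bsub>P\<^esub> remainder (e + e') (r + r') (s + s') (t + t') = (x \<oplus>\<^bsub>P\<^esub> remainder e r s t) \<oplus>\<^bsub>P\<^esub> (y \<oplus>\<^bsub>P\<^esub> remainder e' r' s' t')"
      unfolding remainder_add using x(1) y(1) remainder_closed by (simp only: P.add.m_ac P.add.m_closed)
    then show "x \<oplus>\<^bsub>P\<^esub> y \<in> ?H" using omega_data_add[OF x(2) y(2)] IP_sub(3)[OF x(3) y(3)] by (auto simp: omega_data_def)
  qed auto
  have w: "word q w \<in> ?H" for w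
  proof -
    obtain e r s where "omega_data (word q w) e r s (qnum (wdeg w) * e)" "word q w \<oplus>\<^bsub>P\<^esub> remainder e r s (qnum (wdeg w) * e) \<in> IP"
      using remainder_word[of w] by (elim exE conjE)
    then show ?thesis by (intro CollectI conjI exI word_closed)
  qed
  show ?thesis using set_mp[OF P_submodule_all[OF sub w] x] by (elim CollectE conjE)
qed

text \<open>If the counit and omega vanish on x, then the parameters of its remainder are zero
  because scalars embed in P; so the remainder is zero and x itself lies in the ideal.\<close>

lemma IP_kernel: "IP = omega_kernel"
proof
  show "omega_kernel \<subseteq> IP"
  proof
    fix x assume "x \<in> omega_kernel"
    then have x: "omega_data x 0 0 0 0" by (simp add: omega_kernel_def)
    then have xP: "x \<in> carrier P" by (simp add: omega_data_def)
    obtain e r s t where d: "omega_data x e r s t" "x \<oplus>\<^bsub>P\<^esub> remainder e r s t \<in> IP" using remainder_ex[OF xP] by blast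
    have "e = 0" using x d unfolding omega_data_def by simp
    moreover have "(const r, const s, const t) = (const 0, const 0, const 0)" using x d unfolding omega_data_def by simp
    then have "r = 0" "s = 0" "t = 0" unfolding prod.inject const_inj by simp_all
    ultimately show "x \<in> IP" using d(2) xP by (simp add: cls_zero[symmetric])
  qed
qed (rule IP_subset_kernel)

text \<open>On words of degree 0 the e^0 coefficient contains the factor [0; q^2] = 0, and such
  words span the sphere.\<close>

lemma omega_data_G0:
  assumes x: "x \<in> G 0"
  shows "\<exists>r s. omega_data x (eps x) r s 0"
proof -
  obtain e r s t where d: "omega_data x e r s t" using remainder_ex[OF G_carrier[OF x]] by blast
  have "snd (snd (omega x)) = \<zero>\<^bsub>P\<^esub>"
  proof (rule lin_hom_eq_span[OF P_vs lin_hom_comp[OF omega_lin thd_lin] smult_lin[OF P_vs, of 0] P_vs Gw_carrier _ x[unfolded degree_comp_def], unfolded vs_zero_smult[OF P_vs G_carrier[OF x]]])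
    fix y assume "y \<in> Gw 0"
    then obtain w where w: "y = word q w" "wdeg w = 0" by blast
    then show "snd (snd (omega y)) = 0 \<odot>\<^bsub>P\<^esub> y" using remainder_word[of w] by (auto simp: omega_data_def vs_zero_smult[OF P_vs])
  qed
  then have "const t = const 0" using d by (simp add: omega_data_def)
  then show ?thesis using d unfolding const_inj by (auto simp: omega_data_def)
qed

subsection \<open>The framing space\<close>

abbreviation "M0 \<equiv> augmentation P \<inter> carrier (CqS2 q)"
abbreviation "N0 \<equiv> IP \<inter> carrier (CqS2 q)"
abbreviation "VX \<equiv> P\<lparr>carrier := M0\<rparr>"
abbreviation "V \<equiv> framing_space q"
abbreviation "fc \<equiv> framing_class q"
abbreviation "\<theta> \<equiv> soldering_form q"
abbreviation "\<rho> \<equiv> framing_coaction q"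

lemma sphere_carrier [simp]: "carrier (CqS2 q) = G 0" by (simp add: CqS2_def)

lemma sphere_eq: "CqS2 q = P\<lparr>carrier := G 0\<rparr>" by (simp add: CqS2_def)

lemma M0_mem: "x \<in> M0 \<longleftrightarrow> x \<in> G 0 \<and> eps x = 0" by (auto simp: augmentation_def)

lemma M0_submodule: "submodule M0 cfield P"
  by (rule vs_submoduleI[OF P_vs]) (auto simp: augmentation_def G_add G_smult vs_closed[OF P_vs])

lemmas VX_vs = vs_sub[OF P_vs M0_submodule]

lemma N0_submodule: "submodule N0 cfield VX"
proof (rule vs_submoduleI[OF VX_vs])
  show "N0 \<subseteq> carrier VX" using IP_kernel by (auto simp: omega_kernel_def omega_data_def augmentation_def)
qed (use IP_sub in \<open>auto simp: G_add G_smult\<close>)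

lemma fc_eq: "N0 +>\<^bsub>VX\<^esub> x = fc x"
  by (simp add: framing_class_def a_r_coset_def r_coset_def)

lemma V_vs: "vs V"
  unfolding framing_space_def by (rule quot_vs[OF VX_vs N0_submodule])

lemma V_carrier: "carrier V = fc ` M0"
  unfolding framing_space_def using quot_carrier[OF VX_vs N0_submodule] unfolding fc_eq by simp

lemma fc_lin: "fc \<in> lin_hom VX V"
  unfolding framing_space_def using quot_lin[OF VX_vs N0_submodule] unfolding fc_eq .

lemma fc_add: "x \<in> M0 \<Longrightarrow> y \<in> M0 \<Longrightarrow> fc (x \<oplus>\<^bsub>P\<^esub> y) = fc x \<oplus>\<^bsub>V\<^esub> fc y"
  using lin_hom_add[OF fc_lin, of x y] by simp

lemma fc_smult: "x \<in> M0 \<Longrightarrow> fc (r \<odot>\<^bsub>P\<^esub> x) = r \<odot>\<^bsub>V\<^esub> fc x"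
  using lin_hom_smult[OF fc_lin, of x r] by simp

lemma fc_closed: "x \<in> M0 \<Longrightarrow> fc x \<in> carrier V" by (simp add: V_carrier)

lemma fc_eq_iff: "x \<in> M0 \<Longrightarrow> y \<in> M0 \<Longrightarrow> fc x = fc y \<longleftrightarrow> x \<oplus>\<^bsub>P\<^esub> (- 1) \<odot>\<^bsub>P\<^esub> y \<in> IP"
proof -
  assume x: "x \<in> M0" "y \<in> M0"
  have "fc x = fc y \<longleftrightarrow> x \<oplus>\<^bsub>P\<^esub> (- 1) \<odot>\<^bsub>P\<^esub> y \<in> N0"
    using quot_eq_iff[OF VX_vs N0_submodule, of x y] vs_minus[OF VX_vs, of x y] x unfolding fc_eq by simp
  then show ?thesis using x by (auto simp: G_add G_smult)
qed

text \<open>A class is a coset of the ideal intersected with the sphere, and omega vanishes on the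
  ideal. So the image of the class is a singleton, as \<open>the_elem\<close> requires.\<close>

lemma soldering_fc:
  assumes x: "x \<in> M0" shows "\<theta> (fc x) = omega x"
proof -
  have xP: "x \<in> carrier P" using x by (auto simp: augmentation_def)
  have m: "y \<in> fc x \<Longrightarrow> omega y = omega x" for y
  proof -
    assume "y \<in> fc x"
    then obtain h where h: "h \<in> N0" "y = h \<oplus>\<^bsub>P\<^esub> x" by (auto simp: framing_class_def a_r_coset_def r_coset_def)
    then have o: "omega_data h 0 0 0 0" using IP_kernel by (auto simp: omega_kernel_def)
    obtain u v w where "omega x = (u, v, w)" "u \<in> carrier P" "v \<in> carrier P" "w \<in> carrier P"
      using lin_hom_closed[OF omega_lin xP] by auto
    then show "omega y = omega x" using o xP unfolding h(2) by (simp add: lin_hom_add[OF omega_lin] omega_data_def)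
  qed
  have "x \<in> fc x"
    using quot_mem[OF VX_vs N0_submodule, of x x] x vs_minus_eq_zero[OF VX_vs, of x x] vs_submoduleD(2)[OF VX_vs N0_submodule] unfolding fc_eq by simp
  moreover have "omega ` fc x = (\<lambda>y. omega x) ` fc x" by (rule image_cong[OF refl m])
  ultimately have "omega ` fc x = {omega x}" by (simp only: image_constant)
  moreover have "\<theta> (fc x) = the_elem (omega ` fc x)"
    by (simp add: soldering_form_def Let_def omega_def wS_def)
  ultimately show ?thesis by simp
qed

abbreviation "bp \<equiv> b_plus q"
abbreviation "bm \<equiv> b_minus q"
abbreviation "Bp \<equiv> fc bp"
abbreviation "Bm \<equiv> fc bm"

lemma b_M0: "bp \<in> M0" "bm \<in> M0"
  unfolding M0_mem using omega_data_words b_G by (simp_all add: omega_data_def)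

lemma theta_b: "\<theta> Bp = e_plus q" "\<theta> Bm = e_minus q"
  using omega_data_words soldering_fc[OF b_M0(1)] soldering_fc[OF b_M0(2)]
  by (simp_all add: omega_data_def e_sel const_smult vs_one[OF P_vs] vs_zero_smult[OF P_vs])

text \<open>The coordinates are the coefficients of omega: with these r and s, the element x - r b_+
  - s b_- has zero data and hence lies in the ideal.\<close>

lemma V_basis:
  assumes v: "v \<in> carrier V"
  shows "\<exists>r s. v = r \<odot>\<^bsub>V\<^esub> Bp \<oplus>\<^bsub>V\<^esub> s \<odot>\<^bsub>V\<^esub> Bm \<and> \<theta> v = (const r, const s, \<zero>\<^bsub>P\<^esub>)"
proof -
  obtain x where x: "x \<in> M0" "v = fc x" using v by (auto simp: V_carrier)
  have xP: "x \<in> carrier P" using x by (auto simp: augmentation_def)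
  have "x \<in> G 0" "eps x = 0" using x(1) unfolding M0_mem by auto
  then obtain r s where d: "omega_data x 0 r s 0" using omega_data_G0[of x] by auto
  have bP: "bp \<in> carrier P" "bm \<in> carrier P" using b_G by auto
  let ?y = "r \<odot>\<^bsub>P\<^esub> bp \<oplus>\<^bsub>P\<^esub> s \<odot>\<^bsub>P\<^esub> bm"
  have "omega_data (x \<oplus>\<^bsub>P\<^esub> (- 1) \<odot>\<^bsub>P\<^esub> ?y) 0 0 0 0"
    using omega_data_add[OF d omega_data_smult[OF omega_data_add[OF omega_data_smult[OF omega_data_words(1), of r] omega_data_smult[OF omega_data_words(2), of s]], of "-1"]] by simp
  then have i: "x \<oplus>\<^bsub>P\<^esub> (- 1) \<odot>\<^bsub>P\<^esub> ?y \<in> IP" unfolding IP_kernel omega_kernel_def by simp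
  note S = vs_submoduleD[OF P_vs M0_submodule]
  have y: "?y \<in> M0" by (intro S b_M0)
  have "v = fc ?y" using fc_eq_iff[OF x(1) y] i x(2) by blast
  also have "\<dots> = r \<odot>\<^bsub>V\<^esub> Bp \<oplus>\<^bsub>V\<^esub> s \<odot>\<^bsub>V\<^esub> Bm" using S(4) b_M0 by (simp only: fc_add fc_smult)
  finally show ?thesis using soldering_fc[OF x(1)] x(2) d by (auto simp: omega_data_def)
qed

lemma theta_lin: "\<theta> \<in> lin_hom V \<Omega>"
proof (rule lin_homI)
  note S = vs_submoduleD[OF P_vs M0_submodule]
  have MP: "x \<in> M0 \<Longrightarrow> x \<in> carrier P" for x using S(1) by blast
  fix v assume "v \<in> carrier V"
  then obtain x where x: "x \<in> M0" "v = fc x" by (auto simp: V_carrier)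
  show "\<theta> v \<in> carrier \<Omega>" unfolding x(2) soldering_fc[OF x(1)] by (rule lin_hom_closed[OF omega_lin MP[OF x(1)]])
  show "\<theta> (r \<odot>\<^bsub>V\<^esub> v) = r \<odot>\<^bsub>\<Omega>\<^esub> \<theta> v" for r
    unfolding x(2) fc_smult[OF x(1), symmetric] soldering_fc[OF S(4)[OF x(1)]] soldering_fc[OF x(1)] by (rule lin_hom_smult[OF omega_lin MP[OF x(1)]])
  fix v' assume "v' \<in> carrier V"
  then obtain y where y: "y \<in> M0" "v' = fc y" by (auto simp: V_carrier)
  show "\<theta> (v \<oplus>\<^bsub>V\<^esub> v') = \<theta> v \<oplus>\<^bsub>\<Omega>\<^esub> \<theta> v'"
    unfolding x(2) y(2) fc_add[OF x(1) y(1), symmetric] soldering_fc[OF S(3)[OF x(1) y(1)]] soldering_fc[OF x(1)] soldering_fc[OF y(1)]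
    by (rule lin_hom_add[OF omega_lin MP[OF x(1)] MP[OF y(1)]])
qed

text \<open>Coordinates for the classes of b_+ and b_-, read off by the counit from the constant
  coefficients of theta. Having them as linear functionals proves that the two classes are
  independent.\<close>

definition kp where "kp v = eps (fst (\<theta> v))"
definition km where "km v = eps (fst (snd (\<theta> v)))"

lemma kp_lin: "kp \<in> lin_hom V cfield" and km_lin: "km \<in> lin_hom V cfield"
  unfolding kp_def[abs_def] km_def[abs_def]
  by (rule lin_hom_comp[OF lin_hom_comp[OF theta_lin fst_lin] eps_lin] lin_hom_comp[OF lin_hom_comp[OF theta_lin snd_lin] eps_lin])+

lemma V_coordinates:
  assumes v: "v \<in> carrier V"
  shows "v = kp v \<odot>\<^bsub>V\<^esub> Bp \<oplus>\<^bsub>V\<^esub> km v \<odot>\<^bsub>V\<^esub> Bm" "\<theta> v = (const (kp v), const (km v), \<zero>\<^bsub>P\<^esub>)"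
proof -
  obtain r s where rs: "v = r \<odot>\<^bsub>V\<^esub> Bp \<oplus>\<^bsub>V\<^esub> s \<odot>\<^bsub>V\<^esub> Bm" "\<theta> v = (const r, const s, \<zero>\<^bsub>P\<^esub>)" using V_basis[OF v] by blast
  then have "kp v = r" "km v = s" by (simp_all add: kp_def km_def)
  then show "v = kp v \<odot>\<^bsub>V\<^esub> Bp \<oplus>\<^bsub>V\<^esub> km v \<odot>\<^bsub>V\<^esub> Bm" "\<theta> v = (const (kp v), const (km v), \<zero>\<^bsub>P\<^esub>)" using rs by simp_all
qed

lemma B_closed: "Bp \<in> carrier V" "Bm \<in> carrier V" by (rule fc_closed[OF b_M0(1)], rule fc_closed[OF b_M0(2)])

lemma k_B [simp]: "kp Bp = 1" "kp Bm = 0" "km Bp = 0" "km Bm = 1"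
  by (simp_all add: kp_def km_def theta_b e_sel)

abbreviation "VA \<equiv> tensor V laurent"
lemmas VA_vs = tensor_vs[OF V_vs laurent_vs]

text \<open>The coaction written in coordinates; it shows that the map described by
  \<open>framing_coaction\<close> exists.\<close>

definition rho0 where
  "rho0 v = kp v \<odot>\<^bsub>VA\<^esub> pure V laurent Bp (tpow 2) \<oplus>\<^bsub>VA\<^esub> km v \<odot>\<^bsub>VA\<^esub> pure V laurent Bm (tpow (- 2))"

lemma scalar_lin: "vs X \<Longrightarrow> x \<in> carrier X \<Longrightarrow> (\<lambda>r. r \<odot>\<^bsub>X\<^esub> x) \<in> lin_hom cfield X"
  by (rule lin_homI) (auto simp: vs_closed vs_add_smult vs_smult_smult)

lemma pure_V: "v \<in> carrier V \<Longrightarrow> pure V laurent v f \<in> carrier VA" by (rule pure_closed[OF V_vs laurent_vs]) simp_all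

lemma rho0_lin: "rho0 \<in> lin_hom V VA"
  unfolding rho0_def[abs_def]
  by (rule lin_hom_plus[OF VA_vs lin_hom_comp[OF kp_lin scalar_lin[OF VA_vs pure_V[OF B_closed(1)]]] lin_hom_comp[OF km_lin scalar_lin[OF VA_vs pure_V[OF B_closed(2)]]]])

lemma rho0_B: "rho0 Bp = pure V laurent Bp (tpow 2)" "rho0 Bm = pure V laurent Bm (tpow (- 2))"
proof -
  interpret T: module cfield VA by (rule VA_vs)
  show "rho0 Bp = pure V laurent Bp (tpow 2)" "rho0 Bm = pure V laurent Bm (tpow (- 2))"
    by (simp_all add: rho0_def vs_one[OF VA_vs] vs_zero_smult[OF VA_vs] pure_V B_closed)
qed

lemma V_hom_eq:
  assumes "f \<in> lin_hom V X" "g \<in> lin_hom V X" "f Bp = g Bp" "f Bm = g Bm" "v \<in> carrier V"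
  shows "f v = g v"
proof -
  have "f (kp v \<odot>\<^bsub>V\<^esub> Bp \<oplus>\<^bsub>V\<^esub> km v \<odot>\<^bsub>V\<^esub> Bm) = g (kp v \<odot>\<^bsub>V\<^esub> Bp \<oplus>\<^bsub>V\<^esub> km v \<odot>\<^bsub>V\<^esub> Bm)"
    using B_closed assms by (simp add: lin_hom_add[OF assms(1)] lin_hom_add[OF assms(2)] lin_hom_smult[OF assms(1)] lin_hom_smult[OF assms(2)] vs_smult_closed[OF V_vs])
  then show ?thesis using V_coordinates(1)[OF assms(5)] by simp
qed

lemma framing_coaction_eq: "v \<in> carrier V \<Longrightarrow> \<rho> v = rho0 v"
proof -
  assume v: "v \<in> carrier V"
  have "\<rho> = restrict rho0 (carrier V)"
    unfolding framing_coaction_def Let_def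
  proof (rule the_equality)
    show "restrict rho0 (carrier V) \<in> extensional (carrier V) \<and> restrict rho0 (carrier V) \<in> lin_hom V VA \<and>
       restrict rho0 (carrier V) Bp = pure V laurent Bp (tpow 2) \<and> restrict rho0 (carrier V) Bm = pure V laurent Bm (tpow (- 2))"
      using lin_hom_restrict[OF rho0_lin V_vs] rho0_B B_closed by simp
    fix \<phi> assume \<phi>: "\<phi> \<in> extensional (carrier V) \<and> \<phi> \<in> lin_hom V VA \<and> \<phi> Bp = pure V laurent Bp (tpow 2) \<and> \<phi> Bm = pure V laurent Bm (tpow (- 2))"
    show "\<phi> = restrict rho0 (carrier V)"
      by (rule extensionalityI[OF conjunct1[OF \<phi>] restrict_extensional]) (use V_hom_eq[OF conjunct1[OF conjunct2[OF \<phi>]] rho0_lin] \<phi> rho0_B in simp)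
  qed
  then show ?thesis using v by simp
qed

lemma rho_lin: "\<rho> \<in> lin_hom V VA" by (rule lin_hom_cong[OF rho0_lin framing_coaction_eq V_vs])

text \<open>Degree 2 is the line of b_+, degree -2 the line of b_-, and every other component is
  zero; one formula covers these cases.\<close>

definition VG :: "int \<Rightarrow> sl2 set set" where
  "VG n = {r \<odot>\<^bsub>V\<^esub> Bp \<oplus>\<^bsub>V\<^esub> s \<odot>\<^bsub>V\<^esub> Bm | r s. (n \<noteq> 2 \<longrightarrow> r = 0) \<and> (n \<noteq> - 2 \<longrightarrow> s = 0)}"

lemma VG_iff: "v \<in> VG n \<longleftrightarrow> v \<in> carrier V \<and> (n \<noteq> 2 \<longrightarrow> kp v = 0) \<and> (n \<noteq> - 2 \<longrightarrow> km v = 0)"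
proof
  assume "v \<in> VG n"
  then obtain r s where v: "v = r \<odot>\<^bsub>V\<^esub> Bp \<oplus>\<^bsub>V\<^esub> s \<odot>\<^bsub>V\<^esub> Bm" "n \<noteq> 2 \<longrightarrow> r = 0" "n \<noteq> - 2 \<longrightarrow> s = 0" by (auto simp: VG_def)
  have k: "kp v = r" "km v = s" unfolding v(1)
    using B_closed by (simp_all add: lin_hom_add[OF kp_lin] lin_hom_add[OF km_lin] lin_hom_smult[OF kp_lin] lin_hom_smult[OF km_lin] vs_smult_closed[OF V_vs])
  have "v \<in> carrier V" unfolding v(1) using B_closed by (simp add: vs_closed[OF V_vs])
  then show "v \<in> carrier V \<and> (n \<noteq> 2 \<longrightarrow> kp v = 0) \<and> (n \<noteq> - 2 \<longrightarrow> km v = 0)"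
    unfolding k using v(2,3) by blast
next
  assume "v \<in> carrier V \<and> (n \<noteq> 2 \<longrightarrow> kp v = 0) \<and> (n \<noteq> - 2 \<longrightarrow> km v = 0)"
  then show "v \<in> VG n" unfolding VG_def using V_coordinates(1)[of v] by blast
qed

lemma VG_submodule: "submodule (VG n) cfield V"
  using lin_hom_zero[OF V_vs vs_cfield kp_lin] lin_hom_zero[OF V_vs vs_cfield km_lin]
  by (intro vs_submoduleI[OF V_vs])
    (auto simp: VG_iff vs_closed[OF V_vs] lin_hom_add[OF kp_lin] lin_hom_add[OF km_lin] lin_hom_smult[OF kp_lin] lin_hom_smult[OF km_lin])

lemma V_graded: "graded_coaction V VG \<rho>"
proof -
  have u: "(\<Union>n. VG n) \<subseteq> carrier V" by (auto simp: VG_iff)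
  note S = vs_submoduleD[OF V_vs span_submodule[OF V_vs u]]
  have B: "Bp \<in> lin_span V (\<Union>n. VG n)" "Bm \<in> lin_span V (\<Union>n. VG n)"
    by (rule set_mp[OF span_superset[OF V_vs]], rule UN_I[of 2], rule UNIV_I, simp add: VG_iff B_closed,
        rule set_mp[OF span_superset[OF V_vs]], rule UN_I[of "-2"], rule UNIV_I, simp add: VG_iff B_closed)
  have "carrier V \<subseteq> lin_span V (\<Union>n. VG n)"
  proof
    fix v assume v: "v \<in> carrier V"
    show "v \<in> lin_span V (\<Union>n. VG n)" by (subst V_coordinates(1)[OF v]) (intro S B)
  qed
  moreover have "\<rho> v = pure V laurent v (tpow n)" if v: "v \<in> VG n" for v n
  proof -
    have c: "v \<in> carrier V" using v by (simp add: VG_iff)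
    note pv = pure_add_left[OF V_vs laurent_vs] pure_smult_left[OF V_vs laurent_vs]
    have "pure V laurent v (tpow n) = kp v \<odot>\<^bsub>VA\<^esub> pure V laurent Bp (tpow n) \<oplus>\<^bsub>VA\<^esub> km v \<odot>\<^bsub>VA\<^esub> pure V laurent Bm (tpow n)"
      using B_closed by (subst V_coordinates(1)[OF c]) (simp add: pv vs_smult_closed[OF V_vs])
    also have "\<dots> = rho0 v"
      using v unfolding rho0_def VG_iff by (cases "n = 2"; cases "n = - 2") (simp_all add: vs_zero_smult[OF VA_vs] pure_V B_closed)
    finally show ?thesis using framing_coaction_eq[OF c] by simp
  qed
  ultimately show ?thesis
    unfolding graded_coaction_def using V_vs VG_submodule S(1) rho_lin by auto
qed

lemma theta_graded: "v \<in> VG n \<Longrightarrow> \<theta> v \<in> OG n"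
  using V_coordinates(2)[of v] G_smult[OF G_one] by (auto simp: VG_iff const_smult vs_zero_smult[OF P_vs])

lemma theta_equivariant: "v \<in> carrier V \<Longrightarrow> fcoact (\<theta> v) = tmap V laurent \<Omega> laurent \<theta> id (\<rho> v)"
proof -
  assume v: "v \<in> carrier V"
  note t = tmap[OF V_vs laurent_vs Omega_vs laurent_vs theta_lin lin_hom_id(1)]
  have "ocoact (\<theta> v) = tmap V laurent \<Omega> laurent \<theta> id (\<rho> v)"
  proof (rule gc_eq[OF V_graded OA_vs lin_hom_comp[OF theta_lin ocoact_lin] lin_hom_comp[OF rho_lin t(1)] _ v])
    fix n v assume n: "v \<in> VG n"
    then show "ocoact (\<theta> v) = tmap V laurent \<Omega> laurent \<theta> id (\<rho> v)"
      using gcD(5)[OF ocoact_graded theta_graded[OF n]] gcD(5)[OF V_graded n] t(2)[of v "tpow n"] by (simp add: VG_iff)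
  qed
  then show ?thesis using form_coaction_eq[OF lin_hom_closed[OF theta_lin v]] by simp
qed

subsection \<open>The framing isomorphism\<close>

abbreviation "PV \<equiv> tensor P V"
text \<open>Generators of total degree 0. The form \<open>0 - k\<close> is the instance n = 0 of
  \<open>gc_diag\<close>, which identifies their span with the coinvariants of P (x) V.\<close>

definition "EG_gens = {pure P V u v | u v k. u \<in> G k \<and> v \<in> VG (0 - k)}"
definition "EG = lin_span PV EG_gens"
abbreviation "E \<equiv> assoc_bundle laurent P \<delta> V \<rho>"
abbreviation "Ls \<equiv> tlift P V \<Omega> (\<lambda>p v. p \<rhd>\<^bsub>\<Omega>\<^esub> \<theta> v)"
abbreviation "M \<equiv> CqS2 q"

lemmas PV_vs = tensor_vs[OF P_vs V_vs]
lemmas PV_graded = gc_diag[OF P_graded V_graded]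
lemma EG_submodule: "submodule EG cfield PV"
  unfolding EG_def EG_gens_def by (rule gcD(2)[OF PV_graded])
lemmas EG_sub = vs_submoduleD[OF PV_vs EG_submodule]

lemma E_carrier: "carrier E = EG"
  unfolding assoc_bundle_def using gc_coinvariants[OF PV_graded] by (simp add: EG_def EG_gens_def)

lemma E_sel: "add E = add PV" "zero E = zero PV" "smult E = (\<lambda>m. tmap P V P V (\<lambda>p. m \<otimes>\<^bsub>P\<^esub> p) id)"
  by (simp_all add: assoc_bundle_def)

lemma Ls: "Ls \<in> lin_hom PV \<Omega>" "p \<in> carrier P \<Longrightarrow> v \<in> carrier V \<Longrightarrow> Ls (pure P V p v) = p \<rhd>\<^bsub>\<Omega>\<^esub> \<theta> v"
proof -
  have b: "bilin P V \<Omega> (\<lambda>p v. p \<rhd>\<^bsub>\<Omega>\<^esub> \<theta> v)" using bilin_pre[OF lact_bilin lin_hom_id(2) theta_lin] by simp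
  show "Ls \<in> lin_hom PV \<Omega>" "p \<in> carrier P \<Longrightarrow> v \<in> carrier V \<Longrightarrow> Ls (pure P V p v) = p \<rhd>\<^bsub>\<Omega>\<^esub> \<theta> v"
    using tlift[OF P_vs V_vs Omega_vs b] by auto
qed

lemma sphere_ring: "ring (P\<lparr>carrier := G 0\<rparr>)"
proof -
  have "abelian_group (P\<lparr>carrier := G 0\<rparr>)" by (rule module.axioms(2)[OF vs_sub[OF P_vs G_submodule]])
  then show ?thesis
    using G_mult[of _ 0 _ 0] G_one by (intro ringI monoidI) (auto simp: P.m_assoc P.l_distr P.r_distr)
qed

definition mact where "mact m = tmap P V P V (\<lambda>p. m \<otimes>\<^bsub>P\<^esub> p) id"

lemma mact:
  assumes m: "m \<in> carrier P"
  shows "mact m \<in> lin_hom PV PV" "p \<in> carrier P \<Longrightarrow> v \<in> carrier V \<Longrightarrow> mact m (pure P V p v) = pure P V (m \<otimes>\<^bsub>P\<^esub> p) v"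
  unfolding mact_def using tmap[OF P_vs V_vs P_vs V_vs bilinD(1)[OF P_mult_bilin m] lin_hom_id(1)] by auto

lemmas PV_eq = tensor_hom_eq[OF P_vs V_vs]
lemmas pure_PV = pure_closed[OF P_vs V_vs]

lemma mact_add: "m \<in> carrier P \<Longrightarrow> n \<in> carrier P \<Longrightarrow> X \<in> carrier PV \<Longrightarrow> mact (m \<oplus>\<^bsub>P\<^esub> n) X = mact m X \<oplus>\<^bsub>PV\<^esub> mact n X"
  by (rule PV_eq[OF PV_vs mact(1) lin_hom_plus[OF PV_vs mact(1) mact(1)]])
    (simp_all add: mact(2) P.l_distr pure_add_left[OF P_vs V_vs])

lemma mact_mult: "m \<in> carrier P \<Longrightarrow> n \<in> carrier P \<Longrightarrow> X \<in> carrier PV \<Longrightarrow> mact (m \<otimes>\<^bsub>P\<^esub> n) X = mact m (mact n X)"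
  by (rule PV_eq[OF PV_vs mact(1) lin_hom_comp[OF mact(1) mact(1)]]) (simp_all add: mact(2) P.m_assoc)

lemma mact_one: "X \<in> carrier PV \<Longrightarrow> mact \<one>\<^bsub>P\<^esub> X = X"
  by (rule PV_eq[OF PV_vs mact(1) lin_hom_id(2)]) (simp_all add: mact(2))

lemma EG_gens_carrier: "EG_gens \<subseteq> carrier PV"
  unfolding EG_gens_def using pure_PV by (auto simp: VG_iff)

lemma mact_EG: "m \<in> G 0 \<Longrightarrow> X \<in> EG \<Longrightarrow> mact m X \<in> EG"
proof (rule lin_hom_span_image[OF PV_vs PV_vs mact(1) EG_submodule EG_gens_carrier])
  fix s assume m: "m \<in> G 0" and "s \<in> EG_gens"
  then obtain u v k where s: "s = pure P V u v" "u \<in> G k" "v \<in> VG (0 - k)" unfolding EG_gens_def by blast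
  then have "mact m s \<in> EG_gens"
    unfolding s(1) EG_gens_def using m s(2,3) G_mult'[OF m s(2), of k]
    by (intro CollectI exI[of _ "m \<otimes>\<^bsub>P\<^esub> u"] exI[of _ v] exI[of _ k]) (simp add: mact(2) VG_iff)
  then show "mact m s \<in> EG" unfolding EG_def by (rule set_mp[OF span_superset[OF PV_vs]])
qed (auto simp: EG_def)

lemma E_left_module: "left_module (P\<lparr>carrier := G 0\<rparr>) E"
proof (rule left_modI[OF sphere_ring])
  show "abelian_group E"
    by (rule abelian_group_cong[OF module.axioms(2)[OF vs_sub[OF PV_vs EG_submodule]]]) (simp_all add: E_carrier E_sel)
qed (use EG_sub(1) in \<open>auto simp: E_carrier E_sel mact_def[symmetric] mact_EG mact_add mact_mult mact_one lin_hom_add[OF mact(1)] subset_iff\<close>)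

lemma sphere_form_module: "left_module (P\<lparr>carrier := G 0\<rparr>) (left_mod \<Omega> (forms \<Omega> D (G 0) (G 0)))"
proof (rule left_modI[OF sphere_ring])
  show "abelian_group (left_mod \<Omega> (forms \<Omega> D (G 0) (G 0)))"
    by (rule abelian_group_cong[OF module.axioms(2)[OF vs_sub[OF Omega_vs forms_submodule[OF G0_carrier G0_carrier]]]]) simp_all
  show "r \<odot>\<^bsub>left_mod \<Omega> (forms \<Omega> D (G 0) (G 0))\<^esub> x \<in> carrier (left_mod \<Omega> (forms \<Omega> D (G 0) (G 0)))"
    if "r \<in> carrier (P\<lparr>carrier := G 0\<rparr>)" "x \<in> carrier (left_mod \<Omega> (forms \<Omega> D (G 0) (G 0)))" for r x
    using that forms_lact[of "G 0" "G 0" "G 0" r x] G_mult'[of r 0 _ 0 0] G0_carrier by simp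
qed (use vs_submoduleD(1)[OF Omega_vs forms_submodule[OF G0_carrier G0_carrier]] in \<open>auto simp: P.l_distr P.r_distr P.m_assoc subset_iff\<close>)

lemma Ls_mact: "m \<in> carrier P \<Longrightarrow> X \<in> carrier PV \<Longrightarrow> Ls (mact m X) = m \<rhd>\<^bsub>\<Omega>\<^esub> Ls X"
  by (rule PV_eq[OF Omega_vs lin_hom_comp[OF mact(1) Ls(1)] lin_hom_comp[OF Ls(1) lact_lin]])
    (simp_all add: mact(2) Ls(2) lact_assoc lin_hom_closed[OF theta_lin] del: Omega_sel)

text \<open>Total degree 0 pairs the line of b_+ with degree -2 in P and the line of b_- with degree
  2; in all other degrees both coordinates of v vanish.\<close>

lemma Ls_EG: "X \<in> EG \<Longrightarrow> Ls X \<in> G (- 2) \<times> G 2 \<times> {\<zero>\<^bsub>P\<^esub>}"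
proof (rule lin_hom_span_image[OF PV_vs Omega_vs Ls(1) Omega_submoduleI[OF G_submodule G_submodule zero_submodule] EG_gens_carrier])
  fix s assume "s \<in> EG_gens"
  then obtain u v k where s: "s = pure P V u v" "u \<in> G k" "v \<in> VG (0 - k)" unfolding EG_gens_def by blast
  then have v: "v \<in> carrier V" "k \<noteq> - 2 \<longrightarrow> kp v = 0" "k \<noteq> 2 \<longrightarrow> km v = 0" by (auto simp: VG_iff)
  then show "Ls s \<in> G (- 2) \<times> G 2 \<times> {\<zero>\<^bsub>P\<^esub>}"
    using s(1,2) by (cases "k = 2"; cases "k = - 2")
      (simp_all add: Ls(2) V_coordinates(2) const_smult cplx_algebraD[OF P_algebra] G_smult vs_zero_smult[OF P_vs])
qed (simp add: EG_def)

text \<open>Theta sends the basis of V to the members e^+ and e^- of the basis of the free module of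
  forms. So the coefficients of the image recover the tensor, already on all of P (x) V.\<close>

lemma Ls_inverse: "X \<in> carrier PV \<Longrightarrow> X = pure P V (fst (Ls X)) Bp \<oplus>\<^bsub>PV\<^esub> pure P V (fst (snd (Ls X))) Bm"
proof -
  assume X: "X \<in> carrier PV"
  note pb = bilinD(2)[OF pure_bilin[OF P_vs V_vs]]
  have l: "(\<lambda>X. pure P V (fst (Ls X)) Bp \<oplus>\<^bsub>PV\<^esub> pure P V (fst (snd (Ls X))) Bm) \<in> lin_hom PV PV"
    by (rule lin_hom_plus[OF PV_vs lin_hom_comp[OF lin_hom_comp[OF Ls(1) fst_lin] pb[OF B_closed(1)]] lin_hom_comp[OF lin_hom_comp[OF Ls(1) snd_lin] pb[OF B_closed(2)]]])
  show ?thesis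
  proof (rule PV_eq[OF PV_vs lin_hom_id(2) l _ X])
    fix p v assume p: "p \<in> carrier P" and v: "v \<in> carrier V"
    have "pure P V p v = pure P V p (kp v \<odot>\<^bsub>V\<^esub> Bp \<oplus>\<^bsub>V\<^esub> km v \<odot>\<^bsub>V\<^esub> Bm)" using V_coordinates(1)[OF v] by simp
    also have "\<dots> = pure P V (kp v \<odot>\<^bsub>P\<^esub> p) Bp \<oplus>\<^bsub>PV\<^esub> pure P V (km v \<odot>\<^bsub>P\<^esub> p) Bm"
      using p B_closed by (simp add: pure_add_right[OF P_vs V_vs] pure_smult_right[OF P_vs V_vs] pure_smult_left[OF P_vs V_vs] vs_smult_closed[OF V_vs])
    finally have e: "pure P V p v = pure P V (kp v \<odot>\<^bsub>P\<^esub> p) Bp \<oplus>\<^bsub>PV\<^esub> pure P V (km v \<odot>\<^bsub>P\<^esub> p) Bm" .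
    have "Ls (pure P V p v) = (kp v \<odot>\<^bsub>P\<^esub> p, km v \<odot>\<^bsub>P\<^esub> p, \<zero>\<^bsub>P\<^esub>)"
      using p v by (simp add: Ls(2) V_coordinates(2) const_smult cplx_algebraD[OF P_algebra])
    then show "pure P V p v = pure P V (fst (Ls (pure P V p v))) Bp \<oplus>\<^bsub>PV\<^esub> pure P V (fst (snd (Ls (pure P V p v)))) Bm"
      by (simp only: fst_conv snd_conv) (rule e)
  qed
qed

lemma framing_iso: "Ls \<in> mod_iso (P\<lparr>carrier := G 0\<rparr>) E (left_mod \<Omega> (forms \<Omega> D (G 0) (G 0)))"
proof -
  have EP: "X \<in> EG \<Longrightarrow> X \<in> carrier PV" for X using EG_sub(1) by blast
  have "Ls \<in> mod_hom (P\<lparr>carrier := G 0\<rparr>) E (left_mod \<Omega> (forms \<Omega> D (G 0) (G 0)))"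
    unfolding mod_hom_def
    using Ls_EG EP by (auto simp: E_carrier E_sel forms_sphere mact_def[symmetric] Ls_mact lin_hom_add[OF Ls(1)] simp del: Omega_sel)
  moreover have "inj_on Ls EG"
  proof (rule inj_onI)
    fix X Y assume "X \<in> EG" "Y \<in> EG" "Ls X = Ls Y"
    then show "X = Y" using Ls_inverse[OF EP[of X]] Ls_inverse[OF EP[of Y]] by simp
  qed
  moreover have "Ls ` EG = G (- 2) \<times> G 2 \<times> {\<zero>\<^bsub>P\<^esub>}"
  proof (rule equalityI; rule subsetI)
    fix w assume "w \<in> Ls ` EG" then show "w \<in> G (- 2) \<times> G 2 \<times> {\<zero>\<^bsub>P\<^esub>}" using Ls_EG by auto
  next
    fix w assume "w \<in> G (- 2) \<times> G 2 \<times> {\<zero>\<^bsub>P\<^esub>}"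
    then obtain x y where w: "w = (x, y, \<zero>\<^bsub>P\<^esub>)" "x \<in> G (- 2)" "y \<in> G 2" by auto
    let ?X = "pure P V x Bp \<oplus>\<^bsub>PV\<^esub> pure P V y Bm"
    have "pure P V x Bp \<in> EG_gens"
      unfolding EG_gens_def by (rule CollectI, rule exI[of _ x], rule exI[of _ Bp], rule exI[of _ "-2"]) (simp add: w VG_iff B_closed)
    moreover have "pure P V y Bm \<in> EG_gens"
      unfolding EG_gens_def by (rule CollectI, rule exI[of _ y], rule exI[of _ Bm], rule exI[of _ 2]) (simp add: w VG_iff B_closed)
    ultimately have "?X \<in> EG" by (intro EG_sub(3)) (auto simp: EG_def intro: set_mp[OF span_superset[OF PV_vs]])
    moreover have "Ls ?X = w"
      using w B_closed by (simp add: lin_hom_add[OF Ls(1)] pure_PV Ls(2) theta_b e_sel)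
    ultimately show "w \<in> Ls ` EG" by (rule image_eqI[OF sym, rotated])
  qed
  ultimately show ?thesis unfolding mod_iso_def bij_betw_def by (simp add: E_carrier forms_sphere)
qed

theorem framed: "framed_quantum_manifold (carrier M) laurent P \<delta> \<Omega> D IA V \<rho> \<theta>"
  unfolding framed_quantum_manifold_def sphere_carrier
proof (intro conjI ballI)
  show "G 0 = coinvariants laurent P \<delta>" by (simp add: coinvariants_P)
  show "right_comodule laurent V \<rho>" by (rule gc_right_comodule[OF V_graded])
  show "\<theta> \<in> lin_hom V (\<Omega>\<lparr>carrier := forms \<Omega> D (carrier P) (G 0)\<rparr>)"
    by (rule lin_hom_into[OF Omega_vs forms_submodule[OF subset_refl G0_carrier] theta_lin]) (simp add: V_coordinates(2) forms_P_M)
  show "fcoact (\<theta> v) = tmap V laurent \<Omega> laurent \<theta> id (\<rho> v)" if "v \<in> carrier V" for v by (rule theta_equivariant[OF that])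
qed (rule calculus principal_bundle E_left_module sphere_form_module framing_iso)+

end

text \<open>Dual basis lemma for three generators. The index set consists of arbitrary distinct
  labels from the type of the module instead of the generators e, e', e'', so that coincidences
  among the generators do no harm.\<close>

lemma projective_dual_basis:
  fixes i j k :: 'x and X :: "('r, 'x, 'k) module_scheme"
  assumes X: "left_module R X" and ij: "i \<noteq> j" "i \<noteq> k" "j \<noteq> k"
    and e: "e \<in> carrier X" "e' \<in> carrier X" "e'' \<in> carrier X"
    and f: "\<And>x. x \<in> carrier X \<Longrightarrow> f x \<in> carrier R" "\<And>x y. x \<in> carrier X \<Longrightarrow> y \<in> carrier X \<Longrightarrow> f (x \<oplus>\<^bsub>X\<^esub> y) = f x \<oplus>\<^bsub>R\<^esub> f y"
      "\<And>r x. r \<in> carrier R \<Longrightarrow> x \<in> carrier X \<Longrightarrow> f (r \<odot>\<^bsub>X\<^esub> x) = r \<otimes>\<^bsub>R\<^esub> f x"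
    and g: "\<And>x. x \<in> carrier X \<Longrightarrow> g x \<in> carrier R" "\<And>x y. x \<in> carrier X \<Longrightarrow> y \<in> carrier X \<Longrightarrow> g (x \<oplus>\<^bsub>X\<^esub> y) = g x \<oplus>\<^bsub>R\<^esub> g y"
      "\<And>r x. r \<in> carrier R \<Longrightarrow> x \<in> carrier X \<Longrightarrow> g (r \<odot>\<^bsub>X\<^esub> x) = r \<otimes>\<^bsub>R\<^esub> g x"
    and h: "\<And>x. x \<in> carrier X \<Longrightarrow> h x \<in> carrier R" "\<And>x y. x \<in> carrier X \<Longrightarrow> y \<in> carrier X \<Longrightarrow> h (x \<oplus>\<^bsub>X\<^esub> y) = h x \<oplus>\<^bsub>R\<^esub> h y"
      "\<And>r x. r \<in> carrier R \<Longrightarrow> x \<in> carrier X \<Longrightarrow> h (r \<odot>\<^bsub>X\<^esub> x) = r \<otimes>\<^bsub>R\<^esub> h x"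
    and exp: "\<And>x. x \<in> carrier X \<Longrightarrow> f x \<odot>\<^bsub>X\<^esub> e \<oplus>\<^bsub>X\<^esub> g x \<odot>\<^bsub>X\<^esub> e' \<oplus>\<^bsub>X\<^esub> h x \<odot>\<^bsub>X\<^esub> e'' = x"
  shows "projective R X"
proof -
  from X interpret R: ring R by (simp add: left_module_def)
  from X interpret X: abelian_group X by (simp add: left_module_def)
  have s [simp]: "\<And>r x. r \<in> carrier R \<Longrightarrow> x \<in> carrier X \<Longrightarrow> r \<odot>\<^bsub>X\<^esub> x \<in> carrier X"
    "\<And>r t x. r \<in> carrier R \<Longrightarrow> t \<in> carrier R \<Longrightarrow> x \<in> carrier X \<Longrightarrow> (r \<oplus>\<^bsub>R\<^esub> t) \<odot>\<^bsub>X\<^esub> x = r \<odot>\<^bsub>X\<^esub> x \<oplus>\<^bsub>X\<^esub> t \<odot>\<^bsub>X\<^esub> x"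
    "\<And>r x y. r \<in> carrier R \<Longrightarrow> x \<in> carrier X \<Longrightarrow> y \<in> carrier X \<Longrightarrow> r \<odot>\<^bsub>X\<^esub> (x \<oplus>\<^bsub>X\<^esub> y) = r \<odot>\<^bsub>X\<^esub> x \<oplus>\<^bsub>X\<^esub> r \<odot>\<^bsub>X\<^esub> y"
    "\<And>r t x. r \<in> carrier R \<Longrightarrow> t \<in> carrier R \<Longrightarrow> x \<in> carrier X \<Longrightarrow> (r \<otimes>\<^bsub>R\<^esub> t) \<odot>\<^bsub>X\<^esub> x = r \<odot>\<^bsub>X\<^esub> (t \<odot>\<^bsub>X\<^esub> x)"
    using X by (simp_all add: left_module_def)
  let ?F = "free_module R {i, j, k}"
  define \<iota> where "\<iota> x l = (if l = i then f x else if l = j then g x else if l = k then h x else \<zero>\<^bsub>R\<^esub>)" for x l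
  define \<pi> where "\<pi> w = w i \<odot>\<^bsub>X\<^esub> e \<oplus>\<^bsub>X\<^esub> w j \<odot>\<^bsub>X\<^esub> e' \<oplus>\<^bsub>X\<^esub> w k \<odot>\<^bsub>X\<^esub> e''" for w
  have fin: "finite {l. \<iota> x l \<noteq> \<zero>\<^bsub>R\<^esub>}" for x by (rule finite_subset[of _ "{i, j, k}"]) (auto simp: \<iota>_def)
  have "\<iota> \<in> mod_hom R X ?F"
    unfolding mod_hom_def free_module_def using fin f g h by (auto simp: \<iota>_def fun_eq_iff)
  moreover have "\<pi> \<in> mod_hom R ?F X"
    unfolding mod_hom_def free_module_def using e by (auto simp: \<pi>_def X.a_ac)
  moreover have "\<pi> (\<iota> x) = x" if "x \<in> carrier X" for x using exp[OF that] ij by (simp add: \<iota>_def \<pi>_def)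
  ultimately show ?thesis unfolding projective_def using X by blast
qed

context quantum_sl2
begin

lemma sphere_forms: "Omega_S2 q = left_mod \<Omega> (forms \<Omega> D (G 0) (G 0))" by (simp add: Omega_S2_def)

theorem sphere_iso:
  "(\<lambda>(f, h). (f \<rhd>\<^bsub>\<Omega>\<^esub> e_minus q) \<oplus>\<^bsub>\<Omega>\<^esub> (h \<rhd>\<^bsub>\<Omega>\<^esub> e_plus q))
     \<in> mod_iso (CqS2 q) (dsum (monopole_bundle q (- 2)) (monopole_bundle q 2)) (Omega_S2 q)"
proof -
  let ?F = "\<lambda>(f, h). (f \<rhd>\<^bsub>\<Omega>\<^esub> e_minus q) \<oplus>\<^bsub>\<Omega>\<^esub> (h \<rhd>\<^bsub>\<Omega>\<^esub> e_plus q)"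
  have F: "(f \<rhd>\<^bsub>\<Omega>\<^esub> e_minus q) \<oplus>\<^bsub>\<Omega>\<^esub> (h \<rhd>\<^bsub>\<Omega>\<^esub> e_plus q) = (h, f, \<zero>\<^bsub>P\<^esub>)" if "f \<in> carrier P" "h \<in> carrier P" for f h
    using that by (simp add: e_sel)
  \<comment> \<open>The two entries are exchanged: f has degree 2 and multiplies e^-, which is the
    second coordinate of a form.\<close>
  have bij: "bij_betw ?F (G 2 \<times> G (- 2)) (G (- 2) \<times> G 2 \<times> {\<zero>\<^bsub>P\<^esub>})"
    by (rule bij_betw_byWitness[where f' = "\<lambda>(x, y, z). (y, x)"]) (auto simp: F simp del: Omega_sel)
  have m: "r \<otimes>\<^bsub>P\<^esub> x \<in> G n" if "r \<in> G 0" "x \<in> G n" for r x n by (rule G_mult'[OF that]) simp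
  have "?F \<in> mod_hom (CqS2 q) (dsum (monopole_bundle q (- 2)) (monopole_bundle q 2)) (Omega_S2 q)"
    unfolding mod_hom_def sphere_forms
    by (auto simp: forms_sphere F m G_add monopole_bundle_def Let_def CqS2_def P.m_assoc)
  then show ?thesis using bij by (simp add: mod_iso_def sphere_forms forms_sphere monopole_bundle_def Let_def)
qed

theorem sphere_projective: "projective (CqS2 q) (Omega_S2 q)"
proof -
  interpret O: abelian_group \<Omega> by (rule module.axioms(2)[OF Omega_vs])
  note G_carrier' = subsetD[OF G0_carrier]
  let ?c = "\<lambda>A B (x, y, z :: sl2). x \<otimes>\<^bsub>P\<^esub> A \<oplus>\<^bsub>P\<^esub> y \<otimes>\<^bsub>P\<^esub> B"
  \<comment> \<open>\<open>A\<close>, \<open>A1\<close>, \<open>A2\<close> are the coefficients of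
    db_0, db_+, db_- in the formula for e^+, and \<open>B\<close>, \<open>B1\<close>,
    \<open>B2\<close> those in the formula for e^-. Substituting both formulas into w = x e^+ + y
    e^- gives the dual basis; its functionals multiply x and y from the right, so they are left
    linear, and by degree their values lie in the sphere.\<close>
  define A B where "A = \<ominus>\<^bsub>P\<^esub> (q_int 2 (inverse (q\<^sup>2)) \<odot>\<^bsub>P\<^esub> (gen q Ga \<otimes>\<^bsub>P\<^esub> gen q Gc))" and "B = \<ominus>\<^bsub>P\<^esub> (q_int 2 (q\<^sup>2) \<odot>\<^bsub>P\<^esub> (gen q Gb \<otimes>\<^bsub>P\<^esub> gen q Gd))"
  define A1 B1 where "A1 = gen q Ga \<otimes>\<^bsub>P\<^esub> gen q Ga" and "B1 = q\<^sup>2 \<odot>\<^bsub>P\<^esub> (gen q Gb \<otimes>\<^bsub>P\<^esub> gen q Gb)"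
  define A2 B2 where "A2 = inverse (q\<^sup>2) \<odot>\<^bsub>P\<^esub> (gen q Gc \<otimes>\<^bsub>P\<^esub> gen q Gc)" and "B2 = gen q Gd \<otimes>\<^bsub>P\<^esub> gen q Gd"
  note defs = A_def B_def A1_def B1_def A2_def B2_def
  have neg: "\<ominus>\<^bsub>P\<^esub> x \<in> G n" if "x \<in> G n" for x n
    using vs_submoduleD(5)[OF P_vs G_submodule G_zero that] that by (simp add: a_minus_def)
  have g: "A \<in> G 2" "A1 \<in> G 2" "A2 \<in> G 2" "B \<in> G (- 2)" "B1 \<in> G (- 2)" "B2 \<in> G (- 2)"
    unfolding defs by ((rule neg)?, (rule G_smult)?, rule G_mult'[OF gen_G[OF refl] gen_G[OF refl]], simp)+
  have D: "D (b_plus q) \<in> forms \<Omega> D (G 0) (G 0)" "D (b_minus q) \<in> forms \<Omega> D (G 0) (G 0)" "D (b_zero q) \<in> forms \<Omega> D (G 0) (G 0)"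
    using b_G[THEN forms_base[OF G_one]] by (simp_all add: d_b word_cls[symmetric])
  have DC: "D (b_plus q) \<in> carrier \<Omega>" "D (b_minus q) \<in> carrier \<Omega>" "D (b_zero q) \<in> carrier \<Omega>"
    using D forms_sphere by auto
  have m: "\<ominus>\<^bsub>\<Omega>\<^esub> (p \<rhd>\<^bsub>\<Omega>\<^esub> w) = (\<ominus>\<^bsub>P\<^esub> p) \<rhd>\<^bsub>\<Omega>\<^esub> w" if "p \<in> carrier P" "w \<in> carrier \<Omega>" for p w
  proof (rule O.minus_equality)
    show "((\<ominus>\<^bsub>P\<^esub> p) \<rhd>\<^bsub>\<Omega>\<^esub> w) \<oplus>\<^bsub>\<Omega>\<^esub> (p \<rhd>\<^bsub>\<Omega>\<^esub> w) = \<zero>\<^bsub>\<Omega>\<^esub>"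
      using that by (cases w) (simp flip: P.l_distr add: P.l_neg)
  qed (use that in \<open>simp_all add: lact_closed del: Omega_sel\<close>)
  have s: "e_plus q = (A1 \<rhd>\<^bsub>\<Omega>\<^esub> D (b_plus q)) \<oplus>\<^bsub>\<Omega>\<^esub> (A2 \<rhd>\<^bsub>\<Omega>\<^esub> D (b_minus q)) \<oplus>\<^bsub>\<Omega>\<^esub> (A \<rhd>\<^bsub>\<Omega>\<^esub> D (b_zero q))"
     "e_minus q = (B2 \<rhd>\<^bsub>\<Omega>\<^esub> D (b_minus q)) \<oplus>\<^bsub>\<Omega>\<^esub> (B1 \<rhd>\<^bsub>\<Omega>\<^esub> D (b_plus q)) \<oplus>\<^bsub>\<Omega>\<^esub> (B \<rhd>\<^bsub>\<Omega>\<^esub> D (b_zero q))"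
    unfolding soldering_formulas[symmetric] a_minus_def defs
    by (simp_all add: m DC vs_closed[OF P_vs] del: Omega_sel)
  have c: "?c U W (x, y, z) \<in> G 0" if "U \<in> G 2" "W \<in> G (- 2)" "x \<in> G (- 2)" "y \<in> G 2" for U W x y z
    using that by (auto intro!: G_add G_mult')
  have exp: "(?c A1 B1 w \<rhd>\<^bsub>\<Omega>\<^esub> D (b_plus q)) \<oplus>\<^bsub>\<Omega>\<^esub> (?c A2 B2 w \<rhd>\<^bsub>\<Omega>\<^esub> D (b_minus q)) \<oplus>\<^bsub>\<Omega>\<^esub> (?c A B w \<rhd>\<^bsub>\<Omega>\<^esub> D (b_zero q)) = w"
    if w: "w \<in> G (- 2) \<times> G 2 \<times> {\<zero>\<^bsub>P\<^esub>}" for w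
  proof -
    obtain x y where xy: "w = (x, y, \<zero>\<^bsub>P\<^esub>)" "x \<in> G (- 2)" "y \<in> G 2" using w by auto
    have C: "x \<in> carrier P" "y \<in> carrier P" "A \<in> carrier P" "A1 \<in> carrier P" "A2 \<in> carrier P" "B \<in> carrier P" "B1 \<in> carrier P" "B2 \<in> carrier P"
      using xy g G_carrier' by blast+
    have "w = (x \<rhd>\<^bsub>\<Omega>\<^esub> e_plus q) \<oplus>\<^bsub>\<Omega>\<^esub> (y \<rhd>\<^bsub>\<Omega>\<^esub> e_minus q)" using C by (simp add: xy e_sel)
    also have "\<dots> = (?c A1 B1 w \<rhd>\<^bsub>\<Omega>\<^esub> D (b_plus q)) \<oplus>\<^bsub>\<Omega>\<^esub> (?c A2 B2 w \<rhd>\<^bsub>\<Omega>\<^esub> D (b_minus q)) \<oplus>\<^bsub>\<Omega>\<^esub> (?c A B w \<rhd>\<^bsub>\<Omega>\<^esub> D (b_zero q))"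
      unfolding s xy using C DC
      by (simp add: lact_assoc lact_closed lin_hom_add[OF lact_lin] lin_hom_add[OF bilinD(2)[OF lact_bilin]] O.a_ac del: Omega_sel)
    finally show ?thesis by simp
  qed
  let ?X = "left_mod \<Omega> (forms \<Omega> D (G 0) (G 0))" and ?R = "P\<lparr>carrier := G 0\<rparr>"
  have coef: "?c U W w \<in> carrier ?R"
    "w' \<in> carrier ?X \<Longrightarrow> ?c U W (w \<oplus>\<^bsub>?X\<^esub> w') = ?c U W w \<oplus>\<^bsub>?R\<^esub> ?c U W w'"
    "r \<in> carrier ?R \<Longrightarrow> ?c U W (r \<odot>\<^bsub>?X\<^esub> w) = r \<otimes>\<^bsub>?R\<^esub> ?c U W w"
    if "U \<in> G 2" "W \<in> G (- 2)" and w: "w \<in> carrier ?X" for U W w w' r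
  proof -
    obtain x y where w: "w = (x, y, \<zero>\<^bsub>P\<^esub>)" "x \<in> G (- 2)" "y \<in> G 2" using w by (auto simp only: left_mod_sel forms_sphere)
    note C = G_carrier'[OF that(1)] G_carrier'[OF that(2)] G_carrier'[OF w(2)] G_carrier'[OF w(3)]
    show "?c U W w \<in> carrier ?R" using c[OF that(1,2) w(2,3)] by (simp add: w)
    show "?c U W (r \<odot>\<^bsub>?X\<^esub> w) = r \<otimes>\<^bsub>?R\<^esub> ?c U W w" if "r \<in> carrier ?R"
      using C that by (simp add: w P.m_assoc P.r_distr)
    assume "w' \<in> carrier ?X"
    then obtain x' y' where w': "w' = (x', y', \<zero>\<^bsub>P\<^esub>)" "x' \<in> G (- 2)" "y' \<in> G 2" by (auto simp only: left_mod_sel forms_sphere)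
    show "?c U W (w \<oplus>\<^bsub>?X\<^esub> w') = ?c U W w \<oplus>\<^bsub>?R\<^esub> ?c U W w'"
      using C G_carrier'[OF w'(2)] G_carrier'[OF w'(3)] by (simp add: w w'(1) P.l_distr P.a_ac)
  qed
  show ?thesis unfolding sphere_eq sphere_forms
  \<comment> \<open>Three triples of sets that are visibly distinct; they serve as labels
    only.\<close>
  proof (rule projective_dual_basis[where i = "({}, {}, {})" and j = "(UNIV, {}, {})" and k = "(UNIV, UNIV, {})",
        OF sphere_form_module _ _ _ _ _ _ coef[OF g(2,5)] coef[OF g(3,6)] coef[OF g(1,4)]])
    show "D (b_plus q) \<in> carrier ?X" "D (b_minus q) \<in> carrier ?X" "D (b_zero q) \<in> carrier ?X" using D by simp_all
  qed (use exp in \<open>simp_all add: forms_sphere del: Omega_sel\<close>)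
qed

end

theorem theorem3p1:
  fixes q :: complex
  assumes "q \<noteq> 0"
  shows
    "let P = CqSL2 q; M = CqS2 q; \<Omega> = Omega_SL2 q; D = d_SL2 q;
         a = gen q Ga; b = gen q Gb; c = gen q Gc; d = gen q Gd;
         bp = b_plus q; bm = b_minus q; b0 = b_zero q;
         \<theta> = soldering_form q;
         \<theta>m = \<theta> (framing_class q bm); \<theta>p = \<theta> (framing_class q bp)
     in
      framed_quantum_manifold (carrier M) laurent P (sl2_coaction q) \<Omega> D (laurent_ideal q)
        (framing_space q) (framing_coaction q) \<theta> \<and>
      (\<lambda>(f, h). (f \<rhd>\<^bsub>\<Omega>\<^esub> \<theta>m) \<oplus>\<^bsub>\<Omega>\<^esub> (h \<rhd>\<^bsub>\<Omega>\<^esub> \<theta>p))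
        \<in> mod_iso M (dsum (monopole_bundle q (- 2)) (monopole_bundle q 2)) (Omega_S2 q) \<and>
      \<theta>m = (((d \<otimes>\<^bsub>P\<^esub> d) \<rhd>\<^bsub>\<Omega>\<^esub> D bm) \<oplus>\<^bsub>\<Omega>\<^esub> ((q\<^sup>2 \<odot>\<^bsub>P\<^esub> (b \<otimes>\<^bsub>P\<^esub> b)) \<rhd>\<^bsub>\<Omega>\<^esub> D bp))
             \<ominus>\<^bsub>\<Omega>\<^esub> ((q_int 2 (q\<^sup>2) \<odot>\<^bsub>P\<^esub> (b \<otimes>\<^bsub>P\<^esub> d)) \<rhd>\<^bsub>\<Omega>\<^esub> D b0) \<and>
      \<theta>m = e_minus q \<and>
      \<theta>p = (((a \<otimes>\<^bsub>P\<^esub> a) \<rhd>\<^bsub>\<Omega>\<^esub> D bp) \<oplus>\<^bsub>\<Omega>\<^esub> ((inverse (q\<^sup>2) \<odot>\<^bsub>P\<^esub> (c \<otimes>\<^bsub>P\<^esub> c)) \<rhd>\<^bsub>\<Omega>\<^esub> D bm))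
             \<ominus>\<^bsub>\<Omega>\<^esub> ((q_int 2 (inverse (q\<^sup>2)) \<odot>\<^bsub>P\<^esub> (a \<otimes>\<^bsub>P\<^esub> c)) \<rhd>\<^bsub>\<Omega>\<^esub> D b0) \<and>
      \<theta>p = e_plus q \<and>
      projective M (Omega_S2 q)"
proof -
  interpret quantum_sl2 q by unfold_locales (fact assms)
  show ?thesis
    unfolding Let_def theta_b
    using framed sphere_iso sphere_projective by (simp only: soldering_formulas)
qed

end
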